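(* Let $d\ge2$. The differential equations $E_k(t)=0$, $k=1,\dots,d-1$, where for $k=2,\dots,d-1$ $$E_k(t) := -\sum_{i=1}^{d} i p_i\, T\bigl(\operatorname{KP}_{i,k}(\mathcal{G}^{\pi_d})\bigr) + t\, \partial_tF^{\pi_d}_k(t) - k F^{\pi_d}_k(t)$$ and $$E_1(t) := -d p_d \sum_{i=1}^{d} i p_i\, T\bigl(\operatorname{KP}_{i,d}(\mathcal{G}^{\pi_d})\bigr) + \partial_tF^{\pi_d}_1(t) - (d+1)t^{-1}F^{\pi_d}_1(t) + \sum_{i=1}^{d-1} i p_i \bigl(dF^{\pi_d}_i(t)-t\,\partial_tF^{\pi_d}_i(t)\bigr) + d\,uv,$$ give rise (by extracting the coefficients of powers of $t$) to recurrence formulas which determine recursively the coefficients $f^{(1)}_n,\dots,f^{(d-1)}_n$ for all $n\ge1$, where $F^{\pi_d}_k(t)=\sum_{n\ge1}f^{(k)}_nt^n$.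
   Context: **Maps.** A bipartite map with $n$ labeled edges (connected or not) is equivalently a pair of permutations $(\sigma_\bullet,\sigma_\circ)$ of $\{1,\dots,n\}$; black vertices, white vertices and faces are the cycles of $\sigma_\bullet,\sigma_\circ,\sigma_\bullet\sigma_\circ$, and face degrees are the cycle lengths of the product. Let $M_{V_\bullet,V_\circ,\lambda}(n)$ be the number of those with $V_\bullet$ black vertices, $V_\circ$ white vertices and face degrees $\lambda\vdash n$, and $$\tau(t,u,v,\mathbf p)=\sum_{n\ge0}\frac{t^n}{n!}\sum_{V_\bullet,V_\circ,\lambda\vdash n}M_{V_\bullet,V_\circ,\lambda}(n)u^{V_\bullet}v^{V_\circ}p_{\lambda_1}p_{\lambda_2}\cdots,\qquad F=\ln\tau,\qquad F_{i_1,i_2,\dots}=\tfrac{\partial}{\partial p_{i_1}}\tfrac{\partial}{\partial p_{i_2}}\cdots F.$$ Fix $d\ge2$; $\pi_d$ sets $p_i=0$ for $i>d$, $\pi_d(\mathbf p)=(p_1,\dots,p_d,0,\dots)$, and $F^{\pi_d}_\lambda=\pi_dF_\lambda\in\mathbb Q[u,v,p_1,\dots,p_d][[t]]$; the dependence on $t$ is displayed as $F^{\pi_d}_k(t)$. The coefficients $f^{(k)}_n$ lie in $\mathbb Q[u,v,p_1,\dots,p_d]$. **KP polynomials.** Let $H_\lambda$ be formal variables indexed by partitions $\lambda$, $H_\lambda$ having degree $|\lambda|$. A hook is a partition $(i,1^a)$, $i\ge1$, $a\ge0$; $\mathcal H_{\rm hook}=\{H_\lambda:\lambda\text{ hook}\}$.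 Let $h_k(\mathbf p)$ be defined by $\exp(\sum_{i\ge1}\frac{p_i}{i}z^i)=\sum_kh_k(\mathbf p)z^k$. The Hirota derivatives are $D_{i_1}\cdots D_{i_r}(\tau\cdot\tau)=\sum_{I\sqcup J=\{1,\dots,r\}}(-1)^{|J|}\tau_{i_I}\tau_{i_J}$ (subscripts on $\tau$ being partial derivatives); with $F=\ln\tau$, $\tau^{-2}D_{i_1}\cdots D_{i_r}(\tau\cdot\tau)$ is the sum over set partitions of $\{1,\dots,r\}$ into blocks $B$ of even size of $\prod_B2F_{i_B}$. Let $\check D=(D_1,2D_2,3D_3,\dots)$. A KP tau function is a series $\tau(\mathbf p)$ with $\sum_{j\ge0}h_j(-2\mathbf q)h_{j+1}(\check D)e^{\sum_iq_iD_i}(\tau\cdot\tau)=0$ identically in $\mathbf q$; it then satisfies, for $k\ge l\ge2$, $$(\star)\quad\bigl(k\,h_l(\check D)D_k+(l-1)h_{k+1}(\check D)D_{l-1}-(k+l-1)D_{k+l-1}D_1\bigr)(\tau\cdot\tau)=0.$$ By Dubrovin–Natanzon, for each $\lambda$ there is $\operatorname{KP}_\lambda\in\mathbb Q[\mathcal H_{\rm hook}]$, homogeneous of degree $|\lambda|$, such that for every KP tau function $F_\lambda$ is the evaluation of $\operatorname{KP}_\lambda$ at $H_\mu=F_\mu$; every hook $(i,1^j)$ occurring in $\operatorname{KP}_\lambda$ has $i\le|\lambda|-\ell(\lambda)+1$; and for $k,l\ge2$, $\operatorname{KP}_{(k,l)}=H_{k+l-1,1}+(\text{a polynomial not containing }H_{k+l-1,1})$.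 They are constructed as follows: $\operatorname{KP}_\lambda=H_\lambda$ for hooks; for non-hooks proceed by induction on $|\lambda|-\ell(\lambda)$. For $\lambda=(k,l)$, $k\ge l\ge2$ (by increasing $l$), divide $(\star)$ by $\tau^2$, solve for $F_{k,l}$, and substitute the already known hook expressions for $F_{k+1,l-1}$ and the other non-hook derivatives. For longer $\lambda$, differentiate the expression of $F_{\lambda_1,\dots,\lambda_{\ell-1}}$ with respect to $p_{\lambda_\ell}$, and replace each resulting $F_{i,1^a,\lambda_\ell}$ by $\partial_{p_1}^a$ of the hook expression of $F_{i,\lambda_\ell}$. Indices of $\operatorname{KP}$ may be written in any order. The series $\tau$ of bipartite maps is a KP tau function (Goulden–Jackson). **$d$-admissible expressions.** Let $\mathcal F_{d\text{-adm}}=\{F^{\pi_d}_{m,1^l}:1\le m\le d-1,\ l\ge0\}$; $d$-admissible expressions are the elements of $\mathbb Q[t,t^{-1},u,v,p_1,\dots,p_d,p_d^{-1}][\mathcal F_{d\text{-adm}}]$, where the $F^{\pi_d}_{m,1^l}$ are treated as formal variables. For $l\ge0$ define $G_{m,1^l}=F^{\pi_d}_{m,1^l}$ for $m=1,\dots,d-1$ and, inductively for $k=0,\dots,d-1$, $$\begin{aligned}G_{d+k,1^l}=\frac1{(d+k)p_d}\Bigl[&-\sum_{\substack{i,j\ge1\\i+j=k}}ij\Bigl(\sum_{\substack{r,s\ge0\\ r+s=l}}\tbinom lrF^{\pi_d}_{i,1^r}F^{\pi_d}_{j,1^s}+\operatorname{KP}_{i,j,1^l}\big|_{H_\mu=F^{\pi_d}_\mu}\Bigr)+(k+1)t^{-1}G_{k+1,1^l}\\&-(u+v)kF^{\pi_d}_{k,1^l}-l(k+1)G_{k+1,1^{l-1}}-uv\,\delta_{k,0}\delta_{l,0}\\&-\sum_{i=1}^{d-k-1}(i+k)p_iF^{\pi_d}_{i+k,1^l}-\sum_{m=0}^{k-1}(d+m)p_{d+m-k}G_{d+m,1^l}\Bigr]\end{aligned}$$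 (terms with coefficient $k=0$ or $l=0$ are zero). Each $G_{m,1^l}$, $1\le m\le2d-1$, is $d$-admissible; $\mathcal G^{\pi_d}$ is the collection of these. $\operatorname{KP}_{i,k}(\mathcal G^{\pi_d})$ denotes $\operatorname{KP}_{i,k}$ with each $H_{m,1^l}$ replaced by $G_{m,1^l}$ (only $m\le2d-1$ occurs when $i,k\le d$). **Operator $T$.** $T$ replaces, in a $d$-admissible expression, every $F^{\pi_d}_{k,1^l}$ ($1\le k\le d-1$, $l\ge0$) by $(t^2\partial_t)^lF^{\pi_d}_k(t)$. Thus each $E_k(t)$ is a differential polynomial in $F^{\pi_d}_1(t),\dots,F^{\pi_d}_{d-1}(t)$, and $E_k(t)=0$ holds for the map generating functions. **Meaning of "determine recursively".** Equating to zero the coefficients of the powers of $t$ in the $E_k(t)$ allows one to compute, successively for $n=1,2,3,\dots$, and for each $n$ successively for $k=1,\dots,d-1$, the coefficient $f^{(k)}_n$ from the previously computed ones. *)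

theory Defs
  imports
    "HOL-Library.Poly_Mapping"
    "HOL-Library.Multiset"
    "HOL-Library.Disjoint_Sets"
    "HOL-Combinatorics.Permutations"
    "HOL-Combinatorics.Orbits"
    "HOL-Computational_Algebra.Polynomial_Factorial"
    "HOL-Computational_Algebra.Formal_Laurent_Series"
begin

section \<open>Multivariate polynomials\<close>

type_synonym ('x, 'a) mpoly = "('x \<Rightarrow>\<^sub>0 nat) \<Rightarrow>\<^sub>0 'a"

definition Const :: "'a::zero \<Rightarrow> ('x, 'a) mpoly" where
  "Const c = Poly_Mapping.single 0 c"

definition Var :: "'x \<Rightarrow> ('x, 'a::zero_neq_one) mpoly" where
  "Var x = Poly_Mapping.single (Poly_Mapping.single x 1) 1"

definition vars :: "('x, 'a::zero) mpoly \<Rightarrow> 'x set" where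
  "vars P = (\<Union>m\<in>Poly_Mapping.keys P. Poly_Mapping.keys m)"

text \<open>Evaluation of a polynomial; \<open>\<phi>\<close> transports the coefficients to the target ring.\<close>

definition eval_mpoly :: "('a::zero \<Rightarrow> 'b::comm_ring_1) \<Rightarrow> ('x \<Rightarrow> 'b) \<Rightarrow> ('x, 'a) mpoly \<Rightarrow> 'b" where
  "eval_mpoly \<phi> f P =
     (\<Sum>m\<in>Poly_Mapping.keys P. \<phi> (Poly_Mapping.lookup P m) *
        (\<Prod>x\<in>Poly_Mapping.keys m. f x ^ Poly_Mapping.lookup m x))"

definition pdiff :: "'x \<Rightarrow> ('x, 'a::comm_ring_1) mpoly \<Rightarrow> ('x, 'a) mpoly" where
  "pdiff x P =
     (\<Sum>m\<in>Poly_Mapping.keys P. Poly_Mapping.single (m - Poly_Mapping.single x 1)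
        (of_nat (Poly_Mapping.lookup m x) * Poly_Mapping.lookup P m))"

text \<open>The derivation with constant coefficients that sends each variable \<open>x\<close> to \<open>\<delta> x\<close>.\<close>

definition derivation :: "('x \<Rightarrow> ('x, 'a::comm_ring_1) mpoly) \<Rightarrow> ('x, 'a) mpoly \<Rightarrow> ('x, 'a) mpoly" where
  "derivation \<delta> P = (\<Sum>x\<in>vars P. pdiff x P * \<delta> x)"

text \<open>Logarithm of a series with constant coefficient 1 and exponential of a series with constant
  coefficient 0; the inner sums are truncated at \<open>n\<close> because the further terms do not contribute.\<close>

definition log_series :: "('x, rat) mpoly fps \<Rightarrow> ('x, rat) mpoly fps" where
  "log_series f = Abs_fps (\<lambda>n. \<Sum>k=1..n. Const ((-1) ^ (k + 1) / of_nat k) * fps_nth ((f - 1) ^ k) n)"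

definition exp_series :: "('x, rat) mpoly fps \<Rightarrow> ('x, rat) mpoly fps" where
  "exp_series f = Abs_fps (\<lambda>n. \<Sum>k\<le>n. Const (1 / fact k) * fps_nth (f ^ k) n)"


section \<open>Bipartite maps\<close>

datatype gen = GU | GV | GP nat

primrec gen_rank :: "gen \<Rightarrow> nat" where
  "gen_rank GU = 0"
| "gen_rank GV = 1"
| "gen_rank (GP i) = i + 2"

text \<open>The order on the generators is immaterial; it only serves to make the polynomial ring
  an instance of \<open>idom\<close>.\<close>

instantiation gen :: linorder
begin

definition less_eq_gen :: "gen \<Rightarrow> gen \<Rightarrow> bool" where
  "x \<le> y \<longleftrightarrow> gen_rank x \<le> gen_rank y"

definition less_gen :: "gen \<Rightarrow> gen \<Rightarrow> bool" where
  "x < y \<longleftrightarrow> gen_rank x < gen_rank y"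

instance
proof
  fix x y :: gen
  show "x \<le> y \<Longrightarrow> y \<le> x \<Longrightarrow> x = y"
    by (cases x; cases y) (auto simp: less_eq_gen_def)
qed (auto simp: less_eq_gen_def less_gen_def)

end

definition cycles :: "nat \<Rightarrow> (nat \<Rightarrow> nat) \<Rightarrow> nat set set" where
  "cycles n \<sigma> = orbit \<sigma> ` {1..n}"

definition cycle_type :: "nat \<Rightarrow> (nat \<Rightarrow> nat) \<Rightarrow> nat multiset" where
  "cycle_type n \<sigma> = image_mset card (mset_set (cycles n \<sigma>))"

definition partitions :: "nat \<Rightarrow> nat multiset set" where
  "partitions n = {lam. 0 \<notin># lam \<and> sum_mset lam = n}"

definition num_maps :: "nat \<Rightarrow> nat \<Rightarrow> nat multiset \<Rightarrow> nat \<Rightarrow> nat" where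
  "num_maps V W lam n = card {(\<sigma>, \<rho>). \<sigma> permutes {1..n} \<and> \<rho> permutes {1..n} \<and>
     card (cycles n \<sigma>) = V \<and> card (cycles n \<rho>) = W \<and> cycle_type n (\<sigma> \<circ> \<rho>) = lam}"

text \<open>\<open>\<tau>\<close> as a power series in \<open>t\<close> over \<open>\<rat>[u,v,p\<^sub>1,p\<^sub>2,\<dots>]\<close>; a permutation of \<open>{1..n}\<close> has at most
  \<open>n\<close> cycles.\<close>

definition tau :: "(gen, rat) mpoly fps" where
  "tau = Abs_fps (\<lambda>n. Const (1 / fact n) *
     (\<Sum>V\<le>n. \<Sum>W\<le>n. \<Sum>lam\<in>partitions n.
        of_nat (num_maps V W lam n) * Var GU ^ V * Var GV ^ W * (\<Prod>i\<in>#lam. Var (GP i))))"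

type_synonym coeff = "(gen, rat) mpoly fract"

definition proj :: "nat \<Rightarrow> (gen, rat) mpoly \<Rightarrow> (gen, rat) mpoly" where
  "proj d = eval_mpoly Const (\<lambda>x. case x of GP i \<Rightarrow> if i > d then 0 else Var x | _ \<Rightarrow> Var x)"

text \<open>\<open>F\<^sub>k\<close> restricted by \<open>\<pi>\<^sub>d\<close>: first differentiate \<open>F = ln \<tau>\<close>, then set \<open>p\<^sub>i = 0\<close> for \<open>i > d\<close>.
  The coefficients are polynomials; they are viewed in the field of fractions because
  division by \<open>p\<^sub>d\<close> is needed below.\<close>

definition Fpi :: "nat \<Rightarrow> nat \<Rightarrow> coeff fps" where
  "Fpi d k = Abs_fps (\<lambda>n. to_fract (proj d (pdiff (GP k) (fps_nth (log_series tau) n))))"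


section \<open>KP polynomials\<close>

text \<open>\<open>hook m l\<close> is the partition \<open>(m,1\<^sup>l)\<close>. Conversely \<open>m\<close> is its largest part and
  \<open>l\<close> is its length minus one.\<close>

definition hook :: "nat \<Rightarrow> nat \<Rightarrow> nat multiset" where
  "hook m l = add_mset m (replicate_mset l 1)"

definition is_hook :: "nat multiset \<Rightarrow> bool" where
  "is_hook lam \<longleftrightarrow> (\<exists>m l. 1 \<le> m \<and> lam = hook m l)"

definition complete_h :: "nat \<Rightarrow> (nat \<Rightarrow> ('x, rat) mpoly) \<Rightarrow> ('x, rat) mpoly" where
  "complete_h k y = fps_nth (exp_series (Abs_fps (\<lambda>i. if i = 0 then 0 else Const (1 / of_nat i) * y i))) k"

text \<open>For \<open>k \<ge> l \<ge> 2\<close>, this polynomial in the Hirota derivatives \<open>D\<^sub>i\<close> (represented by \<open>Var i\<close>)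
  annihilates \<open>\<tau>\<cdot>\<tau>\<close> for every KP tau function \<open>\<tau>\<close>.\<close>

definition hirota_op :: "nat \<Rightarrow> nat \<Rightarrow> (nat, rat) mpoly" where
  "hirota_op k l =
     (let Dc = (\<lambda>i. of_nat i * Var i) in
      of_nat k * complete_h l Dc * Var k
      + of_nat (l - 1) * complete_h (k + 1) Dc * Var (l - 1)
      - of_nat (k + l - 1) * Var (k + l - 1) * Var 1)"

text \<open>\<open>\<tau>\<^sup>-\<^sup>2 D\<^sub>i\<^sub>1\<cdots>D\<^sub>i\<^sub>r(\<tau>\<cdot>\<tau>)\<close> for \<open>is = [i\<^sub>1,\<dots>,i\<^sub>r]\<close>, with \<open>g \<mu>\<close> in place of \<open>F\<^sub>\<mu>\<close>.\<close>

definition hirota :: "(nat multiset \<Rightarrow> ('x, rat) mpoly) \<Rightarrow> nat list \<Rightarrow> ('x, rat) mpoly" where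
  "hirota g is = (\<Sum>\<P> | partition_on {..<length is} \<P> \<and> (\<forall>B\<in>\<P>. even (card B)).
     \<Prod>B\<in>\<P>. 2 * g (image_mset (nth is) (mset_set B)))"

definition monom_list :: "(nat \<Rightarrow>\<^sub>0 nat) \<Rightarrow> nat list" where
  "monom_list m =
     concat (map (\<lambda>i. replicate (Poly_Mapping.lookup m i) i) (sorted_list_of_set (Poly_Mapping.keys m)))"

definition hirota_poly :: "(nat multiset \<Rightarrow> ('x, rat) mpoly) \<Rightarrow> (nat, rat) mpoly \<Rightarrow> ('x, rat) mpoly" where
  "hirota_poly g P = (\<Sum>m\<in>Poly_Mapping.keys P. Const (Poly_Mapping.lookup P m) * hirota g (monom_list m))"

text \<open>The well-founded order of the inductive construction: by \<open>|\<lambda>| - \<ell>(\<lambda>)\<close>, then by length,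
  then by the smallest part.\<close>

definition KP_order :: "(nat multiset \<times> nat multiset) set" where
  "KP_order = measures [\<lambda>lam. sum_mset lam - size lam, size, \<lambda>lam. Min_mset lam]"

definition d_p1 :: "(nat multiset, rat) mpoly \<Rightarrow> (nat multiset, rat) mpoly" where
  "d_p1 = derivation (\<lambda>mu. Var (add_mset 1 mu))"

text \<open>One step of the construction of \<open>KP\<^sub>\<lambda>\<close> as a polynomial in the variables \<open>H\<^sub>\<mu>\<close>, with
  \<open>g\<close> giving the polynomials constructed before and \<open>0\<close> elsewhere, in particular \<open>g \<lambda> = 0\<close>.
  For \<open>\<lambda> = (k,l)\<close>, the only term with \<open>F\<^sub>k\<^sub>,\<^sub>l\<close> in the equation given by \<open>hirota_op k l\<close>, divided
  by \<open>\<tau>\<^sup>2\<close>, is \<open>2k F\<^sub>k\<^sub>,\<^sub>l\<close>, so the evaluation with \<open>g\<close> is exactly the sum of the remaining terms.\<close>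

definition KP_step ::
    "nat multiset \<Rightarrow> (nat multiset \<Rightarrow> (nat multiset, rat) mpoly) \<Rightarrow> (nat multiset, rat) mpoly" where
  "KP_step lam g =
     (if is_hook lam then Var lam
      else if size lam = 2 then
        (let k = Max_mset lam; l = Min_mset lam in
         Const (- 1 / (2 * of_nat k)) * hirota_poly g (hirota_op k l))
      else
        (let q = Min_mset lam in
         derivation (\<lambda>mu. (d_p1 ^^ (size mu - 1)) (g {#Max_mset mu, q#})) (g (lam - {#q#}))))"

function KP :: "nat multiset \<Rightarrow> (nat multiset, rat) mpoly" where
  "KP lam = KP_step lam (\<lambda>mu. if (mu, lam) \<in> KP_order then KP mu else 0)"
  by auto
termination
  by (relation KP_order) (auto simp: KP_order_def)

declare KP.simps [simp del]


section \<open>Admissible expressions and the differential equations\<close>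

text \<open>Polynomials in the formal variables \<open>F\<^sub>m\<^sub>,\<^sub>1\<^sub>l\<close> (represented by \<open>Var (hook m l)\<close>), with
  coefficients in the field of Laurent series in \<open>t\<close> over \<open>coeff\<close>; this contains the
  \<open>d\<close>-admissible expressions, where the coefficients are in \<open>\<rat>[t,t\<^sup>-\<^sup>1,u,v,p\<^sub>1,\<dots>,p\<^sub>d,p\<^sub>d\<^sup>-\<^sup>1]\<close>.\<close>

type_synonym adm = "(nat multiset, coeff fls) mpoly"

definition u_coeff :: coeff where "u_coeff = to_fract (Var GU)"
definition v_coeff :: coeff where "v_coeff = to_fract (Var GV)"
definition p_coeff :: "nat \<Rightarrow> coeff" where "p_coeff i = to_fract (Var (GP i))"

definition coeff_adm :: "coeff \<Rightarrow> adm" where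
  "coeff_adm c = Const (fls_const c)"

definition rat_adm :: "rat \<Rightarrow> adm" where
  "rat_adm q = coeff_adm (to_fract (Const q))"

text \<open>For fixed \<open>d \<ge> 2\<close>, \<open>G_adm d m l\<close> is \<open>G\<^sub>m\<^sub>,\<^sub>1\<^sub>l\<close>. It is used for \<open>1 \<le> m \<le> 2d - 1\<close> only; the case
  \<open>d < 2\<close> is excluded for termination.\<close>

function G_adm :: "nat \<Rightarrow> nat \<Rightarrow> nat \<Rightarrow> adm" where
  "G_adm d m l =
    (if m < d \<or> d < 2 then Var (hook m l)
     else let k = m - d in
       coeff_adm (1 / (of_nat (d + k) * p_coeff d)) *
       (- (\<Sum>i\<in>{1..<k}. of_nat (i * (k - i)) *
             ((\<Sum>r\<le>l. of_nat (l choose r) * Var (hook i r) * Var (hook (k - i) (l - r)))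
              + eval_mpoly rat_adm Var (KP ({#i, k - i#} + replicate_mset l 1))))
        + of_nat (k + 1) * Const fls_X_inv * G_adm d (k + 1) l
        - coeff_adm (u_coeff + v_coeff) * of_nat k * Var (hook k l)
        - of_nat (l * (k + 1)) * G_adm d (k + 1) (l - 1)
        - (if k = 0 \<and> l = 0 then coeff_adm (u_coeff * v_coeff) else 0)
        - (\<Sum>i\<in>{1..<d - k}. of_nat (i + k) * coeff_adm (p_coeff i) * Var (hook (i + k) l))
        - (\<Sum>j<k. of_nat (d + j) * coeff_adm (p_coeff (d + j - k)) * G_adm d (d + j) l)))"
  by auto
termination
  by (relation "measure (\<lambda>(d, m, l). m)") auto

declare G_adm.simps [simp del]

definition KP_G :: "nat \<Rightarrow> nat \<Rightarrow> nat \<Rightarrow> adm" where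
  "KP_G d i k = eval_mpoly rat_adm (\<lambda>mu. G_adm d (Max_mset mu) (size mu - 1)) (KP {#i, k#})"

text \<open>The operator \<open>T\<close>, with an arbitrary family \<open>X\<close> of power series in \<open>t\<close> as the unknowns
  \<open>F\<^sub>1(t), F\<^sub>2(t), \<dots>\<close>.\<close>

definition T_op :: "(nat \<Rightarrow> coeff fps) \<Rightarrow> adm \<Rightarrow> coeff fls" where
  "T_op X = eval_mpoly (\<lambda>c. c)
     (\<lambda>mu. ((\<lambda>f. fls_X ^ 2 * fls_deriv f) ^^ (size mu - 1)) (fps_to_fls (X (Max_mset mu))))"

text \<open>The differential polynomial \<open>E\<^sub>k(t)\<close> in the unknowns \<open>X\<close>; the differential equation for the
  map generating functions is \<open>E_eq d (Fpi d) k = 0\<close>.\<close>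

definition E_eq :: "nat \<Rightarrow> (nat \<Rightarrow> coeff fps) \<Rightarrow> nat \<Rightarrow> coeff fls" where
  "E_eq d X k =
    (let x = (\<lambda>i. fps_to_fls (X i)) in
     if k = 1 then
       - (of_nat d * fls_const (p_coeff d) * (\<Sum>i=1..d. of_nat i * fls_const (p_coeff i) * T_op X (KP_G d i d)))
       + fls_deriv (x 1) - of_nat (d + 1) * fls_X_inv * x 1
       + (\<Sum>i=1..d-1. of_nat i * fls_const (p_coeff i) * (of_nat d * x i - fls_X * fls_deriv (x i)))
       + of_nat d * fls_const (u_coeff * v_coeff)
     else
       - (\<Sum>i=1..d. of_nat i * fls_const (p_coeff i) * T_op X (KP_G d i k))
       + fls_X * fls_deriv (x k) - of_nat k * x k)"

end

theory Submission imports Defs begin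

text \<open>Deleting a rooted edge turns the count of pairs of permutations into Virasoro constraints for
  \<open>\<tau>\<close>, which combine into an evolution equation in \<open>t\<close>. Passing a vertex operator through the
  evolution operator shifts \<open>u\<close> and \<open>v\<close> by \<open>\<plusminus>1\<close> and leaves a defect; for the product of two copies
  of \<open>\<tau>\<close> the shifts and defects of the two copies cancel, so the KP bilinear identity, which holds at
  \<open>t = 0\<close>, persists. Hence \<open>F\<^sub>\<lambda>\<close> is the value of the KP polynomial.

  After the projection, the Virasoro constraints can be solved for the derivatives with
  \<open>m \<ge> d\<close>, and the lowest one says that \<open>\<partial>/\<partial>p\<^sub>1\<close> acts as \<open>t\<^sup>2 \<partial>\<^sub>t\<close>. Substituting this in the Euler relation
  \<open>t \<partial>\<^sub>t F\<^sub>k = k F\<^sub>k + \<Sum> i p\<^sub>i F\<^sub>i\<^sub>,\<^sub>k\<close> gives the differential equations.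

  For the recursion, the KP polynomial of \<open>(i,k)\<close> is \<open>H\<close> of the hook \<open>(i+k-1,1)\<close> plus terms in hooks
  \<open>(m,1\<^sup>l)\<close> with \<open>m \<le> i+k-2\<close>, \<open>l \<ge> 1\<close>, and without constant term. Comparing how far the coefficient of a power of
  \<open>t\<close> in each expression looks into the unknown series shows that only the term with the hook
  \<open>(d+k-1,1)\<close> involves the new coefficient. At \<open>t\<^sup>n\<close> for \<open>k \<ge> 2\<close> its total factor is
  \<open>-(n(d-1)(k-1) + k(k-1))/(d+k-1)\<close>, and at \<open>t\<^sup>n\<^sup>-\<^sup>1\<close> for \<open>k = 1\<close> it is
  \<open>-((d-1)\<^sup>2 n + d-1)/(2d-1)\<close>.\<close>

subsection \<open>Evaluation and derivations of polynomials\<close>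

text \<open>The usual proof that \<open>tau\<close> is a KP tau function expands it in Schur
  functions and needs characters of symmetric groups. Here only differential operators occur. The
  bilinear identity says that a residue in z vanishes; the two defects add up to a derivative d/dz,
  so their residue is 0. What remains is an evolution operator with shifted u and v applied to the
  previous residue, which is already 0. The obstacle is finiteness: the operators are infinite sums,
  and the vertex operator is infinite in both directions. The coefficient of t^n in
  \<open>tau\<close> has weight at most n in the p_i, so every sum is cut at a bound
  \<open>M\<close> or \<open>K\<close>, and identities are claimed only where the bound exceeds the
  weight. Once p_i = 0 for i > d, the cut at d is exact. The recursion is asserted for arbitrary
  series \<open>X\<close> with zero constant terms. Nothing that holds only for maps may enter
  there: the expressions \<open>G_adm\<close> are formal, and their behaviour in t has to be read
  off from their definition. Positivity of an integer numerator then shows that the coefficient of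
  the new unknown is nonzero.\<close>

definition monom_eval :: "('x \<Rightarrow> 'b::comm_ring_1) \<Rightarrow> ('x \<Rightarrow>\<^sub>0 nat) \<Rightarrow> 'b" where
  "monom_eval f m = (\<Prod>x\<in>Poly_Mapping.keys m. f x ^ Poly_Mapping.lookup m x)"

lemma monom_eval_superset:
  assumes "finite A" "Poly_Mapping.keys m \<subseteq> A"
  shows "monom_eval f m = (\<Prod>x\<in>A. f x ^ Poly_Mapping.lookup m x)"
  unfolding monom_eval_def using assms
  by (intro prod.mono_neutral_left) (auto simp: in_keys_iff)

lemma monom_eval_add: "monom_eval f (m + n) = monom_eval f m * monom_eval f n"
proof -
  let ?A = "Poly_Mapping.keys m \<union> Poly_Mapping.keys n"
  have "Poly_Mapping.keys (m + n) \<subseteq> ?A"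
    by (rule Poly_Mapping.keys_add)
  then show ?thesis
    by (simp add: monom_eval_superset[of ?A] prod.distrib[symmetric] lookup_add power_add)
qed

lemma monom_eval_0 [simp]: "monom_eval f 0 = 1"
  by (simp add: monom_eval_def)

lemma monom_eval_single [simp]: "monom_eval f (Poly_Mapping.single x k) = f x ^ k"
  by (simp add: monom_eval_def)

lemma mpoly_sum_singles:
  "(\<Sum>m\<in>Poly_Mapping.keys P. Poly_Mapping.single m (Poly_Mapping.lookup P m)) = P"
proof (rule poly_mapping_eqI)
  fix k
  show "Poly_Mapping.lookup (\<Sum>m\<in>Poly_Mapping.keys P. Poly_Mapping.single m (Poly_Mapping.lookup P m)) k
      = Poly_Mapping.lookup P k"
    by (cases "k \<in> Poly_Mapping.keys P")
       (auto simp: lookup_sum lookup_single when_def in_keys_iff sum.delta)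
qed

lemma mpoly_induct_single [case_names single add]:
  fixes P :: "('x, 'a::comm_monoid_add) mpoly"
  assumes single: "\<And>m c. Q (Poly_Mapping.single m c)"
    and add: "\<And>P R. Q P \<Longrightarrow> Q R \<Longrightarrow> Q (P + R)"
  shows "Q P"
proof -
  have "Q (\<Sum>m\<in>A. Poly_Mapping.single m (Poly_Mapping.lookup P m))" if "finite A" for A
    using that
  proof induction
    case empty
    show ?case using single[of 0 0] by simp
  next
    case (insert x A)
    then show ?case using add single by simp
  qed
  from this[of "Poly_Mapping.keys P"] show ?thesis
    by (simp add: mpoly_sum_singles)
qed

lemma keys_sum_subset:
  "Poly_Mapping.keys (\<Sum>i\<in>I. f i) \<subseteq> (\<Union>i\<in>I. Poly_Mapping.keys (f i))"
proof (induction I rule: infinite_finite_induct)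
  case (insert x F)
  then show ?case using Poly_Mapping.keys_add[of "f x" "sum f F"] by auto
qed auto

text \<open>Cancellation can remove monomials from the support of \<open>P + Q\<close>; by
  \<open>g m 0 = 0\<close> they may be counted all the same.\<close>

lemma sum_keys_add:
  assumes "\<And>m. g m 0 = 0" "\<And>m a b. g m (a + b) = g m a + g m b"
  shows "(\<Sum>m\<in>Poly_Mapping.keys (P + Q). g m (Poly_Mapping.lookup (P + Q) m)) =
    (\<Sum>m\<in>Poly_Mapping.keys P. g m (Poly_Mapping.lookup P m)) + (\<Sum>m\<in>Poly_Mapping.keys Q. g m (Poly_Mapping.lookup Q m))"
  using assms by (intro setsum_keys_plus_distrib) auto

lemma monom_induct [case_names zero add]:
  fixes m :: "'x \<Rightarrow>\<^sub>0 nat"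
  assumes "Q 0" "\<And>m x. Q m \<Longrightarrow> Q (m + Poly_Mapping.single x 1)"
  shows "Q m"
proof (induction "\<Sum>x\<in>Poly_Mapping.keys m. Poly_Mapping.lookup m x" arbitrary: m rule: less_induct)
  case less
  show ?case
  proof (cases "m = 0")
    case True
    then show ?thesis using assms by simp
  next
    case False
    then obtain x where x: "x \<in> Poly_Mapping.keys m"
      by (metis all_not_in_conv keys_eq_empty)
    let ?m = "m - Poly_Mapping.single x 1"
    have m: "m = ?m + Poly_Mapping.single x 1"
      using x by (intro poly_mapping_eqI) (auto simp: lookup_add lookup_minus lookup_single when_def in_keys_iff)
    have sub: "Poly_Mapping.keys ?m \<subseteq> Poly_Mapping.keys m"
      by (auto simp: in_keys_iff lookup_minus)
    have "(\<Sum>y\<in>Poly_Mapping.keys ?m. Poly_Mapping.lookup ?m y) = (\<Sum>y\<in>Poly_Mapping.keys m. Poly_Mapping.lookup ?m y)"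
      using sub by (intro sum.mono_neutral_left) (auto simp: in_keys_iff)
    also have "\<dots> < (\<Sum>y\<in>Poly_Mapping.keys m. Poly_Mapping.lookup m y)"
      using x by (intro sum_strict_mono_ex1) (auto simp: lookup_minus in_keys_iff lookup_single intro!: bexI[of _ x])
    finally have "Q ?m" by (rule less)
    then show ?thesis using assms(2) m by metis
  qed
qed

lemma Const_0 [simp]: "Const 0 = 0"
  and Const_1 [simp]: "Const 1 = 1"
  and Const_add: "Const (a + b) = Const a + Const b"
  by (simp_all add: Const_def single_add)

lemma Const_mult: "Const (a * b) = Const a * Const (b::'a::comm_ring_1)"
  by (simp add: Const_def mult_single)

lemma Const_uminus: "Const (- a) = - Const (a::'a::comm_ring_1)"
  by (simp add: Const_def single_uminus)

lemma Const_of_nat [simp]: "Const (of_nat n) = of_nat n"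
  by (simp add: Const_def)

lemma Const_power: "Const (a ^ n) = Const (a::'a::comm_ring_1) ^ n"
  by (induction n) (simp_all add: Const_mult)

text \<open>The bound \<open>V\<close> on the variables lets an induction use facts known only for
  variables that occur in \<open>P\<close>, as when a derivation and an evaluation are
  compared.\<close>

lemma mpoly_induct_vars [consumes 1, case_names Const add Var]:
  fixes P :: "('x, 'a::comm_ring_1) mpoly"
  assumes vars: "vars P \<subseteq> V"
    and const: "\<And>c. Q (Const c)"
    and add: "\<And>P R. Q P \<Longrightarrow> Q R \<Longrightarrow> Q (P + R)"
    and var: "\<And>P x. x \<in> V \<Longrightarrow> Q P \<Longrightarrow> Q (P * Var x)"
  shows "Q P"
proof -
  have single: "Q (Poly_Mapping.single m c)" if "Poly_Mapping.keys m \<subseteq> V" for m c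
    using that
  proof (induction m rule: monom_induct)
    case zero
    show ?case using const[of c] by (simp add: Const_def)
  next
    case (add m x)
    have x: "x \<in> V" and "Poly_Mapping.keys m \<subseteq> V"
      using add(2) by (auto simp: in_keys_iff lookup_add)
    moreover have "Poly_Mapping.single (m + Poly_Mapping.single x 1) c = Poly_Mapping.single m c * Var x"
      by (simp add: Var_def mult_single)
    ultimately show ?case using var[OF x add(1)] by simp
  qed
  have "Q (\<Sum>m\<in>A. Poly_Mapping.single m (Poly_Mapping.lookup P m))" if "finite A" "A \<subseteq> Poly_Mapping.keys P" for A
    using that
  proof induction
    case empty
    show ?case using const[of 0] by (simp add: Const_def)
  next
    case (insert x A)
    have "Poly_Mapping.keys x \<subseteq> V" using vars insert by (auto simp: vars_def)
    then show ?case using insert add single by simp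
  qed
  from this[of "Poly_Mapping.keys P"] show ?thesis
    by (simp add: mpoly_sum_singles)
qed

lemma mpoly_induct [case_names Const add Var]:
  fixes P :: "('x, 'a::comm_ring_1) mpoly"
  assumes "\<And>c. Q (Const c)" "\<And>P R. Q P \<Longrightarrow> Q R \<Longrightarrow> Q (P + R)" "\<And>P x. Q P \<Longrightarrow> Q (P * Var x)"
  shows "Q P"
  by (rule mpoly_induct_vars[of P UNIV]) (use assms in auto)

text \<open>Unital ring homomorphisms. Besides embeddings of coefficients, the locale is applied to
  evaluations, to the embeddings of the two copies of the variables, to the projection and to
  \<open>T_op\<close>.\<close>

locale coeff_hom =
  fixes \<phi> :: "'a::comm_ring_1 \<Rightarrow> 'b::comm_ring_1"
  assumes hom_0 [simp]: "\<phi> 0 = 0" and hom_1 [simp]: "\<phi> 1 = 1"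
    and hom_add: "\<phi> (a + b) = \<phi> a + \<phi> b" and hom_mult: "\<phi> (a * b) = \<phi> a * \<phi> b"
begin

lemma hom_uminus: "\<phi> (- a) = - \<phi> a"
  using hom_add[of a "- a"] by (simp add: eq_neg_iff_add_eq_0 add.commute)

lemma hom_diff: "\<phi> (a - b) = \<phi> a - \<phi> b"
  using hom_add[of a "- b"] by (simp add: hom_uminus)

lemma hom_sum: "\<phi> (\<Sum>i\<in>I. g i) = (\<Sum>i\<in>I. \<phi> (g i))"
  by (induction I rule: infinite_finite_induct) (simp_all add: hom_add)

lemma hom_prod: "\<phi> (\<Prod>i\<in>I. g i) = (\<Prod>i\<in>I. \<phi> (g i))"
  by (induction I rule: infinite_finite_induct) (simp_all add: hom_mult)

lemma hom_power: "\<phi> (a ^ n) = \<phi> a ^ n"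
  by (induction n) (simp_all add: hom_mult)

lemma hom_of_nat: "\<phi> (of_nat n) = of_nat n"
  by (induction n) (simp_all add: hom_add)

lemma eval_mpoly_alt: "eval_mpoly \<phi> f P = (\<Sum>m\<in>Poly_Mapping.keys P. \<phi> (Poly_Mapping.lookup P m) * monom_eval f m)"
  by (simp add: eval_mpoly_def monom_eval_def)

lemma eval_single: "eval_mpoly \<phi> f (Poly_Mapping.single m c) = \<phi> c * monom_eval f m"
  by (simp add: eval_mpoly_alt)

lemma eval_add: "eval_mpoly \<phi> f (P + Q) = eval_mpoly \<phi> f P + eval_mpoly \<phi> f Q"
  unfolding eval_mpoly_alt by (rule sum_keys_add) (simp_all add: hom_add distrib_right)

lemma eval_0 [simp]: "eval_mpoly \<phi> f 0 = 0"
  by (simp add: eval_mpoly_alt)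

lemma eval_Const [simp]: "eval_mpoly \<phi> f (Const c) = \<phi> c"
  by (simp add: Const_def eval_single)

lemma eval_1 [simp]: "eval_mpoly \<phi> f 1 = 1"
  using eval_Const[of f 1] by simp

lemma eval_Var [simp]: "eval_mpoly \<phi> f (Var x) = f x"
  by (simp add: Var_def eval_single)

lemma eval_mult: "eval_mpoly \<phi> f (P * Q) = eval_mpoly \<phi> f P * eval_mpoly \<phi> f Q"
proof (induction P rule: mpoly_induct_single)
  case (single m c)
  show ?case
  proof (induction Q rule: mpoly_induct_single)
    case (single n d)
    show ?case by (simp add: mult_single eval_single hom_mult monom_eval_add)
  qed (simp add: distrib_left eval_add)
qed (simp add: distrib_right eval_add)

lemma coeff_hom_eval: "coeff_hom (eval_mpoly \<phi> f)"
  by unfold_locales (simp_all add: eval_add eval_mult)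

lemmas eval_diff = coeff_hom.hom_diff[OF coeff_hom_eval]
  and eval_sum = coeff_hom.hom_sum[OF coeff_hom_eval]
  and eval_prod = coeff_hom.hom_prod[OF coeff_hom_eval]
  and eval_of_nat = coeff_hom.hom_of_nat[OF coeff_hom_eval]

lemma eval_cong:
  assumes "\<And>x. x \<in> vars P \<Longrightarrow> f x = g x"
  shows "eval_mpoly \<phi> f P = eval_mpoly \<phi> g P"
  unfolding eval_mpoly_def using assms
  by (intro sum.cong refl arg_cong2[of _ _ _ _ "(*)"] arg_cong2[of _ _ _ _ "(^)"] prod.cong assms)
     (auto simp: vars_def)

end

lemma coeff_hom_unique:
  assumes "coeff_hom \<psi>" "coeff_hom \<chi>" "\<And>c. \<psi> (Const c) = \<chi> (Const c)" "\<And>x. \<psi> (Var x) = \<chi> (Var x)"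
  shows "\<psi> P = \<chi> (P :: ('x, 'a::comm_ring_1) mpoly)"
proof -
  interpret A: coeff_hom \<psi> by fact
  interpret B: coeff_hom \<chi> by fact
  show ?thesis
    by (induction P rule: mpoly_induct) (simp_all add: assms A.hom_add B.hom_add A.hom_mult B.hom_mult)
qed

lemma coeff_hom_comp: "coeff_hom f \<Longrightarrow> coeff_hom g \<Longrightarrow> coeff_hom (\<lambda>x. f (g x))"
  by (auto simp: coeff_hom_def)

lemma coeff_hom_Const: "coeff_hom Const"
  by unfold_locales (simp_all add: Const_add Const_mult)

lemma coeff_hom_id: "coeff_hom (\<lambda>x. x)"
  by unfold_locales simp_all

locale ring_derivation =
  fixes \<delta> :: "'a::comm_ring_1 \<Rightarrow> 'a"
  assumes add: "\<delta> (x + y) = \<delta> x + \<delta> y"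
    and mult: "\<delta> (x * y) = \<delta> x * y + x * \<delta> y"
begin

lemma zero [simp]: "\<delta> 0 = 0"
  using add[of 0 0] by simp

lemma one [simp]: "\<delta> 1 = 0"
  using mult[of 1 1] by simp

lemma uminus: "\<delta> (- x) = - \<delta> x"
  using add[of x "- x"] by (simp add: eq_neg_iff_add_eq_0 add.commute)

lemma diff: "\<delta> (x - y) = \<delta> x - \<delta> y"
  using add[of x "- y"] by (simp add: uminus)

lemma sum: "\<delta> (\<Sum>i\<in>I. f i) = (\<Sum>i\<in>I. \<delta> (f i))"
  by (induction I rule: infinite_finite_induct) (simp_all add: add)

lemma of_nat [simp]: "\<delta> (of_nat n) = 0"
  by (induction n) (simp_all add: add)

lemma of_nat_mult [simp]: "\<delta> (of_nat n * x) = of_nat n * \<delta> x"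
  by (simp add: mult)

lemma power: "\<delta> (x ^ Suc n) = of_nat (Suc n) * x ^ n * \<delta> x"
  by (induction n) (simp_all add: mult algebra_simps)

lemma prod:
  assumes "finite I"
  shows "\<delta> (\<Prod>i\<in>I. f i) = (\<Sum>i\<in>I. \<delta> (f i) * (\<Prod>j\<in>I - {i}. f j))"
  using assms
proof induction
  case (insert x I)
  have "(\<Prod>j\<in>insert x I - {i}. f j) = f x * (\<Prod>j\<in>I - {i}. f j)" if "i \<in> I" for i
  proof -
    have "insert x I - {i} = insert x (I - {i})" using that insert by auto
    then show ?thesis using insert by simp
  qed
  moreover have "insert x I - {x} = I" using insert by auto
  ultimately show ?case using insert
    by (simp add: mult sum_distrib_left mult_ac)
qed simp

end

section \<open>Partial derivatives and derivations given by their values on the variables\<close>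

lemma pdiff_single:
  "pdiff x (Poly_Mapping.single m c) =
    Poly_Mapping.single (m - Poly_Mapping.single x 1) (of_nat (Poly_Mapping.lookup m x) * c)"
  by (simp add: pdiff_def)

lemma pdiff_add: "pdiff x (P + Q) = pdiff x P + pdiff x Q"
  unfolding pdiff_def by (rule sum_keys_add) (simp_all add: distrib_left single_add)

text \<open>Subtraction of exponents is truncated at 0, and the hypothesis keeps it exact. When the
  exponent is 0, the derivative has the factor 0.\<close>

lemma monom_diff_single:
  "Poly_Mapping.lookup m x \<noteq> 0 \<Longrightarrow> (m + n) - Poly_Mapping.single x (1::nat) = (m - Poly_Mapping.single x 1) + n"
  by (intro poly_mapping_eqI) (auto simp: lookup_add lookup_minus lookup_single when_def)

lemma pdiff_mult: "pdiff x (P * Q) = pdiff x P * Q + P * pdiff x Q"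
proof (induction P rule: mpoly_induct_single)
  case (single m c)
  show ?case
  proof (induction Q rule: mpoly_induct_single)
    case (single n d)
    have "Poly_Mapping.single (m + n - Poly_Mapping.single x 1) (of_nat (Poly_Mapping.lookup m x) * c * d)
      = Poly_Mapping.single (m - Poly_Mapping.single x 1 + n) (of_nat (Poly_Mapping.lookup m x) * c * d)"
      using monom_diff_single[of m x n] by (cases "Poly_Mapping.lookup m x = 0") simp_all
    moreover have "Poly_Mapping.single (m + n - Poly_Mapping.single x 1) (of_nat (Poly_Mapping.lookup n x) * c * d)
      = Poly_Mapping.single (m + (n - Poly_Mapping.single x 1)) (of_nat (Poly_Mapping.lookup n x) * c * d)"
      using monom_diff_single[of n x m]
      by (cases "Poly_Mapping.lookup n x = 0") (simp_all add: add.commute)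
    ultimately show ?case
      by (simp add: mult_single pdiff_single lookup_add distrib_right distrib_left single_add mult_ac add_ac)
  qed (simp add: distrib_left pdiff_add algebra_simps)
qed (simp add: distrib_right pdiff_add algebra_simps)

lemma ring_derivation_pdiff: "ring_derivation (pdiff x)"
  by unfold_locales (simp_all add: pdiff_add pdiff_mult)

global_interpretation pdiff: ring_derivation "pdiff x" for x
  by (rule ring_derivation_pdiff)

lemma pdiff_Const [simp]: "pdiff x (Const c) = 0"
  by (simp add: Const_def pdiff_single)

lemma pdiff_Const_mult: "pdiff x (Const c * P) = Const c * pdiff x P"
  by (simp add: pdiff_mult)

lemma pdiff_Var: "pdiff x (Var y) = (if x = y then 1 else 0)"
  by (auto simp: Var_def pdiff_single lookup_single)

lemma pdiff_commute: "pdiff x (pdiff y P) = pdiff y (pdiff x P)"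
proof (induction P rule: mpoly_induct)
  case (Var P z)
  then show ?case by (simp add: pdiff_mult pdiff_add pdiff_Var)
qed (simp_all add: pdiff_add)

lemma pdiff_eq_0: "x \<notin> vars P \<Longrightarrow> pdiff x P = 0"
  by (simp add: pdiff_def vars_def in_keys_iff)

lemma finite_vars [simp]: "finite (vars P)"
  by (simp add: vars_def)

lemma vars_add: "vars (P + Q) \<subseteq> vars P \<union> vars Q"
  unfolding vars_def using Poly_Mapping.keys_add[of P Q] by blast

lemma vars_mult: "vars (P * Q) \<subseteq> vars P \<union> vars (Q :: ('x, 'a::comm_ring_1) mpoly)"
proof
  fix x assume "x \<in> vars (P * Q)"
  then obtain m where m: "m \<in> Poly_Mapping.keys (P * Q)" "x \<in> Poly_Mapping.keys m"
    by (auto simp: vars_def)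
  then obtain a b where "m = a + b" "a \<in> Poly_Mapping.keys P" "b \<in> Poly_Mapping.keys Q"
    using Poly_Mapping.keys_mult[of P Q] by blast
  then show "x \<in> vars P \<union> vars Q"
    using m Poly_Mapping.keys_add[of a b] by (auto simp: vars_def)
qed

lemma vars_Const [simp]: "vars (Const c) = {}"
  by (simp add: vars_def Const_def)

lemma vars_0 [simp]: "vars 0 = {}"
  by (simp add: vars_def)

lemma vars_1 [simp]: "vars 1 = {}"
  by (simp add: vars_def)

lemma vars_Var [simp]: "vars (Var x :: ('x, 'a::comm_ring_1) mpoly) = {x}"
  by (simp add: vars_def Var_def)

lemma vars_uminus [simp]: "vars (- P) = vars (P :: ('x, 'a::comm_ring_1) mpoly)"
  by (simp add: vars_def in_keys_iff set_eq_iff)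

lemma vars_sum: "vars (\<Sum>i\<in>I. f i) \<subseteq> (\<Union>i\<in>I. vars (f i))"
  unfolding vars_def using keys_sum_subset[of f I] by blast

lemma derivation_superset:
  assumes "finite A" "vars P \<subseteq> A"
  shows "derivation \<delta> P = (\<Sum>x\<in>A. pdiff x P * \<delta> x)"
  unfolding derivation_def using assms
  by (intro sum.mono_neutral_left) (auto simp: pdiff_eq_0)

lemma derivation_add: "derivation \<delta> (P + Q) = derivation \<delta> P + derivation \<delta> Q"
proof -
  let ?A = "vars P \<union> vars Q"
  show ?thesis using vars_add[of P Q]
    by (simp add: derivation_superset[of ?A] pdiff_add distrib_right sum.distrib)
qed

lemma derivation_mult: "derivation \<delta> (P * Q) = derivation \<delta> P * Q + P * derivation \<delta> Q"
proof -
  let ?A = "vars P \<union> vars Q"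
  show ?thesis using vars_mult[of P Q]
    by (simp add: derivation_superset[of ?A] pdiff_mult distrib_right sum.distrib sum_distrib_left
        sum_distrib_right mult_ac distrib_left)
qed

lemma ring_derivation_derivation: "ring_derivation (derivation \<delta>)"
  by unfold_locales (simp_all add: derivation_add derivation_mult)

lemma derivation_Var [simp]: "derivation \<delta> (Var x) = \<delta> x"
  by (simp add: derivation_def pdiff_Var)

lemma derivation_Const [simp]: "derivation \<delta> (Const c) = 0"
  by (simp add: derivation_def)

text \<open>Both sides obey the Leibniz rule along the evaluation, so agreement on the variables of
  \<open>P\<close> decides. This links the formal derivations in the construction of
  \<open>KP\<close> with differentiation of F.\<close>

lemma (in coeff_hom) eval_derivation:
  assumes D: "ring_derivation D" and const: "\<And>c. D (\<phi> c) = 0"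
    and vars: "\<And>x. x \<in> vars P \<Longrightarrow> eval_mpoly \<phi> f (\<delta> x) = D (f x)"
  shows "eval_mpoly \<phi> f (derivation \<delta> P) = D (eval_mpoly \<phi> f P)"
proof -
  interpret D: ring_derivation D by (rule D)
  interpret \<delta>: ring_derivation "derivation \<delta>" by (rule ring_derivation_derivation)
  show ?thesis using subset_refl[of "vars P"]
    by (induction P rule: mpoly_induct_vars)
       (simp_all add: const vars D.add D.mult \<delta>.add \<delta>.mult eval_add eval_mult)
qed

subsection \<open>A vertex operator\<close>

text \<open>The index maps have to be inverse to each other only where the summands are nonzero. Two
  cut-off sums can thus be matched although their index sets do not correspond: weights make the
  surplus terms vanish.\<close>

lemma sum_reindex_support:
  assumes "finite S" "finite T"
    and ij: "\<And>x. x \<in> S \<Longrightarrow> g x \<noteq> 0 \<Longrightarrow> j x \<in> T \<and> i (j x) = x \<and> h (j x) = g x"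
    and ji: "\<And>y. y \<in> T \<Longrightarrow> h y \<noteq> 0 \<Longrightarrow> i y \<in> S \<and> j (i y) = y \<and> g (i y) = h y"
  shows "sum g S = sum h T"
proof -
  have "sum g S = sum g {x\<in>S. g x \<noteq> 0}"
    using assms(1) by (intro sum.mono_neutral_right) auto
  also have "\<dots> = sum h {y\<in>T. h y \<noteq> 0}"
    by (rule sum.reindex_bij_witness[of _ i j]) (auto dest: ij ji)
  also have "\<dots> = sum h T"
    using assms(2) by (intro sum.mono_neutral_left) auto
  finally show ?thesis .
qed

text \<open>With \<open>al i\<close> = i d/dp_i this is the sum of p_(k+1) L_k over the Virasoro
  operators L_k, cut at \<open>M\<close>; it gives d tau / dt.\<close>

definition map_op :: "(nat \<Rightarrow> 'a \<Rightarrow> 'a) \<Rightarrow> (nat \<Rightarrow> 'a) \<Rightarrow> 'a \<Rightarrow> 'a \<Rightarrow> nat \<Rightarrow> 'a::comm_ring_1 \<Rightarrow> 'a" where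
  "map_op al p u v M x = (\<Sum>a=1..M. \<Sum>b=1..M. p a * (p b * al (a + b - 1) x))
     + (\<Sum>j=1..M. (u + v) * (p (j + 1) * al j x))
     + (\<Sum>i=1..M. \<Sum>j=1..M. p (i + j + 1) * al i (al j x))
     + u * v * (p 1 * x)"

text \<open>Here \<open>al i\<close> plays the role of \<open>i \<partial>/\<partial>p\<^sub>i\<close>, \<open>W n\<close> is the set of elements of weight at most \<open>n\<close>,
  \<open>eta m\<close> is the part of degree \<open>m\<close> of a translation of the variables, and the sign \<open>s\<close> distinguishes
  the two copies of the variables.\<close>

locale vertex_op =
  fixes al :: "nat \<Rightarrow> 'a::comm_ring_1 \<Rightarrow> 'a" and p :: "nat \<Rightarrow> 'a" and u v s :: 'a
    and W :: "int \<Rightarrow> 'a set" and h :: "nat \<Rightarrow> 'a" and eta :: "nat \<Rightarrow> 'a \<Rightarrow> 'a"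
  assumes s_cases: "s = 1 \<or> s = - 1"
    and al_add: "al i (x + y) = al i x + al i y"
    and al_mult: "al i (x * y) = al i x * y + x * al i y"
    and al_commute: "al i (al j x) = al j (al i x)"
    and al_h: "i \<ge> 1 \<Longrightarrow> al i (h m) = (if i \<le> m then s * h (m - i) else 0)"
    and W_add: "x \<in> W n \<Longrightarrow> y \<in> W n \<Longrightarrow> x + y \<in> W n"
    and W_neg: "n < 0 \<Longrightarrow> W n = {0}"
    and W_0: "0 \<in> W n"
    and W_al: "i \<ge> 1 \<Longrightarrow> x \<in> W n \<Longrightarrow> al i x \<in> W (n - int i)"
    and W_p: "i \<ge> 1 \<Longrightarrow> x \<in> W n \<Longrightarrow> p i * x \<in> W (n + int i)"
    and W_eta: "x \<in> W n \<Longrightarrow> eta m x \<in> W (n - int m)"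
    and eta_add: "eta m (x + y) = eta m x + eta m y"
    and eta_al: "i \<ge> 1 \<Longrightarrow> eta m (al i x) = al i (eta m x)"
    and eta_p: "a \<ge> 1 \<Longrightarrow> eta m (p a * x) = p a * eta m x - (if a \<le> m then s * eta (m - a) x else 0)"
    and eta_uv: "eta m (u * x) = u * eta m x" "eta m (v * x) = v * eta m x"
    and al_uv: "al i u = 0" "al i v = 0"
begin

lemma s: "s * s = 1"
  using s_cases by auto

lemma al_zero [simp]: "al i 0 = 0"
  using al_add[of i 0 0] by simp

lemma eta_zero [simp]: "eta i 0 = 0"
  using eta_add[of i 0 0] by simp

lemma al_sum: "al i (\<Sum>x\<in>A. f x) = (\<Sum>x\<in>A. al i (f x))"
  by (induction A rule: infinite_finite_induct) (simp_all add: al_add)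

lemma eta_sum: "eta i (\<Sum>x\<in>A. f x) = (\<Sum>x\<in>A. eta i (f x))"
  by (induction A rule: infinite_finite_induct) (simp_all add: eta_add)

text \<open>An integer index with value 0 below 0 spares case distinctions for shifted indices such
  as m - 1 - i - j.\<close>

definition Phi :: "'a \<Rightarrow> int \<Rightarrow> 'a" where
  "Phi x m = (if m < 0 then 0 else eta (nat m) x)"

text \<open>\<open>ell K\<close> sends the Laurent series with coefficients \<open>\<phi>\<close> to its pairing with the complete
  homogeneous functions; \<open>K\<close> bounds the degrees.\<close>

definition ell :: "nat \<Rightarrow> (int \<Rightarrow> 'a) \<Rightarrow> 'a" where
  "ell K \<phi> = (\<Sum>m=1..K. h (m - 1) * \<phi> (int m))"

text \<open>The evolution operator with \<open>u\<close> and \<open>v\<close> shifted by \<open>c\<close>, and the defect that remains when it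
  is moved past the vertex operator.\<close>

definition BB :: "nat \<Rightarrow> 'a \<Rightarrow> 'a \<Rightarrow> 'a" where
  "BB M c x = (\<Sum>a=1..M. \<Sum>b=1..M. p a * (p b * al (a + b - 1) x))
     + (\<Sum>j=1..M. (u + v + 2 * c) * (p (j + 1) * al j x))
     + (\<Sum>i=1..M. \<Sum>j=1..M. p (i + j + 1) * al i (al j x))
     + (u + c) * (v + c) * (p 1 * x)"

definition DD :: "nat \<Rightarrow> 'a \<Rightarrow> int \<Rightarrow> 'a" where
  "DD M x m = s * ((\<Sum>a=1..M. \<Sum>b=1..M. p a * p b * Phi x (m - 1 + int a + int b))
      + 2 * (\<Sum>b=1..M. \<Sum>j=1..M. p b * al j (Phi x (m - 1 + int b - int j)))
      + (\<Sum>i=1..M. \<Sum>j=1..M. al i (al j (Phi x (m - 1 - int i - int j)))))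
    + (\<Sum>a=1..M. of_nat a * p a * Phi x (m - 1 + int a))
    - (\<Sum>j=1..M. of_nat j * al j (Phi x (m - 1 - int j)))
    + s * (u + v) * ((\<Sum>a=1..M. p a * Phi x (m - 1 + int a)) + (\<Sum>j=1..M. al j (Phi x (m - 1 - int j))))
    + s * (u * v) * Phi x (m - 1)"

lemma BB_map_op: "BB M c = map_op al p (u + c) (v + c) M"
proof
  fix x
  have c: "u + v + 2 * c = u + c + (v + c)" by simp
  show "BB M c x = map_op al p (u + c) (v + c) M x"
    unfolding BB_def map_op_def c by (rule refl)
qed

lemma Phi_neg: "m < 0 \<Longrightarrow> Phi x m = 0"
  by (simp add: Phi_def)

lemma Phi_W: "x \<in> W n \<Longrightarrow> Phi x m \<in> W (n - m)"
  using W_eta[of x n "nat m"] by (auto simp: Phi_def W_0)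

lemma W_negD: "x \<in> W n \<Longrightarrow> n < 0 \<Longrightarrow> x = 0"
  using W_neg by auto

lemma Phi_big: "x \<in> W n \<Longrightarrow> m > n \<Longrightarrow> Phi x m = 0"
  using Phi_W[of x n m] W_negD by simp

lemma al_Phi_big: "x \<in> W n \<Longrightarrow> i \<ge> 1 \<Longrightarrow> m + int i > n \<Longrightarrow> al i (Phi x m) = 0"
  using W_al[OF _ Phi_W[of x n m], of i] W_negD by simp

lemma Phi_al: "i \<ge> 1 \<Longrightarrow> Phi (al i x) m = al i (Phi x m)"
  by (simp add: Phi_def eta_al)

lemma Phi_add: "Phi (x + y) m = Phi x m + Phi y m"
  by (simp add: Phi_def eta_add)

lemma Phi_sum: "Phi (\<Sum>i\<in>A. f i) m = (\<Sum>i\<in>A. Phi (f i) m)"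
  by (simp add: Phi_def eta_sum)

lemma Phi_p: "a \<ge> 1 \<Longrightarrow> Phi (p a * x) m = p a * Phi x m - s * Phi x (m - int a)"
  by (auto simp: Phi_def eta_p nat_diff_distrib' not_le nat_less_iff le_nat_iff)

lemma Phi_uv: "Phi (u * x) m = u * Phi x m" "Phi (v * x) m = v * Phi x m"
  by (simp_all add: Phi_def eta_uv)

lemma ell_add: "ell K (\<lambda>m. f m + g m) = ell K f + ell K g"
  by (simp add: ell_def algebra_simps sum.distrib)

lemma ell_sum: "ell K (\<lambda>m. \<Sum>i\<in>A. f i m) = (\<Sum>i\<in>A. ell K (f i))"
  by (simp add: ell_def sum_distrib_left, subst sum.swap) simp

lemma ell_mult: "ell K (\<lambda>m. c * f m) = c * ell K f"
  by (simp add: ell_def sum_distrib_left mult_ac)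

text \<open>The derivation lowers the index of \<open>h (m - 1)\<close> by \<open>i\<close>;
  renaming m moves the shift to \<open>\<phi>\<close>. As \<open>\<phi>\<close> vanishes above
  \<open>K\<close>, no term is lost at the cut.\<close>

lemma al_ell:
  assumes "i \<ge> 1" "\<And>m. m > int K \<Longrightarrow> \<phi> m = 0"
  shows "al i (ell K \<phi>) = ell K (\<lambda>m. al i (\<phi> m) + s * \<phi> (m + int i))"
proof -
  have "(\<Sum>m=1..K. al i (h (m - 1)) * \<phi> (int m)) = (\<Sum>m=1..K. h (m - 1) * (s * \<phi> (int m + int i)))"
  proof (rule sum_reindex_support[where j = "\<lambda>m. m - i" and i = "\<lambda>m. m + i"])
    fix x assume x: "x \<in> {1..K}" "al i (h (x - 1)) * \<phi> (int x) \<noteq> 0"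
    then have *: "i \<le> x - 1" using al_h[OF assms(1), of "x - 1"] by (auto split: if_splits)
    then have "int (x - i) + int i = int x" "x - Suc i = x - i - 1" by auto
    then show "x - i \<in> {1..K} \<and> x - i + i = x \<and> h (x - i - 1) * (s * \<phi> (int (x - i) + int i)) = al i (h (x - 1)) * \<phi> (int x)"
      using * x assms(1) al_h[OF assms(1), of "x - 1"] by auto
  next
    fix y assume y: "y \<in> {1..K}" "h (y - 1) * (s * \<phi> (int y + int i)) \<noteq> 0"
    then have "\<phi> (int y + int i) \<noteq> 0" by auto
    then have "y + i \<le> K" using assms(2)[of "int y + int i"] by linarith
    then show "y + i \<in> {1..K} \<and> y + i - i = y \<and>
        al i (h (y + i - 1)) * \<phi> (int (y + i)) = h (y - 1) * (s * \<phi> (int y + int i))"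
      using y assms(1) al_h[OF assms(1), of "y + i - 1"] by (auto simp: add_ac)
  qed auto
  then show ?thesis
    by (simp add: ell_def al_sum al_mult distrib_left sum.distrib add.commute)
qed

context
  fixes M :: nat and n m :: int and f :: 'a
  assumes f: "f \<in> W n" and m: "m \<ge> 1" and M: "int M \<ge> n"
begin

text \<open>The p_(j+1) with j \<ge> 1 and p_1 are all the p_a; the surplus term a = M + 1 is 0 by
  weight.\<close>

lemma shift_linear:
  "(\<Sum>j=1..M. p (j + 1) * Phi f (m + int j)) + p 1 * Phi f m = (\<Sum>a=1..M. p a * Phi f (m - 1 + int a))"
proof -
  define G where "G a = p a * Phi f (m - 1 + int a)" for a
  have "(\<Sum>a=1..Suc M. G a) = G 1 + (\<Sum>a=Suc 1..Suc M. G a)"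
    by (rule sum.atLeast_Suc_atMost) simp
  also have "(\<Sum>a=Suc 1..Suc M. G a) = (\<Sum>a=1..M. G (Suc a))"
    by (rule sum.shift_bounds_cl_Suc_ivl)
  finally have "(\<Sum>j=1..M. p (j + 1) * Phi f (m + int j)) + p 1 * Phi f m = (\<Sum>a=1..Suc M. G a)"
    by (simp add: G_def add.commute)
  also have "\<dots> = (\<Sum>a=1..M. p a * Phi f (m - 1 + int a))"
    using M m Phi_big[OF f, of "m + int M"] by (simp add: G_def)
  finally show ?thesis .
qed

text \<open>The pairs (b, j) on the right with b = j + 1, with b > j + 1 and with b \<le> j give the
  three sums on the left, in this order.\<close>

lemma shift_mixed:
  "(\<Sum>j=1..M. p (j + 1) * al j (Phi f m)) + (\<Sum>i=1..M. \<Sum>j=1..M. p (i + j + 1) * al j (Phi f (m + int i)))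
     + (\<Sum>a=1..M. \<Sum>b=1..M. p b * al (a + b - 1) (Phi f (m - int a)))
   = (\<Sum>b=1..M. \<Sum>j=1..M. p b * al j (Phi f (m - 1 + int b - int j)))"
proof -
  define F where "F = (\<lambda>(b, j). p b * al j (Phi f (m - 1 + int b - int j)))"
  let ?S = "{1..M} \<times> {1..M}"
  \<comment> \<open>For b > n the weight of the term would be negative; for j > m - 1 + b the index
    of \<open>Phi\<close> is.\<close>
  have supp: "int b \<le> n \<and> int j \<le> m - 1 + int b" if "F (b, j) \<noteq> 0" "j \<ge> 1" for b j
  proof (rule ccontr)
    assume "\<not> ?thesis"
    then consider "int b > n" | "m - 1 + int b - int j < 0" by linarith
    then show False
    proof cases
      case 1
      then show ?thesis using that m al_Phi_big[OF f, of j "m - 1 + int b - int j"] by (simp add: F_def)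
    next
      case 2
      then show ?thesis using that by (simp add: F_def Phi_neg)
    qed
  qed
  have "(\<Sum>b=1..M. \<Sum>j=1..M. p b * al j (Phi f (m - 1 + int b - int j))) = sum F ?S"
    by (simp add: F_def sum.cartesian_product)
  also have "\<dots> = sum F {x\<in>?S. fst x = snd x + 1} + sum F {x\<in>?S. fst x > snd x + 1} + sum F {x\<in>?S. fst x \<le> snd x}"
    by (subst sum.union_disjoint[symmetric]; (subst sum.union_disjoint[symmetric])?)
       (auto intro!: sum.cong)
  also have "sum F {x\<in>?S. fst x = snd x + 1} = (\<Sum>j=1..M. p (j + 1) * al j (Phi f m))"
  proof (rule sum_reindex_support[where j = snd and i = "\<lambda>j. (j + 1, j)"])
    fix y assume y: "y \<in> {1..M}" "p (y + 1) * al y (Phi f m) \<noteq> 0"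
    then show "(y + 1, y) \<in> {x\<in>?S. fst x = snd x + 1} \<and> snd (y + 1, y) = y \<and> F (y + 1, y) = p (y + 1) * al y (Phi f m)"
      using supp[of "y + 1" y] M by (auto simp: F_def)
  qed (auto simp: F_def)
  also have "sum F {x\<in>?S. fst x > snd x + 1} = (\<Sum>(i,j)\<in>?S. p (i + j + 1) * al j (Phi f (m + int i)))"
  proof (rule sum_reindex_support[where j = "\<lambda>(b, j). (b - j - 1, j)" and i = "\<lambda>(i, j). (i + j + 1, j)"])
    fix y assume y: "y \<in> ?S" "(case y of (i, j) \<Rightarrow> p (i + j + 1) * al j (Phi f (m + int i))) \<noteq> 0"
    then show "(case y of (i, j) \<Rightarrow> (i + j + 1, j)) \<in> {x\<in>?S. fst x > snd x + 1} \<and>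
      (case case y of (i, j) \<Rightarrow> (i + j + 1, j) of (b, j) \<Rightarrow> (b - j - 1, j)) = y \<and>
      F (case y of (i, j) \<Rightarrow> (i + j + 1, j)) = (case y of (i, j) \<Rightarrow> p (i + j + 1) * al j (Phi f (m + int i)))"
      using supp[of "fst y + snd y + 1" "snd y"] M by (auto simp: F_def split: prod.splits)
  next
    fix x assume x: "x \<in> {x\<in>?S. fst x > snd x + 1}" "F x \<noteq> 0"
    then have "m + int (fst x - snd x - 1) = m - 1 + int (fst x) - int (snd x)" by auto
    then show "(case x of (b, j) \<Rightarrow> (b - j - 1, j)) \<in> ?S \<and>
      (case case x of (b, j) \<Rightarrow> (b - j - 1, j) of (i, j) \<Rightarrow> (i + j + 1, j)) = x \<and>
      (case case x of (b, j) \<Rightarrow> (b - j - 1, j) of (i, j) \<Rightarrow> p (i + j + 1) * al j (Phi f (m + int i))) = F x"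
      using x by (auto simp: F_def algebra_simps split: prod.splits)
  qed auto
  also have "sum F {x\<in>?S. fst x \<le> snd x} = (\<Sum>(a,b)\<in>?S. p b * al (a + b - 1) (Phi f (m - int a)))"
  proof (rule sum_reindex_support[where j = "\<lambda>(b, j). (j + 1 - b, b)" and i = "\<lambda>(a, b). (b, a + b - 1)"])
    fix y assume y: "y \<in> ?S" "(case y of (a, b) \<Rightarrow> p b * al (a + b - 1) (Phi f (m - int a))) \<noteq> 0"
    then have "F (snd y, fst y + snd y - 1) \<noteq> 0"
      by (auto simp: F_def of_nat_diff split: prod.splits)
    moreover have y1: "fst y + snd y - 1 \<ge> 1" using y by auto
    ultimately have "int (snd y) \<le> n \<and> int (fst y + snd y - 1) \<le> m - 1 + int (snd y)"
      by (rule supp)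
    then have "int (snd y) \<le> n \<and> int (fst y) \<le> m"
      using y by (auto simp: of_nat_diff)
    moreover have "m - int (fst y) + int (fst y + snd y - 1) \<le> n"
    proof (rule ccontr)
      assume "\<not> ?thesis"
      then have "al (fst y + snd y - 1) (Phi f (m - int (fst y))) = 0"
        by (intro al_Phi_big[OF f y1]) linarith
      then show False using y by (auto split: prod.splits)
    qed
    ultimately have "int (fst y + snd y - 1) \<le> n" using m y by auto
    then show "(case y of (a, b) \<Rightarrow> (b, a + b - 1)) \<in> {x\<in>?S. fst x \<le> snd x} \<and>
      (case case y of (a, b) \<Rightarrow> (b, a + b - 1) of (b, j) \<Rightarrow> (j + 1 - b, b)) = y \<and>
      F (case y of (a, b) \<Rightarrow> (b, a + b - 1)) = (case y of (a, b) \<Rightarrow> p b * al (a + b - 1) (Phi f (m - int a)))"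
      using y M by (auto simp: F_def of_nat_diff split: prod.splits)
  next
    fix x assume x: "x \<in> {x\<in>?S. fst x \<le> snd x}" "F x \<noteq> 0"
    then have "m - int (snd x + 1 - fst x) = m - 1 + int (fst x) - int (snd x)" by auto
    then show "(case x of (b, j) \<Rightarrow> (j + 1 - b, b)) \<in> ?S \<and>
      (case case x of (b, j) \<Rightarrow> (j + 1 - b, b) of (a, b) \<Rightarrow> (b, a + b - 1)) = x \<and>
      (case case x of (b, j) \<Rightarrow> (j + 1 - b, b) of (a, b) \<Rightarrow> p b * al (a + b - 1) (Phi f (m - int a))) = F x"
      using x by (auto simp: F_def algebra_simps split: prod.splits)
  qed auto
  finally show ?thesis
    by (simp add: sum.cartesian_product)
qed

text \<open>There are a - 2 pairs of positive integers with i + j + 1 = a, and the first sum adds 2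
  for a \<ge> 2; for a = 1 the last term alone contributes. The total is a in either case.\<close>

lemma shift_quadratic:
  "2 * (\<Sum>j=1..M. p (j + 1) * Phi f (m + int j)) + (\<Sum>i=1..M. \<Sum>j=1..M. p (i + j + 1) * Phi f (m + int i + int j))
     + p 1 * Phi f m = (\<Sum>a=1..M. of_nat a * p a * Phi f (m - 1 + int a))"
proof -
  define F where "F a = p a * Phi f (m - 1 + int a)" for a
  have supp: "int a \<le> n" if "F a \<noteq> 0" for a
  proof (rule ccontr)
    assume "\<not> int a \<le> n"
    then show False using that Phi_big[OF f, of "m - 1 + int a"] m by (simp add: F_def)
  qed
  have "(\<Sum>i=1..M. \<Sum>j=1..M. p (i + j + 1) * Phi f (m + int i + int j)) = (\<Sum>(i, j)\<in>{1..M}\<times>{1..M}. F (i + j + 1))"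
    by (simp add: F_def sum.cartesian_product algebra_simps)
  also have "\<dots> = (\<Sum>(a, i)\<in>(SIGMA a:{1..M}. {1..a-2}). F a)"
  proof (rule sum_reindex_support[where j = "\<lambda>(i, j). (i + j + 1, i)" and i = "\<lambda>(a, i). (i, a - i - 1)"])
    fix x assume x: "x \<in> {1..M} \<times> {1..M}" "(case x of (i, j) \<Rightarrow> F (i + j + 1)) \<noteq> 0"
    then show "(case x of (i, j) \<Rightarrow> (i + j + 1, i)) \<in> (SIGMA a:{1..M}. {1..a-2}) \<and>
       (case case x of (i, j) \<Rightarrow> (i + j + 1, i) of (a, i) \<Rightarrow> (i, a - i - 1)) = x \<and>
       (case case x of (i, j) \<Rightarrow> (i + j + 1, i) of (a, i) \<Rightarrow> F a) = (case x of (i, j) \<Rightarrow> F (i + j + 1))"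
      using supp[of "fst x + snd x + 1"] M by (auto split: prod.splits)
  qed auto
  also have "\<dots> = (\<Sum>a=1..M. of_nat (a - 2) * F a)"
    by (subst sum.Sigma[symmetric]) auto
  finally have 1: "(\<Sum>i=1..M. \<Sum>j=1..M. p (i + j + 1) * Phi f (m + int i + int j)) = (\<Sum>a=1..M. of_nat (a - 2) * F a)" .
  have "(\<Sum>a=1..M. of_nat a * F a) = (\<Sum>a=1..M. of_nat (a - 2) * F a + 2 * F a - (if a = 1 then F 1 else 0))"
  proof (rule sum.cong)
    fix a assume a: "a \<in> {1..M}"
    show "of_nat a * F a = of_nat (a - 2) * F a + 2 * F a - (if a = 1 then F 1 else 0)"
    proof (cases "a = 1")
      case False
      then have "of_nat a = (of_nat (a - 2) + 2 :: 'a)"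
        using a by (simp add: of_nat_diff)
      then show ?thesis using False by (simp add: algebra_simps)
    qed simp
  qed simp
  also have "\<dots> = (\<Sum>a=1..M. of_nat (a - 2) * F a) + 2 * (\<Sum>a=1..M. F a) - F 1"
  proof -
    have "F 1 = 0" if "M = 0" using supp[of 1] M that by linarith
    then have "(\<Sum>a=1..M. if a = 1 then F 1 else 0) = F 1"
      by (cases "M = 0") auto
    then show ?thesis by (simp add: sum.distrib sum_subtractf sum_distrib_left)
  qed
  also have "(\<Sum>a=1..M. F a) = (\<Sum>j=1..M. p (j + 1) * Phi f (m + int j)) + F 1"
    using shift_linear by (simp add: F_def)
  finally show ?thesis
    using 1 by (simp add: F_def algebra_simps)
qed

text \<open>Exactly j pairs of positive integers satisfy a + b - 1 = j.\<close>

lemma shift_al: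
  "(\<Sum>a=1..M. \<Sum>b=1..M. al (a + b - 1) (Phi f (m - int a - int b))) = (\<Sum>j=1..M. of_nat j * al j (Phi f (m - 1 - int j)))"
proof -
  define F where "F a = al a (Phi f (m - 1 - int a))" for a
  have supp: "int a \<le> n" if "F a \<noteq> 0" "a \<ge> 1" for a
  proof (rule ccontr)
    assume *: "\<not> ?thesis"
    show False
    proof (cases "m - 1 \<le> n")
      case True
      then show ?thesis using * that by (simp add: F_def Phi_neg)
    next
      case False
      then show ?thesis using that al_Phi_big[OF f, of a "m - 1 - int a"] by (simp add: F_def)
    qed
  qed
  have "al (a + b - 1) (Phi f (m - int a - int b)) = F (a + b - 1)" if "a \<ge> 1" for a b
    using that by (simp add: F_def of_nat_diff algebra_simps)
  then have "(\<Sum>a=1..M. \<Sum>b=1..M. al (a + b - 1) (Phi f (m - int a - int b))) = (\<Sum>(a, b)\<in>{1..M}\<times>{1..M}. F (a + b - 1))"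
    by (subst sum.cartesian_product[symmetric]) (intro sum.cong, auto)
  also have "\<dots> = (\<Sum>(j, a)\<in>(SIGMA j:{1..M}. {1..j}). F j)"
  proof (rule sum_reindex_support[where j = "\<lambda>(a, b). (a + b - 1, a)" and i = "\<lambda>(j, a). (a, j + 1 - a)"])
    fix x assume x: "x \<in> {1..M} \<times> {1..M}" "(case x of (a, b) \<Rightarrow> F (a + b - 1)) \<noteq> 0"
    then have "int (fst x + snd x - 1) \<le> n"
      using supp[of "fst x + snd x - 1"] by (auto split: prod.splits)
    with x show "(case x of (a, b) \<Rightarrow> (a + b - 1, a)) \<in> (SIGMA j:{1..M}. {1..j}) \<and>
       (case case x of (a, b) \<Rightarrow> (a + b - 1, a) of (j, a) \<Rightarrow> (a, j + 1 - a)) = x \<and>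
       (case case x of (a, b) \<Rightarrow> (a + b - 1, a) of (j, a) \<Rightarrow> F j) = (case x of (a, b) \<Rightarrow> F (a + b - 1))"
      using M by (auto split: prod.splits)
  qed auto
  also have "\<dots> = (\<Sum>j=1..M. of_nat j * F j)"
    by (subst sum.Sigma[symmetric]) auto
  finally show ?thesis
    by (simp add: F_def)
qed

end

lemma ell_cong: "(\<And>m. m \<ge> 1 \<Longrightarrow> f m = g m) \<Longrightarrow> ell K f = ell K g"
  unfolding ell_def by (intro sum.cong) auto

lemma Phi_pp:
  assumes "a \<ge> 1" "b \<ge> 1"
  shows "Phi (p a * (p b * x)) m = p a * (p b * Phi x m) - s * (p b * Phi x (m - int a)) - s * (p a * Phi x (m - int b))
    + Phi x (m - int a - int b)"
proof -
  have "Phi (p a * (p b * x)) m = p a * (p b * Phi x m - s * Phi x (m - int b))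
      - s * (p b * Phi x (m - int a) - s * Phi x (m - int a - int b))"
    using assms by (simp add: Phi_p)
  also have "\<dots> = p a * (p b * Phi x m) - s * (p b * Phi x (m - int a)) - s * (p a * Phi x (m - int b))
    + (s * s) * Phi x (m - int a - int b)"
    by (simp add: algebra_simps)
  finally show ?thesis by (simp add: s)
qed

text \<open>Moving \<open>al i\<close> into \<open>ell\<close> adds s times the value at m + i;
  moving p_a into \<open>Phi\<close> subtracts s times the value at m - a. The shift of u and v by s
  is what completes the sums of the defect: it supplies the pairs b = j + 1 in the mixed sum and the
  remaining multiplicities in the sum of a p_a.\<close>

theorem BB_ell:
  assumes f: "f \<in> W n" and M: "int M \<ge> n" and K: "int K \<ge> n"
  shows "BB M s (ell K (Phi f)) = ell K (Phi (BB M 0 f)) + ell K (DD M f)"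
proof -
  let ?P = "Phi f"
  have P0: "?P m = 0" if "m > int K" for m
    using that K Phi_big[OF f] by simp
  have al1: "al i (ell K ?P) = ell K (\<lambda>m. al i (?P m) + s * ?P (m + int i))" if "i \<ge> 1" for i
    using that P0 by (rule al_ell)
  have al2: "al i (al j (ell K ?P)) = ell K (\<lambda>m. al i (al j (?P m)) + al i (s * ?P (m + int j))
      + s * (al j (?P (m + int i)) + s * ?P (m + int i + int j)))" if "i \<ge> 1" "j \<ge> 1" for i j
    unfolding al1[OF that(2)] by (subst al_ell[OF that(1)]) (simp_all add: P0 al_add)
  have "al i 1 = 0" for i using al_mult[of i 1 1] by simp
  moreover from this have "al i (- 1) = 0" for i using al_add[of i 1 "- 1"] by simp
  ultimately have als: "al i s = 0" for i
    using s_cases by auto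
  have "BB M s (ell K ?P) = ell K (\<lambda>m.
       (\<Sum>a=1..M. \<Sum>b=1..M. p a * (p b * (al (a + b - 1) (?P m) + s * ?P (m + int (a + b - 1)))))
     + (\<Sum>j=1..M. (u + v + 2 * s) * (p (j + 1) * (al j (?P m) + s * ?P (m + int j))))
     + (\<Sum>i=1..M. \<Sum>j=1..M. p (i + j + 1) * (al i (al j (?P m)) + al i (s * ?P (m + int j))
      + s * (al j (?P (m + int i)) + s * ?P (m + int i + int j))))
     + (u + s) * (v + s) * (p 1 * ?P m))"
  proof -
    have 1: "(\<Sum>a=1..M. \<Sum>b=1..M. p a * (p b * al (a + b - 1) (ell K ?P))) =
        (\<Sum>a=1..M. \<Sum>b=1..M. p a * (p b * ell K (\<lambda>m. al (a + b - 1) (?P m) + s * ?P (m + int (a + b - 1)))))"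
      by (intro sum.cong refl, subst al1) auto
    have 2: "(\<Sum>j=1..M. (u + v + 2 * s) * (p (j + 1) * al j (ell K ?P))) =
        (\<Sum>j=1..M. (u + v + 2 * s) * (p (j + 1) * ell K (\<lambda>m. al j (?P m) + s * ?P (m + int j))))"
      by (intro sum.cong refl, subst al1) auto
    have 3: "(\<Sum>i=1..M. \<Sum>j=1..M. p (i + j + 1) * al i (al j (ell K ?P))) =
        (\<Sum>i=1..M. \<Sum>j=1..M. p (i + j + 1) * ell K (\<lambda>m. al i (al j (?P m)) + al i (s * ?P (m + int j))
          + s * (al j (?P (m + int i)) + s * ?P (m + int i + int j))))"
      by (intro sum.cong refl, subst al2) auto
    show ?thesis
      unfolding BB_def 1 2 3 unfolding ell_add ell_sum ell_mult by (rule refl)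
  qed
  also have "\<dots> = ell K (\<lambda>m. Phi (BB M 0 f) m + DD M f m)"
  proof (rule ell_cong)
    fix m :: int assume m: "m \<ge> 1"
    let ?S = "\<lambda>g. \<Sum>a=1..M. \<Sum>b=1..M. g a b"
    define t1 where "t1 = ?S (\<lambda>a b. p a * (p b * al (a + b - 1) (?P m)))"
    define t2 where "t2 = ?S (\<lambda>a b. p a * (p b * ?P (m - 1 + int a + int b)))"
    define t3 where "t3 = (\<Sum>j=1..M. p (j + 1) * al j (?P m))"
    define t4 where "t4 = (\<Sum>j=1..M. p (j + 1) * ?P (m + int j))"
    define t5 where "t5 = ?S (\<lambda>i j. p (i + j + 1) * al i (al j (?P m)))"
    define t6 where "t6 = ?S (\<lambda>i j. p (i + j + 1) * al j (?P (m + int i)))"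
    define t7 where "t7 = ?S (\<lambda>i j. p (i + j + 1) * ?P (m + int i + int j))"
    define t8 where "t8 = ?S (\<lambda>a b. p b * al (a + b - 1) (?P (m - int a)))"
    define t9 where "t9 = ?S (\<lambda>a b. al (a + b - 1) (?P (m - int a - int b)))"
    define t10 where "t10 = (\<Sum>j=1..M. al j (?P (m - 1 - int j)))"
    define t11 where "t11 = ?S (\<lambda>i j. al i (al j (?P (m - 1 - int i - int j))))"
    have t6': "t6 = ?S (\<lambda>i j. p (i + j + 1) * al i (?P (m + int j)))"
      unfolding t6_def by (subst sum.swap) (simp add: add.commute)
    have t8': "t8 = ?S (\<lambda>a b. p a * al (a + b - 1) (?P (m - int b)))"
      unfolding t8_def by (subst sum.swap) (simp add: add.commute)
    have L: "(\<Sum>a=1..M. \<Sum>b=1..M. p a * (p b * (al (a + b - 1) (?P m) + s * ?P (m + int (a + b - 1)))))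
     + (\<Sum>j=1..M. (u + v + 2 * s) * (p (j + 1) * (al j (?P m) + s * ?P (m + int j))))
     + (\<Sum>i=1..M. \<Sum>j=1..M. p (i + j + 1) * (al i (al j (?P m)) + al i (s * ?P (m + int j))
      + s * (al j (?P (m + int i)) + s * ?P (m + int i + int j))))
     + (u + s) * (v + s) * (p 1 * ?P m)
     = t1 + s * t2 + (u + v + 2 * s) * (t3 + s * t4) + t5 + s * t6 + s * t6 + s * s * t7 + (u + s) * (v + s) * (p 1 * ?P m)"
    proof -
      have 1: "(\<Sum>a=1..M. \<Sum>b=1..M. p a * (p b * (al (a + b - 1) (?P m) + s * ?P (m + int (a + b - 1))))) = t1 + s * t2"
        unfolding t1_def t2_def sum_distrib_left sum.distrib[symmetric]
        by (intro sum.cong refl) (simp add: algebra_simps of_nat_diff)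
      have 2: "(\<Sum>j=1..M. (u + v + 2 * s) * (p (j + 1) * (al j (?P m) + s * ?P (m + int j)))) = (u + v + 2 * s) * (t3 + s * t4)"
        unfolding t3_def t4_def sum_distrib_left sum.distrib[symmetric]
        by (intro sum.cong refl) (simp add: algebra_simps)
      have 3: "(\<Sum>i=1..M. \<Sum>j=1..M. p (i + j + 1) * (al i (al j (?P m)) + al i (s * ?P (m + int j))
        + s * (al j (?P (m + int i)) + s * ?P (m + int i + int j)))) = t5 + s * t6 + s * t6 + s * s * t7"
        apply (subst (1) t6')
        unfolding t5_def t6_def t7_def sum_distrib_left sum.distrib[symmetric]
        by (intro sum.cong refl) (simp add: algebra_simps al_mult als)
      show ?thesis unfolding 1 2 3 by (simp add: algebra_simps)
    qed
    have R1: "Phi (BB M 0 f) m = t1 - s * t8 - s * t8 + t9 + (u + v) * (t3 - s * t10) + t5 - s * t11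
        + u * v * (p 1 * ?P m - s * ?P (m - 1))"
    proof -
      have uv: "Phi ((u + v + 2 * 0) * x) k = (u + v) * Phi x k" "Phi ((u + 0) * (v + 0) * x) k = u * v * Phi x k" for x k
        by (simp_all add: distrib_right Phi_add Phi_uv mult.assoc)
      have Phi_al2: "Phi (al (a + b - Suc 0) f) k = al (a + b - Suc 0) (?P k)" if "Suc 0 \<le> a \<and> a \<le> M" "Suc 0 \<le> b \<and> b \<le> M" for a b k
        using that by (intro Phi_al) auto
      have 1: "(\<Sum>a=1..M. \<Sum>b=1..M. Phi (p a * (p b * al (a + b - 1) f)) m) = t1 - s * t8 - s * t8 + t9"
        apply (subst (1) t8')
        unfolding t1_def t8_def t9_def sum_distrib_left sum.distrib[symmetric] sum_subtractf[symmetric]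
        by (intro sum.cong refl, subst Phi_pp) (simp_all add: Phi_al2 algebra_simps)
      have 2: "(\<Sum>j=1..M. (u + v) * Phi (p (j + 1) * al j f) m) = (u + v) * (t3 - s * t10)"
        unfolding t3_def t10_def sum_distrib_left sum_subtractf[symmetric]
        by (intro sum.cong refl, subst Phi_p) (simp_all add: Phi_al algebra_simps)
      have 3: "(\<Sum>i=1..M. \<Sum>j=1..M. Phi (p (i + j + 1) * al i (al j f)) m) = t5 - s * t11"
        unfolding t5_def t11_def sum_distrib_left sum_subtractf[symmetric]
        by (intro sum.cong refl, subst Phi_p) (simp_all add: Phi_al algebra_simps)
      have 4: "Phi (p 1 * f) m = p 1 * ?P m - s * ?P (m - 1)"
        by (simp add: Phi_p)
      show ?thesis
        unfolding BB_def Phi_add Phi_sum uv 1 2 3 4 by (simp add: algebra_simps)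
    qed
    have R2: "DD M f m = s * (t2 + 2 * (t3 + t6 + t8) + t11) + (2 * t4 + t7 + p 1 * ?P m) - t9
        + s * (u + v) * ((t4 + p 1 * ?P m) + t10) + s * (u * v) * ?P (m - 1)"
      unfolding DD_def shift_mixed[OF f m M, symmetric] shift_linear[OF f m M, symmetric]
        shift_quadratic[OF f m M, symmetric] shift_al[OF f m M, symmetric]
      by (simp add: t2_def t3_def t4_def t6_def t7_def t8_def t9_def t10_def t11_def mult.assoc)
    have ss: "s * (s * x) = x" for x by (simp add: mult.assoc[symmetric] s)
    show "(\<Sum>a=1..M. \<Sum>b=1..M. p a * (p b * (al (a + b - 1) (?P m) + s * ?P (m + int (a + b - 1)))))
     + (\<Sum>j=1..M. (u + v + 2 * s) * (p (j + 1) * (al j (?P m) + s * ?P (m + int j))))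
     + (\<Sum>i=1..M. \<Sum>j=1..M. p (i + j + 1) * (al i (al j (?P m)) + al i (s * ?P (m + int j))
      + s * (al j (?P (m + int i)) + s * ?P (m + int i + int j))))
     + (u + s) * (v + s) * (p 1 * ?P m) = Phi (BB M 0 f) m + DD M f m"
      unfolding L R1 R2 by (simp add: algebra_simps ss s)
  qed
  finally show ?thesis by (simp add: ell_add)
qed

end

section \<open>The two vertex operators together and the cancellation of their defects\<close>

locale vertex_pair =
  A: vertex_op al p u v 1 W h eta + B: vertex_op al' p' u v "- 1" W h eta
  for al al' :: "nat \<Rightarrow> 'a::comm_ring_1 \<Rightarrow> 'a" and p p' :: "nat \<Rightarrow> 'a" and u v :: 'a
    and W :: "int \<Rightarrow> 'a set" and h :: "nat \<Rightarrow> 'a" and eta :: "nat \<Rightarrow> 'a \<Rightarrow> 'a" +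
  assumes eta_rec: "of_nat m * eta m x = (\<Sum>i=1..m. al' i (eta (m - i) x) - al i (eta (m - i) x))"
    and h_rec: "of_nat m * h m = (\<Sum>i=1..m. (p i - p' i) * h (m - i))"
    and al_al': "al i (al' j x) = al' j (al i x)"
begin

text \<open>Up to sign this is the residue of d/dz (H(z) phi(z)) with H = sum of h_k z^k and phi =
  sum of phi_k z^(-k): by \<open>h_rec\<close>, z H' is H times the sum of (p_a - p'_a) z^a, and
  \<open>ell\<close> reads off the coefficient of z^(-1).\<close>

lemma ell_total:
  assumes K: "\<And>k. k \<ge> int K \<Longrightarrow> \<phi> k = 0" and M: "M \<ge> K"
  shows "A.ell K (\<lambda>m. of_int (m - 1) * \<phi> (m - 1) - (\<Sum>a=1..M. (p a - p' a) * \<phi> (m - 1 + int a))) = 0"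
proof -
  have "(\<Sum>m=1..K. h (m - 1) * (of_int (int m - 1) * \<phi> (int m - 1))) =
      (\<Sum>(m, a)\<in>(SIGMA m:{1..K}. {1..m - 1}). (p a - p' a) * h (m - 1 - a) * \<phi> (int m - 1))"
  proof -
    have "h (m - 1) * (of_int (int m - 1) * \<phi> (int m - 1)) = (\<Sum>a=1..m - 1. (p a - p' a) * h (m - 1 - a) * \<phi> (int m - 1))"
      if "m \<ge> 1" for m
    proof -
      have "h (m - 1) * (of_int (int m - 1) * \<phi> (int m - 1)) = (of_nat (m - 1) * h (m - 1)) * \<phi> (int m - 1)"
        using that by (simp add: of_nat_diff mult_ac)
      then show ?thesis by (simp add: h_rec sum_distrib_right)
    qed
    then show ?thesis by (subst sum.Sigma[symmetric]) (auto intro: sum.cong)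
  qed
  also have "\<dots> = (\<Sum>(m, a)\<in>{1..K}\<times>{1..M}. h (m - 1) * ((p a - p' a) * \<phi> (int m - 1 + int a)))"
  proof (rule sum_reindex_support[where j = "\<lambda>(m, a). (m - a, a)" and i = "\<lambda>(m, a). (m + a, a)"])
    fix y assume y: "y \<in> {1..K}\<times>{1..M}" "(case y of (m, a) \<Rightarrow> h (m - 1) * ((p a - p' a) * \<phi> (int m - 1 + int a))) \<noteq> 0"
    have "fst y + snd y \<le> K"
      using K[of "int (fst y) - 1 + int (snd y)"] y by (cases "fst y + snd y \<le> K") (auto split: prod.splits)
    then show "(case y of (m, a) \<Rightarrow> (m + a, a)) \<in> (SIGMA m:{1..K}. {1..m - 1}) \<and>
        (case case y of (m, a) \<Rightarrow> (m + a, a) of (m, a) \<Rightarrow> (m - a, a)) = y \<and>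
        (case case y of (m, a) \<Rightarrow> (m + a, a) of (m, a) \<Rightarrow> (p a - p' a) * h (m - 1 - a) * \<phi> (int m - 1)) =
        (case y of (m, a) \<Rightarrow> h (m - 1) * ((p a - p' a) * \<phi> (int m - 1 + int a)))"
      using y by (auto simp: algebra_simps split: prod.splits)
  qed (use M in \<open>auto simp: mult_ac of_nat_diff split: prod.splits\<close>)
  finally show ?thesis
    by (simp add: A.ell_def sum_subtractf right_diff_distrib sum_distrib_left sum.cartesian_product)
qed

text \<open>The operator -z d/dz brings down the exponent of the translation; this is
  \<open>eta_rec\<close> for all integer indices. Outside 0 \<le> k \<le> n both sides vanish, which
  permits any cut \<open>M\<close> from n on.\<close>

lemma theta:
  assumes f: "f \<in> W n" and M: "int M \<ge> n"
  shows "of_int k * A.Phi f k = (\<Sum>i=1..M. al' i (A.Phi f (k - int i)) - al i (A.Phi f (k - int i)))"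
proof (cases "k < 0 \<or> k > n")
  case True
  then show ?thesis
  proof
    assume "k < 0"
    then show ?thesis by (simp add: A.Phi_neg)
  next
    assume k: "k > n"
    have "al' i (A.Phi f (k - int i)) - al i (A.Phi f (k - int i)) = 0" if "i \<in> {1..M}" for i
      using that k A.al_Phi_big[OF f, of i "k - int i"] B.al_Phi_big[OF f, of i "k - int i"]
      by (simp add: A.Phi_def B.Phi_def)
    then show ?thesis using k A.Phi_big[OF f, of k] by (simp add: sum.neutral)
  qed
next
  case False
  then have k: "0 \<le> k" "nat k \<le> M" using M by auto
  have "of_int k * A.Phi f k = (\<Sum>i=1..nat k. al' i (eta (nat k - i) f) - al i (eta (nat k - i) f))"
    using k eta_rec[of "nat k" f] by (simp add: A.Phi_def)
  also have "\<dots> = (\<Sum>i=1..nat k. al' i (A.Phi f (k - int i)) - al i (A.Phi f (k - int i)))"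
    using k by (intro sum.cong) (auto simp: A.Phi_def nat_diff_distrib')
  also have "\<dots> = (\<Sum>i=1..M. al' i (A.Phi f (k - int i)) - al i (A.Phi f (k - int i)))"
    using k by (intro sum.mono_neutral_left) (auto simp: A.Phi_neg)
  finally show ?thesis .
qed

text \<open>The sum J + J' of the two currents J = sum of p_a z^a + sum of al_j z^(-j), applied to
  \<open>Phi f\<close>.\<close>

definition Psi :: "nat \<Rightarrow> 'a \<Rightarrow> int \<Rightarrow> 'a" where
  "Psi M f m = (\<Sum>a=1..M. (p a + p' a) * A.Phi f (m + int a)) + (\<Sum>j=1..M. al j (A.Phi f (m - int j)) + al' j (A.Phi f (m - int j)))"

text \<open>The quadratic parts of the two defects are J^2 and -J'^2. In the product (J - J')(J +
  J') the first factor acts, by \<open>theta\<close>, as the total derivative of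
  \<open>ell_total\<close>. The terms with factors a and j arise when z d/dz meets the powers of z
  inside J + J'; the u v terms are opposite.\<close>

lemma DD_sum:
  assumes f: "f \<in> W n" and M: "int M \<ge> n"
  shows "A.DD M f m + B.DD M f m =
     - (of_int (m - 1) * Psi M f (m - 1) - (\<Sum>a=1..M. (p a - p' a) * Psi M f (m - 1 + int a)))
     - (u + v) * (of_int (m - 1) * A.Phi f (m - 1) - (\<Sum>a=1..M. (p a - p' a) * A.Phi f (m - 1 + int a)))"
proof -
  let ?P = "A.Phi f" and ?S = "\<lambda>g. \<Sum>a=1..M. \<Sum>b=1..M. g a b"
  define pp where "pp = ?S (\<lambda>a b. p a * p b * ?P (m - 1 + int a + int b))"
  define pp' where "pp' = ?S (\<lambda>a b. p' a * p' b * ?P (m - 1 + int a + int b))"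
  define qq where "qq = ?S (\<lambda>a b. p a * p' b * ?P (m - 1 + int a + int b))"
  define pa where "pa = ?S (\<lambda>b j. p b * al j (?P (m - 1 + int b - int j)))"
  define pa' where "pa' = ?S (\<lambda>b j. p b * al' j (?P (m - 1 + int b - int j)))"
  define p'a where "p'a = ?S (\<lambda>b j. p' b * al j (?P (m - 1 + int b - int j)))"
  define p'a' where "p'a' = ?S (\<lambda>b j. p' b * al' j (?P (m - 1 + int b - int j)))"
  define aa where "aa = ?S (\<lambda>i j. al i (al j (?P (m - 1 - int i - int j))))"
  define aa' where "aa' = ?S (\<lambda>i j. al' i (al' j (?P (m - 1 - int i - int j))))"
  define ab where "ab = ?S (\<lambda>i j. al i (al' j (?P (m - 1 - int i - int j))))"
  define ap where "ap = (\<Sum>a=1..M. of_nat a * p a * ?P (m - 1 + int a))"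
  define ap' where "ap' = (\<Sum>a=1..M. of_nat a * p' a * ?P (m - 1 + int a))"
  define ja where "ja = (\<Sum>j=1..M. of_nat j * al j (?P (m - 1 - int j)))"
  define ja' where "ja' = (\<Sum>j=1..M. of_nat j * al' j (?P (m - 1 - int j)))"
  define P where "P = (\<Sum>a=1..M. p a * ?P (m - 1 + int a))"
  define P' where "P' = (\<Sum>a=1..M. p' a * ?P (m - 1 + int a))"
  define A where "A = (\<Sum>j=1..M. al j (?P (m - 1 - int j)))"
  define A' where "A' = (\<Sum>j=1..M. al' j (?P (m - 1 - int j)))"
  have qq': "qq = ?S (\<lambda>a b. p' a * p b * ?P (m - 1 + int a + int b))"
    unfolding qq_def by (subst sum.swap) (simp add: algebra_simps)
  have ab': "ab = ?S (\<lambda>i j. al' i (al j (?P (m - 1 - int i - int j))))"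
    unfolding ab_def by (subst sum.swap) (simp add: al_al' algebra_simps)
  have th: "of_int (m - 1) * ?P (m - 1) = A' - A"
    unfolding theta[OF f M] A_def A'_def by (simp add: sum_subtractf)
  have D: "A.DD M f m = pp + 2 * pa + aa + ap - ja + (u + v) * (P + A) + u * v * ?P (m - 1)"
    unfolding A.DD_def pp_def[symmetric] pa_def[symmetric] aa_def[symmetric] ap_def[symmetric] ja_def[symmetric]
      P_def[symmetric] A_def[symmetric] by (simp add: algebra_simps)
  have D': "B.DD M f m = - (pp' + 2 * p'a' + aa') + ap' - ja' - (u + v) * (P' + A') - u * v * ?P (m - 1)"
    unfolding B.DD_def pp'_def[symmetric] p'a'_def[symmetric] aa'_def[symmetric] ap'_def[symmetric] ja'_def[symmetric]
      P'_def[symmetric] A'_def[symmetric] by (simp add: algebra_simps)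
  have Q: "(\<Sum>a=1..M. (p a - p' a) * ?P (m - 1 + int a)) = P - P'"
    by (simp add: P_def P'_def left_diff_distrib sum_subtractf)
  have QPsi: "(\<Sum>a=1..M. (p a - p' a) * Psi M f (m - 1 + int a)) = pp - pp' + pa + pa' - p'a - p'a'"
  proof -
    have "(\<Sum>a=1..M. (p a - p' a) * Psi M f (m - 1 + int a)) =
       ?S (\<lambda>a b. (p a - p' a) * ((p b + p' b) * ?P (m - 1 + int a + int b)))
       + ?S (\<lambda>b j. (p b - p' b) * (al j (?P (m - 1 + int b - int j)) + al' j (?P (m - 1 + int b - int j))))"
      by (simp add: Psi_def distrib_left sum.distrib sum_distrib_left)
    also have "?S (\<lambda>a b. (p a - p' a) * ((p b + p' b) * ?P (m - 1 + int a + int b))) = pp + qq - qq - pp'"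
      apply (subst (2) qq')
      unfolding pp_def pp'_def qq_def sum.distrib[symmetric] sum_subtractf[symmetric]
      by (intro sum.cong refl) (simp add: algebra_simps)
    also have "?S (\<lambda>b j. (p b - p' b) * (al j (?P (m - 1 + int b - int j)) + al' j (?P (m - 1 + int b - int j))))
        = pa + pa' - p'a - p'a'"
      unfolding pa_def pa'_def p'a_def p'a'_def sum.distrib[symmetric] sum_subtractf[symmetric]
      by (intro sum.cong refl) (simp add: algebra_simps)
    finally show ?thesis by simp
  qed
  have ThPsi: "of_int (m - 1) * Psi M f (m - 1) = pa' - pa + p'a' - p'a - ap - ap' + aa' - aa + ja + ja'"
  proof -
    have 1: "of_int (m - 1) * ((p a + p' a) * ?P (m - 1 + int a)) =
        (p a + p' a) * (\<Sum>j=1..M. al' j (?P (m - 1 + int a - int j)) - al j (?P (m - 1 + int a - int j)))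
         - of_nat a * p a * ?P (m - 1 + int a) - of_nat a * p' a * ?P (m - 1 + int a)" for a
      unfolding theta[OF f M, symmetric] by (simp add: algebra_simps)
    have al_int: "al j (of_int k * x) = of_int k * al j x" "al' j (of_int k * x) = of_int k * al' j x" for j k x
    proof -
      have "al j (of_nat k) = 0" "al' j (of_nat k) = 0" for k
        using A.al_mult[of j 1 1] B.al_mult[of j 1 1]
        by (induction k) (simp_all add: A.al_add B.al_add)
      moreover have neg: "al j (- x) = - al j x" "al' j (- x) = - al' j x" for x
        using A.al_add[of j x "- x"] B.al_add[of j x "- x"] by (simp_all add: add_eq_0_iff)
      moreover obtain i where "k = int i \<or> k = - int i"
        by (cases k rule: int_cases2) auto
      ultimately have "al j (of_int k) = 0" "al' j (of_int k) = 0"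
        by (auto simp: neg)
      then show "al j (of_int k * x) = of_int k * al j x" "al' j (of_int k * x) = of_int k * al' j x"
        by (simp_all add: A.al_mult B.al_mult)
    qed
    have al_diff: "al j (x - y) = al j x - al j y" "al' j (x - y) = al' j x - al' j y" for j x y
      using A.al_add[of j "x - y" y] B.al_add[of j "x - y" y] by (simp_all add: algebra_simps)
    have 2: "of_int (m - 1) * (al j (?P (m - 1 - int j)) + al' j (?P (m - 1 - int j))) =
        (\<Sum>i=1..M. al j (al' i (?P (m - 1 - int j - int i))) - al j (al i (?P (m - 1 - int j - int i)))
          + al' j (al' i (?P (m - 1 - int j - int i))) - al' j (al i (?P (m - 1 - int j - int i))))
        + of_nat j * al j (?P (m - 1 - int j)) + of_nat j * al' j (?P (m - 1 - int j))" for j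
    proof -
      have "of_int (m - 1) * (al j (?P (m - 1 - int j)) + al' j (?P (m - 1 - int j))) =
        al j (of_int (m - 1 - int j) * ?P (m - 1 - int j)) + al' j (of_int (m - 1 - int j) * ?P (m - 1 - int j))
        + of_nat j * al j (?P (m - 1 - int j)) + of_nat j * al' j (?P (m - 1 - int j))"
        unfolding al_int by (simp add: algebra_simps)
      then show ?thesis
        unfolding theta[OF f M] by (simp add: A.al_sum B.al_sum al_diff sum.distrib sum_subtractf)
    qed
    have "of_int (m - 1) * Psi M f (m - 1) =
       (\<Sum>a=1..M. of_int (m - 1) * ((p a + p' a) * ?P (m - 1 + int a)))
       + (\<Sum>j=1..M. of_int (m - 1) * (al j (?P (m - 1 - int j)) + al' j (?P (m - 1 - int j))))"
      by (simp add: Psi_def distrib_left sum_distrib_left)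
    also have "(\<Sum>a=1..M. of_int (m - 1) * ((p a + p' a) * ?P (m - 1 + int a))) = pa' - pa + p'a' - p'a - ap - ap'"
      unfolding 1 pa_def pa'_def p'a_def p'a'_def ap_def ap'_def sum.distrib[symmetric] sum_subtractf[symmetric] sum_distrib_left
      by (intro sum.cong refl arg_cong2[of _ _ _ _ "(-)"]) (simp add: algebra_simps)
    also have "(\<Sum>j=1..M. of_int (m - 1) * (al j (?P (m - 1 - int j)) + al' j (?P (m - 1 - int j)))) =
       ab - aa + aa' - ab + ja + ja'"
      apply (subst (2) ab')
      unfolding 2 aa_def aa'_def ab_def ja_def ja'_def
      by (simp add: sum.distrib sum_subtractf)
    finally show ?thesis by simp
  qed
  show ?thesis
    unfolding D D' Q QPsi ThPsi th by (simp add: algebra_simps)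
qed

lemma Psi_big:
  assumes f: "f \<in> W n" and k: "k > n"
  shows "Psi M f k = 0"
proof -
  have "A.Phi f (k + int a) = 0" for a
    using A.Phi_big[OF f] k by simp
  moreover have "al j (A.Phi f (k - int j)) = 0" "al' j (A.Phi f (k - int j)) = 0" if "j \<ge> 1" for j
    using A.al_Phi_big[OF f that, of "k - int j"] B.al_Phi_big[OF f that, of "k - int j"] k by (simp_all)
  ultimately show ?thesis by (simp add: Psi_def)
qed

text \<open>The left side is an operator applied to the pairing of f, the right side the pairing of
  the evolved f, so vanishing is inherited. The bound \<open>K\<close> is strict because
  \<open>ell_total\<close> wants zeros from \<open>K\<close> on.\<close>

theorem bilinear_evolution:
  assumes f: "f \<in> W n" and K: "int K > n" and M: "M \<ge> K"
  shows "A.BB M 1 (A.ell K (A.Phi f)) + B.BB M (- 1) (A.ell K (A.Phi f)) = A.ell K (A.Phi (A.BB M 0 f + B.BB M 0 f))"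
proof -
  have "A.ell K (\<lambda>m. A.DD M f m + B.DD M f m) = A.ell K (\<lambda>m.
     (- 1) * (of_int (m - 1) * Psi M f (m - 1) - (\<Sum>a=1..M. (p a - p' a) * Psi M f (m - 1 + int a)))
     + (- (u + v)) * (of_int (m - 1) * A.Phi f (m - 1) - (\<Sum>a=1..M. (p a - p' a) * A.Phi f (m - 1 + int a))))"
  proof (rule A.ell_cong)
    fix m
    have e: "- x - c * y = (- 1) * x + (- c) * y" for x c y :: 'a
      by simp
    have "n \<le> int M" using K M by linarith
    then show "A.DD M f m + B.DD M f m =
     (- 1) * (of_int (m - 1) * Psi M f (m - 1) - (\<Sum>a=1..M. (p a - p' a) * Psi M f (m - 1 + int a)))
     + (- (u + v)) * (of_int (m - 1) * A.Phi f (m - 1) - (\<Sum>a=1..M. (p a - p' a) * A.Phi f (m - 1 + int a)))"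
      unfolding e[symmetric] by (rule DD_sum[OF f])
  qed
  also have "\<dots> = 0"
    unfolding A.ell_add A.ell_mult using K M
    by (subst (1 2) ell_total) (auto simp: Psi_big[OF f] A.Phi_big[OF f])
  finally have "A.ell K (A.DD M f) + A.ell K (B.DD M f) = 0"
    by (simp add: A.ell_add)
  moreover have "A.Phi (x + y) = (\<lambda>m. A.Phi x m + A.Phi y m)" for x y
    by (simp add: fun_eq_iff A.Phi_add)
  ultimately show ?thesis
    using A.BB_ell[OF f, of M K] B.BB_ell[OF f, of M K] K M
    by (simp add: A.ell_add algebra_simps)
qed

end

lemma ring_derivation_cmult: "ring_derivation \<delta> \<Longrightarrow> ring_derivation (\<lambda>x. c * \<delta> x)"
  by (auto simp: ring_derivation_def algebra_simps)

lemma ring_derivation_diff: "ring_derivation \<delta> \<Longrightarrow> ring_derivation \<epsilon> \<Longrightarrow> ring_derivation (\<lambda>x. \<delta> x - \<epsilon> x)"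
  by (auto simp: ring_derivation_def algebra_simps)

text \<open>Recursions of Newton type determine n h_n; over the rationals the factor n can be
  cancelled.\<close>

lemma torsion_free:
  fixes P :: "('x, rat) mpoly"
  assumes "of_nat n * P = of_nat n * Q" "n > 0"
  shows "P = Q"
proof -
  have "Const (1 / of_nat n) * (of_nat n * R) = R" for R :: "('x, rat) mpoly"
    using assms(2) by (simp add: mult.assoc[symmetric] Const_mult[symmetric] flip: Const_of_nat)
  then show ?thesis using assms(1) by metis
qed

lemma of_nat_inverse_mult:
  fixes P :: "('x, rat) mpoly"
  assumes "n > 0"
  shows "of_nat n * (Const (1 / of_nat n) * P) = P"
  using assms by (simp add: mult.assoc[symmetric] Const_mult[symmetric] flip: Const_of_nat)

subsection \<open>Exponential series\<close>

lemma fps_power_nth_0: "fps_nth (f::'a::comm_ring_1 fps) 0 = 0 \<Longrightarrow> k > n \<Longrightarrow> fps_nth (f ^ k) n = 0"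
  by (simp add: fps_pow_nth_below_subdegree startsby_zero_power_prefix)

lemma exp_series_deriv:
  fixes f :: "('x, rat) mpoly fps"
  assumes f: "fps_nth f 0 = 0"
  shows "fps_deriv (exp_series f) = fps_deriv f * exp_series f"
proof (rule fps_ext)
  fix n
  \<comment> \<open>The truncation in the definition can be raised to any common bound, which the
    coefficients of a product require.\<close>
  have *: "fps_nth (exp_series f) m = (\<Sum>k\<le>N. Const (1 / fact k) * fps_nth (f ^ k) m)" if "m \<le> N" for m N
    unfolding exp_series_def using that
    by (simp, intro sum.mono_neutral_left) (auto simp: fps_power_nth_0[OF f])
  have "fps_nth (fps_deriv (exp_series f)) n = (\<Sum>k\<le>Suc n. Const (1 / fact k) * fps_nth (fps_deriv (f ^ k)) n)"
  proof -
    have "fps_nth (exp_series f) (n + 1) = (\<Sum>k\<le>Suc n. Const (1 / fact k) * fps_nth (f ^ k) (n + 1))"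
      by (rule *) simp
    then show ?thesis
      unfolding fps_deriv_nth by (simp only: sum_distrib_left mult.left_commute)
  qed
  also have "\<dots> = (\<Sum>k\<le>n. Const (1 / fact (Suc k)) * fps_nth (fps_deriv (f ^ Suc k)) n)"
    by (subst sum.atMost_Suc_shift) simp
  also have "\<dots> = (\<Sum>k\<le>n. Const (1 / fact k) * fps_nth (fps_deriv f * f ^ k) n)"
  proof (rule sum.cong)
    fix k
    have "fps_deriv (f ^ Suc k) = of_nat (Suc k) * (fps_deriv f * f ^ k)"
      by (simp only: fps_deriv_power diff_Suc_1 fps_of_nat[symmetric] mult.assoc)
    then have "fps_nth (fps_deriv (f ^ Suc k)) n = of_nat (Suc k) * fps_nth (fps_deriv f * f ^ k) n"
      by (simp add: fps_of_nat[symmetric] del: of_nat_Suc)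
    moreover have "Const (1 / fact (Suc k)) * of_nat (Suc k) = (Const (1 / fact k) :: ('x, rat) mpoly)"
      by (simp add: Const_mult[symmetric] field_simps flip: Const_of_nat del: of_nat_Suc)
    ultimately show "Const (1 / fact (Suc k)) * fps_nth (fps_deriv (f ^ Suc k)) n = Const (1 / fact k) * fps_nth (fps_deriv f * f ^ k) n"
      by (simp only: mult.assoc[symmetric])
  qed simp
  also have "\<dots> = fps_nth (fps_deriv f * exp_series f) n"
    unfolding fps_mult_nth sum_distrib_left
    by (subst sum.swap, intro sum.cong refl, subst *[of _ n]) (auto simp: sum_distrib_left mult_ac)
  finally show "fps_nth (fps_deriv (exp_series f)) n = fps_nth (fps_deriv f * exp_series f) n" .
qed

lemma complete_h_0 [simp]: "complete_h 0 y = 1"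
  by (simp add: complete_h_def exp_series_def)

text \<open>Newton's identity, read off from the derivative of the exponential. With
  \<open>complete_h_0\<close> it determines all the \<open>complete_h\<close>, and the later
  arguments work from it.\<close>

lemma complete_h_rec: "of_nat m * complete_h m y = (\<Sum>i=1..m. y i * complete_h (m - i) y)"
proof (cases m)
  case (Suc n)
  define f where "f = Abs_fps (\<lambda>i. if i = 0 then 0 else Const (1 / of_nat i) * y i)"
  have "of_nat m * complete_h m y = fps_nth (fps_deriv (exp_series f)) n"
    by (simp add: complete_h_def f_def Suc)
  also have "\<dots> = (\<Sum>i=0..n. fps_nth (fps_deriv f) i * complete_h (n - i) y)"
    by (subst exp_series_deriv) (simp_all add: f_def fps_mult_nth complete_h_def)
  also have "\<dots> = (\<Sum>i=0..n. y (Suc i) * complete_h (n - i) y)"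
    by (intro sum.cong refl) (simp add: f_def of_nat_inverse_mult del: of_nat_Suc)
  also have "\<dots> = (\<Sum>i=1..m. y i * complete_h (m - i) y)"
    unfolding Suc One_nat_def by (subst sum.shift_bounds_cl_Suc_ivl) (simp add: atLeast0AtMost)
  finally show ?thesis .
qed simp

text \<open>In Newton's identity for m the term j = i gives i times the claimed value, and the other
  terms, by induction, m - i times.\<close>

lemma al_complete_h:
  fixes y :: "nat \<Rightarrow> ('x, rat) mpoly" and \<delta> :: "('x, rat) mpoly \<Rightarrow> ('x, rat) mpoly"
  assumes "ring_derivation \<delta>" "\<And>j. j \<ge> 1 \<Longrightarrow> \<delta> (y j) = (if j = i then of_nat i * c else 0)" "i \<ge> 1" "\<delta> c = 0"
  shows "\<delta> (complete_h m y) = (if i \<le> m then c * complete_h (m - i) y else 0)"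
proof -
  interpret \<delta>: ring_derivation \<delta> by fact
  show ?thesis
  proof (induction m rule: less_induct)
    case (less m)
    show ?case
    proof (cases "m = 0")
      case False
      have "of_nat m * \<delta> (complete_h m y) = \<delta> (of_nat m * complete_h m y)"
        by simp
      also have "\<dots> = (\<Sum>j=1..m. \<delta> (y j) * complete_h (m - j) y) + (\<Sum>j=1..m. y j * \<delta> (complete_h (m - j) y))"
        by (simp only: complete_h_rec \<delta>.sum \<delta>.mult sum.distrib)
      also have "(\<Sum>j=1..m. \<delta> (y j) * complete_h (m - j) y) = (\<Sum>j=1..m. if j = i then of_nat i * c * complete_h (m - i) y else 0)"
        using assms(2) by (intro sum.cong) auto
      also have "\<dots> = (if i \<le> m then of_nat i * c * complete_h (m - i) y else 0)"
        using assms(3) by simp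
      also have "(\<Sum>j=1..m. y j * \<delta> (complete_h (m - j) y)) = (\<Sum>j=1..m. if i \<le> m - j then c * (y j * complete_h (m - i - j) y) else 0)"
        using less by (intro sum.cong) (auto simp: add.commute mult_ac)
      also have "\<dots> = (if i \<le> m then c * (of_nat (m - i) * complete_h (m - i) y) else 0)"
      proof (cases "i \<le> m")
        case True
        have "(\<Sum>j=1..m. if i \<le> m - j then c * (y j * complete_h (m - i - j) y) else 0)
          = (\<Sum>j=1..m - i. c * (y j * complete_h (m - i - j) y))"
          using True assms(3) by (intro sum.mono_neutral_cong_right) auto
        then show ?thesis using True by (simp only: complete_h_rec sum_distrib_left if_True)
      qed (auto intro: sum.neutral)
      finally have "of_nat m * \<delta> (complete_h m y) = of_nat m * (if i \<le> m then c * complete_h (m - i) y else 0)"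
        by (auto simp: of_nat_diff algebra_simps)
      then show ?thesis using False by (rule torsion_free[of m, OF _ neq0_conv[THEN iffD1]])
    qed (use assms(3) in auto)
  qed
qed

subsection \<open>Complete homogeneous functions of derivations\<close>

text \<open>For commuting derivations this is h_m with the operators inserted, the coefficient of
  z^m in exp (sum of \<open>\<delta> i\<close> z^i / i) applied to \<open>x\<close>. Newton's
  recursion serves as definition, as operators cannot be substituted into an
  \<open>mpoly\<close>.\<close>

fun hop :: "(nat \<Rightarrow> ('x, rat) mpoly \<Rightarrow> ('x, rat) mpoly) \<Rightarrow> nat \<Rightarrow> ('x, rat) mpoly \<Rightarrow> ('x, rat) mpoly" where
  "hop \<delta> m x = (if m = 0 then x else Const (1 / of_nat m) * (\<Sum>i\<in>{1..m}. \<delta> i (hop \<delta> (m - i) x)))"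

declare hop.simps [simp del]

lemma hop_0 [simp]: "hop \<delta> 0 x = x"
  by (simp add: hop.simps)

lemma hop_rec: "of_nat m * hop \<delta> m x = (\<Sum>i=1..m. \<delta> i (hop \<delta> (m - i) x))"
  by (cases "m = 0") (simp_all add: hop.simps[of _ m] of_nat_inverse_mult)

text \<open>Newton's recursion has one solution, so a formula for \<open>hop\<close> is proved by
  checking the recursion for the proposed value.\<close>

lemma hop_unique:
  assumes "\<And>m. m > 0 \<Longrightarrow> of_nat m * g m = (\<Sum>i=1..m. \<delta> i (g (m - i)))" "g 0 = x"
  shows "hop \<delta> m x = g m"
proof (induction m rule: less_induct)
  case (less m)
  show ?case
  proof (cases "m = 0")
    case False
    have "of_nat m * hop \<delta> m x = of_nat m * g m"
      using False assms(1)[of m] unfolding hop_rec by (simp add: less)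
    then show ?thesis
      using False by (rule torsion_free[of m, OF _ neq0_conv[THEN iffD1]])
  qed (use assms in auto)
qed

locale derivation_family =
  fixes \<delta> :: "nat \<Rightarrow> ('x, rat) mpoly \<Rightarrow> ('x, rat) mpoly"
  assumes deriv: "ring_derivation (\<delta> i)"
begin

lemma d_add: "\<delta> i (x + y) = \<delta> i x + \<delta> i y"
  by (rule ring_derivation.add[OF deriv])

lemma d_mult: "\<delta> i (x * y) = \<delta> i x * y + x * \<delta> i y"
  by (rule ring_derivation.mult[OF deriv])

lemma d_diff: "\<delta> i (x - y) = \<delta> i x - \<delta> i y"
  by (rule ring_derivation.diff[OF deriv])

lemma hop_add: "hop \<delta> m (x + y) = hop \<delta> m x + hop \<delta> m y"
  by (rule hop_unique) (simp_all add: distrib_left hop_rec d_add sum.distrib)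

lemma hop_cmult: "(\<And>i. \<delta> i c = 0) \<Longrightarrow> hop \<delta> m (c * x) = c * hop \<delta> m x"
  by (rule hop_unique) (simp_all add: mult.left_commute[of _ c] hop_rec d_mult sum_distrib_left)

lemma hop_uminus: "hop \<delta> m (- x) = - hop \<delta> m x"
  using hop_cmult[of "- 1" m x] ring_derivation.uminus[OF deriv, of _ 1] ring_derivation.one[OF deriv] by simp

lemma hop_commute:
  assumes \<epsilon>: "ring_derivation \<epsilon>" and "\<And>i x. \<epsilon> (\<delta> i x) = \<delta> i (\<epsilon> x)"
  shows "hop \<delta> m (\<epsilon> x) = \<epsilon> (hop \<delta> m x)"
proof (rule hop_unique)
  interpret \<epsilon>: ring_derivation \<epsilon> by (rule \<epsilon>)
  fix m
  have "of_nat m * \<epsilon> (hop \<delta> m x) = \<epsilon> (of_nat m * hop \<delta> m x)" by simp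
  then show "of_nat m * \<epsilon> (hop \<delta> m x) = (\<Sum>i=1..m. \<delta> i (\<epsilon> (hop \<delta> (m - i) x)))"
    by (simp only: hop_rec \<epsilon>.sum assms(2))
qed simp

text \<open>In generating form the exponential turns multiplication by \<open>q\<close> into
  multiplication by q - s z^a: the translation in a vertex operator.\<close>

lemma hop_mult_linear:
  assumes "\<And>i. i \<ge> 1 \<Longrightarrow> \<delta> i q = (if i = a then - (of_nat a * s) else 0)" "a \<ge> 1" "\<And>i. \<delta> i s = 0"
  shows "hop \<delta> m (q * x) = q * hop \<delta> m x - (if a \<le> m then s * hop \<delta> (m - a) x else 0)"
proof (rule hop_unique)
  fix m :: nat
  have "(\<Sum>i=1..m. \<delta> i (q * hop \<delta> (m - i) x - (if a \<le> m - i then s * hop \<delta> (m - i - a) x else 0)))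
    = (\<Sum>i=1..m. \<delta> i q * hop \<delta> (m - i) x) + (\<Sum>i=1..m. q * \<delta> i (hop \<delta> (m - i) x))
      - (\<Sum>i=1..m. if a \<le> m - i then s * \<delta> i (hop \<delta> (m - a - i) x) else 0)"
    unfolding sum.distrib[symmetric] sum_subtractf[symmetric]
    by (intro sum.cong refl) (auto simp: d_diff d_mult assms(3) ring_derivation.zero[OF deriv] add.commute)
  also have "(\<Sum>i=1..m. \<delta> i q * hop \<delta> (m - i) x) = (\<Sum>i=1..m. if i = a then - (of_nat a * s) * hop \<delta> (m - a) x else 0)"
    using assms(1) by (intro sum.cong) auto
  also have "\<dots> = (if a \<le> m then - (of_nat a * s) * hop \<delta> (m - a) x else 0)"
    using assms(2) by simp
  also have "(\<Sum>i=1..m. q * \<delta> i (hop \<delta> (m - i) x)) = q * (of_nat m * hop \<delta> m x)"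
    by (simp only: hop_rec sum_distrib_left)
  also have "(\<Sum>i=1..m. if a \<le> m - i then s * \<delta> i (hop \<delta> (m - a - i) x) else 0) =
      (if a \<le> m then s * (of_nat (m - a) * hop \<delta> (m - a) x) else 0)"
  proof (cases "a \<le> m")
    case True
    have "(\<Sum>i=1..m. if a \<le> m - i then s * \<delta> i (hop \<delta> (m - a - i) x) else 0) =
       (\<Sum>i=1..m - a. s * \<delta> i (hop \<delta> (m - a - i) x))"
      using True assms(2) by (intro sum.mono_neutral_cong_right) auto
    then show ?thesis using True by (simp only: hop_rec sum_distrib_left if_True)
  qed (auto intro: sum.neutral)
  finally show "of_nat m * (q * hop \<delta> m x - (if a \<le> m then s * hop \<delta> (m - a) x else 0)) =
     (\<Sum>i=1..m. \<delta> i (q * hop \<delta> (m - i) x - (if a \<le> m - i then s * hop \<delta> (m - i - a) x else 0)))"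
    by (auto simp: of_nat_diff algebra_simps)
qed (use assms(2) in auto)

end

subsection \<open>Weights\<close>

definition monom_weight :: "('x \<Rightarrow> nat) \<Rightarrow> ('x \<Rightarrow>\<^sub>0 nat) \<Rightarrow> nat" where
  "monom_weight w m = (\<Sum>x\<in>Poly_Mapping.keys m. w x * Poly_Mapping.lookup m x)"

lemma monom_weight_superset:
  assumes "finite A" "Poly_Mapping.keys m \<subseteq> A"
  shows "monom_weight w m = (\<Sum>x\<in>A. w x * Poly_Mapping.lookup m x)"
  unfolding monom_weight_def using assms by (intro sum.mono_neutral_left) (auto simp: in_keys_iff)

lemma monom_weight_add: "monom_weight w (m + n) = monom_weight w m + monom_weight w n"
proof -
  let ?A = "Poly_Mapping.keys m \<union> Poly_Mapping.keys n"
  have "Poly_Mapping.keys (m + n) \<subseteq> ?A"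
    by (rule Poly_Mapping.keys_add)
  then show ?thesis
    by (simp add: monom_weight_superset[of ?A] sum.distrib[symmetric] lookup_add distrib_left)
qed

lemma monom_weight_0 [simp]: "monom_weight w 0 = 0"
  by (simp add: monom_weight_def)

lemma monom_weight_single [simp]: "monom_weight w (Poly_Mapping.single x k) = w x * k"
  by (simp add: monom_weight_def)

text \<open>The bound is an integer: lowering operators may push it below 0, where only the zero
  polynomial is left. That is the source of every truncation.\<close>

definition bounded_weight :: "('x \<Rightarrow> nat) \<Rightarrow> int \<Rightarrow> ('x, 'a::comm_ring_1) mpoly set" where
  "bounded_weight w n = {P. \<forall>m\<in>Poly_Mapping.keys P. int (monom_weight w m) \<le> n}"

lemma bounded_weight_add: "P \<in> bounded_weight w n \<Longrightarrow> Q \<in> bounded_weight w n \<Longrightarrow> P + Q \<in> bounded_weight w n"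
  using Poly_Mapping.keys_add[of P Q] by (auto simp: bounded_weight_def)

lemma bounded_weight_0 [simp]: "0 \<in> bounded_weight w n"
  by (simp add: bounded_weight_def)

lemma bounded_weight_sum: "(\<And>i. i \<in> I \<Longrightarrow> f i \<in> bounded_weight w n) \<Longrightarrow> (\<Sum>i\<in>I. f i) \<in> bounded_weight w n"
  by (induction I rule: infinite_finite_induct) (auto intro: bounded_weight_add)

lemma bounded_weight_mult: "P \<in> bounded_weight w n \<Longrightarrow> Q \<in> bounded_weight w m \<Longrightarrow> P * Q \<in> bounded_weight w (n + m)"
  using Poly_Mapping.keys_mult[of P Q] by (fastforce simp: bounded_weight_def monom_weight_add)

lemma bounded_weight_neg: "n < 0 \<Longrightarrow> bounded_weight w n = {0}"
proof -
  assume "n < 0"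
  then have "P = 0" if "P \<in> bounded_weight w n" for P :: "('a, 'b) mpoly"
  proof -
    have "Poly_Mapping.keys P = {}" using that \<open>n < 0\<close> by (force simp: bounded_weight_def)
    then show ?thesis by simp
  qed
  then show ?thesis by auto
qed

lemma bounded_weight_Const: "n \<ge> 0 \<Longrightarrow> Const c \<in> bounded_weight w n"
  by (simp add: bounded_weight_def Const_def)

lemma bounded_weight_Var: "n \<ge> int (w x) \<Longrightarrow> Var x \<in> bounded_weight w n"
  by (simp add: bounded_weight_def Var_def)

lemma bounded_weight_mono: "n \<le> m \<Longrightarrow> P \<in> bounded_weight w n \<Longrightarrow> P \<in> bounded_weight w m"
  by (fastforce simp: bounded_weight_def)

lemma bounded_weight_cmult: "P \<in> bounded_weight w n \<Longrightarrow> Const c * P \<in> bounded_weight w n"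
  using bounded_weight_mult[OF bounded_weight_Const[of 0 c w]] by simp

lemma bounded_weight_of_nat: "P \<in> bounded_weight w n \<Longrightarrow> of_nat c * P \<in> bounded_weight w n"
  using bounded_weight_cmult[of P w n "of_nat c"] by simp

lemma bounded_weight_diff: "P \<in> bounded_weight w n \<Longrightarrow> Q \<in> bounded_weight w n \<Longrightarrow> P - Q \<in> bounded_weight w n"
  using bounded_weight_add[of P w n "Const (-1) * Q"] bounded_weight_cmult[of Q w n "-1"]
  by (simp add: Const_uminus)

lemma bounded_weight_pdiff:
  assumes "P \<in> bounded_weight w n"
  shows "pdiff x P \<in> bounded_weight w (n - int (w x))"
  unfolding pdiff_def
proof (rule bounded_weight_sum)
  fix m assume m: "m \<in> Poly_Mapping.keys P"
  let ?s = "Poly_Mapping.single x (1::nat)"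
  show "Poly_Mapping.single (m - ?s) (of_nat (Poly_Mapping.lookup m x) * Poly_Mapping.lookup P m) \<in> bounded_weight w (n - int (w x))"
  proof (cases "Poly_Mapping.lookup m x = 0")
    case False
    then have "m = (m - ?s) + ?s"
      by (intro poly_mapping_eqI) (auto simp: lookup_add lookup_minus lookup_single when_def)
    then have "monom_weight w m = monom_weight w (m - ?s) + w x"
      by (metis monom_weight_add monom_weight_single mult.right_neutral)
    then show ?thesis using assms m by (auto simp: bounded_weight_def)
  qed simp
qed

lemma bounded_weight_hop:
  assumes "\<And>i n P. i \<ge> 1 \<Longrightarrow> P \<in> bounded_weight w n \<Longrightarrow> \<delta> i P \<in> bounded_weight w (n - int i)" "P \<in> bounded_weight w n"
  shows "hop \<delta> m P \<in> bounded_weight w (n - int m)"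
proof (induction m rule: less_induct)
  case (less m)
  show ?case
  proof (cases "m = 0")
    case False
    have "\<delta> i (hop \<delta> (m - i) P) \<in> bounded_weight w (n - int m)" if "i \<in> {1..m}" for i
      using assms(1)[OF _ less[of "m - i"], of i] that by (simp add: of_nat_diff)
    then show ?thesis using False
      by (auto simp: hop.simps[of _ m] intro!: bounded_weight_cmult bounded_weight_sum)
  qed (use assms in auto)
qed

text \<open>Two copies of the variables \<open>p\<^sub>i\<close>: \<open>Inl (GP i)\<close> and \<open>Inr i\<close>.\<close>

type_synonym mpoly2 = "(gen + nat, rat) mpoly"

definition emb1 :: "(gen, rat) mpoly \<Rightarrow> mpoly2" where
  "emb1 = eval_mpoly Const (\<lambda>g. Var (Inl g))"

text \<open>The two copies share u and v; only the p_i are doubled.\<close>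

definition emb2 :: "(gen, rat) mpoly \<Rightarrow> mpoly2" where
  "emb2 = eval_mpoly Const (\<lambda>g. case g of GP i \<Rightarrow> Var (Inr i) | _ \<Rightarrow> Var (Inl g))"

definition diag :: "mpoly2 \<Rightarrow> (gen, rat) mpoly" where
  "diag = eval_mpoly Const (\<lambda>x. case x of Inl g \<Rightarrow> Var g | Inr i \<Rightarrow> Var (GP i))"

definition swap :: "mpoly2 \<Rightarrow> mpoly2" where
  "swap = eval_mpoly Const (\<lambda>x. case x of Inl (GP i) \<Rightarrow> Var (Inr i) | Inl g \<Rightarrow> Var (Inl g) | Inr i \<Rightarrow> Var (Inl (GP i)))"

interpretation Const: coeff_hom Const
  by (rule coeff_hom_Const)

interpretation emb1: coeff_hom emb1
  unfolding emb1_def by (rule Const.coeff_hom_eval)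

interpretation emb2: coeff_hom emb2
  unfolding emb2_def by (rule Const.coeff_hom_eval)

interpretation diag: coeff_hom diag
  unfolding diag_def by (rule Const.coeff_hom_eval)

interpretation swap: coeff_hom swap
  unfolding swap_def by (rule Const.coeff_hom_eval)

lemma emb_Const [simp]: "emb1 (Const c) = Const c" "emb2 (Const c) = Const c" "diag (Const c) = Const c" "swap (Const c) = Const c"
  by (simp_all add: emb1_def emb2_def diag_def swap_def)

lemma emb1_Var [simp]: "emb1 (Var g) = Var (Inl g)"
  by (simp add: emb1_def)

lemma emb2_Var [simp]: "emb2 (Var (GP i)) = Var (Inr i)" "emb2 (Var GU) = Var (Inl GU)" "emb2 (Var GV) = Var (Inl GV)"
  by (simp_all add: emb2_def)

lemma diag_Var [simp]: "diag (Var (Inl g)) = Var g" "diag (Var (Inr i)) = Var (GP i)"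
  by (simp_all add: diag_def)

lemma swap_Var [simp]: "swap (Var (Inl (GP i))) = Var (Inr i)" "swap (Var (Inl GU)) = Var (Inl GU)"
   "swap (Var (Inl GV)) = Var (Inl GV)" "swap (Var (Inr i)) = Var (Inl (GP i))"
  by (simp_all add: swap_def)

lemma diag_emb1 [simp]: "diag (emb1 f) = f"
  by (rule coeff_hom_unique[OF coeff_hom_comp[OF diag.coeff_hom_axioms emb1.coeff_hom_axioms] coeff_hom_id]) simp_all

lemma diag_emb2 [simp]: "diag (emb2 f) = f"
proof (rule coeff_hom_unique[OF coeff_hom_comp[OF diag.coeff_hom_axioms emb2.coeff_hom_axioms] coeff_hom_id])
  show "diag (emb2 (Var x)) = Var x" for x by (cases x) simp_all
qed simp

lemma swap_emb1: "swap (emb1 f) = emb2 f"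
proof (rule coeff_hom_unique[OF coeff_hom_comp[OF swap.coeff_hom_axioms emb1.coeff_hom_axioms] emb2.coeff_hom_axioms])
  show "swap (emb1 (Var x)) = emb2 (Var x)" for x by (cases x) simp_all
qed simp

lemma swap_emb2: "swap (emb2 f) = emb1 f"
proof (rule coeff_hom_unique[OF coeff_hom_comp[OF swap.coeff_hom_axioms emb2.coeff_hom_axioms] emb1.coeff_hom_axioms])
  show "swap (emb2 (Var x)) = emb1 (Var x)" for x by (cases x) simp_all
qed simp

lemma diag_swap: "diag (swap x) = diag x"
proof (rule coeff_hom_unique[OF coeff_hom_comp[OF diag.coeff_hom_axioms swap.coeff_hom_axioms] diag.coeff_hom_axioms])
  show "diag (swap (Var x)) = diag (Var x)" for x
    by (cases x; (cases "projl x")?) simp_all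
qed simp

section \<open>Derivations in the two copies, Hirota derivatives and the concrete vertex
  operators\<close>

definition alg :: "nat \<Rightarrow> (gen, rat) mpoly \<Rightarrow> (gen, rat) mpoly" where
  "alg i f = of_nat i * pdiff (GP i) f"

definition al1 :: "nat \<Rightarrow> mpoly2 \<Rightarrow> mpoly2" where
  "al1 i f = of_nat i * pdiff (Inl (GP i)) f"

definition al2 :: "nat \<Rightarrow> mpoly2 \<Rightarrow> mpoly2" where
  "al2 i f = of_nat i * pdiff (Inr i) f"

interpretation alg: ring_derivation "alg i" for i
  unfolding alg_def by (intro ring_derivation_cmult ring_derivation_pdiff)

interpretation al1: ring_derivation "al1 i" for i
  unfolding al1_def by (intro ring_derivation_cmult ring_derivation_pdiff)

interpretation al2: ring_derivation "al2 i" for i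
  unfolding al2_def by (intro ring_derivation_cmult ring_derivation_pdiff)

lemma al_Const [simp]: "al1 i (Const c) = 0" "al2 i (Const c) = 0" "alg i (Const c) = 0"
  by (simp_all add: al1_def al2_def alg_def)

lemma al_Var: "al1 i (Var x) = (if x = Inl (GP i) then of_nat i else 0)" "al2 i (Var x) = (if x = Inr i then of_nat i else 0)"
   "alg i (Var y) = (if y = GP i then of_nat i else 0)"
  by (simp_all add: al1_def al2_def alg_def pdiff_Var)

lemma al_commute: "al1 i (al1 j x) = al1 j (al1 i x)" "al2 i (al2 j x) = al2 j (al2 i x)" "al1 i (al2 j x) = al2 j (al1 i x)"
  by (simp_all add: al1_def al2_def pdiff_commute mult_ac)

lemma al1_emb1: "al1 i (emb1 f) = emb1 (alg i f)"
  by (induction f rule: mpoly_induct)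
     (simp_all add: emb1.hom_add emb1.hom_mult emb1.hom_of_nat al1.add al1.mult alg.add alg.mult al_Var)

lemma al2_emb1 [simp]: "al2 i (emb1 f) = 0"
  by (induction f rule: mpoly_induct)
     (simp_all add: emb1.hom_add emb1.hom_mult al2.add al2.mult al_Var)

lemma emb2_Var_cases: "emb2 (Var x) = (case x of GP i \<Rightarrow> Var (Inr i) | _ \<Rightarrow> Var (Inl x))"
  by (cases x) simp_all

lemma al2_emb2: "al2 i (emb2 f) = emb2 (alg i f)"
  by (induction f rule: mpoly_induct)
     (simp_all add: emb2.hom_add emb2.hom_mult emb2.hom_of_nat al2.add al2.mult alg.add alg.mult al_Var emb2_Var_cases split: gen.splits)

lemma al1_emb2 [simp]: "al1 i (emb2 f) = 0"
  by (induction f rule: mpoly_induct)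
     (simp_all add: emb2.hom_add emb2.hom_mult al1.add al1.mult al_Var emb2_Var_cases split: gen.splits)

lemma swap_al1: "swap (al1 i x) = al2 i (swap x)"
proof (induction x rule: mpoly_induct)
  case (Var P x)
  have "swap (al1 i (Var x)) = al2 i (swap (Var x))"
    by (cases x; (cases "projl x")?) (simp_all add: al_Var swap.hom_of_nat)
  then show ?case using Var by (simp add: al1.mult al2.mult swap.hom_add swap.hom_mult)
qed (simp_all add: al1.add al2.add swap.hom_add)

lemma swap_swap: "swap (swap x) = x"
proof (rule coeff_hom_unique[OF coeff_hom_comp[OF swap.coeff_hom_axioms swap.coeff_hom_axioms] coeff_hom_id])
  show "swap (swap (Var x)) = Var x" for x
    by (cases x; (cases "projl x")?) simp_all
qed simp

lemma swap_al2: "swap (al2 i x) = al1 i (swap x)"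
  using swap_al1[of i "swap x"] by (metis swap_swap)

definition gen_weight :: "gen \<Rightarrow> nat" where
  "gen_weight g = (case g of GP i \<Rightarrow> i | _ \<Rightarrow> 0)"

definition gen_weight2 :: "gen + nat \<Rightarrow> nat" where
  "gen_weight2 x = (case x of Inl g \<Rightarrow> gen_weight g | Inr i \<Rightarrow> i)"

abbreviation "del2 \<equiv> \<lambda>i x. al2 i x - al1 i x"

text \<open>i times the Hirota derivative D_i, before \<open>diag\<close> identifies the copies;
  hence \<open>hop Dop m\<close> is h_m of the rescaled derivatives D_1, 2 D_2, 3 D_3 and so
  on.\<close>

definition Dop :: "nat \<Rightarrow> mpoly2 \<Rightarrow> mpoly2" where
  "Dop i x = al1 i x - al2 i x"

abbreviation "h2 \<equiv> \<lambda>m. complete_h m (\<lambda>i. Var (Inl (GP i)) - Var (Inr i) :: mpoly2)"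

interpretation del2: derivation_family del2
  by unfold_locales (simp_all add: al1.add al2.add al1.mult al2.mult algebra_simps)

interpretation Dop: ring_derivation "Dop i" for i
  by unfold_locales (simp_all add: Dop_def al1.add al2.add al1.mult al2.mult algebra_simps)

interpretation Dop: derivation_family Dop
  by unfold_locales (simp_all add: Dop.add Dop.mult)

text \<open>Here \<open>h2 m\<close> is h_m(p - p'), and \<open>hop del2\<close> generates the
  translation of p_i to p_i - z^(-i) and of p'_i to p'_i + z^(-i), whence the opposite signs s of
  the two copies.\<close>

interpretation VP: vertex_pair al1 al2 "\<lambda>i. Var (Inl (GP i))" "\<lambda>i. Var (Inr i)" "Var (Inl GU)" "Var (Inl GV)"
  "bounded_weight gen_weight2" h2 "hop del2"
proof
  let ?W = "bounded_weight gen_weight2 :: int \<Rightarrow> mpoly2 set"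
  show al1W: "al1 i x \<in> ?W (n - int i)" if "i \<ge> 1" "x \<in> ?W n" for i x n
    using bounded_weight_of_nat[OF bounded_weight_pdiff[OF that(2), of "Inl (GP i)"]]
    by (simp add: al1_def gen_weight2_def gen_weight_def)
  show al2W: "al2 i x \<in> ?W (n - int i)" if "i \<ge> 1" "x \<in> ?W n" for i x n
    using bounded_weight_of_nat[OF bounded_weight_pdiff[OF that(2), of "Inr i"]]
    by (simp add: al2_def gen_weight2_def)
  show "hop del2 m x \<in> ?W (n - int m)" if "x \<in> ?W n" for m x n
    using that by (intro bounded_weight_hop bounded_weight_diff al1W al2W)
  show "Var (Inl (GP i)) * x \<in> ?W (n + int i)" if "x \<in> ?W n" for i x n
    using bounded_weight_mult[OF bounded_weight_Var that, of "Inl (GP i)" "int i"]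
    by (simp add: gen_weight2_def gen_weight_def add.commute)
  show "Var (Inr i) * x \<in> ?W (n + int i)" if "x \<in> ?W n" for i x n
    using bounded_weight_mult[OF bounded_weight_Var that, of "Inr i" "int i"]
    by (simp add: gen_weight2_def add.commute)
  show "al1 i (h2 m) = (if i \<le> m then 1 * h2 (m - i) else 0)" if "i \<ge> 1" for i m
    using that by (intro al_complete_h al1.ring_derivation_axioms) (auto simp: al1.diff al_Var)
  show "al2 i (h2 m) = (if i \<le> m then - 1 * h2 (m - i) else 0)" if "i \<ge> 1" for i m
    using that by (intro al_complete_h al2.ring_derivation_axioms) (auto simp: al2.diff al_Var al2.uminus)
  show "hop del2 m (al1 i x) = al1 i (hop del2 m x)" if "i \<ge> 1" for i m x
    by (intro del2.hop_commute al1.ring_derivation_axioms) (simp add: al1.diff al_commute)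
  show "hop del2 m (al2 i x) = al2 i (hop del2 m x)" if "i \<ge> 1" for i m x
    by (intro del2.hop_commute al2.ring_derivation_axioms) (simp add: al2.diff al_commute)
  show "hop del2 m (Var (Inl (GP a)) * x) = Var (Inl (GP a)) * hop del2 m x - (if a \<le> m then 1 * hop del2 (m - a) x else 0)"
    if "a \<ge> 1" for a m x
    using that by (intro del2.hop_mult_linear) (auto simp: al_Var)
  show "hop del2 m (Var (Inr a) * x) = Var (Inr a) * hop del2 m x - (if a \<le> m then - 1 * hop del2 (m - a) x else 0)"
    if "a \<ge> 1" for a m x
    using that by (intro del2.hop_mult_linear) (auto simp: al_Var al1.uminus al2.uminus)
  show "hop del2 m (Var (Inl GU) * x) = Var (Inl GU) * hop del2 m x" for m x
    by (intro del2.hop_cmult) (simp add: al_Var)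
  show "hop del2 m (Var (Inl GV) * x) = Var (Inl GV) * hop del2 m x" for m x
    by (intro del2.hop_cmult) (simp add: al_Var)
qed (auto simp: al1.add al2.add al1.mult al2.mult al_commute bounded_weight_add bounded_weight_neg del2.hop_add al_Var
      hop_rec complete_h_rec)

lemma swap_hop: "swap (hop del2 m x) = hop Dop m (swap x)"
proof (rule hop_unique[where g = "\<lambda>m. swap (hop del2 m x)", symmetric])
  fix m :: nat
  have "of_nat m * swap (hop del2 m x) = swap (of_nat m * hop del2 m x)"
    by (simp add: swap.hom_mult swap.hom_of_nat)
  also have "\<dots> = (\<Sum>i=1..m. Dop i (swap (hop del2 (m - i) x)))"
    by (simp only: hop_rec swap.hom_sum swap.hom_diff swap_al1 swap_al2 Dop_def)
  finally show "of_nat m * swap (hop del2 m x) = (\<Sum>i=1..m. Dop i (swap (hop del2 (m - i) x)))" .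
qed simp

text \<open>\<open>del2\<close> is the negative of \<open>Dop\<close>; exchanging the copies, which
  \<open>diag\<close> does not see, restores the sign.\<close>

lemma diag_hop_del2: "diag (hop del2 m x) = diag (hop Dop m (swap x))"
  unfolding swap_hop[symmetric] diag_swap by (rule refl)

lemma Dop_h2:
  assumes "k \<ge> 1"
  shows "Dop k (h2 m) = (if k \<le> m then 2 * h2 (m - k) else 0)"
proof (rule al_complete_h[OF Dop.ring_derivation_axioms _ assms])
  show "Dop k 2 = 0"
    using Dop.of_nat[of k 2] by simp
  show "Dop k (Var (Inl (GP j)) - Var (Inr j)) = (if j = k then of_nat k * 2 else 0)" for j
    by (simp add: Dop_def al1.diff al2.diff al_Var)
qed

lemma diag_h2: "diag (h2 m) = (if m = 0 then 1 else 0)"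
proof (cases "m = 0")
  case False
  have "of_nat m * diag (h2 m) = diag (of_nat m * h2 m)"
    by (simp add: diag.hom_mult diag.hom_of_nat)
  also have "\<dots> = of_nat m * 0"
    by (simp add: complete_h_rec diag.hom_sum diag.hom_mult diag.hom_diff)
  finally show ?thesis using False torsion_free[of m "diag (h2 m)" 0] by simp
qed simp

text \<open>A shape closed under \<open>Dop\<close>: a derivative either hits h, which raises
  \<open>c\<close> and doubles \<open>z\<close>, or passes to \<open>g\<close>. On the diagonal only
  the summand with h_0 survives.\<close>

definition HS :: "nat \<Rightarrow> nat \<Rightarrow> nat \<Rightarrow> (nat \<Rightarrow> mpoly2) \<Rightarrow> mpoly2" where
  "HS K c z g = (\<Sum>m=1..K. (if c \<le> m - 1 then of_nat z * h2 (m - 1 - c) else 0) * g m)"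

lemma Dop_HS:
  assumes "k \<ge> 1"
  shows "Dop k (HS K c z g) = HS K (c + k) (2 * z) g + HS K c z (\<lambda>m. Dop k (g m))"
proof -
  have "Dop k ((if c \<le> m - 1 then of_nat z * h2 (m - 1 - c) else 0) * g m) =
     (if c + k \<le> m - 1 then of_nat (2 * z) * h2 (m - 1 - (c + k)) else 0) * g m
     + (if c \<le> m - 1 then of_nat z * h2 (m - 1 - c) else 0) * Dop k (g m)" if "m \<ge> 1" for m
  proof (cases "c \<le> m - 1")
    case True
    have "Dop k (of_nat z * h2 (m - 1 - c) * g m) = of_nat z * (Dop k (h2 (m - 1 - c)) * g m) + of_nat z * h2 (m - 1 - c) * Dop k (g m)"
      unfolding mult.assoc Dop.mult Dop.of_nat by (simp only: distrib_left mult_zero_left add_0_left)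
    also have "Dop k (h2 (m - 1 - c)) = (if c + k \<le> m - 1 then 2 * h2 (m - 1 - (c + k)) else 0)"
      using True by (subst Dop_h2[OF assms]) auto
    finally show ?thesis using True
      by (simp only: if_True) (auto simp: mult_ac)
  next
    case False
    then have "\<not> c + k \<le> m - 1" by simp
    with False show ?thesis by (simp only: if_False mult_zero_left Dop.zero add_0_left)
  qed
  then have "(\<Sum>m=1..K. Dop k ((if c \<le> m - 1 then of_nat z * h2 (m - 1 - c) else 0) * g m)) =
     (\<Sum>m=1..K. (if c + k \<le> m - 1 then of_nat (2 * z) * h2 (m - 1 - (c + k)) else 0) * g m
     + (if c \<le> m - 1 then of_nat z * h2 (m - 1 - c) else 0) * Dop k (g m))"
    by (intro sum.cong refl) (simp only: atLeastAtMost_iff)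
  then show ?thesis
    unfolding HS_def Dop.sum by (simp only: sum.distrib)
qed

lemma diag_HS:
  assumes "c < K"
  shows "diag (HS K c z g) = of_nat z * diag (g (c + 1))"
proof -
  have "diag (HS K c z g) = (\<Sum>m=1..K. if m = c + 1 then of_nat z * diag (g (c + 1)) else 0)"
    unfolding HS_def diag.hom_sum
    by (intro sum.cong) (auto simp: diag.hom_mult diag.hom_of_nat diag_h2)
  then show ?thesis using assms by simp
qed

section \<open>Bilinear identity and Hirota equations for a solution of the evolution
  equation\<close>

locale map_series =
  fixes tz :: "nat \<Rightarrow> (gen, rat) mpoly"
  assumes tz_0: "tz 0 = 1"
    and tz_weight: "tz n \<in> bounded_weight gen_weight (int n)"
    and tz_evo: "M \<ge> n \<Longrightarrow> of_nat (Suc n) * tz (Suc n) = map_op alg (\<lambda>i. Var (GP i)) (Var GU) (Var GV) M (tz n)"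
begin

text \<open>The coefficient of t^n in tau(p) tau(p').\<close>

definition TT :: "nat \<Rightarrow> mpoly2" where
  "TT n = (\<Sum>a\<le>n. emb1 (tz a) * emb2 (tz (n - a)))"

lemma map_op_sum:
  assumes "\<And>i. ring_derivation (al i)"
  shows "map_op al p u v M (\<Sum>x\<in>A. f x) = (\<Sum>x\<in>A. map_op al p u v M (f x))"
proof -
  have 0: "map_op al p u v M 0 = 0"
    by (simp add: map_op_def ring_derivation.zero[OF assms])
  have add: "map_op al p u v M (x + y) = map_op al p u v M x + map_op al p u v M y" for x y
    by (simp add: map_op_def ring_derivation.add[OF assms] distrib_left sum.distrib)
  show ?thesis
    by (induction A rule: infinite_finite_induct) (simp_all add: 0 add)
qed

lemma map_op_cmult:
  assumes "\<And>i. ring_derivation (al i)" "\<And>i. al i y = 0"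
  shows "map_op al p u v M (x * y) = map_op al p u v M x * y"
  by (simp add: map_op_def ring_derivation.mult[OF assms(1)] assms(2) distrib_right sum_distrib_right mult.assoc)

lemma map_op_emb1:
  "map_op al1 (\<lambda>i. Var (Inl (GP i))) (Var (Inl GU)) (Var (Inl GV)) M (emb1 x * emb2 y) =
   emb1 (map_op alg (\<lambda>i. Var (GP i)) (Var GU) (Var GV) M x) * emb2 y"
  by (subst map_op_cmult[OF al1.ring_derivation_axioms al1_emb2])
     (simp add: map_op_def al1_emb1 emb1.hom_add emb1.hom_mult emb1.hom_sum)

lemma map_op_emb2:
  "map_op al2 (\<lambda>i. Var (Inr i)) (Var (Inl GU)) (Var (Inl GV)) M (emb1 x * emb2 y) =
   emb1 x * emb2 (map_op alg (\<lambda>i. Var (GP i)) (Var GU) (Var GV) M y)"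
  unfolding mult.commute[of "emb1 x"]
  by (subst map_op_cmult[OF al2.ring_derivation_axioms al2_emb1])
     (simp add: map_op_def al2_emb2 emb2.hom_add emb2.hom_mult emb2.hom_sum)

lemma TT_evo:
  assumes "M \<ge> n"
  shows "of_nat (Suc n) * TT (Suc n) =
    map_op al1 (\<lambda>i. Var (Inl (GP i))) (Var (Inl GU)) (Var (Inl GV)) M (TT n)
    + map_op al2 (\<lambda>i. Var (Inr i)) (Var (Inl GU)) (Var (Inl GV)) M (TT n)"
proof -
  let ?B = "map_op alg (\<lambda>i. Var (GP i)) (Var GU) (Var GV) M"
  have evo: "of_nat (Suc a) * tz (Suc a) = ?B (tz a)" if "a \<le> n" for a
    using assms that by (intro tz_evo) simp
  have e1: "of_nat (Suc a) * emb1 (tz (Suc a)) = emb1 (?B (tz a))" if "a \<le> n" for a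
    unfolding evo[OF that, symmetric] emb1.hom_mult emb1.hom_of_nat by (rule refl)
  have e2: "of_nat (Suc a) * emb2 (tz (Suc a)) = emb2 (?B (tz a))" if "a \<le> n" for a
    unfolding evo[OF that, symmetric] emb2.hom_mult emb2.hom_of_nat by (rule refl)
  have "of_nat (Suc n) * TT (Suc n) = (\<Sum>a\<le>Suc n. of_nat a * emb1 (tz a) * emb2 (tz (Suc n - a)))
      + (\<Sum>a\<le>Suc n. emb1 (tz a) * (of_nat (Suc n - a) * emb2 (tz (Suc n - a))))"
    unfolding TT_def sum_distrib_left sum.distrib[symmetric]
    by (intro sum.cong refl) (auto simp: of_nat_diff algebra_simps)
  also have "(\<Sum>a\<le>Suc n. of_nat a * emb1 (tz a) * emb2 (tz (Suc n - a))) = (\<Sum>a\<le>n. emb1 (?B (tz a)) * emb2 (tz (n - a)))"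
    by (subst sum.atMost_Suc_shift) (auto simp: e1 simp del: of_nat_Suc)
  also have "(\<Sum>a\<le>Suc n. emb1 (tz a) * (of_nat (Suc n - a) * emb2 (tz (Suc n - a)))) =
      (\<Sum>a\<le>n. emb1 (tz a) * (of_nat (Suc n - a) * emb2 (tz (Suc n - a))))"
    by simp
  also have "\<dots> = (\<Sum>a\<le>n. emb1 (tz a) * emb2 (?B (tz (n - a))))"
    by (intro sum.cong refl) (simp add: Suc_diff_le e2 del: of_nat_Suc)
  finally show ?thesis
    unfolding TT_def map_op_sum[OF al1.ring_derivation_axioms] map_op_sum[OF al2.ring_derivation_axioms]
    by (simp only: map_op_emb1 map_op_emb2)
qed

lemma bounded_weight_emb:
  assumes "f \<in> bounded_weight gen_weight n"
  shows "emb1 f \<in> bounded_weight gen_weight2 n" "emb2 f \<in> bounded_weight gen_weight2 n"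
proof -
  have prod: "(\<And>x. x \<in> A \<Longrightarrow> g x \<in> bounded_weight w (int (c x))) \<Longrightarrow> (\<Prod>x\<in>A. g x) \<in> bounded_weight w (int (\<Sum>x\<in>A. c x))"
    if "finite A" for A and g :: "'d \<Rightarrow> mpoly2" and c w
    using that
    by (induction A rule: finite_induct) (auto simp: bounded_weight_mult bounded_weight_Const[of 0 1, simplified])
  have pow: "g \<in> bounded_weight w (int c) \<Longrightarrow> g ^ k \<in> bounded_weight w (int (c * k))" for g :: mpoly2 and w c k
    using prod[of "{..<k}" "\<lambda>_. g" w "\<lambda>_. c"] by (simp add: mult.commute)
  have *: "eval_mpoly Const g f \<in> bounded_weight gen_weight2 n" if g: "\<And>x. g x \<in> bounded_weight gen_weight2 (int (gen_weight x))"
    for g :: "gen \<Rightarrow> mpoly2"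
    unfolding eval_mpoly_def
  proof (rule bounded_weight_sum)
    fix m assume m: "m \<in> Poly_Mapping.keys f"
    have "(\<Prod>x\<in>Poly_Mapping.keys m. g x ^ Poly_Mapping.lookup m x) \<in> bounded_weight gen_weight2 (int (monom_weight gen_weight m))"
      unfolding monom_weight_def by (intro prod pow g) simp
    moreover have "int (monom_weight gen_weight m) \<le> n"
      using m assms by (auto simp: bounded_weight_def)
    ultimately show "Const (Poly_Mapping.lookup f m) * (\<Prod>x\<in>Poly_Mapping.keys m. g x ^ Poly_Mapping.lookup m x) \<in> bounded_weight gen_weight2 n"
      by (blast intro: bounded_weight_cmult bounded_weight_mono)
  qed
  show "emb1 f \<in> bounded_weight gen_weight2 n"
    unfolding emb1_def by (rule *) (auto simp: gen_weight2_def intro: bounded_weight_Var)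
  show "emb2 f \<in> bounded_weight gen_weight2 n"
    unfolding emb2_def by (rule *) (auto simp: gen_weight2_def gen_weight_def intro: bounded_weight_Var split: gen.splits)
qed

lemma TT_weight: "TT n \<in> bounded_weight gen_weight2 (int n)"
  unfolding TT_def
proof (rule bounded_weight_sum)
  fix a assume "a \<in> {..n}"
  then show "emb1 (tz a) * emb2 (tz (n - a)) \<in> bounded_weight gen_weight2 (int n)"
    using bounded_weight_mult[OF bounded_weight_emb(1)[OF tz_weight[of a]] bounded_weight_emb(2)[OF tz_weight[of "n - a"]]]
    by (simp add: of_nat_diff)
qed

lemma Phi_of_nat: "VP.A.Phi (of_nat c * x) m = of_nat c * VP.A.Phi x m"
  using del2.hop_cmult[of "of_nat c" "nat m" x] unfolding VP.A.Phi_def by simp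

text \<open>\<open>TT (Suc n)\<close> is, up to the factor n + 1, the evolution of
  \<open>TT n\<close>, and \<open>bilinear_evolution\<close> carries zero to zero. At n = 0 the
  product is 1, which translation fixes, and the pairing starts only at m = 1.\<close>

lemma bilinear_zero:
  assumes "K > n"
  shows "VP.A.ell K (VP.A.Phi (TT n)) = 0"
  using assms
proof (induction n)
  case 0
  have "TT 0 = 1"
    by (simp add: TT_def tz_0)
  moreover have "hop del2 m 1 = 0" if "m > 0" for m
    using that by (subst hop_unique[where g = "\<lambda>m. if m = 0 then 1 else 0"]) (auto intro!: sum.neutral)
  ultimately show ?case
    by (auto simp: VP.A.ell_def VP.A.Phi_def intro: sum.neutral)
next
  case (Suc n)
  have "of_nat (Suc n) * VP.A.ell K (VP.A.Phi (TT (Suc n))) = VP.A.ell K (\<lambda>m. of_nat (Suc n) * VP.A.Phi (TT (Suc n)) m)"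
    by (simp only: VP.A.ell_mult)
  also have "(\<lambda>m. of_nat (Suc n) * VP.A.Phi (TT (Suc n)) m) = VP.A.Phi (VP.A.BB K 0 (TT n) + VP.B.BB K 0 (TT n))"
    unfolding Phi_of_nat[symmetric] VP.A.BB_map_op VP.B.BB_map_op add_0_right
    using Suc.prems by (subst TT_evo[of n K]) auto
  also have "VP.A.ell K \<dots> = VP.A.BB K 1 (VP.A.ell K (VP.A.Phi (TT n))) + VP.B.BB K (- 1) (VP.A.ell K (VP.A.Phi (TT n)))"
    using VP.bilinear_evolution[OF TT_weight[of n], of K K] Suc.prems by simp
  also have "VP.A.ell K (VP.A.Phi (TT n)) = 0"
    using Suc by simp
  also have "VP.A.BB K 1 0 + VP.B.BB K (- 1) 0 = of_nat (Suc n) * 0"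
    by (simp add: VP.A.BB_def VP.B.BB_def)
  finally show ?case
    by (rule torsion_free) simp
qed

lemma HS_zero: "K > n \<Longrightarrow> HS K 0 1 (\<lambda>m. hop del2 m (TT n)) = 0"
  using bilinear_zero[of n K]
  unfolding HS_def VP.A.ell_def VP.A.Phi_def by simp

lemma swap_TT: "swap (TT n) = TT n"
proof -
  have "swap (TT n) = (\<Sum>a\<le>n. emb1 (tz (n - a)) * emb2 (tz a))"
    by (simp add: TT_def swap.hom_sum swap.hom_mult swap_emb1 swap_emb2 mult.commute)
  also have "\<dots> = TT n"
    unfolding TT_def by (rule sum.reindex_bij_witness[of _ "\<lambda>a. n - a" "\<lambda>a. n - a"]) auto
  finally show ?thesis .
qed

lemma Dop_hop_del2: "Dop k (hop del2 m x) = hop del2 m (Dop k x)"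
  by (rule del2.hop_commute[symmetric, OF Dop.ring_derivation_axioms])
     (simp add: Dop_def al1.diff al2.diff al_commute algebra_simps)

lemma swap_Dop: "swap (Dop k x) = - Dop k (swap x)"
  by (simp add: Dop_def swap.hom_diff swap_al1 swap_al2)

lemma hop_del2_1: "hop del2 1 x = - Dop 1 x"
  by (simp add: hop.simps Dop_def)

lemma diag_hop_del2_Dop: "diag (hop del2 m (Dop k (TT n))) = - diag (hop Dop m (Dop k (TT n)))"
  by (simp only: diag_hop_del2 swap_Dop swap_TT Dop.hop_uminus diag.hom_uminus)

text \<open>\<open>Dop k\<close> is applied to the bilinear identity, then p' = p. All h_m(p - p')
  except h_0 become 0, which leaves m = k + 1, where h was differentiated with factor 2, and m = 1,
  where it was not.\<close>

theorem hirota_1: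
  assumes "k \<ge> 1"
  shows "2 * diag (hop Dop (k + 1) (TT n)) = diag (Dop 1 (Dop k (TT n)))"
proof -
  let ?K = "n + k + 2"
  have "0 = diag (Dop k (HS ?K 0 1 (\<lambda>m. hop del2 m (TT n))))"
    using HS_zero[of n ?K] by simp
  also have "\<dots> = 2 * diag (hop del2 (k + 1) (TT n)) + diag (hop del2 1 (Dop k (TT n)))"
    unfolding Dop_HS[OF assms] diag.hom_add
    by (subst (1 2) diag_HS) (simp_all add: Dop_hop_del2)
  also have "diag (hop del2 1 (Dop k (TT n))) = - diag (Dop 1 (Dop k (TT n)))"
    by (simp only: hop_del2_1 diag.hom_uminus)
  finally show ?thesis
    by (simp add: diag_hop_del2 swap_TT)
qed

text \<open>The same with two derivatives; the term with h_(k+l+1) is then eliminated by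
  \<open>hirota_1\<close> for k + l. With l - 1 in place of l this is the relation behind
  \<open>hirota_op\<close>.\<close>

theorem hirota_2:
  assumes k: "k \<ge> 1" and l: "l \<ge> 1"
  shows "diag (hop Dop (k + 1) (Dop l (TT n))) + diag (hop Dop (l + 1) (Dop k (TT n))) = diag (Dop 1 (Dop (k + l) (TT n)))"
proof -
  let ?K = "n + k + l + 2" and ?x = "diag (Dop 1 (Dop l (Dop k (TT n))))"
  \<comment> \<open>Each Hirota derivative changes sign when the copies are exchanged, so an odd
    number of them gives 0 on the diagonal.\<close>
  have "?x = diag (swap (Dop 1 (Dop l (Dop k (TT n)))))"
    by (simp only: diag_swap)
  also have "\<dots> = - ?x"
    by (simp only: swap_Dop swap_TT Dop.uminus diag.hom_uminus minus_minus)
  finally have "2 * ?x = 2 * 0"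
    by (metis mult_2 mult_zero_right neg_eq_iff_add_eq_0 add_eq_0_iff)
  then have x: "?x = 0"
    using torsion_free[of 2 ?x 0] by simp
  have "0 = diag (Dop l (Dop k (HS ?K 0 1 (\<lambda>m. hop del2 m (TT n)))))"
    using HS_zero[of n ?K] by simp
  also have "\<dots> = 4 * diag (hop del2 (k + l + 1) (TT n)) + 2 * diag (hop del2 (k + 1) (Dop l (TT n)))
     + 2 * diag (hop del2 (l + 1) (Dop k (TT n))) + diag (hop del2 1 (Dop l (Dop k (TT n))))"
    unfolding Dop_HS[OF k] Dop.add Dop_HS[OF l] diag.hom_add
    by (subst (1 2 3 4) diag_HS) (simp_all add: Dop_hop_del2)
  also have "diag (hop del2 1 (Dop l (Dop k (TT n)))) = - ?x"
    by (simp only: hop_del2_1 diag.hom_uminus)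
  also have "diag (hop del2 (k + 1) (Dop l (TT n))) = - diag (hop Dop (k + 1) (Dop l (TT n)))"
    by (rule diag_hop_del2_Dop)
  also have "diag (hop del2 (l + 1) (Dop k (TT n))) = - diag (hop Dop (l + 1) (Dop k (TT n)))"
    by (rule diag_hop_del2_Dop)
  also have "diag (hop del2 (k + l + 1) (TT n)) = diag (hop Dop (k + l + 1) (TT n))"
    by (simp only: diag_hop_del2 swap_TT)
  finally have "2 * (diag (hop Dop (k + 1) (Dop l (TT n))) + diag (hop Dop (l + 1) (Dop k (TT n)))) =
     2 * (2 * diag (hop Dop (k + l + 1) (TT n)))"
    using x by (simp add: algebra_simps)
  also have "2 * diag (hop Dop (k + l + 1) (TT n)) = diag (Dop 1 (Dop (k + l) (TT n)))"
    using k by (intro hirota_1) simp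
  finally have "of_nat 2 * (diag (hop Dop (k + 1) (Dop l (TT n))) + diag (hop Dop (l + 1) (Dop k (TT n)))) =
     of_nat 2 * diag (Dop 1 (Dop (k + l) (TT n)))"
    by (simp only: of_nat_numeral)
  then show ?thesis
    by (rule torsion_free) simp
qed

end

section \<open>The monomials of the Hirota operator and their coefficients\<close>

definition mono_mset :: "(nat \<Rightarrow>\<^sub>0 nat) \<Rightarrow> nat multiset" where
  "mono_mset m = mset (monom_list m)"

lemma count_mono_mset: "count (mono_mset m) i = Poly_Mapping.lookup m i"
proof -
  have "mono_mset m = (\<Sum>i\<in>Poly_Mapping.keys m. replicate_mset (Poly_Mapping.lookup m i) i)"
    by (simp add: mono_mset_def monom_list_def mset_concat sum_list_distinct_conv_sum_set comp_def)
  then have "count (mono_mset m) i = (\<Sum>j\<in>Poly_Mapping.keys m. if i = j then Poly_Mapping.lookup m j else 0)"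
    by (simp add: count_sum)
  also have "\<dots> = Poly_Mapping.lookup m i"
    by (simp add: in_keys_iff)
  finally show ?thesis .
qed

lemma mono_mset_0 [simp]: "mono_mset 0 = {#}"
  by (rule multiset_eqI) (simp add: count_mono_mset)

lemma mono_mset_add: "mono_mset (m + n) = mono_mset m + mono_mset n"
  by (rule multiset_eqI) (simp add: count_mono_mset lookup_add)

lemma mono_mset_single [simp]: "mono_mset (Poly_Mapping.single i 1) = {#i#}"
  by (rule multiset_eqI) (simp add: count_mono_mset lookup_single when_def)

lemma mono_mset_single_Suc [simp]: "mono_mset (Poly_Mapping.single i (Suc 0)) = {#i#}"
  using mono_mset_single[of i] by simp

lemma mono_mset_inject: "mono_mset m = mono_mset n \<longleftrightarrow> m = n"
  by (metis count_mono_mset poly_mapping_eqI)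

lemma keys_mult_Var:
  assumes "m \<in> Poly_Mapping.keys (P * Var i)"
  shows "\<exists>m'\<in>Poly_Mapping.keys P. m = m' + Poly_Mapping.single i 1"
  using assms Poly_Mapping.keys_mult[of P "Var i"] by (auto simp: Var_def)

lemma lookup_mult_Var: "Poly_Mapping.lookup (P * Var i) (m + Poly_Mapping.single i 1) = Poly_Mapping.lookup (P :: ('x, 'a::comm_ring_1) mpoly) m"
proof (induction P rule: mpoly_induct_single)
  case (single n c)
  then show ?case by (simp add: Var_def mult_single lookup_single when_def)
qed (simp add: distrib_right lookup_add)

lemma lookup_Const_mult: "Poly_Mapping.lookup (Const c * P) m = c * Poly_Mapping.lookup (P :: ('x, 'a::comm_ring_1) mpoly) m"
proof (induction P rule: mpoly_induct_single)
  case (single n d)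
  then show ?case by (simp add: Const_def mult_single lookup_single when_def)
qed (simp add: distrib_left lookup_add)

lemma keys_Const_mult: "Poly_Mapping.keys (Const c * P) \<subseteq> Poly_Mapping.keys (P :: ('x, 'a::comm_ring_1) mpoly)"
  by (auto simp: in_keys_iff lookup_Const_mult)

lemma keys_of_nat_mult: "Poly_Mapping.keys (of_nat c * P) \<subseteq> Poly_Mapping.keys (P :: ('x, 'a::comm_ring_1) mpoly)"
  using keys_Const_mult[of "of_nat c" P] by simp

abbreviation hvar :: "nat \<Rightarrow> (nat, rat) mpoly" where
  "hvar n \<equiv> complete_h n (\<lambda>i. of_nat i * Var i)"

lemma complete_h_unfold:
  assumes "n > 0"
  shows "complete_h n y = Const (1 / of_nat n) * (\<Sum>i=1..n. y i * complete_h (n - i) y)"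
  unfolding complete_h_rec[symmetric] using of_nat_inverse_mult[OF assms, of "complete_h n y"]
  by (simp add: mult.left_commute)

lemma keys_hvar:
  assumes "m \<in> Poly_Mapping.keys (hvar n)"
  shows "sum_mset (mono_mset m) = n" "0 \<notin># mono_mset m"
proof -
  have "sum_mset (mono_mset m) = n \<and> 0 \<notin># mono_mset m"
    using assms
  proof (induction n arbitrary: m rule: less_induct)
    case (less n)
    show ?case
    proof (cases "n = 0")
      case True
      then show ?thesis using less.prems by simp
    next
      case False
      have "m \<in> Poly_Mapping.keys (\<Sum>i=1..n. of_nat i * Var i * hvar (n - i))"
        using less.prems complete_h_unfold[of n "\<lambda>i. of_nat i * Var i :: (nat, rat) mpoly"] False
          subsetD[OF keys_Const_mult] by simp
      then obtain i where i: "i \<in> {1..n}" "m \<in> Poly_Mapping.keys (of_nat i * Var i * hvar (n - i))"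
        using subsetD[OF keys_sum_subset] by fast
      then have "m \<in> Poly_Mapping.keys (of_nat i * (hvar (n - i) * Var i))"
        by (simp add: mult_ac)
      then have "m \<in> Poly_Mapping.keys (hvar (n - i) * Var i)"
        by (rule subsetD[OF keys_of_nat_mult])
      from keys_mult_Var[OF this] obtain m' where "m' \<in> Poly_Mapping.keys (hvar (n - i))" "m = m' + Poly_Mapping.single i 1"
        by blast
      then show ?thesis using less.IH[of "n - i" m'] i by (auto simp: mono_mset_add)
    qed
  qed
  then show "sum_mset (mono_mset m) = n" "0 \<notin># mono_mset m" by auto
qed

lemma sum_mset_eq_singleton:
  fixes M :: "nat multiset"
  assumes "size M = 1" "sum_mset M = n"
  shows "M = {#n#}"
  using size_1_singleton_mset[OF assms(1)] assms(2) by auto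

text \<open>The linear part of h_n(y) is y_n / n, and y_n = n D_n here.\<close>

lemma lookup_hvar_single:
  assumes "n > 0"
  shows "Poly_Mapping.lookup (hvar n) (Poly_Mapping.single n 1) = 1"
proof -
  let ?m = "Poly_Mapping.single n (1::nat)"
  have "Poly_Mapping.lookup (of_nat i * Var i * hvar (n - i)) ?m = (if i = n then of_nat n else 0)" if "i \<in> {1..n}" for i
  proof (cases "i = n")
    case True
    have "Poly_Mapping.lookup (Const (of_nat n) * (1 * Var n)) (0 + ?m) = (of_nat n :: rat)"
      unfolding lookup_Const_mult lookup_mult_Var by simp
    then show ?thesis using True by simp
  next
    case False
    have "?m \<notin> Poly_Mapping.keys (of_nat i * (hvar (n - i) * Var i))"
    proof
      assume "?m \<in> Poly_Mapping.keys (of_nat i * (hvar (n - i) * Var i))"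
      then have "?m \<in> Poly_Mapping.keys (hvar (n - i) * Var i)"
        by (rule subsetD[OF keys_of_nat_mult])
      from keys_mult_Var[OF this] obtain m' where "?m = m' + Poly_Mapping.single i 1"
        by blast
      then have "mono_mset ?m = mono_mset m' + {#i#}" by (simp only: mono_mset_add mono_mset_single)
      then have "i \<in># mono_mset ?m" by simp
      then show False using False by simp
    qed
    then show ?thesis using False by (simp add: in_keys_iff mult_ac)
  qed
  then show ?thesis using assms
    by (subst complete_h_unfold) (simp_all add: lookup_Const_mult lookup_sum)
qed

text \<open>What can be said of every monomial of \<open>hirota_op k l\<close>: those with two
  factors are among three leading ones, all others have at least three factors.\<close>

definition op_mset :: "nat \<Rightarrow> nat \<Rightarrow> nat multiset \<Rightarrow> bool" where
  "op_mset k l M \<longleftrightarrow> sum_mset M = k + l \<and> 0 \<notin># M \<and> size M \<ge> 2 \<and>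
     (size M = 2 \<longrightarrow> M \<in> {{#k, l#}, {#k + 1, l - 1#}, {#k + l - 1, 1#}})"

lemma op_mset_hvar:
  assumes "m \<in> Poly_Mapping.keys (hvar n * Var j)" "n \<ge> 1" "j \<ge> 1"
  shows "sum_mset (mono_mset m) = n + j" "0 \<notin># mono_mset m" "size (mono_mset m) \<ge> 2"
    "size (mono_mset m) = 2 \<Longrightarrow> mono_mset m = {#n, j#}" "j \<in># mono_mset m"
proof -
  obtain m' where m': "m' \<in> Poly_Mapping.keys (hvar n)" "m = m' + Poly_Mapping.single j 1"
    using keys_mult_Var[OF assms(1)] by blast
  then have mm: "mono_mset m = add_mset j (mono_mset m')"
    by (simp add: mono_mset_add)
  have ne: "mono_mset m' \<noteq> {#}" using keys_hvar(1)[OF m'(1)] assms by auto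
  show "sum_mset (mono_mset m) = n + j" "0 \<notin># mono_mset m" "j \<in># mono_mset m"
    using keys_hvar[OF m'(1)] assms by (auto simp: mm)
  show "size (mono_mset m) \<ge> 2"
    using ne by (cases "mono_mset m'") (auto simp: mm)
  show "mono_mset m = {#n, j#}" if "size (mono_mset m) = 2"
  proof -
    have "mono_mset m' = {#n#}"
      using that keys_hvar(1)[OF m'(1)] by (intro sum_mset_eq_singleton) (auto simp: mm)
    then show ?thesis by (simp add: mm)
  qed
qed

lemma hirota_op_alt:
  "hirota_op k l = of_nat k * (hvar l * Var k) + of_nat (l - 1) * (hvar (k + 1) * Var (l - 1))
     - of_nat (k + l - 1) * (Var 1 * Var (k + l - 1))"
  by (simp add: hirota_op_def Let_def mult_ac)

lemma keys_hirota_op: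
  assumes m: "m \<in> Poly_Mapping.keys (hirota_op k l)" and kl: "k \<ge> l" "l \<ge> 2"
  shows "op_mset k l (mono_mset m)"
proof -
  have keys_diff: "Poly_Mapping.keys (P - Q) \<subseteq> Poly_Mapping.keys P \<union> Poly_Mapping.keys Q" for P Q :: "(nat, rat) mpoly"
    by (auto simp: in_keys_iff lookup_minus)
  have "m \<in> Poly_Mapping.keys (hvar l * Var k) \<or> m \<in> Poly_Mapping.keys (hvar (k + 1) * Var (l - 1)) \<or> 
      m \<in> Poly_Mapping.keys (Var 1 * Var (k + l - 1) :: (nat, rat) mpoly)"
    using m unfolding hirota_op_alt
    by (auto dest!: subsetD[OF keys_diff] subsetD[OF Poly_Mapping.keys_add] subsetD[OF keys_of_nat_mult])
  then consider "m \<in> Poly_Mapping.keys (hvar l * Var k)" | "m \<in> Poly_Mapping.keys (hvar (k + 1) * Var (l - 1))"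
    | "m = Poly_Mapping.single 1 1 + Poly_Mapping.single (k + l - 1) 1"
    by (auto simp: Var_def mult_single)
  then show ?thesis
  proof cases
    case 1
    from op_mset_hvar[OF 1] kl show ?thesis by (auto simp: op_mset_def add_mset_commute)
  next
    case 2
    from op_mset_hvar[OF 2] kl show ?thesis by (auto simp: op_mset_def)
  next
    case 3
    then show ?thesis using kl by (auto simp: op_mset_def mono_mset_add)
  qed
qed

text \<open>Only the first summand contributes: the second has a factor D_(l-1) and the third a
  factor D_1, and neither l - 1 nor 1 is k or l. The value is the same for k = l.\<close>

lemma lookup_hirota_op:
  assumes kl: "k \<ge> l" "l \<ge> 2" and m: "mono_mset m = {#k, l#}"
  shows "Poly_Mapping.lookup (hirota_op k l) m = of_nat k"
proof -
  have "m = Poly_Mapping.single l 1 + Poly_Mapping.single k 1"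
    using m by (subst mono_mset_inject[symmetric]) (simp add: mono_mset_add)
  then have 1: "Poly_Mapping.lookup (hvar l * Var k) m = 1"
    using kl lookup_hvar_single[of l] by (simp only: lookup_mult_Var)
  have "m \<notin> Poly_Mapping.keys (hvar (k + 1) * Var (l - 1))"
  proof
    assume "m \<in> Poly_Mapping.keys (hvar (k + 1) * Var (l - 1))"
    then have "l - 1 \<in># {#k, l#}" using op_mset_hvar(5)[of m "k + 1" "l - 1"] kl m by fastforce
    moreover have "l - 1 \<noteq> k" "l - 1 \<noteq> l" using kl by auto
    ultimately show False by simp
  qed
  then have 2: "Poly_Mapping.lookup (hvar (k + 1) * Var (l - 1)) m = 0"
    by (simp add: in_keys_iff)
  have 3: "Poly_Mapping.lookup (Var 1 * Var (k + l - 1)) m = (0::rat)"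
  proof -
    have "m \<noteq> Poly_Mapping.single 1 1 + Poly_Mapping.single (k + l - 1) 1"
    proof
      assume "m = Poly_Mapping.single 1 1 + Poly_Mapping.single (k + l - 1) 1"
      then have "{#k, l#} = {#k + l - 1, 1#}" using m by (simp add: mono_mset_add)
      then have "1 \<in># {#k, l#}" by simp
      then show False using kl by auto
    qed
    then show ?thesis by (simp add: Var_def mult_single lookup_single when_def)
  qed
  have lookup_of_nat: "Poly_Mapping.lookup (of_nat c * P) m = of_nat c * Poly_Mapping.lookup P m" for c and P :: "(nat, rat) mpoly"
    using lookup_Const_mult[of "of_nat c" P m] by simp
  show ?thesis
    unfolding hirota_op_alt lookup_minus lookup_add lookup_of_nat 1 2 3 by (simp only: mult_1_right mult_zero_right add_0_right diff_zero)
qed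

subsection \<open>Blocks\<close>

definition even_partitions :: "nat \<Rightarrow> nat set set set" where
  "even_partitions n = {P. partition_on {..<n} P \<and> (\<forall>B\<in>P. even (card B))}"

definition block :: "nat list \<Rightarrow> nat set \<Rightarrow> nat multiset" where
  "block is B = image_mset (nth is) (mset_set B)"

text \<open>The sum of \<open>hirota\<close> in any commutative ring, so that it can also be formed
  for power series.\<close>

definition hirota_gen :: "(nat multiset \<Rightarrow> 'b::comm_ring_1) \<Rightarrow> nat list \<Rightarrow> 'b" where
  "hirota_gen g is = (\<Sum>P\<in>even_partitions (length is). \<Prod>B\<in>P. 2 * g (block is B))"

lemma hirota_hirota_gen: "hirota g is = hirota_gen g is"
  by (simp add: hirota_def hirota_gen_def even_partitions_def block_def)

lemma even_partitionsD:
  assumes "P \<in> even_partitions n" "B \<in> P"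
  shows "B \<subseteq> {..<n}" "finite B" "B \<noteq> {}" "even (card B)"
proof -
  show "B \<subseteq> {..<n}" "B \<noteq> {}" "even (card B)"
    using assms by (auto simp: even_partitions_def partition_on_def)
  then show "finite B" by (meson finite_lessThan finite_subset)
qed

lemma size_block: "size (block is B) = card B"
  by (simp add: block_def)

lemma image_mset_nth: "image_mset (nth is) (mset_set {..<length is}) = mset is"
proof -
  have "mset is = mset (map (nth is) [0..<length is])" by (simp add: map_nth)
  then show ?thesis by (simp only: mset_map mset_upt atLeast0LessThan)
qed

lemma block_subset:
  assumes "P \<in> even_partitions (length is)" "B \<in> P"
  shows "block is B \<subseteq># mset is"
proof -
  have "mset_set B \<subseteq># mset_set {..<length is}"
    using even_partitionsD[OF assms] by (intro subset_imp_msubset_mset_set) auto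
  then have "block is B \<subseteq># image_mset (nth is) (mset_set {..<length is})"
    unfolding block_def by (rule image_mset_subseteq_mono)
  then show ?thesis by (simp only: image_mset_nth)
qed

lemma size_block_ge_2:
  assumes "P \<in> even_partitions n" "B \<in> P"
  shows "size (block is B) \<ge> 2"
proof -
  have "card B \<noteq> 0" "even (card B)" using even_partitionsD[OF assms] by auto
  then show ?thesis unfolding size_block by (cases "card B = 1") auto
qed

lemma even_partitions_2: "even_partitions 2 = {{{..<2}}}"
proof -
  have "P = {{..<2}}" if P: "P \<in> even_partitions 2" for P
  proof -
    have "B = {..<2}" if "B \<in> P" for B
    proof -
      have "card B \<ge> 2" using size_block_ge_2[OF P that] by (simp add: size_block)
      then show ?thesis using even_partitionsD[OF P that]
        by (intro card_seteq) auto
    qed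
    moreover have "{..<2} = \<Union>P" using P partition_onD1 unfolding even_partitions_def by blast
    then have "(0::nat) \<in> \<Union>P" by (metis lessThan_iff zero_less_numeral)
    ultimately show ?thesis by auto
  qed
  moreover have "{{..<2}} \<in> even_partitions 2"
    by (simp add: even_partitions_def partition_on_space lessThan_empty_iff)
  ultimately show ?thesis by blast
qed

lemma hirota_gen_2:
  assumes "length is = 2"
  shows "hirota_gen g is = 2 * g (mset is)"
proof -
  have "block is {..<2} = mset is"
    unfolding block_def assms[symmetric] by (rule image_mset_nth)
  then show ?thesis by (simp add: hirota_gen_def assms even_partitions_2)
qed

lemma hirota_gen_cong:
  assumes "\<And>P B. P \<in> even_partitions (length is) \<Longrightarrow> B \<in> P \<Longrightarrow> g (block is B) = g' (block is B)"
  shows "hirota_gen g is = hirota_gen g' is"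
  unfolding hirota_gen_def using assms by (intro sum.cong prod.cong refl) auto

section \<open>The order of the construction and the size of blocks\<close>

lemma sum_mset_ge_size: "0 \<notin># M \<Longrightarrow> size M \<le> sum_mset (M :: nat multiset)"
  by (induction M) auto

text \<open>|M| - length(M) is the sum of the numbers part - 1, all nonnegative, so omitting parts
  cannot raise it.\<close>

lemma sum_minus_size_mono:
  fixes M N :: "nat multiset"
  assumes "M \<subseteq># N" "0 \<notin># N"
  shows "sum_mset M - size M \<le> sum_mset N - size N"
proof -
  obtain K where "N = M + K" using assms(1) using mset_subset_eq_exists_conv by blast
  then show ?thesis using assms(2) sum_mset_ge_size[of M] sum_mset_ge_size[of K] by auto
qed

lemma KP_orderI1: "sum_mset M - size M < sum_mset N - size N \<Longrightarrow> (M, N) \<in> KP_order"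
  and KP_orderI2: "sum_mset M - size M \<le> sum_mset N - size N \<Longrightarrow> size M < size N \<Longrightarrow> (M, N) \<in> KP_order"
  and KP_orderI3: "sum_mset M - size M \<le> sum_mset N - size N \<Longrightarrow> size M \<le> size N \<Longrightarrow> Min_mset M < Min_mset N \<Longrightarrow> (M, N) \<in> KP_order"
  by (auto simp: KP_order_def)

lemma wf_KP_order: "wf KP_order"
  by (simp add: KP_order_def)

lemma KP_order_irrefl: "(M, M) \<notin> KP_order"
  by (simp add: KP_order_def)

text \<open>Every derivative in the equation given by \<open>hirota_op k l\<close>, apart from the one solved for,
  is smaller than \<open>(k,l)\<close>.\<close>

lemma block_order:
  assumes op: "op_mset k l (mset is)" and kl: "k \<ge> l" "l \<ge> 2" and ne: "mset is \<noteq> {#k, l#}"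
    and P: "P \<in> even_partitions (length is)" "B \<in> P"
  shows "(block is B, {#k, l#}) \<in> KP_order"
proof (cases "length is = 2")
  case True
  then have "mset is \<in> {{#k + 1, l - 1#}, {#k + l - 1, 1#}}"
    using op ne by (auto simp: op_mset_def)
  moreover have "block is B = mset is"
  proof -
    have "size (block is B) \<ge> size (mset is)" using size_block_ge_2[OF P] True by simp
    then show ?thesis using block_subset[OF P] mset_subset_size[of "block is B" "mset is"] by (auto simp: subset_mset.le_less)
  qed
  ultimately show ?thesis using kl by (auto intro!: KP_orderI3)
next
  case False
  then have "length is > 2" using op by (simp add: op_mset_def)
  moreover have "sum_mset (block is B) - size (block is B) \<le> sum_mset (mset is) - size (mset is)"
    using op unfolding op_mset_def by (intro sum_minus_size_mono block_subset[OF P]) blast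
  moreover have "sum_mset (mset is) = k + l" using op by (auto simp: op_mset_def)
  ultimately show ?thesis
    using kl by (intro KP_orderI1) auto
qed

text \<open>A block of a monomial of degree k + l with at least two factors inherits the bound k + l
  - 2. This is where the bound on the largest part of the hooks in \<open>KP\<close> comes
  from.\<close>

lemma block_bound:
  assumes op: "op_mset k l (mset is)" and P: "P \<in> even_partitions (length is)" "B \<in> P"
  shows "0 \<notin># block is B" "block is B \<noteq> {#}" "sum_mset (block is B) - size (block is B) \<le> k + l - 2"
proof -
  have "0 \<notin># mset is" using op unfolding op_mset_def by blast
  then show "0 \<notin># block is B" using mset_subset_eqD[OF block_subset[OF P]] by blast
  show "block is B \<noteq> {#}" using size_block_ge_2[OF P, of "is"] by auto
  have "sum_mset (block is B) - size (block is B) \<le> sum_mset (mset is) - size (mset is)"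
    using op unfolding op_mset_def by (intro sum_minus_size_mono block_subset[OF P]) blast
  then show "sum_mset (block is B) - size (block is B) \<le> k + l - 2"
    using op by (auto simp: op_mset_def)
qed

section \<open>Operators acting on coefficients, and logarithmic derivatives\<close>

definition fps_cw :: "('a \<Rightarrow> 'b) \<Rightarrow> 'a fps \<Rightarrow> 'b fps" where
  "fps_cw f x = Abs_fps (\<lambda>n. f (fps_nth x n))"

lemma fps_cw_nth [simp]: "fps_nth (fps_cw f x) n = f (fps_nth x n)"
  by (simp add: fps_cw_def)

lemma ring_derivation_fps_cw:
  assumes "ring_derivation \<delta>"
  shows "ring_derivation (fps_cw \<delta>)"
proof -
  interpret \<delta>: ring_derivation \<delta> by fact
  show ?thesis
    by unfold_locales (auto intro!: fps_ext simp: fps_mult_nth \<delta>.add \<delta>.sum \<delta>.mult sum.distrib)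
qed

lemma coeff_hom_fps_cw:
  assumes "coeff_hom \<phi>"
  shows "coeff_hom (fps_cw \<phi>)"
proof -
  interpret \<phi>: coeff_hom \<phi> by fact
  show ?thesis
    by unfold_locales (auto intro!: fps_ext simp: fps_mult_nth \<phi>.hom_add \<phi>.hom_sum \<phi>.hom_mult)
qed

lemma geometric_sum_fps:
  fixes g :: "'a::comm_ring_1"
  shows "(\<Sum>k<N. (- g) ^ k) * (1 + g) = 1 - (- g) ^ N"
  by (induction N) (simp_all add: algebra_simps)

text \<open>The derivation \<open>D\<close> may act differently on each power of t, through
  \<open>\<delta> n\<close>. This covers derivatives in the p_i and also the Euler operator, which
  contains t d/dt.\<close>

lemma log_series_derivation:
  fixes f :: "('x, rat) mpoly fps"
  assumes f: "fps_nth f 0 = 1" and D: "ring_derivation D" "\<And>g n. fps_nth (D g) n = \<delta> n (fps_nth g n)"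
    and \<delta>: "\<And>n x y. \<delta> n (x + y) = \<delta> n x + \<delta> n y" "\<And>n c x. \<delta> n (Const c * x) = Const c * \<delta> n x"
  shows "f * D (log_series f) = D f"
proof (rule fps_ext)
  fix n
  interpret c: ring_derivation D by fact
  have \<delta>_0: "\<delta> n 0 = 0" for n
    using \<delta>(1)[of n 0 0] by simp
  have \<delta>_sum: "\<delta> n (\<Sum>i\<in>I. h i) = (\<Sum>i\<in>I. \<delta> n (h i))" for n and I :: "nat set" and h
    by (induction I rule: infinite_finite_induct) (simp_all add: \<delta>(1) \<delta>_0)
  define g where "g = f - 1"
  have g0: "fps_nth g 0 = 0" by (simp add: g_def f)
  have "D f = D (1 + g)" by (simp add: g_def)
  then have df: "D f = D g" by (simp only: c.add c.one add_0_left)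
  have log: "fps_nth (log_series f) m = (\<Sum>k=1..N. Const ((-1) ^ (k + 1) / of_nat k) * fps_nth (g ^ k) m)" if "m \<le> N" for m N
    unfolding log_series_def g_def[symmetric] using that
    by (simp, intro sum.mono_neutral_left) (auto simp: fps_power_nth_0[OF g0])
  \<comment> \<open>Termwise differentiation of log (1 + g) leaves a geometric series in -g; its cut
    at \<open>N\<close> is felt only beyond the order considered, as g has no constant term.\<close>
  have dlog: "fps_nth (D (log_series f)) m = fps_nth ((\<Sum>k<N. (- g) ^ k) * D g) m" if "m \<le> N" for m N
  proof -
    have "fps_nth (D (log_series f)) m = (\<Sum>k=1..N. Const ((-1) ^ (k + 1) / of_nat k) * fps_nth (D (g ^ k)) m)"
      by (simp add: log[OF that] D(2) \<delta>_sum \<delta>(2))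
    also have "\<dots> = (\<Sum>k<N. Const ((-1) ^ k / of_nat (Suc k)) * fps_nth (D (g ^ Suc k)) m)"
      unfolding One_nat_def sum.atLeast1_atMost_eq by simp
    also have "\<dots> = (\<Sum>k<N. fps_nth ((- g) ^ k * D g) m)"
    proof (rule sum.cong)
      fix k
      have "fps_nth (D (g ^ Suc k)) m = of_nat (Suc k) * fps_nth (g ^ k * D g) m"
        unfolding c.power mult.assoc by (simp add: fps_of_nat[symmetric] del: of_nat_Suc)
      then have "Const ((-1) ^ k / of_nat (Suc k)) * fps_nth (D (g ^ Suc k)) m
         = (Const ((-1) ^ k / of_nat (Suc k)) * of_nat (Suc k)) * fps_nth (g ^ k * D g) m"
        by (simp only: mult.assoc)
      also have "Const ((-1) ^ k / of_nat (Suc k)) * of_nat (Suc k) = (Const ((-1) ^ k) :: ('x, rat) mpoly)"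
        by (simp add: Const_mult[symmetric] flip: Const_of_nat del: of_nat_Suc)
      also have "Const ((-1) ^ k) = ((-1) ^ k :: ('x, rat) mpoly)"
        by (simp add: Const_power Const_uminus)
      also have "(-1) ^ k * fps_nth (g ^ k * D g) m = fps_nth ((- g) ^ k * D g) m"
        by (cases "even k") simp_all
      finally show "Const ((-1) ^ k / of_nat (Suc k)) * fps_nth (D (g ^ Suc k)) m = fps_nth ((- g) ^ k * D g) m" .
    qed simp
    finally show ?thesis
      by (simp add: sum_distrib_right fps_sum_nth)
  qed
  have "fps_nth (f * D (log_series f)) n = fps_nth (f * ((\<Sum>k<Suc n. (- g) ^ k) * D g)) n"
    unfolding fps_mult_nth[of f] by (intro sum.cong refl, subst dlog[of _ "Suc n"]) auto
  also have "f * ((\<Sum>k<Suc n. (- g) ^ k) * D g) = ((\<Sum>k<Suc n. (- g) ^ k) * (1 + g)) * D g"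
    by (simp add: g_def mult_ac)
  also have "\<dots> = D g - (- g) ^ Suc n * D g"
    by (simp only: geometric_sum_fps left_diff_distrib mult_1)
  also have "fps_nth \<dots> n = fps_nth (D g) n"
  proof -
    have "fps_nth ((- g) ^ Suc n) i = 0" if "i \<le> n" for i
      using that g0 by (intro fps_power_nth_0) auto
    then show ?thesis by (simp only: fps_sub_nth fps_mult_nth) simp
  qed
  finally show "fps_nth (f * D (log_series f)) n = fps_nth (D f) n"
    by (simp add: df)
qed

lemma log_series_deriv:
  fixes f :: "('x, rat) mpoly fps"
  assumes f: "fps_nth f 0 = 1" and \<delta>: "ring_derivation \<delta>" "\<And>c. \<delta> (Const c) = 0"
  shows "f * fps_cw \<delta> (log_series f) = fps_cw \<delta> f"
  by (rule log_series_derivation[OF f ring_derivation_fps_cw[OF \<delta>(1)], of "\<lambda>_. \<delta>"])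
     (simp_all add: ring_derivation.add[OF \<delta>(1)] ring_derivation.mult[OF \<delta>(1)] \<delta>(2))

subsection \<open>Set partitions\<close>

text \<open>Deleting r from a partition of \<open>insert r A\<close> shows the alternative: r was a
  block by itself, or it was added to a block B of a partition of A.\<close>

lemma sum_partitions_insert:
  assumes "finite A" "r \<notin> A"
  shows "(\<Sum>P | partition_on (insert r A) P. f P) =
    (\<Sum>P | partition_on A P. f (insert {r} P) + (\<Sum>B\<in>P. f (insert (insert r B) (P - {B}))))"
proof -
  let ?S = "{P. partition_on A P}"
  have fin: "finite ?S" using assms(1) by (rule finitely_many_partition_on)
  have finP: "finite P" if "P \<in> ?S" for P
    using that assms(1) finite_elements by blast
  have notin: "r \<notin> B" if "P \<in> ?S" "B \<in> P" for P B
    using that assms(2) by (auto simp: partition_on_def)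
  have disj: "disjnt B (\<Union>(P - {B}))" if "P \<in> ?S" "B \<in> P" for P B
    using that by (auto simp: partition_on_def disjoint_def disjnt_def)
  have U: "{P. partition_on (insert r A) P} = (insert {r} ` ?S) \<union> (\<lambda>(P, B). insert (insert r B) (P - {B})) ` (SIGMA P:?S. P)"
    (is "?L = ?R1 \<union> ?R2")
  proof (intro equalityI subsetI)
    fix Q assume "Q \<in> ?L"
    then have Q: "partition_on (insert r A) Q" by simp
    then obtain C where C: "C \<in> Q" "r \<in> C" by (auto simp: partition_on_def)
    define P where "P = Q - {C}"
    have QC: "Q = insert C P" using C by (auto simp: P_def)
    have "disjnt C (\<Union>P)"
      using Q C unfolding P_def partition_on_def disjoint_def disjnt_def by blast
    then have P: "partition_on (insert r A - C) P" "C \<subseteq> insert r A"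
      using Q unfolding QC by (auto simp: partition_on_insert)
    show "Q \<in> ?R1 \<union> ?R2"
    proof (cases "C = {r}")
      case True
      then have "partition_on A P" using P assms(2) by simp
      then show ?thesis using QC True by auto
    next
      case False
      define B where "B = C - {r}"
      have B: "B \<noteq> {}" "C = insert r B" "B \<subseteq> A" "r \<notin> B" using False C P assms(2) by (auto simp: B_def)
      have AB: "insert r A - C = A - B" using B assms(2) by auto
      then have "disjnt B (\<Union>P)" using P(1) by (auto simp: partition_on_def disjnt_def)
      then have "partition_on A (insert B P)"
        using P AB B by (simp add: partition_on_insert)
      moreover have "B \<notin> P" using \<open>disjnt B (\<Union>P)\<close> B by (auto simp: disjnt_def)
      ultimately have "(insert B P, B) \<in> (SIGMA P:?S. P)" "Q = insert (insert r B) (insert B P - {B})"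
        using QC B by auto
      then show ?thesis by (intro UnI2 image_eqI[where x = "(insert B P, B)"]) simp_all
    qed
  next
    fix Q assume "Q \<in> ?R1 \<union> ?R2"
    then show "Q \<in> ?L"
    proof
      assume "Q \<in> ?R1"
      then obtain P where P: "P \<in> ?S" "Q = insert {r} P" by auto
      moreover have "disjnt {r} (\<Union>P)" using P assms(2) by (auto simp: partition_on_def)
      moreover have "insert r A - {r} = A" using assms(2) by auto
      ultimately show ?thesis by (simp add: partition_on_insert)
    next
      assume "Q \<in> ?R2"
      then obtain P B where P: "P \<in> ?S" "B \<in> P" "Q = insert (insert r B) (P - {B})" by auto
      have PB: "P = insert B (P - {B})" using P by auto
      then have "partition_on (A - B) (P - {B})" "B \<subseteq> A" "B \<noteq> {}"
        using partition_on_insert[OF disj[OF P(1,2)], of A] P(1) by auto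
      moreover have "disjnt (insert r B) (\<Union>(P - {B}))"
        using disj[OF P(1,2)] P assms(2) by (auto simp: partition_on_def disjnt_def)
      moreover have "insert r A - insert r B = A - B" using assms(2) by auto
      ultimately show ?thesis using P(3) by (auto simp: partition_on_insert)
    qed
  qed
  \<comment> \<open>The block containing r recovers B, which makes the second parametrisation
    injective.\<close>
  have key: "\<Union>{C\<in>insert (insert r B) (P - {B}). r \<in> C} = insert r B" if "P \<in> ?S" "B \<in> P" for P B
    using notin[OF that(1)] by auto
  have inj1: "inj_on (insert {r}) ?S"
  proof (rule inj_onI)
    fix P Q assume *: "P \<in> ?S" "Q \<in> ?S" "insert {r} P = insert {r} Q"
    have "{r} \<notin> P" "{r} \<notin> Q" using notin[OF *(1), of "{r}"] notin[OF *(2), of "{r}"] by auto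
    then show "P = Q" using *(3) by (simp add: insert_ident)
  qed
  have inj2: "inj_on (\<lambda>(P, B). insert (insert r B) (P - {B})) (SIGMA P:?S. P)"
  proof (rule inj_onI, clarify)
    fix P B Q C assume *: "partition_on A P" "B \<in> P" "partition_on A Q" "C \<in> Q"
      "insert (insert r B) (P - {B}) = insert (insert r C) (Q - {C})"
    then have "insert r B = insert r C" using key[of P B] key[of Q C] by simp
    moreover have "r \<notin> B" "r \<notin> C" using notin[of P B] notin[of Q C] * by auto
    ultimately have BC: "B = C" by (simp add: insert_ident)
    moreover have "insert r B \<notin> P - {B}" "insert r B \<notin> Q - {B}"
      using notin[of P "insert r B"] notin[of Q "insert r B"] * by auto
    ultimately have "P - {B} = Q - {B}" using *(5) by (simp add: insert_ident)
    then have "insert B (P - {B}) = insert B (Q - {B})" by simp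
    then show "P = Q \<and> B = C" using *(2,4) BC by (simp add: insert_absorb)
  qed
  have disj12: "?R1 \<inter> ?R2 = {}"
  proof -
    have False if *: "P \<in> ?S" "Q \<in> ?S" "B \<in> Q" "insert {r} P = insert (insert r B) (Q - {B})" for P Q B
    proof -
      have "{r} \<in> insert (insert r B) (Q - {B})" using *(4) by auto
      then have "{r} = insert r B" using notin[OF *(2)] by auto
      then have "B = {}" using notin[OF *(2,3)] by auto
      then show False using * by (auto simp: partition_on_def)
    qed
    then show ?thesis by (auto simp: image_iff)
  qed
  have "(\<Sum>P | partition_on (insert r A) P. f P) = sum f ?R1 + sum f ?R2"
    unfolding U using fin finP disj12 by (intro sum.union_disjoint) auto
  also have "sum f ?R1 = (\<Sum>P\<in>?S. f (insert {r} P))"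
    by (subst sum.reindex[OF inj1]) simp
  also have "sum f ?R2 = (\<Sum>P\<in>?S. \<Sum>B\<in>P. f (insert (insert r B) (P - {B})))"
    by (subst sum.reindex[OF inj2], subst sum.Sigma) (use fin finP in \<open>auto intro!: sum.cong\<close>)
  finally show ?thesis by (simp add: sum.distrib)
qed

text \<open>The formula of Faa di Bruno for the exponential of a series with derivatives \<open>L\<close>.\<close>

lemma iterated_derivatives_exp:
  fixes T :: "'a::comm_ring_1"
  assumes \<delta>: "\<And>j. ring_derivation (\<delta> j)" and T: "\<And>j. \<delta> j T = T * L {#j#}"
    and L: "\<And>j B. B \<noteq> {#} \<Longrightarrow> \<delta> j (L B) = L (add_mset j B)"
  shows "fold \<delta> is T = T * (\<Sum>P | partition_on {..<length is} P. \<Prod>B\<in>P. L (block is B))"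
proof (induction "is" rule: rev_induct)
  case Nil
  then show ?case by (simp add: partition_on_empty)
next
  case (snoc j "is")
  let ?n = "length is"
  have fin: "finite B" if "partition_on {..<?n} P" "B \<in> P" for P B
    using that by (metis finite_lessThan finite_subset partition_onD1 Union_upper)
  have sub: "B \<subseteq> {..<?n}" if "partition_on {..<?n} P" "B \<in> P" for P B
    using that by (auto simp: partition_on_def)
  have old: "block (is @ [j]) B = block is B" if "partition_on {..<?n} P" "B \<in> P" for P B
    unfolding block_def using sub[OF that] fin[OF that]
    by (intro image_mset_cong) (auto simp: nth_append)
  have new: "block (is @ [j]) (insert ?n B) = add_mset j (block is B)" if "partition_on {..<?n} P" "B \<in> P" for P B
  proof -
    have "?n \<notin> B" using sub[OF that] by auto
    then have "block (is @ [j]) (insert ?n B) = add_mset j (block (is @ [j]) B)"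
      using fin[OF that] by (simp add: block_def)
    then show ?thesis using old[OF that] by simp
  qed
  have ne: "block is B \<noteq> {#}" if "partition_on {..<?n} P" "B \<in> P" for P B
  proof -
    have "B \<noteq> {}" using that by (auto simp: partition_on_def)
    then show ?thesis using fin[OF that] by (simp add: block_def mset_set_empty_iff)
  qed
  interpret \<delta>: ring_derivation "\<delta> j" by (rule \<delta>)
  let ?S = "\<lambda>P. \<Prod>B\<in>P. L (block is B)"
  \<comment> \<open>Differentiating a factor enlarges its block by the new index, while
    differentiating \<open>T\<close> opens a new block with that index alone.\<close>
  have d: "\<delta> j (?S P) = (\<Sum>B\<in>P. \<Prod>C\<in>insert (insert ?n B) (P - {B}). L (block (is @ [j]) C))"
    and e: "L {#j#} * ?S P = (\<Prod>C\<in>insert {?n} P. L (block (is @ [j]) C))" if P: "partition_on {..<?n} P" for P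
  proof -
    have finP: "finite P" using P finite_elements by blast
    have "insert ?n B \<notin> P" for B using sub[OF P] by auto
    then have "(\<Prod>C\<in>insert (insert ?n B) (P - {B}). L (block (is @ [j]) C)) = \<delta> j (L (block is B)) * (\<Prod>C\<in>P - {B}. L (block is C))"
      if "B \<in> P" for B
      using finP that P by (simp add: new[OF P] old[OF P] L[OF ne[OF P]] cong: prod.cong_simp)
    then show "\<delta> j (?S P) = (\<Sum>B\<in>P. \<Prod>C\<in>insert (insert ?n B) (P - {B}). L (block (is @ [j]) C))"
      using finP by (simp add: \<delta>.prod)
    have "{?n} \<notin> P" using sub[OF P] by auto
    moreover have "block (is @ [j]) {?n} = {#j#}" by (simp add: block_def)
    ultimately show "L {#j#} * ?S P = (\<Prod>C\<in>insert {?n} P. L (block (is @ [j]) C))"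
      using finP by (simp add: old[OF P] cong: prod.cong_simp)
  qed
  have "fold \<delta> (is @ [j]) T = \<delta> j (T * (\<Sum>P | partition_on {..<?n} P. ?S P))"
    by (simp add: snoc)
  also have "\<dots> = T * (\<Sum>P | partition_on {..<?n} P. L {#j#} * ?S P + \<delta> j (?S P))"
    by (simp add: \<delta>.mult T \<delta>.sum sum.distrib sum_distrib_left distrib_left mult_ac)
  also have "(\<Sum>P | partition_on {..<?n} P. L {#j#} * ?S P + \<delta> j (?S P)) =
     (\<Sum>P | partition_on (insert ?n {..<?n}) P. \<Prod>B\<in>P. L (block (is @ [j]) B))"
    by (subst sum_partitions_insert) (auto intro!: sum.cong simp: d e)
  finally show ?case by (simp add: lessThan_Suc)
qed

section \<open>Hooks, and variables of derived polynomials\<close>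

lemma hook_eq_iff: "1 \<le> m \<Longrightarrow> 1 \<le> m' \<Longrightarrow> hook m l = hook m' l' \<longleftrightarrow> m = m' \<and> l = l'"
proof
  assume *: "1 \<le> m" "1 \<le> m'" "hook m l = hook m' l'"
  from arg_cong[OF *(3), of size] have l: "l = l'" by (simp add: hook_def)
  from arg_cong[OF *(3), of sum_mset] l have "m = m'" by (simp add: hook_def sum_mset_replicate_mset)
  then show "m = m' \<and> l = l'" using l by simp
qed simp

lemma size_hook [simp]: "size (hook m l) = Suc l"
  by (simp add: hook_def)

lemma sum_hook [simp]: "sum_mset (hook m l) = m + l"
  by (simp add: hook_def sum_mset_replicate_mset)

lemma Max_hook [simp]: "1 \<le> m \<Longrightarrow> Max_mset (hook m l) = m"
  by (rule Max_eqI) (auto simp: hook_def split: if_splits)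

lemma add_mset_1_hook: "add_mset 1 (hook m l) = hook m (Suc l)"
  by (simp add: hook_def)

text \<open>\<open>b\<close> stands for |lambda| - length(lambda) and bounds m - 1. With c = 1 the
  hook has at least one 1 besides its first part.\<close>

definition hooks :: "nat \<Rightarrow> nat \<Rightarrow> nat multiset set" where
  "hooks b c = {hook m l |m l. 1 \<le> m \<and> m \<le> b + 1 \<and> l \<ge> c}"

lemma hooks_mono: "b \<le> b' \<Longrightarrow> hooks b c \<subseteq> hooks b' c"
  unfolding hooks_def by force

lemma vars_pdiff: "vars (pdiff x P) \<subseteq> vars (P :: ('x, 'a::comm_ring_1) mpoly)"
proof -
  have "Poly_Mapping.keys k \<subseteq> vars P" if k: "k \<in> Poly_Mapping.keys (pdiff x P)" for k
  proof -
    obtain m where m: "m \<in> Poly_Mapping.keys P"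
      "k \<in> Poly_Mapping.keys (Poly_Mapping.single (m - Poly_Mapping.single x 1) (of_nat (Poly_Mapping.lookup m x) * Poly_Mapping.lookup P m))"
      using subsetD[OF keys_sum_subset k[unfolded pdiff_def]] by blast
    then have "k = m - Poly_Mapping.single x 1" by (auto split: if_splits)
    then have "Poly_Mapping.keys k \<subseteq> Poly_Mapping.keys m" by (auto simp: in_keys_iff lookup_minus)
    then show ?thesis using m(1) by (auto simp: vars_def)
  qed
  then show ?thesis by (auto simp: vars_def)
qed

lemma vars_sum_le: "(\<And>i. i \<in> I \<Longrightarrow> vars (f i) \<subseteq> V) \<Longrightarrow> vars (\<Sum>i\<in>I. f i) \<subseteq> V"
  by (intro order_trans[OF vars_sum] UN_least)

lemma vars_mult_le: "vars P \<subseteq> V \<Longrightarrow> vars Q \<subseteq> V \<Longrightarrow> vars (P * Q) \<subseteq> (V :: 'x set)" for P Q :: "('x, 'a::comm_ring_1) mpoly"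
  by (intro order_trans[OF vars_mult] Un_least)

lemma vars_prod_le: "(\<And>i. i \<in> I \<Longrightarrow> vars (f i) \<subseteq> V) \<Longrightarrow> vars (\<Prod>i\<in>I. f i :: ('x, 'a::comm_ring_1) mpoly) \<subseteq> V"
  by (induction I rule: infinite_finite_induct) (simp_all add: vars_mult_le)

lemma vars_derivation_le:
  assumes "vars P \<subseteq> V" "\<And>x. x \<in> vars P \<Longrightarrow> vars (\<delta> x) \<subseteq> V"
  shows "vars (derivation \<delta> P) \<subseteq> V"
  unfolding derivation_def by (intro vars_sum_le vars_mult_le order_trans[OF vars_pdiff assms(1)] assms(2))

lemma vars_d_p1: "vars P \<subseteq> hooks b c \<Longrightarrow> vars (d_p1 P) \<subseteq> hooks b c"
proof -
  assume P: "vars P \<subseteq> hooks b c"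
  then have "vars (d_p1 P) \<subseteq> hooks b c \<union> add_mset 1 ` hooks b c"
    unfolding d_p1_def by (intro vars_derivation_le) auto
  moreover have "add_mset 1 ` hooks b c \<subseteq> hooks b c"
  proof
    fix x assume "x \<in> add_mset 1 ` hooks b c"
    then obtain m l where "x = add_mset 1 (hook m l)" "1 \<le> m" "m \<le> b + 1" "l \<ge> c" by (auto simp: hooks_def)
    then have "x = hook m (Suc l)" "1 \<le> m" "m \<le> b + 1" "Suc l \<ge> c" by (auto simp: add_mset_1_hook[simplified])
    then show "x \<in> hooks b c" unfolding hooks_def by blast
  qed
  ultimately show ?thesis by blast
qed

lemma vars_d_p1_power: "vars P \<subseteq> hooks b c \<Longrightarrow> vars ((d_p1 ^^ k) P) \<subseteq> hooks b c"
  by (induction k) (auto simp: vars_d_p1)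

lemma vars_numeral_mult: "vars (2 * P) \<subseteq> vars (P :: ('x, rat) mpoly)"
proof -
  have "(Const 2 :: ('x, rat) mpoly) = 2"
    by (metis Const_of_nat of_nat_numeral)
  then show ?thesis using vars_mult_le[of "Const 2" "vars P" P] vars_Const[of "2::rat", where ?'a = 'x] by (metis empty_subsetI order_refl)
qed

lemma vars_hirota_gen:
  fixes g :: "nat multiset \<Rightarrow> ('x, rat) mpoly"
  assumes "\<And>P B. P \<in> even_partitions (length is) \<Longrightarrow> B \<in> P \<Longrightarrow> vars (g (block is B)) \<subseteq> V"
  shows "vars (hirota_gen g is) \<subseteq> V"
  unfolding hirota_gen_def
  by (intro vars_sum_le vars_prod_le order_trans[OF vars_numeral_mult] assms)

section \<open>The recursion for the KP polynomials and the hooks that occur in them\<close>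

definition KP_prev :: "nat multiset \<Rightarrow> nat multiset \<Rightarrow> (nat multiset, rat) mpoly" where
  "KP_prev lam mu = (if (mu, lam) \<in> KP_order then KP mu else 0)"

lemma KP_unfold: "KP lam = KP_step lam (KP_prev lam)"
  by (subst KP.simps) (simp add: KP_prev_def[abs_def])

lemma KP_hook: "1 \<le> m \<Longrightarrow> KP (hook m l) = Var (hook m l)"
  by (subst KP_unfold) (auto simp: KP_step_def is_hook_def)

lemma non_hook_cases:
  assumes "\<not> is_hook lam" "0 \<notin># lam" "lam \<noteq> {#}"
  obtains (two) k l where "lam = {#k, l#}" "k \<ge> l" "l \<ge> 2" | (more) "size lam \<ge> 3"
proof (cases "size lam \<ge> 3")
  case False
  have s: "size lam = 2"
  proof (rule ccontr)
    assume "size lam \<noteq> 2"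
    moreover have "size lam \<noteq> 0" using assms(3) by simp
    ultimately have "size lam = 1" using False by linarith
    then obtain m where "lam = {#m#}" using size_1_singleton_mset by blast
    then have "lam = hook m 0" "1 \<le> m" using assms(2) by (auto simp: hook_def Suc_le_eq)
    then show False using assms(1) by (auto simp: is_hook_def)
  qed
  obtain a N where aN: "lam = add_mset a N" using assms(3) by (cases lam) auto
  then have "size N = 1" using s by simp
  then obtain b where ab: "lam = {#a, b#}" using size_1_singleton_mset aN by blast
  define k where "k = max a b"
  define l where "l = min a b"
  have kl: "lam = {#k, l#}" "k \<ge> l" by (auto simp: ab k_def l_def max_def min_def add_mset_commute)
  have "l \<ge> 2"
  proof (rule ccontr)
    assume "\<not> l \<ge> 2"
    moreover have "l \<noteq> 0" using assms(2) kl(1) by auto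
    ultimately have "l = 1" "k \<ge> 1" using kl(2) by linarith+
    then have "lam = hook k 1" using kl by (simp add: hook_def)
    then show False using assms(1) \<open>k \<ge> 1\<close> by (auto simp: is_hook_def)
  qed
  then show ?thesis using kl two by blast
qed (use more in blast)

lemma not_is_hook_pair: "k \<ge> 2 \<Longrightarrow> l \<ge> 2 \<Longrightarrow> \<not> is_hook {#k, l#}"
proof
  assume kl: "k \<ge> 2" "l \<ge> 2" "is_hook {#k, l#}"
  then obtain m a where m: "{#k, l#} = hook m a" by (auto simp: is_hook_def)
  then have "Suc 1 = Suc a" by (metis size_hook size_add_mset size_single One_nat_def)
  then have "1 \<in># {#k, l#}" using m by (simp add: hook_def)
  then show False using kl by auto
qed

lemma KP_pair:
  assumes "k \<ge> l" "l \<ge> 2"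
  shows "KP {#k, l#} = Const (- 1 / (2 * of_nat k)) * hirota_poly (KP_prev {#k, l#}) (hirota_op k l)"
  using assms not_is_hook_pair[of k l]
  by (subst KP_unfold) (simp add: KP_step_def Let_def max_def min_def)

lemma mono_list: "mset (monom_list m) = mono_mset m"
  by (simp add: mono_mset_def)

text \<open>Facts shared by the inductions over \<open>KP_order\<close> for length at least 3. With
  mu = lambda without its smallest part q, a hook (m,1^l) in the polynomial of mu has m - 1 \<le>
  |mu| - length(mu); adding q - 1 gives |lambda| - length(lambda), so the pair (m, q), being
  shorter, precedes lambda.\<close>

lemma KP_more:
  assumes lam: "\<not> is_hook lam" "0 \<notin># lam" "size lam \<ge> 3"
  defines "q \<equiv> Min_mset lam"
  shows "KP lam = derivation (\<lambda>mu. (d_p1 ^^ (size mu - 1)) (KP_prev lam {#Max_mset mu, q#})) (KP (lam - {#q#}))"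
    and "q \<in># lam" and "q \<ge> 1" and "(lam - {#q#}, lam) \<in> KP_order"
    and "\<And>m l. hook m l \<in> hooks (sum_mset (lam - {#q#}) - size (lam - {#q#})) c \<Longrightarrow> 1 \<le> m \<Longrightarrow> ({#m, q#}, lam) \<in> KP_order"
    and "\<And>m l. hook m l \<in> hooks (sum_mset (lam - {#q#}) - size (lam - {#q#})) c \<Longrightarrow> 1 \<le> m \<Longrightarrow> m + q - 2 \<le> sum_mset lam - size lam"
    and "sum_mset (lam - {#q#}) - size (lam - {#q#}) \<le> sum_mset lam - size lam"
    and "0 \<notin># lam - {#q#}" and "lam - {#q#} \<noteq> {#}"
proof -
  have ne: "lam \<noteq> {#}" using lam(3) by auto
  show q: "q \<in># lam" unfolding q_def using ne by (intro Min_in) auto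
  show q1: "q \<ge> 1" using q lam(2) by (cases q) auto
  define mu where "mu = lam - {#q#}"
  have lam_mu: "lam = add_mset q mu" using q by (simp add: mu_def)
  show z: "0 \<notin># lam - {#q#}" using lam(2) by (auto dest: in_diffD)
  then have sz: "size mu \<le> sum_mset mu" using sum_mset_ge_size by (simp add: mu_def)
  show le: "sum_mset (lam - {#q#}) - size (lam - {#q#}) \<le> sum_mset lam - size lam"
    unfolding mu_def[symmetric] using q1 sz by (simp add: lam_mu)
  show ord: "(lam - {#q#}, lam) \<in> KP_order"
    using le by (rule KP_orderI2) (simp add: lam_mu)
  show bound: "m + q - 2 \<le> sum_mset lam - size lam"
    if "hook m l \<in> hooks (sum_mset (lam - {#q#}) - size (lam - {#q#})) c" "1 \<le> m" for m l
  proof -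
    have "m \<le> sum_mset mu - size mu + 1"
      using that by (auto simp: hooks_def mu_def[symmetric] hook_eq_iff)
    then show ?thesis using q1 sz that(2) by (simp add: lam_mu)
  qed
  show "({#m, q#}, lam) \<in> KP_order"
    if "hook m l \<in> hooks (sum_mset (lam - {#q#}) - size (lam - {#q#})) c" "1 \<le> m" for m l
    using bound[OF that] lam(3) by (intro KP_orderI2) auto
  show "lam - {#q#} \<noteq> {#}" 
  proof -
    have "size mu \<ge> 2" using lam(3) by (simp add: lam_mu)
    then show ?thesis unfolding mu_def by auto
  qed
  show "KP lam = derivation (\<lambda>mu. (d_p1 ^^ (size mu - 1)) (KP_prev lam {#Max_mset mu, q#})) (KP (lam - {#q#}))"
    using lam ord by (subst KP_unfold) (simp add: KP_step_def Let_def q_def[symmetric] KP_prev_def[of _ "lam - {#q#}"])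
qed

text \<open>Blocks of the Hirota equation never exceed the bound on m, and \<open>d_p1\<close> only
  appends parts 1. For length at least 3, a hook (m,1^l) differentiated in direction q is replaced
  by derivatives of the polynomial of (m, q), which obeys the bound. From length 2 on, every hook
  has a further part 1, since all blocks have at least two elements; this later controls constant
  terms and delays in t.\<close>

lemma vars_KP:
  assumes "0 \<notin># lam" "lam \<noteq> {#}"
  shows "vars (KP lam) \<subseteq> hooks (sum_mset lam - size lam) (min 1 (size lam - 1))"
  using assms
proof (induction lam rule: wf_induct_rule[OF wf_KP_order])
  case (1 lam)
  let ?b = "sum_mset lam - size lam" and ?c = "min 1 (size lam - 1)"
  show ?case
  proof (cases "is_hook lam")
    case True
    then obtain m l where ml: "lam = hook m l" "1 \<le> m" by (auto simp: is_hook_def)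
    then have "hook m l \<in> hooks ?b ?c" unfolding hooks_def by (intro CollectI exI[of _ m] exI[of _ l]) simp
    then show ?thesis using ml by (simp add: KP_hook)
  next
    case False
    then show ?thesis
    proof (cases rule: non_hook_cases[OF False 1(2,3)])
      case (1 k l)
      have lam: "lam = {#k, l#}" by fact
      have "vars (hirota_gen (KP_prev lam) (monom_list m)) \<subseteq> hooks ?b ?c" if m: "m \<in> Poly_Mapping.keys (hirota_op k l)" for m
      proof (rule vars_hirota_gen)
        fix P B assume P: "P \<in> even_partitions (length (monom_list m))" "B \<in> P"
        have op: "op_mset k l (mset (monom_list m))" using keys_hirota_op[OF m] 1 by (simp add: mono_list)
        let ?mu = "block (monom_list m) B"
        note bd = block_bound[OF op P]
        have "vars (KP ?mu) \<subseteq> hooks (sum_mset ?mu - size ?mu) (min 1 (size ?mu - 1))" if "(?mu, lam) \<in> KP_order"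
          using "1.IH"[OF that] bd by blast
        moreover have "hooks (sum_mset ?mu - size ?mu) (min 1 (size ?mu - 1)) \<subseteq> hooks ?b ?c"
        proof -
          have "min 1 (size ?mu - 1) = ?c" using size_block_ge_2[OF P, of "monom_list m"] by (simp add: lam)
          then show ?thesis using bd(3) by (simp add: lam hooks_mono)
        qed
        ultimately show "vars (KP_prev lam ?mu) \<subseteq> hooks ?b ?c"
          by (auto simp: KP_prev_def)
      qed
      then have "vars (hirota_poly (KP_prev lam) (hirota_op k l)) \<subseteq> hooks ?b ?c"
        unfolding hirota_poly_def hirota_hirota_gen
        by (intro vars_sum_le vars_mult_le) simp_all
      then show ?thesis
        unfolding lam KP_pair[OF 1(2,3)] by (intro vars_mult_le) simp_all
    next
      case 2
      define q where "q = Min_mset lam"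
      define mu where "mu = lam - {#q#}"
      note K = KP_more[OF False "1.prems"(1) 2, folded q_def, folded mu_def]
      have IH: "vars (KP mu) \<subseteq> hooks (sum_mset mu - size mu) (min 1 (size mu - 1))"
        using "1.IH"[OF K(4)] K(8,9) by blast
      have "min 1 (size mu - 1) = ?c" using 2 K(2) by (simp add: mu_def size_Diff_singleton)
      then have IH': "vars (KP mu) \<subseteq> hooks (sum_mset mu - size mu) ?c" using IH by simp
      have "vars ((d_p1 ^^ (size nu - 1)) (KP_prev lam {#Max_mset nu, q#})) \<subseteq> hooks ?b ?c" if nu: "nu \<in> vars (KP mu)" for nu
      proof -
        have "nu \<in> hooks (sum_mset mu - size mu) ?c" using nu IH' by blast
        moreover from this obtain m l where "nu = hook m l" "1 \<le> m" unfolding hooks_def by blast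
        ultimately have ml: "nu = hook m l" "1 \<le> m" "hook m l \<in> hooks (sum_mset mu - size mu) ?c" by simp_all
        have "vars (KP {#m, q#}) \<subseteq> hooks (sum_mset {#m, q#} - size {#m, q#}) (min 1 (size {#m, q#} - 1))"
          using ml K(3) by (intro "1.IH" K(5)[OF ml(3)]) auto
        also have "\<dots> \<subseteq> hooks ?b ?c"
          using K(6)[OF ml(3,2)] 2 by (simp add: hooks_mono)
        finally show ?thesis using ml by (intro vars_d_p1_power) (auto simp: KP_prev_def)
      qed
      moreover have "vars (KP mu) \<subseteq> hooks ?b ?c"
        using IH' hooks_mono[OF K(7)] by blast
      ultimately show ?thesis
        unfolding K(1) by (intro vars_derivation_le)
    qed
  qed
qed

subsection \<open>Polynomials in the Hirota derivatives\<close>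

definition DH :: "nat \<Rightarrow> mpoly2 \<Rightarrow> mpoly2" where
  "DH i x = pdiff (Inl (GP i)) x - pdiff (Inr i) x"

lemma Dop_DH: "Dop i x = of_nat i * DH i x"
  by (simp add: Dop_def DH_def al1_def al2_def right_diff_distrib)

interpretation DH: ring_derivation "DH i" for i
  unfolding DH_def by (intro ring_derivation_diff ring_derivation_pdiff)

lemma DH_Const_mult: "DH i (Const c * x) = Const c * DH i x"
  by (simp add: DH_def pdiff_Const_mult right_diff_distrib)

lemma DH_commute: "DH i (DH j x) = DH j (DH i x)"
  by (simp add: DH_def pdiff.diff pdiff_commute algebra_simps)

lemma fold_DH_mset: "mset xs = mset ys \<Longrightarrow> fold DH xs x = fold DH ys x"
  by (rule fold_multiset_equiv[THEN fun_cong]) (auto simp: fun_eq_iff DH_commute)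

text \<open>The differential operator P(D_1, D_2, ...) on the doubled ring; the D_i commute, so a
  fixed listing of each monomial is enough.\<close>

definition act :: "(nat, rat) mpoly \<Rightarrow> mpoly2 \<Rightarrow> mpoly2" where
  "act P x = (\<Sum>m\<in>Poly_Mapping.keys P. Const (Poly_Mapping.lookup P m) * fold DH (monom_list m) x)"

lemma act_add: "act (P + Q) x = act P x + act Q x"
  unfolding act_def by (rule sum_keys_add) (simp_all add: Const_add distrib_right)

lemma act_single: "act (Poly_Mapping.single m c) x = Const c * fold DH (monom_list m) x"
  by (simp add: act_def)

lemma act_Const_mult: "act (Const c * P) x = Const c * act P x"
proof (induction P rule: mpoly_induct_single)
  case (single m d)
  have "Const c * Poly_Mapping.single m d = Poly_Mapping.single m (c * d)"
    by (simp add: Const_def mult_single)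
  then show ?case by (simp add: act_single Const_mult mult.assoc)
qed (simp add: distrib_left act_add)

lemma act_of_nat_mult: "act (of_nat c * P) x = of_nat c * act P x"
  using act_Const_mult[of "of_nat c" P x] by simp

lemma act_uminus: "act (- P) x = - act P x"
  using act_Const_mult[of "- 1" P x] by (simp add: Const_uminus)

lemma act_0 [simp]: "act 0 x = 0"
  by (simp add: act_def)

lemma act_sum: "act (\<Sum>i\<in>I. f i) x = (\<Sum>i\<in>I. act (f i) x)"
  by (induction I rule: infinite_finite_induct) (simp_all add: act_add)

lemma act_mult_Var: "act (P * Var i) x = DH i (act P x)"
proof (induction P rule: mpoly_induct_single)
  case (single m c)
  have "mset (monom_list (m + Poly_Mapping.single i 1)) = mset (monom_list m @ [i])"
    unfolding mono_list by (simp add: mono_mset_add mono_list)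
  then have "fold DH (monom_list (m + Poly_Mapping.single i 1)) x = fold DH (monom_list m @ [i]) x"
    by (rule fold_DH_mset)
  then show ?case
    by (simp add: Var_def mult_single act_single DH_Const_mult)
qed (simp add: distrib_right act_add DH.add)

lemma act_hvar: "act (hvar m) x = hop Dop m x"
proof (rule hop_unique[where g = "\<lambda>m. act (hvar m) x", symmetric])
  fix m :: nat
  have "of_nat m * act (hvar m) x = act (\<Sum>i=1..m. of_nat i * (hvar (m - i) * Var i)) x"
    unfolding act_of_nat_mult[symmetric] complete_h_rec by (simp add: mult_ac)
  then show "of_nat m * act (hvar m) x = (\<Sum>i=1..m. Dop i (act (hvar (m - i)) x))"
    by (simp only: act_sum act_of_nat_mult act_mult_Var Dop_DH)
next
  have "monom_list 0 = []" by (simp add: monom_list_def)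
  then have "act (Const 1) x = x" unfolding Const_def act_single by simp
  then show "act (hvar 0) x = x" by simp
qed

lemma DH_hop_Dop: "DH k (hop Dop m x) = hop Dop m (DH k x)"
  by (rule Dop.hop_commute[symmetric, OF DH.ring_derivation_axioms])
     (simp add: Dop_DH DH_commute)

lemma act_hirota_op:
  "act (hirota_op k l) x = hop Dop l (Dop k x) + hop Dop (k + 1) (Dop (l - 1) x) - Dop 1 (Dop (k + l - 1) x)"
proof -
  have "act (Var 1 * Var (k + l - 1)) x = DH (k + l - 1) (DH 1 x)"
    using act_mult_Var[of "Var 1" "k + l - 1" x] act_mult_Var[of 1 1 x] act_hvar[of 0 x] by simp
  then have "act (hirota_op k l) x = of_nat k * DH k (hop Dop l x) + of_nat (l - 1) * DH (l - 1) (hop Dop (k + 1) x)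
      - of_nat (k + l - 1) * DH (k + l - 1) (DH 1 x)"
    unfolding hirota_op_alt diff_conv_add_uminus act_add act_uminus act_of_nat_mult act_mult_Var act_hvar by simp
  also have "of_nat k * DH k (hop Dop l x) = hop Dop l (Dop k x)"
    unfolding DH_hop_Dop by (subst Dop_DH, rule Dop.hop_cmult[symmetric]) simp
  also have "of_nat (l - 1) * DH (l - 1) (hop Dop (k + 1) x) = hop Dop (k + 1) (Dop (l - 1) x)"
    unfolding DH_hop_Dop by (subst Dop_DH, rule Dop.hop_cmult[symmetric]) simp
  also have "of_nat (k + l - 1) * DH (k + l - 1) (DH 1 x) = Dop 1 (Dop (k + l - 1) x)"
    using DH_commute[of 1 "k + l - 1" x] by (simp add: Dop_DH)
  finally show ?thesis .
qed

subsection \<open>Derivatives of the logarithm\<close>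

lemma pdiff_emb: "pdiff (Inl (GP i)) (emb1 f) = emb1 (pdiff (GP i) f)" "pdiff (Inr i) (emb1 f) = 0"
  "pdiff (Inl (GP i)) (emb2 f) = 0" "pdiff (Inr i) (emb2 f) = emb2 (pdiff (GP i) f)"
  by (induction f rule: mpoly_induct)
     (simp_all add: emb1.hom_add emb1.hom_mult emb2.hom_add emb2.hom_mult pdiff_add pdiff_mult pdiff_Var emb2_Var_cases
        split: gen.splits)

interpretation pdiff_commuting: comp_fun_commute "\<lambda>i. pdiff (GP i)"
  by unfold_locales (simp add: fun_eq_iff pdiff_commute)

context map_series
begin

definition tauS :: "(gen, rat) mpoly fps" where "tauS = Abs_fps tz"

definition FS :: "nat multiset \<Rightarrow> (gen, rat) mpoly fps" where
  "FS mu = fps_cw (\<lambda>f. fold_mset (\<lambda>i. pdiff (GP i)) f mu) (log_series tauS)"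

abbreviation pd :: "nat \<Rightarrow> (gen, rat) mpoly fps \<Rightarrow> (gen, rat) mpoly fps" where
  "pd i \<equiv> fps_cw (pdiff (GP i))"

lemma pd_FS: "pd i (FS mu) = FS (add_mset i mu)"
  by (rule fps_ext) (simp add: FS_def)

lemma pd_tauS: "pd i tauS = tauS * FS {#i#}"
proof -
  have "tauS * pd i (log_series tauS) = pd i tauS"
    by (rule log_series_deriv) (simp_all add: tauS_def tz_0 ring_derivation_pdiff)
  moreover have "FS {#i#} = pd i (log_series tauS)"
    by (rule fps_ext) (simp add: FS_def)
  ultimately show ?thesis by simp
qed

text \<open>The logarithm of tau(p) tau(p') is F(p) + F(p'), and every D_i differentiates the second
  summand with a minus sign.\<close>

definition LS :: "nat multiset \<Rightarrow> mpoly2 fps" where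
  "LS B = fps_cw emb1 (FS B) + (- 1) ^ size B * fps_cw emb2 (FS B)"

lemma fps_TT: "Abs_fps TT = fps_cw emb1 tauS * fps_cw emb2 tauS"
  by (rule fps_ext) (simp add: TT_def tauS_def fps_mult_nth atLeast0AtMost)

interpretation dH: ring_derivation "fps_cw (DH j)" for j
  by (rule ring_derivation_fps_cw) (rule DH.ring_derivation_axioms)

interpretation E1: coeff_hom "fps_cw emb1"
  by (rule coeff_hom_fps_cw) (rule emb1.coeff_hom_axioms)

interpretation E2: coeff_hom "fps_cw emb2"
  by (rule coeff_hom_fps_cw) (rule emb2.coeff_hom_axioms)

interpretation dg: coeff_hom "fps_cw diag"
  by (rule coeff_hom_fps_cw) (rule diag.coeff_hom_axioms)

lemma dH_E1: "fps_cw (DH j) (fps_cw emb1 x) = fps_cw emb1 (pd j x)"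
  by (rule fps_ext) (simp add: DH_def pdiff_emb)

lemma dH_E2: "fps_cw (DH j) (fps_cw emb2 x) = - fps_cw emb2 (pd j x)"
  by (rule fps_ext) (simp add: DH_def pdiff_emb)

lemma fold_dH: "fold (\<lambda>j. fps_cw (DH j)) is (Abs_fps TT) =
   Abs_fps TT * (\<Sum>P | partition_on {..<length is} P. \<Prod>B\<in>P. LS (block is B))"
proof (rule iterated_derivatives_exp)
  show "ring_derivation (fps_cw (DH j))" for j
    by (rule dH.ring_derivation_axioms)
  show "fps_cw (DH j) (Abs_fps TT) = Abs_fps TT * LS {#j#}" for j
    unfolding fps_TT dH.mult dH_E1 dH_E2 pd_tauS E1.hom_mult E2.hom_mult LS_def
    by (simp add: algebra_simps)
  have sign: "fps_cw (DH j) ((- 1) ^ n * y) = (- 1) ^ n * fps_cw (DH j) y" for j n y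
    by (cases "even n") (simp_all add: dH.uminus)
  show "fps_cw (DH j) (LS B) = LS (add_mset j B)" if "B \<noteq> {#}" for j B
    unfolding LS_def dH.add sign dH_E1 dH_E2 pd_FS by simp
qed

lemma diag_emb_fps: "fps_cw diag (fps_cw emb1 x) = x" "fps_cw diag (fps_cw emb2 x) = x"
  by (rule fps_ext, simp)+

text \<open>The reason why only set partitions into blocks of even size enter Hirota
  derivatives.\<close>

lemma diag_LS: "fps_cw diag (LS B) = (if even (size B) then 2 * FS B else 0)"
proof -
  have "fps_cw diag ((- 1) ^ n * y) = (- 1) ^ n * fps_cw diag y" for n y
    by (cases "even n") (simp_all add: dg.hom_uminus)
  then show ?thesis by (auto simp: LS_def dg.hom_add diag_emb_fps)
qed

lemma diag_fold_dH: "fps_cw diag (fold (\<lambda>j. fps_cw (DH j)) is (Abs_fps TT)) = tauS\<^sup>2 * hirota_gen FS is"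
proof -
  have fin: "finite {P. partition_on {..<length is} P}"
    by (intro finitely_many_partition_on) simp
  have "(\<Sum>P | partition_on {..<length is} P. \<Prod>B\<in>P. fps_cw diag (LS (block is B))) = hirota_gen FS is"
    unfolding hirota_gen_def
  proof (rule sum.mono_neutral_cong_right[OF fin])
    show "even_partitions (length is) \<subseteq> {P. partition_on {..<length is} P}"
      by (auto simp: even_partitions_def)
    show "\<forall>P\<in>{P. partition_on {..<length is} P} - even_partitions (length is). (\<Prod>B\<in>P. fps_cw diag (LS (block is B))) = 0"
    proof
      fix P assume P: "P \<in> {P. partition_on {..<length is} P} - even_partitions (length is)"
      then obtain B where "B \<in> P" "odd (card B)" by (auto simp: even_partitions_def)
      moreover have "finite P" using P finite_elements[of "{..<length is}" P] by auto
      ultimately show "(\<Prod>B\<in>P. fps_cw diag (LS (block is B))) = 0"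
        by (intro prod_zero) (auto simp: diag_LS size_block intro!: bexI[of _ B])
    qed
    show "(\<Prod>B\<in>P. fps_cw diag (LS (block is B))) = (\<Prod>B\<in>P. 2 * FS (block is B))" if "P \<in> even_partitions (length is)" for P
      using even_partitionsD[OF that] by (intro prod.cong) (auto simp: diag_LS size_block)
  qed
  moreover have "fps_cw diag (Abs_fps TT) = tauS\<^sup>2"
    by (simp add: fps_TT dg.hom_mult diag_emb_fps power2_eq_square)
  ultimately show ?thesis
    by (simp add: fold_dH dg.hom_mult dg.hom_sum dg.hom_prod)
qed

lemma fold_fps_cw_nth: "fps_nth (fold (\<lambda>j. fps_cw (DH j)) is x) n = fold DH is (fps_nth x n)"
  by (induction "is" arbitrary: x) simp_all

abbreviation ratc :: "rat \<Rightarrow> (gen, rat) mpoly fps" where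
  "ratc q \<equiv> fps_const (Const q)"

lemma coeff_hom_ratc: "coeff_hom ratc"
  by unfold_locales (simp_all add: Const_add Const_mult)

theorem hirota_equation:
  assumes "k \<ge> l" "l \<ge> 2"
  shows "(\<Sum>m\<in>Poly_Mapping.keys (hirota_op k l). ratc (Poly_Mapping.lookup (hirota_op k l) m) * hirota_gen FS (monom_list m)) = 0"
    (is "?H = 0")
proof -
  have "tauS\<^sup>2 * ?H = (\<Sum>m\<in>Poly_Mapping.keys (hirota_op k l). ratc (Poly_Mapping.lookup (hirota_op k l) m) *
      fps_cw diag (fold (\<lambda>j. fps_cw (DH j)) (monom_list m) (Abs_fps TT)))"
    unfolding diag_fold_dH sum_distrib_left by (simp add: mult.left_commute)
  also have "\<dots> = 0"
  proof (rule fps_ext)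
    fix n
    have "fps_nth (\<Sum>m\<in>Poly_Mapping.keys (hirota_op k l). ratc (Poly_Mapping.lookup (hirota_op k l) m) *
      fps_cw diag (fold (\<lambda>j. fps_cw (DH j)) (monom_list m) (Abs_fps TT))) n = diag (act (hirota_op k l) (TT n))"
      by (simp add: fps_sum_nth fold_fps_cw_nth act_def diag.hom_sum diag.hom_mult)
    also have "\<dots> = 0"
    proof -
      have "k \<ge> 1" "l - 1 \<ge> 1" and l: "l - 1 + 1 = l" "k + (l - 1) = k + l - 1" using assms by auto
      from hirota_2[OF this(1,2), of n] show ?thesis
        unfolding l by (simp add: act_hirota_op diag.hom_add diag.hom_diff add.commute)
    qed
    finally show "fps_nth (\<Sum>m\<in>Poly_Mapping.keys (hirota_op k l). ratc (Poly_Mapping.lookup (hirota_op k l) m) *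
      fps_cw diag (fold (\<lambda>j. fps_cw (DH j)) (monom_list m) (Abs_fps TT))) n = fps_nth 0 n" by simp
  qed
  finally have "tauS\<^sup>2 * ?H = 0" .
  \<comment> \<open>The square of \<open>tauS\<close> can be cancelled because power series over
    this polynomial ring form a domain, which is the purpose of the linear order on the
    generators.\<close>
  moreover have "tauS\<^sup>2 \<noteq> 0"
  proof
    assume "tauS\<^sup>2 = 0"
    then have "fps_nth (tauS\<^sup>2) 0 = 0" by simp
    then show False by (simp add: tauS_def tz_0 fps_power_zeroth)
  qed
  ultimately show ?thesis using mult_eq_0_iff[of "tauS\<^sup>2" ?H] by simp
qed

subsection \<open>Evaluation of the KP polynomials\<close>

interpretation ev: coeff_hom ratc
  by (rule coeff_hom_ratc)

abbreviation ev :: "(nat multiset, rat) mpoly \<Rightarrow> (gen, rat) mpoly fps" where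
  "ev \<equiv> eval_mpoly ratc FS"

lemma ev_hirota: "ev (hirota_gen g is) = hirota_gen (\<lambda>mu. ev (g mu)) is"
proof -
  have "ev 2 = 2" using ev.eval_of_nat[of FS 2] by simp
  then show ?thesis by (simp add: hirota_gen_def ev.eval_sum ev.eval_prod ev.eval_mult)
qed

lemma ring_derivation_pd: "ring_derivation (pd i)"
  by (rule ring_derivation_fps_cw) (rule ring_derivation_pdiff)

lemma pd_ratc: "pd i (ratc c) = 0"
  by (rule fps_ext) simp

lemma ev_d_p1: "ev (d_p1 P) = pd 1 (ev P)"
  unfolding d_p1_def
  by (rule ev.eval_derivation[OF ring_derivation_pd pd_ratc]) (simp add: pd_FS)

text \<open>All derivatives in the Hirota equation except F_(k,l) belong to partitions before (k,l),
  so by induction the step of the construction solves the true equation for F_(k,l). For longer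
  partitions the formal derivation evaluates to d/dp_q, because F of (m,1^l,q) is the l-th
  p_1-derivative of F_(m,q).\<close>

theorem ev_KP:
  assumes "0 \<notin># lam" "lam \<noteq> {#}"
  shows "ev (KP lam) = FS lam"
  using assms
proof (induction lam rule: wf_induct_rule[OF wf_KP_order])
  case (1 lam)
  show ?case
  proof (cases "is_hook lam")
    case True
    then obtain m l where ml: "lam = hook m l" "1 \<le> m" by (auto simp: is_hook_def)
    then show ?thesis by (simp add: KP_hook)
  next
    case False
    then show ?thesis
    proof (cases rule: non_hook_cases[OF False 1(2,3)])
      case (1 k l)
      have lam: "lam = {#k, l#}" by fact
      define m0 where "m0 = Poly_Mapping.single k (1::nat) + Poly_Mapping.single l 1"
      have m0: "mono_mset m0 = lam"
        by (simp add: m0_def mono_mset_add lam)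
      have hm0: "hirota_gen g (monom_list m0) = 2 * g lam" for g :: "nat multiset \<Rightarrow> (gen, rat) mpoly fps"
      proof -
        have "length (monom_list m0) = 2"
          using m0 by (simp add: mono_mset_def lam flip: size_mset)
        then show ?thesis using hirota_gen_2[of "monom_list m0" g] by (simp add: mono_list m0)
      qed
      let ?op = "hirota_op k l"
      have c0: "Poly_Mapping.lookup ?op m0 = of_nat k"
        using lookup_hirota_op[OF 1(2,3)] m0 lam by simp
      then have m0_keys: "m0 \<in> Poly_Mapping.keys ?op"
        using 1 by (simp add: in_keys_iff)
      have same: "hirota_gen (\<lambda>mu. ev (KP_prev lam mu)) (monom_list m) = hirota_gen FS (monom_list m)"
        if m: "m \<in> Poly_Mapping.keys ?op - {m0}" for m
      proof (rule hirota_gen_cong)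
        fix P B assume P: "P \<in> even_partitions (length (monom_list m))" "B \<in> P"
        have op: "op_mset k l (mset (monom_list m))" using keys_hirota_op[of m] m 1 by (simp add: mono_list)
        have "mset (monom_list m) \<noteq> {#k, l#}"
          using m m0 mono_mset_inject[of m m0] by (auto simp: mono_list lam)
        from block_order[OF op 1(2,3) this P] block_bound[OF op P] "1.IH"
        show "ev (KP_prev lam (block (monom_list m) B)) = FS (block (monom_list m) B)"
          by (simp add: KP_prev_def lam)
      qed
      have "ev (hirota_poly (KP_prev lam) ?op) =
         (\<Sum>m\<in>Poly_Mapping.keys ?op. ratc (Poly_Mapping.lookup ?op m) * hirota_gen (\<lambda>mu. ev (KP_prev lam mu)) (monom_list m))"
        by (simp add: hirota_poly_def hirota_hirota_gen ev.eval_sum ev.eval_mult ev_hirota)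
      also have "\<dots> = ratc (of_nat k) * (2 * ev (KP_prev lam lam)) +
         (\<Sum>m\<in>Poly_Mapping.keys ?op - {m0}. ratc (Poly_Mapping.lookup ?op m) * hirota_gen FS (monom_list m))"
        using m0_keys same by (simp add: sum.remove[OF _ m0_keys] hm0 c0)
      also have "ev (KP_prev lam lam) = 0"
        by (simp add: KP_prev_def KP_order_irrefl)
      also have "(\<Sum>m\<in>Poly_Mapping.keys ?op - {m0}. ratc (Poly_Mapping.lookup ?op m) * hirota_gen FS (monom_list m)) =
         - (ratc (of_nat k) * (2 * FS lam))"
        using hirota_equation[OF 1(2,3)] m0_keys
        by (simp add: sum.remove[OF _ m0_keys] hm0 c0 eq_neg_iff_add_eq_0 add.commute)
      finally have "ev (hirota_poly (KP_prev lam) ?op) = - (ratc (2 * of_nat k) * FS lam)"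
      proof -
        have "ratc 2 = 2" using ev.hom_of_nat[of 2] by simp
        then have "ratc (2 * of_nat k) = 2 * ratc (of_nat k)" using ev.hom_mult[of 2 "of_nat k"] by simp
        moreover assume "ev (hirota_poly (KP_prev lam) ?op) = ratc (of_nat k) * (2 * 0) + - (ratc (of_nat k) * (2 * FS lam))"
        ultimately show ?thesis by (simp add: mult_ac)
      qed
      then have "ev (KP lam) = ratc (- 1 / (2 * of_nat k)) * - (ratc (2 * of_nat k) * FS lam)"
        unfolding lam KP_pair[OF 1(2,3)] by (simp add: ev.eval_mult)
      also have "\<dots> = ratc (- 1 / (2 * of_nat k) * (- (2 * of_nat k))) * FS lam"
        unfolding ev.hom_mult ev.hom_uminus by (simp only: mult_minus_left mult_minus_right mult.assoc)
      also have "- 1 / (2 * of_nat k) * (- (2 * of_nat k)) = (1 :: rat)"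
        using 1 by simp
      finally show ?thesis by simp
    next
      case 2
      define q where "q = Min_mset lam"
      define mu where "mu = lam - {#q#}"
      note K = KP_more[OF False "1.prems"(1) 2, folded q_def, folded mu_def]
      have IH: "ev (KP mu) = FS mu"
        using "1.IH"[OF K(4)] K(8,9) by blast
      have "ev (KP lam) = pd q (ev (KP mu))"
        unfolding K(1)
      proof (rule ev.eval_derivation[OF ring_derivation_pd pd_ratc])
        fix nu assume "nu \<in> vars (KP mu)"
        then have nu: "nu \<in> hooks (sum_mset mu - size mu) (min 1 (size mu - 1))"
          using vars_KP[OF K(8,9)] by blast
        then obtain m l where ml: "nu = hook m l" "1 \<le> m" unfolding hooks_def by blast
        have ev_pow: "ev ((d_p1 ^^ j) P) = (pd 1 ^^ j) (ev P)" for j P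
          by (induction j) (simp_all add: ev_d_p1)
        have FS_pow: "(pd 1 ^^ j) (FS M) = FS (M + replicate_mset j 1)" for j M
          by (induction j) (simp_all add: pd_FS)
        have ord: "({#m, q#}, lam) \<in> KP_order"
          using K(5)[OF nu[unfolded ml(1)] ml(2)] .
        then have "ev (KP {#m, q#}) = FS {#m, q#}"
          using ml K(3) by (intro "1.IH") auto
        then have "ev ((d_p1 ^^ (size nu - 1)) (KP_prev lam {#Max_mset nu, q#})) = FS ({#m, q#} + replicate_mset l 1)"
          using ord ml by (simp add: ev_pow[unfolded One_nat_def] FS_pow[unfolded One_nat_def] KP_prev_def)
        also have "{#m, q#} + replicate_mset l 1 = add_mset q nu"
          by (simp add: ml(1) hook_def add_mset_commute)
        finally show "ev ((d_p1 ^^ (size nu - 1)) (KP_prev lam {#Max_mset nu, q#})) = pd q (FS nu)"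
          by (simp add: pd_FS)
      qed
      also have "\<dots> = FS lam"
        unfolding IH pd_FS using K(2) by (simp add: mu_def)
      finally show ?thesis .
    qed
  qed
qed

end

subsection \<open>Cycles of a permutation multiplied by a transposition\<close>

lemma orbit_explicit:
  assumes c: "\<And>i. Suc i < n \<Longrightarrow> f (c i) = c (Suc i)" "f (c (n - 1)) = c 0" and n: "n > 0"
  shows "orbit f (c 0) = c ` {..<n}"
proof -
  have step: "f (c (i mod n)) = c (Suc i mod n)" for i
  proof (cases "Suc (i mod n) = n")
    case True
    then have "i mod n = n - 1" "Suc i mod n = 0" by (auto simp: mod_Suc)
    then show ?thesis using c(2) by simp
  next
    case False
    then have "Suc (i mod n) < n" using n by (simp add: Suc_lessI)
    then show ?thesis using c(1)[of "i mod n"] by (simp add: mod_Suc)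
  qed
  have pow: "(f ^^ k) (c 0) = c (k mod n)" for k
    using n by (induction k) (simp_all add: step)
  have "c i \<in> orbit f (c 0)" if "i < n" for i
  proof -
    have "c i = (f ^^ (i + n)) (c 0)" using that by (simp only: pow) simp
    then show ?thesis using n unfolding orbit_altdef by blast
  qed
  then show ?thesis
    using n by (auto simp: orbit_altdef pow)
qed

context
  fixes \<pi> :: "'a \<Rightarrow> 'a" and S :: "'a set"
  assumes \<pi>: "\<pi> permutes S" "finite S"
begin

lemma permutation_pi: "permutation \<pi>"
  using \<pi> by (auto simp: permutation_permutes)

lemma orbit_enum:
  obtains m where "m > 0" "orbit \<pi> z = (\<lambda>i. (\<pi> ^^ i) z) ` {..<m}" "inj_on (\<lambda>i. (\<pi> ^^ i) z) {..<m}" "(\<pi> ^^ m) z = z"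
proof -
  have z: "z \<in> orbit \<pi> z" using permutation_pi by (rule permutation_self_in_orbit)
  let ?m = "funpow_dist1 \<pi> z z"
  have "orbit \<pi> z = (\<lambda>i. (\<pi> ^^ i) z) ` {..<?m}"
    using orbit_conv_funpow_dist1[OF z] by (simp only: atLeast0LessThan)
  moreover have "inj_on (\<lambda>i. (\<pi> ^^ i) z) {..<?m}"
    using inj_on_funpow_dist1[OF z] by (simp only: atLeast0LessThan)
  ultimately show ?thesis using that[of ?m] funpow_dist1_prop[OF z] by simp
qed

context
  fixes x y :: 'a
  assumes xy: "x \<noteq> y"
begin

lemma orbit_transpose_other:
  assumes "x \<notin> orbit \<pi> z" "y \<notin> orbit \<pi> z"
  shows "orbit (transpose x y \<circ> \<pi>) z = orbit \<pi> z"
proof (rule orbit_cong)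
  show "z \<in> orbit \<pi> z" using permutation_pi by (rule permutation_self_in_orbit)
  fix w assume "w \<in> orbit \<pi> z"
  then have "\<pi> w \<in> orbit \<pi> z" by (rule orbit.step)
  then have "\<pi> w \<noteq> x" "\<pi> w \<noteq> y" using assms by auto
  then show "(transpose x y \<circ> \<pi>) w = \<pi> w" by simp
qed

text \<open>The walk from x follows its old cycle; where it would return to x, the transposition
  sends it to y, and it closes only after the cycle of y.\<close>

lemma orbit_transpose_join:
  assumes "y \<notin> orbit \<pi> x"
  shows "orbit (transpose x y \<circ> \<pi>) x = orbit \<pi> x \<union> orbit \<pi> y"
proof -
  obtain m where m: "m > 0" "orbit \<pi> x = (\<lambda>i. (\<pi> ^^ i) x) ` {..<m}" "inj_on (\<lambda>i. (\<pi> ^^ i) x) {..<m}" "(\<pi> ^^ m) x = x"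
    by (rule orbit_enum)
  obtain n where n: "n > 0" "orbit \<pi> y = (\<lambda>i. (\<pi> ^^ i) y) ` {..<n}" "inj_on (\<lambda>i. (\<pi> ^^ i) y) {..<n}" "(\<pi> ^^ n) y = y"
    by (rule orbit_enum)
  have xy': "(\<pi> ^^ i) x \<noteq> y" "(\<pi> ^^ i) y \<noteq> x" for i
  proof -
    show 1: "(\<pi> ^^ i) x \<noteq> y" for i
      using assms orbit_altdef_permutation[OF permutation_pi, of x] by auto
    have "x \<notin> orbit \<pi> y"
      using assms permutation_pi by (meson orbit_swap permutation_self_in_orbit)
    then show "(\<pi> ^^ i) y \<noteq> x"
      using orbit_altdef_permutation[OF permutation_pi, of y] by auto
  qed
  have ne_x: "(\<pi> ^^ i) x \<noteq> (\<pi> ^^ k) x" if "i < m" "k < m" "i \<noteq> k" for i k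
    using inj_onD[OF m(3), of i k] that by auto
  have ne_y: "(\<pi> ^^ i) y \<noteq> (\<pi> ^^ k) y" if "i < n" "k < n" "i \<noteq> k" for i k
    using inj_onD[OF n(3), of i k] that by auto
  define c where "c i = (if i < m then (\<pi> ^^ i) x else (\<pi> ^^ (i - m)) y)" for i
  have "orbit (transpose x y \<circ> \<pi>) (c 0) = c ` {..<m + n}"
  proof (rule orbit_explicit)
    fix i assume i: "Suc i < m + n"
    consider "Suc i < m" | "Suc i = m" | "i \<ge> m" by linarith
    then show "(transpose x y \<circ> \<pi>) (c i) = c (Suc i)"
    proof cases
      case 1
      have "(\<pi> ^^ Suc i) x \<noteq> (\<pi> ^^ 0) x" using 1 by (intro ne_x) simp_all
      then show ?thesis using 1 xy'(1)[of "Suc i"] by (simp add: c_def)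
    next
      case 2
      then have "\<pi> (c i) = x" using m(4) by (auto simp: c_def)
      then show ?thesis using 2 by (simp add: c_def)
    next
      case 3
      have "Suc (i - m) < n" using i 3 by linarith
      then have "(\<pi> ^^ Suc (i - m)) y \<noteq> (\<pi> ^^ 0) y" by (intro ne_y) simp_all
      then show ?thesis using 3 xy'(2)[of "Suc (i - m)"] by (simp add: c_def Suc_diff_le)
    qed
  next
    have "\<pi> (c (m + n - 1)) = (\<pi> ^^ n) y"
      using n(1) by (cases n) (auto simp: c_def)
    then show "(transpose x y \<circ> \<pi>) (c (m + n - 1)) = c 0"
      using m(1) by (simp add: n(4) c_def)
  qed (use m in simp)
  also have "c ` {..<m + n} = c ` {..<m} \<union> c ` ((\<lambda>i. i + m) ` {..<n})"
  proof -
    have "{..<m + n} = {..<m} \<union> (\<lambda>i. i + m) ` {..<n}"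
    proof (intro equalityI subsetI)
      fix i assume "i \<in> {..<m + n}"
      then show "i \<in> {..<m} \<union> (\<lambda>i. i + m) ` {..<n}"
        by (cases "i < m") (auto intro!: image_eqI[of _ _ "i - m"])
    qed auto
    then show ?thesis by (simp only: image_Un)
  qed
  also have "c ` {..<m} = orbit \<pi> x" by (simp add: m(2) c_def)
  also have "c ` ((\<lambda>i. i + m) ` {..<n}) = orbit \<pi> y" unfolding n(2) image_image by (simp add: c_def)
  finally have "orbit (transpose x y \<circ> \<pi>) (c 0) = orbit \<pi> x \<union> orbit \<pi> y" .
  moreover have "c 0 = x" using m(1) by (simp add: c_def)
  ultimately show ?thesis by (simp only:)
qed

text \<open>After j steps the walk from x would reach y and is sent back to x; the walk from y
  closes after the other m - j steps.\<close>

lemma orbit_transpose_split: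
  assumes j: "0 < j" "j < m" and y: "y = (\<pi> ^^ j) x"
    and m: "orbit \<pi> x = (\<lambda>i. (\<pi> ^^ i) x) ` {..<m}" "inj_on (\<lambda>i. (\<pi> ^^ i) x) {..<m}" "(\<pi> ^^ m) x = x"
  shows "orbit (transpose x y \<circ> \<pi>) x = (\<lambda>i. (\<pi> ^^ i) x) ` {..<j}"
    and "orbit (transpose x y \<circ> \<pi>) y = (\<lambda>i. (\<pi> ^^ i) x) ` {j..<m}"
proof -
  have ne: "(\<pi> ^^ i) x \<noteq> (\<pi> ^^ k) x" if "i < m" "k < m" "i \<noteq> k" for i k
    using inj_onD[OF m(2), of i k] that by auto
  have "orbit (transpose x y \<circ> \<pi>) ((\<pi> ^^ 0) x) = (\<lambda>i. (\<pi> ^^ i) x) ` {..<j}"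
  proof (rule orbit_explicit)
    fix i assume "Suc i < j"
    then show "(transpose x y \<circ> \<pi>) ((\<pi> ^^ i) x) = (\<pi> ^^ Suc i) x"
      using ne[of "Suc i" 0] ne[of "Suc i" j] j by (simp add: y)
  next
    show "(transpose x y \<circ> \<pi>) ((\<pi> ^^ (j - 1)) x) = (\<pi> ^^ 0) x"
      using j by (cases j) (simp_all add: y)
  qed (use j in simp)
  then show "orbit (transpose x y \<circ> \<pi>) x = (\<lambda>i. (\<pi> ^^ i) x) ` {..<j}" by simp
  have "orbit (transpose x y \<circ> \<pi>) ((\<pi> ^^ (0 + j)) x) = (\<lambda>i. (\<pi> ^^ (i + j)) x) ` {..<m - j}"
  proof (rule orbit_explicit[where c = "\<lambda>i. (\<pi> ^^ (i + j)) x"])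
    fix i assume "Suc i < m - j"
    then show "(transpose x y \<circ> \<pi>) ((\<pi> ^^ (i + j)) x) = (\<pi> ^^ (Suc i + j)) x"
      using ne[of "Suc (i + j)" 0] ne[of "Suc (i + j)" j] j by (simp add: y)
  next
    have "\<pi> ((\<pi> ^^ (m - j - 1 + j)) x) = (\<pi> ^^ m) x" using j by (cases m) simp_all
    then show "(transpose x y \<circ> \<pi>) ((\<pi> ^^ (m - j - 1 + j)) x) = (\<pi> ^^ (0 + j)) x"
      using j m(3) by (simp add: y)
  qed (use j in simp)
  also have "(\<lambda>i. (\<pi> ^^ (i + j)) x) ` {..<m - j} = (\<lambda>i. (\<pi> ^^ i) x) ` ((\<lambda>i. i + j) ` {..<m - j})"
    by (simp add: image_image)
  also have "(\<lambda>i. i + j) ` {..<m - j} = {j..<m}"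
  proof (intro equalityI subsetI)
    fix i assume "i \<in> {j..<m}"
    then show "i \<in> (\<lambda>i. i + j) ` {..<m - j}" by (auto intro!: image_eqI[of _ _ "i - j"])
  qed auto
  finally have "orbit (transpose x y \<circ> \<pi>) ((\<pi> ^^ (0 + j)) x) = (\<lambda>i. (\<pi> ^^ i) x) ` {j..<m}" .
  moreover have "(\<pi> ^^ (0 + j)) x = y" by (simp add: y)
  ultimately show "orbit (transpose x y \<circ> \<pi>) y = (\<lambda>i. (\<pi> ^^ i) x) ` {j..<m}" by (simp only:)
qed

end

end

subsection \<open>Cycles as a set\<close>

definition cyc :: "'a set \<Rightarrow> ('a \<Rightarrow> 'a) \<Rightarrow> 'a set set" where
  "cyc S \<pi> = orbit \<pi> ` S"

lemma cycles_cyc: "cycles n \<pi> = cyc {1..n} \<pi>"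
  by (simp add: cycles_def cyc_def)

context
  fixes \<pi> :: "'a \<Rightarrow> 'a" and S :: "'a set"
  assumes \<pi>: "\<pi> permutes S" "finite S"
begin

lemma self_in_orbit: "x \<in> orbit \<pi> x"
  by (rule permutation_self_in_orbit) (use \<pi> in \<open>auto simp: permutation_permutes\<close>)

lemma orbit_eq: "y \<in> orbit \<pi> x \<Longrightarrow> orbit \<pi> y = orbit \<pi> x"
  using cyclic_on_orbit[OF \<pi>] by (rule orbit_cyclic_eq3)

lemma cyc_eqI: "C \<in> cyc S \<pi> \<Longrightarrow> x \<in> C \<Longrightarrow> C = orbit \<pi> x"
  by (auto simp: cyc_def orbit_eq)

lemma cyc_subset: "C \<in> cyc S \<pi> \<Longrightarrow> C \<subseteq> S"
  using permutes_orbit_subset[OF \<pi>(1)] by (auto simp: cyc_def)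

lemma finite_cyc: "finite (cyc S \<pi>)" "C \<in> cyc S \<pi> \<Longrightarrow> finite C"
  using \<pi>(2) cyc_subset by (auto simp: cyc_def intro: finite_subset)

lemma cyc_nonempty: "C \<in> cyc S \<pi> \<Longrightarrow> card C > 0"
  using self_in_orbit finite_cyc(2) by (auto simp: card_gt_0_iff cyc_def)

lemma Union_cyc: "\<Union>(cyc S \<pi>) = S"
proof (intro equalityI subsetI)
  fix x assume "x \<in> S"
  then show "x \<in> \<Union>(cyc S \<pi>)" using self_in_orbit[of x] by (auto simp: cyc_def)
qed (use cyc_subset in blast)

lemma sum_over_cyc:
  fixes f :: "'a set \<Rightarrow> 'b::comm_ring_1"
  assumes "\<D> \<subseteq> cyc S \<pi>"
  shows "(\<Sum>a\<in>\<Union>\<D>. f (orbit \<pi> a)) = (\<Sum>C\<in>\<D>. of_nat (card C) * f C)"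
proof -
  have "(\<Sum>a\<in>\<Union>\<D>. f (orbit \<pi> a)) = (\<Sum>C\<in>\<D>. \<Sum>a\<in>C. f (orbit \<pi> a))"
  proof (rule sum.Union_disjoint[unfolded comp_def])
    show "\<forall>A\<in>\<D>. finite A" using assms finite_cyc by auto
    show "\<forall>A\<in>\<D>. \<forall>B\<in>\<D>. A \<noteq> B \<longrightarrow> A \<inter> B = {}"
      using assms cyc_eqI by blast
  qed
  also have "\<dots> = (\<Sum>C\<in>\<D>. \<Sum>a\<in>C. f C)"
    using assms cyc_eqI by (intro sum.cong refl) (metis subsetD)
  finally show ?thesis by simp
qed

end

lemma cyc_transpose_join:
  assumes \<pi>: "\<pi> permutes S" "finite S" and x: "x \<in> S" and y: "y \<in> S" "y \<notin> orbit \<pi> x"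
  defines "\<rho> \<equiv> transpose x y \<circ> \<pi>"
  shows "orbit \<rho> x = orbit \<pi> x \<union> orbit \<pi> y"
    and "cyc S \<rho> - {orbit \<rho> x} = cyc S \<pi> - {orbit \<pi> x} - {orbit \<pi> y}"
proof -
  have xy: "x \<noteq> y" using y self_in_orbit[OF \<pi>, of x] by auto
  have \<rho>: "\<rho> permutes S" unfolding \<rho>_def using \<pi> x y by (simp add: permutes_compose permutes_swap_id)
  show new: "orbit \<rho> x = orbit \<pi> x \<union> orbit \<pi> y"
    unfolding \<rho>_def by (rule orbit_transpose_join[OF \<pi> xy y(2)])
  have old: "orbit \<rho> z = orbit \<pi> z" if "z \<notin> orbit \<rho> x" for z
    unfolding \<rho>_def
  proof (rule orbit_transpose_other[OF \<pi> xy])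
    show "x \<notin> orbit \<pi> z" using that orbit_eq[OF \<pi>, of x z] self_in_orbit[OF \<pi>, of z] by (auto simp: new)
    show "y \<notin> orbit \<pi> z" using that orbit_eq[OF \<pi>, of y z] self_in_orbit[OF \<pi>, of z] by (auto simp: new)
  qed
  have eq: "orbit \<rho> z = orbit \<rho> x" if "z \<in> orbit \<rho> x" for z
    using orbit_eq[OF \<rho> \<pi>(2) that] .
  show "cyc S \<rho> - {orbit \<rho> x} = cyc S \<pi> - {orbit \<pi> x} - {orbit \<pi> y}"
  proof (intro equalityI subsetI)
    fix C assume "C \<in> cyc S \<rho> - {orbit \<rho> x}"
    then obtain z where z: "z \<in> S" "C = orbit \<rho> z" "C \<noteq> orbit \<rho> x" by (auto simp: cyc_def)
    then have zn: "z \<notin> orbit \<rho> x" using eq by auto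
    then have "C = orbit \<pi> z" using old z by simp
    moreover have "z \<in> orbit \<pi> z" by (rule self_in_orbit[OF \<pi>])
    ultimately show "C \<in> cyc S \<pi> - {orbit \<pi> x} - {orbit \<pi> y}"
      using zn z(1) by (auto simp: cyc_def new)
  next
    fix C assume "C \<in> cyc S \<pi> - {orbit \<pi> x} - {orbit \<pi> y}"
    then obtain z where z: "z \<in> S" "C = orbit \<pi> z" "C \<noteq> orbit \<pi> x" "C \<noteq> orbit \<pi> y" by (auto simp: cyc_def)
    then have zn: "z \<notin> orbit \<rho> x" using orbit_eq[OF \<pi>, of z] by (auto simp: new)
    then have "C = orbit \<rho> z" using old z by simp
    moreover have "z \<in> C" using z self_in_orbit[OF \<pi>] by simp
    ultimately show "C \<in> cyc S \<rho> - {orbit \<rho> x}"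
      using zn z(1) by (auto simp: cyc_def)
  qed
qed

lemma cyc_transpose_split:
  assumes \<pi>: "\<pi> permutes S" "finite S" and x: "x \<in> S" and j: "0 < j" "j < m" and y: "y = (\<pi> ^^ j) x"
    and m: "orbit \<pi> x = (\<lambda>i. (\<pi> ^^ i) x) ` {..<m}" "inj_on (\<lambda>i. (\<pi> ^^ i) x) {..<m}" "(\<pi> ^^ m) x = x"
  defines "\<rho> \<equiv> transpose x y \<circ> \<pi>" and "B \<equiv> (\<lambda>i. (\<pi> ^^ i) x) ` {j..<m}"
  shows "card (orbit \<rho> x) = j" and "card B = m - j" and "B \<notin> cyc S \<pi> - {orbit \<pi> x}"
    and "cyc S \<rho> - {orbit \<rho> x} = insert B (cyc S \<pi> - {orbit \<pi> x})"
proof -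
  have ne: "(\<pi> ^^ i) x \<noteq> (\<pi> ^^ k) x" if "i < m" "k < m" "i \<noteq> k" for i k
    using inj_onD[OF m(2), of i k] that by auto
  have xy: "x \<noteq> y" using ne[of 0 j] j by (simp add: y)
  have yx: "y \<in> orbit \<pi> x" using j by (auto simp: m(1) y)
  then have yS: "y \<in> S" using permutes_orbit_subset[OF \<pi>(1) x] by blast
  have \<rho>: "\<rho> permutes S" unfolding \<rho>_def using \<pi> x yS by (simp add: permutes_compose permutes_swap_id)
  note sp = orbit_transpose_split[OF \<pi> xy j y m, folded \<rho>_def B_def]
  show "card (orbit \<rho> x) = j" unfolding sp using j by (subst card_image) (auto intro!: inj_on_subset[OF m(2)])
  show "card B = m - j" unfolding B_def using j by (subst card_image) (auto intro!: inj_on_subset[OF m(2)])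
  have un: "orbit \<pi> x = orbit \<rho> x \<union> B"
  proof -
    have "{..<m} = {..<j} \<union> {j..<m}" using j by auto
    then show ?thesis unfolding m(1) sp(1) B_def by (simp only: image_Un)
  qed
  have xB: "x \<notin> B" using ne[of 0] j by (force simp: B_def)
  have yB: "y \<in> B" using sp(2) self_in_orbit[OF \<rho> \<pi>(2), of y] by simp
  show BC: "B \<notin> cyc S \<pi> - {orbit \<pi> x}"
    using cyc_eqI[OF \<pi> _ yB] orbit_eq[OF \<pi> yx] by auto
  have old: "orbit \<rho> z = orbit \<pi> z" if "z \<notin> orbit \<pi> x" for z
    unfolding \<rho>_def
  proof (rule orbit_transpose_other[OF \<pi> xy])
    show "x \<notin> orbit \<pi> z" using that orbit_eq[OF \<pi>, of x z] self_in_orbit[OF \<pi>, of z] by auto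
    show "y \<notin> orbit \<pi> z" using that orbit_eq[OF \<pi>, of y z] orbit_eq[OF \<pi> yx] self_in_orbit[OF \<pi>, of z] by auto
  qed
  show "cyc S \<rho> - {orbit \<rho> x} = insert B (cyc S \<pi> - {orbit \<pi> x})"
  proof (intro equalityI subsetI)
    fix C assume "C \<in> cyc S \<rho> - {orbit \<rho> x}"
    then obtain z where z: "z \<in> S" "C = orbit \<rho> z" "C \<noteq> orbit \<rho> x" by (auto simp: cyc_def)
    show "C \<in> insert B (cyc S \<pi> - {orbit \<pi> x})"
    proof (cases "z \<in> orbit \<pi> x")
      case True
      then have "z \<in> B" using z orbit_eq[OF \<rho> \<pi>(2), of z x] by (auto simp: un)
      then have "C = B" using z orbit_eq[OF \<rho> \<pi>(2), of z y] by (simp add: sp(2))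
      then show ?thesis by simp
    next
      case False
      then have "C = orbit \<pi> z" using old z by simp
      moreover have "orbit \<pi> z \<noteq> orbit \<pi> x" using False self_in_orbit[OF \<pi>, of z] by auto
      ultimately show ?thesis using z(1) by (auto simp: cyc_def)
    qed
  next
    fix C assume "C \<in> insert B (cyc S \<pi> - {orbit \<pi> x})"
    then consider "C = B" | "C \<in> cyc S \<pi>" "C \<noteq> orbit \<pi> x" by auto
    then show "C \<in> cyc S \<rho> - {orbit \<rho> x}"
    proof cases
      case 1
      have "B \<noteq> orbit \<rho> x" using xB self_in_orbit[OF \<rho> \<pi>(2), of x] by auto
      moreover have "B \<in> cyc S \<rho>" using yS sp(2) by (auto simp: cyc_def)
      ultimately show ?thesis using 1 by simp
    next
      case 2
      then obtain z where z: "z \<in> S" "C = orbit \<pi> z" "C \<noteq> orbit \<pi> x" by (auto simp: cyc_def)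
      then have zn: "z \<notin> orbit \<pi> x" using orbit_eq[OF \<pi>, of z x] by auto
      then have "C = orbit \<rho> z" using old z by simp
      moreover have "z \<in> C" using z self_in_orbit[OF \<pi>] by simp
      ultimately show ?thesis using zn z(1) un by (auto simp: cyc_def)
    qed
  qed
qed

subsection \<open>Deleting a rooted edge\<close>

text \<open>The part of (k+1) d/dp_(k+1) of the cycle product that belongs to the marked point
  \<open>x\<close>: the cycle of x has length k + 1 and is left out.\<close>

definition rooted_weight :: "(nat \<Rightarrow> 'b::comm_ring_1) \<Rightarrow> 'a set \<Rightarrow> 'a \<Rightarrow> nat \<Rightarrow> ('a \<Rightarrow> 'a) \<Rightarrow> 'b" where
  "rooted_weight q S x k \<pi> = (if card (orbit \<pi> x) = k + 1 then \<Prod>C\<in>cyc S \<pi> - {orbit \<pi> x}. q (card C) else 0)"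

text \<open>For a = x nothing changes. A point a of another cycle C joins C to the cycle of x, with
  \<open>card C\<close> choices. A point of the same cycle cuts it, and exactly one choice leaves k
  + 1 points with x.\<close>

lemma sum_transpositions:
  fixes q :: "nat \<Rightarrow> 'b::comm_ring_1" and u :: 'b
  assumes \<pi>: "\<pi> permutes S" "finite S" and x: "x \<in> S"
  defines "\<D> \<equiv> cyc S \<pi> - {orbit \<pi> x}" and "M \<equiv> card (orbit \<pi> x)"
  shows "(\<Sum>a\<in>S. (if a = x then u else 1) * rooted_weight q S x k (transpose x a \<circ> \<pi>)) =
     u * (if M = k + 1 then \<Prod>C\<in>\<D>. q (card C) else 0)
     + (\<Sum>C\<in>\<D>. of_nat (card C) * (if M + card C = k + 1 then \<Prod>C\<in>\<D> - {C}. q (card C) else 0))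
     + (if k + 1 < M then q (M - k - 1) * (\<Prod>C\<in>\<D>. q (card C)) else 0)"
proof -
  let ?f = "\<lambda>a. (if a = x then u else 1) * rooted_weight q S x k (transpose x a \<circ> \<pi>)"
  let ?O = "orbit \<pi> x"
  have xO: "x \<in> ?O" by (rule self_in_orbit[OF \<pi>])
  have finO: "finite ?O" using permutes_orbit_subset[OF \<pi>(1) x] \<pi>(2) by (rule finite_subset)
  have finD: "finite \<D>" "\<And>C. C \<in> \<D> \<Longrightarrow> finite C" using finite_cyc[OF \<pi>] by (auto simp: \<D>_def)
  have OD: "?O \<inter> \<Union>\<D> = {}"
    using cyc_eqI[OF \<pi>] orbit_eq[OF \<pi>] by (fastforce simp: \<D>_def)
  have "?O \<in> cyc S \<pi>" using x by (auto simp: cyc_def)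
  then have S: "S = insert x (?O - {x}) \<union> \<Union>\<D>"
    using Union_cyc[OF \<pi>] xO by (auto simp: \<D>_def)
  have "sum ?f S = sum ?f (insert x (?O - {x})) + sum ?f (\<Union>\<D>)"
    using finO finD OD xO by (subst S, intro sum.union_disjoint) auto
  also have "sum ?f (insert x (?O - {x})) = ?f x + sum ?f (?O - {x})"
    using finO by (intro sum.insert) auto
  also have "?f x = u * (if M = k + 1 then \<Prod>C\<in>\<D>. q (card C) else 0)"
    by (simp add: rooted_weight_def M_def \<D>_def)
  also have "sum ?f (?O - {x}) = (if k + 1 < M then q (M - k - 1) * (\<Prod>C\<in>\<D>. q (card C)) else 0)"
  proof -
    obtain m where m: "m > 0" "?O = (\<lambda>i. (\<pi> ^^ i) x) ` {..<m}" "inj_on (\<lambda>i. (\<pi> ^^ i) x) {..<m}" "(\<pi> ^^ m) x = x"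
      by (rule orbit_enum[OF \<pi>])
    have Mm: "M = m" unfolding M_def m(2) by (simp add: card_image[OF m(3)])
    have "?O - {x} = (\<lambda>i. (\<pi> ^^ i) x) ` ({..<m} - {0})"
      unfolding m(2) using m(1) inj_on_image_set_diff[OF m(3), of "{..<m}" "{0}"] by simp
    also have "{..<m} - {0} = {1..<m}" by auto
    finally have "sum ?f (?O - {x}) = (\<Sum>j\<in>{1..<m}. ?f ((\<pi> ^^ j) x))"
      using inj_on_subset[OF m(3), of "{1..<m}"] by (simp add: sum.reindex subset_iff)
    also have "\<dots> = (\<Sum>j\<in>{1..<m}. if j = k + 1 then q (m - k - 1) * (\<Prod>C\<in>\<D>. q (card C)) else 0)"
    proof (rule sum.cong)
      fix j assume j: "j \<in> {1..<m}"
      then have j': "0 < j" "j < m" by auto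
      note sp = cyc_transpose_split[OF \<pi> x j' refl m(2-4)]
      have "(\<pi> ^^ j) x \<noteq> x" using inj_onD[OF m(3), of j 0] j' by auto
      then have "?f ((\<pi> ^^ j) x) = rooted_weight q S x k (transpose x ((\<pi> ^^ j) x) \<circ> \<pi>)"
        by simp
      also have "\<dots> = (if j = k + 1 then (\<Prod>C\<in>insert ((\<lambda>i. (\<pi> ^^ i) x) ` {j..<m}) \<D>. q (card C)) else 0)"
        unfolding rooted_weight_def sp(1,4) \<D>_def by (rule refl)
      also have "\<dots> = (if j = k + 1 then q (m - k - 1) * (\<Prod>C\<in>\<D>. q (card C)) else 0)"
        unfolding prod.insert[OF finD(1) sp(3)[folded \<D>_def]] sp(2) by simp
      finally show "?f ((\<pi> ^^ j) x) = (if j = k + 1 then q (m - k - 1) * (\<Prod>C\<in>\<D>. q (card C)) else 0)" .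
    qed simp
    finally show ?thesis by (simp add: Mm)
  qed
  also have "sum ?f (\<Union>\<D>) = (\<Sum>a\<in>\<Union>\<D>. if M + card (orbit \<pi> a) = k + 1 then \<Prod>C\<in>\<D> - {orbit \<pi> a}. q (card C) else 0)"
  proof (rule sum.cong)
    fix a assume a: "a \<in> \<Union>\<D>"
    then have aS: "a \<in> S" "a \<notin> ?O" "a \<noteq> x" using S OD xO by auto
    have aD: "orbit \<pi> a \<in> \<D>" using a cyc_eqI[OF \<pi>] by (auto simp: \<D>_def)
    note jo = cyc_transpose_join[OF \<pi> x aS(1,2)]
    have "card (?O \<union> orbit \<pi> a) = M + card (orbit \<pi> a)"
      unfolding M_def using finO finD(2)[OF aD] OD aD by (intro card_Un_disjoint) auto
    then show "?f a = (if M + card (orbit \<pi> a) = k + 1 then \<Prod>C\<in>\<D> - {orbit \<pi> a}. q (card C) else 0)"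
      using aS(3) unfolding rooted_weight_def jo(2) unfolding jo(1) by (simp add: \<D>_def)
  qed simp
  also have "\<dots> = (\<Sum>C\<in>\<D>. of_nat (card C) * (if M + card C = k + 1 then \<Prod>C\<in>\<D> - {C}. q (card C) else 0))"
    by (rule sum_over_cyc[OF \<pi>, of \<D>]) (auto simp: \<D>_def)
  finally show ?thesis by (simp only: add_ac)
qed

lemma cyc_insert_fixed:
  assumes "\<pi> permutes S" "finite S" "x \<notin> S"
  shows "orbit \<pi> x = {x}" "cyc (insert x S) \<pi> - {{x}} = cyc S \<pi>"
proof -
  have "\<pi> x = x" using assms by (simp add: permutes_def)
  then show 1: "orbit \<pi> x = {x}" by (simp add: orbit_eq_singleton_iff)
  have "{x} \<notin> cyc S \<pi>" using cyc_subset[OF assms(1,2), of "{x}"] assms(3) by auto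
  then show "cyc (insert x S) \<pi> - {{x}} = cyc S \<pi>" by (simp add: cyc_def 1)
qed

text \<open>The point x, fixed at first, is multiplied in by b and then by a. If both are x the
  weight is u v; if one is, a single cycle of length k is joined, with weight u + v in total.
  Otherwise either two cycles are joined, or one is joined and then cut.\<close>

lemma sum_double_transpositions:
  fixes q :: "nat \<Rightarrow> 'b::comm_ring_1" and u v :: 'b
  assumes \<pi>: "\<pi> permutes S" "finite S" and x: "x \<notin> S"
  defines "\<C> \<equiv> cyc S \<pi>"
  shows "(\<Sum>b\<in>insert x S. (if b = x then v else 1) * (\<Sum>a\<in>insert x S. (if a = x then u else 1) *
       rooted_weight q (insert x S) x k (transpose x a \<circ> (transpose x b \<circ> \<pi>)))) =
     (if k = 0 then u * v * (\<Prod>C\<in>\<C>. q (card C)) else 0)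
     + (u + v) * (\<Sum>C\<in>\<C>. of_nat (card C) * (if card C = k then \<Prod>C\<in>\<C> - {C}. q (card C) else 0))
     + (\<Sum>C\<in>\<C>. of_nat (card C) * (\<Sum>C'\<in>\<C> - {C}. of_nat (card C') *
          (if card C + card C' = k then \<Prod>C\<in>\<C> - {C} - {C'}. q (card C) else 0)))
     + (\<Sum>C\<in>\<C>. of_nat (card C) * (if k < card C then q (card C - k) * (\<Prod>C\<in>\<C> - {C}. q (card C)) else 0))"
proof -
  let ?S = "insert x S"
  let ?T = "\<lambda>\<rho>. \<Sum>a\<in>?S. (if a = x then u else 1) * rooted_weight q ?S x k (transpose x a \<circ> \<rho>)"
  have \<pi>': "\<pi> permutes ?S" using \<pi>(1) by (rule permutes_subset) auto
  have fin: "finite ?S" using \<pi>(2) by simp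
  note fixed = cyc_insert_fixed[OF \<pi> x]
  have T0: "?T \<pi> = u * (if k = 0 then \<Prod>C\<in>\<C>. q (card C) else 0)
      + (\<Sum>C\<in>\<C>. of_nat (card C) * (if card C = k then \<Prod>C\<in>\<C> - {C}. q (card C) else 0))"
    unfolding sum_transpositions[OF \<pi>' fin insertI1] fixed(1) unfolding fixed(2) \<C>_def by simp
  have Tb: "?T (transpose x b \<circ> \<pi>) = u * (if card (orbit \<pi> b) = k then \<Prod>C\<in>\<C> - {orbit \<pi> b}. q (card C) else 0)
      + (\<Sum>C'\<in>\<C> - {orbit \<pi> b}. of_nat (card C') * (if card (orbit \<pi> b) + card C' = k then \<Prod>C\<in>\<C> - {orbit \<pi> b} - {C'}. q (card C) else 0))
      + (if k < card (orbit \<pi> b) then q (card (orbit \<pi> b) - k) * (\<Prod>C\<in>\<C> - {orbit \<pi> b}. q (card C)) else 0)"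
    if b: "b \<in> S" for b
  proof -
    have xb: "b \<in> ?S" "b \<notin> orbit \<pi> x" using b x by (auto simp: fixed)
    note jo = cyc_transpose_join[OF \<pi>' fin insertI1 xb]
    have "orbit \<pi> b \<subseteq> S" using permutes_orbit_subset[OF \<pi>(1) b] .
    then have "finite (orbit \<pi> b)" "x \<notin> orbit \<pi> b" using \<pi>(2) x by (auto intro: finite_subset)
    then have card: "card ({x} \<union> orbit \<pi> b) = card (orbit \<pi> b) + 1" by simp
    have \<rho>: "transpose x b \<circ> \<pi> permutes ?S" using \<pi>' b by (simp add: permutes_compose permutes_swap_id)
    show ?thesis
      unfolding sum_transpositions[OF \<rho> fin insertI1] jo(2) unfolding jo(1) fixed(1) unfolding fixed(2) card \<C>_def by simp
  qed
  have "(\<Sum>b\<in>?S. (if b = x then v else 1) * ?T (transpose x b \<circ> \<pi>)) = v * ?T \<pi> + (\<Sum>b\<in>S. ?T (transpose x b \<circ> \<pi>))"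
  proof -
    have ins: "(\<Sum>b\<in>?S. (if b = x then v else 1) * g b) = v * g x + (\<Sum>b\<in>S. g b)" for g :: "'a \<Rightarrow> 'b"
    proof -
      have "(\<Sum>b\<in>S. (if b = x then v else 1) * g b) = (\<Sum>b\<in>S. g b)"
        using x by (intro sum.cong) auto
      then show ?thesis using \<pi>(2) x by simp
    qed
    have "transpose x x \<circ> \<pi> = \<pi>" by (simp add: fun_eq_iff)
    then show ?thesis using ins[of "\<lambda>b. ?T (transpose x b \<circ> \<pi>)"] by (simp only:)
  qed
  also have "(\<Sum>b\<in>S. ?T (transpose x b \<circ> \<pi>)) = (\<Sum>C\<in>\<C>. of_nat (card C) *
      (u * (if card C = k then \<Prod>C\<in>\<C> - {C}. q (card C) else 0)
      + (\<Sum>C'\<in>\<C> - {C}. of_nat (card C') * (if card C + card C' = k then \<Prod>C\<in>\<C> - {C} - {C'}. q (card C) else 0))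
      + (if k < card C then q (card C - k) * (\<Prod>C\<in>\<C> - {C}. q (card C)) else 0)))"
    using sum_over_cyc[OF \<pi>, of "cyc S \<pi>", unfolded Union_cyc[OF \<pi>], folded \<C>_def] Tb by simp
  also have "\<dots> = u * (\<Sum>C\<in>\<C>. of_nat (card C) * (if card C = k then \<Prod>C\<in>\<C> - {C}. q (card C) else 0))
      + (\<Sum>C\<in>\<C>. of_nat (card C) * (\<Sum>C'\<in>\<C> - {C}. of_nat (card C') *
          (if card C + card C' = k then \<Prod>C\<in>\<C> - {C} - {C'}. q (card C) else 0)))
      + (\<Sum>C\<in>\<C>. of_nat (card C) * (if k < card C then q (card C - k) * (\<Prod>C\<in>\<C> - {C}. q (card C)) else 0))"
    unfolding sum_distrib_left[of u] sum.distrib[symmetric]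
    by (intro sum.cong refl) (simp only: distrib_left mult.left_commute)
  finally have E: "(\<Sum>b\<in>?S. (if b = x then v else 1) * ?T (transpose x b \<circ> \<pi>)) = v * ?T \<pi> + \<dots>" .
  have K: "(if k = 0 then u * v * W else 0) = v * (u * (if k = 0 then W else 0))" for W :: 'b
    by (simp add: mult_ac)
  show ?thesis
    unfolding E T0 K by (simp only: distrib_left distrib_right add_ac)
qed

text \<open>The Virasoro operator L_k without its term in d/dp_(k+1), cut at \<open>M\<close>. At k
  = 0 the term \<open>alg 0\<close> is 0 because of the factor i in \<open>alg i\<close>.\<close>

definition vir :: "nat \<Rightarrow> nat \<Rightarrow> (gen, rat) mpoly \<Rightarrow> (gen, rat) mpoly" where
  "vir M k f = (\<Sum>i=1..M. Var (GP i) * alg (i + k) f) + (Var GU + Var GV) * alg k f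
     + (\<Sum>i\<in>{1..<k}. alg i (alg (k - i) f)) + (if k = 0 then Var GU * Var GV * f else 0)"

abbreviation pvar :: "nat \<Rightarrow> (gen, rat) mpoly" where
  "pvar i \<equiv> Var (GP i)"

lemma alg_prod:
  assumes "finite \<C>"
  shows "alg i (\<Prod>C\<in>\<C>. pvar (card C)) = (\<Sum>C\<in>\<C>. of_nat (card C) * (if card C = i then \<Prod>C\<in>\<C> - {C}. pvar (card C) else 0))"
  using assms by (subst alg.prod) (auto simp: al_Var intro!: sum.cong)

text \<open>\<open>alg i\<close> selects a cycle of length i with weight i, that is, one of its
  points. The terms become those found by inserting a rooted edge, provided that \<open>M\<close>
  reaches the longest cycle.\<close>

lemma vir_prod:
  fixes \<C> :: "'a set set"
  assumes fin: "finite \<C>" and C: "\<And>C. C \<in> \<C> \<Longrightarrow> card C > 0" "\<And>C. C \<in> \<C> \<Longrightarrow> card C \<le> M"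
  shows "vir M k (\<Prod>C\<in>\<C>. pvar (card C)) =
     (if k = 0 then Var GU * Var GV * (\<Prod>C\<in>\<C>. pvar (card C)) else 0)
     + (Var GU + Var GV) * (\<Sum>C\<in>\<C>. of_nat (card C) * (if card C = k then \<Prod>C\<in>\<C> - {C}. pvar (card C) else 0))
     + (\<Sum>C\<in>\<C>. of_nat (card C) * (\<Sum>C'\<in>\<C> - {C}. of_nat (card C') *
          (if card C + card C' = k then \<Prod>C\<in>\<C> - {C} - {C'}. pvar (card C) else 0)))
     + (\<Sum>C\<in>\<C>. of_nat (card C) * (if k < card C then pvar (card C - k) * (\<Prod>C\<in>\<C> - {C}. pvar (card C)) else 0))"
proof -
  let ?w = "\<lambda>\<D>. \<Prod>C\<in>\<D>. pvar (card C)"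
  have "(\<Sum>i=1..M. pvar i * alg (i + k) (?w \<C>)) = (\<Sum>C\<in>\<C>. \<Sum>i=1..M. pvar i * (of_nat (card C) * (if card C = i + k then ?w (\<C> - {C}) else 0)))"
    unfolding alg_prod[OF fin] sum_distrib_left by (rule sum.swap)
  also have "\<dots> = (\<Sum>C\<in>\<C>. of_nat (card C) * (if k < card C then pvar (card C - k) * ?w (\<C> - {C}) else 0))"
  proof (rule sum.cong)
    fix X assume X: "X \<in> \<C>"
    have "(\<Sum>i=1..M. pvar i * (of_nat (card X) * (if card X = i + k then ?w (\<C> - {X}) else 0))) =
       (\<Sum>i=1..M. if i = card X - k then (if k < card X then of_nat (card X) * (pvar (card X - k) * ?w (\<C> - {X})) else 0) else 0)"
      by (intro sum.cong) auto
    also have "\<dots> = of_nat (card X) * (if k < card X then pvar (card X - k) * ?w (\<C> - {X}) else 0)"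
      using C(2)[OF X] by auto
    finally show "(\<Sum>i=1..M. pvar i * (of_nat (card X) * (if card X = i + k then ?w (\<C> - {X}) else 0))) = \<dots>" .
  qed simp
  finally have 1: "(\<Sum>i=1..M. pvar i * alg (i + k) (?w \<C>)) = \<dots>" .
  have "(\<Sum>i\<in>{1..<k}. alg i (alg (k - i) (?w \<C>))) = (\<Sum>i\<in>{1..<k}. \<Sum>C\<in>\<C>. of_nat (card C) * (if card C = k - i then
      (\<Sum>C'\<in>\<C> - {C}. of_nat (card C') * (if card C' = i then ?w (\<C> - {C} - {C'}) else 0)) else 0))"
    unfolding alg_prod[OF fin] alg.sum using fin by (intro sum.cong refl) (simp add: alg_prod)
  also have "\<dots> = (\<Sum>C\<in>\<C>. \<Sum>C'\<in>\<C> - {C}. \<Sum>i\<in>{1..<k}. if i = card C' then (if card C + card C' = k then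
      of_nat (card C) * (of_nat (card C') * ?w (\<C> - {C} - {C'})) else 0) else 0)"
  proof (subst sum.swap, intro sum.cong refl)
    fix X assume X: "X \<in> \<C>"
    have "(\<Sum>i\<in>{1..<k}. of_nat (card X) * (if card X = k - i then (\<Sum>C'\<in>\<C> - {X}. of_nat (card C') * (if card C' = i then ?w (\<C> - {X} - {C'}) else 0)) else 0))
      = (\<Sum>i\<in>{1..<k}. \<Sum>C'\<in>\<C> - {X}. if i = card C' then (if card X + card C' = k then
      of_nat (card X) * (of_nat (card C') * ?w (\<C> - {X} - {C'})) else 0) else 0)"
    proof (intro sum.cong refl)
      fix i assume i: "i \<in> {1..<k}"
      show "of_nat (card X) * (if card X = k - i then (\<Sum>C'\<in>\<C> - {X}. of_nat (card C') * (if card C' = i then ?w (\<C> - {X} - {C'}) else 0)) else 0)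
       = (\<Sum>C'\<in>\<C> - {X}. if i = card C' then (if card X + card C' = k then
      of_nat (card X) * (of_nat (card C') * ?w (\<C> - {X} - {C'})) else 0) else 0)"
      proof (cases "card X = k - i")
        case True
        then have "card X + i = k" using i by auto
        then have "of_nat (card X) * (of_nat (card Y) * (if card Y = i then ?w (\<C> - {X} - {Y}) else 0)) =
          (if i = card Y then (if card X + card Y = k then of_nat (card X) * (of_nat (card Y) * ?w (\<C> - {X} - {Y})) else 0) else 0)" for Y
          by auto
        then show ?thesis unfolding if_P[OF True] sum_distrib_left by (intro sum.cong refl)
      next
        case False
        then have "(if i = card Y then (if card X + card Y = k then of_nat (card X) * (of_nat (card Y) * ?w (\<C> - {X} - {Y})) else 0) else 0) = 0" for Y
          using i by auto
        then show ?thesis unfolding if_not_P[OF False] mult_zero_right by (intro sum.neutral[symmetric] ballI)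
      qed
    qed
    then show "(\<Sum>i\<in>{1..<k}. of_nat (card X) * (if card X = k - i then (\<Sum>C'\<in>\<C> - {X}. of_nat (card C') * (if card C' = i then ?w (\<C> - {X} - {C'}) else 0)) else 0))
      = (\<Sum>C'\<in>\<C> - {X}. \<Sum>i\<in>{1..<k}. if i = card C' then (if card X + card C' = k then
      of_nat (card X) * (of_nat (card C') * ?w (\<C> - {X} - {C'})) else 0) else 0)"
      by (simp only: sum.swap[of _ "{1..<k}"])
  qed
  also have "\<dots> = (\<Sum>C\<in>\<C>. of_nat (card C) * (\<Sum>C'\<in>\<C> - {C}. of_nat (card C') *
          (if card C + card C' = k then ?w (\<C> - {C} - {C'}) else 0)))"
  proof (intro sum.cong refl)
    fix X assume X: "X \<in> \<C>"
    show "(\<Sum>C'\<in>\<C> - {X}. \<Sum>i\<in>{1..<k}. if i = card C' then (if card X + card C' = k then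
      of_nat (card X) * (of_nat (card C') * ?w (\<C> - {X} - {C'})) else 0) else 0) = of_nat (card X) * (\<Sum>C'\<in>\<C> - {X}. of_nat (card C') *
          (if card X + card C' = k then ?w (\<C> - {X} - {C'}) else 0))"
      unfolding sum_distrib_left
    proof (intro sum.cong refl)
      fix Y assume Y: "Y \<in> \<C> - {X}"
      have "card Y \<in> {1..<k}" if "card X + card Y = k" using that C(1)[OF X] C(1)[of Y] Y by auto
      then show "(\<Sum>i\<in>{1..<k}. if i = card Y then (if card X + card Y = k then
        of_nat (card X) * (of_nat (card Y) * ?w (\<C> - {X} - {Y})) else 0) else 0) =
        of_nat (card X) * (of_nat (card Y) * (if card X + card Y = k then ?w (\<C> - {X} - {Y}) else 0))"
        by auto
    qed
  qed
  finally show ?thesis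
    unfolding vir_def 1 by (simp add: alg_prod[OF fin] add_ac)
qed

subsection \<open>The generating polynomial of maps with labelled edges\<close>

definition map_weight :: "'a set \<Rightarrow> ('a \<Rightarrow> 'a) \<Rightarrow> ('a \<Rightarrow> 'a) \<Rightarrow> (gen, rat) mpoly" where
  "map_weight S \<sigma> \<rho> = Var GU ^ card (cyc S \<sigma>) * Var GV ^ card (cyc S \<rho>)"

definition ZZ :: "'a set \<Rightarrow> (gen, rat) mpoly" where
  "ZZ S = (\<Sum>\<sigma> | \<sigma> permutes S. \<Sum>\<rho> | \<rho> permutes S. map_weight S \<sigma> \<rho> * (\<Prod>C\<in>cyc S (\<sigma> \<circ> \<rho>). pvar (card C)))"

text \<open>For a \<noteq> x the new point enters the cycle of a; for a = x it forms a cycle of its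
  own.\<close>

lemma card_cyc_transpose:
  assumes \<pi>: "\<pi> permutes S" "finite S" and x: "x \<notin> S" and a: "a \<in> insert x S"
  shows "card (cyc (insert x S) (transpose x a \<circ> \<pi>)) = card (cyc S \<pi>) + (if a = x then 1 else 0)"
proof (cases "a = x")
  case True
  note fixed = cyc_insert_fixed[OF \<pi> x]
  have "{x} \<notin> cyc S \<pi>" using fixed(2) by auto
  moreover have "cyc (insert x S) \<pi> = insert {x} (cyc S \<pi>)" using fixed by (auto simp: cyc_def)
  ultimately show ?thesis using True finite_cyc(1)[OF \<pi>] by simp
next
  case False
  then have aS: "a \<in> S" using a by simp
  note fixed = cyc_insert_fixed[OF \<pi> x]
  have \<pi>': "\<pi> permutes insert x S" using \<pi>(1) by (rule permutes_subset) auto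
  have fin: "finite (insert x S)" using \<pi>(2) by simp
  have xb: "a \<in> insert x S" "a \<notin> orbit \<pi> x" using aS x by (auto simp: fixed)
  note jo = cyc_transpose_join[OF \<pi>' fin insertI1 xb, unfolded fixed]
  let ?\<rho> = "transpose x a \<circ> \<pi>"
  have \<rho>: "?\<rho> permutes insert x S" using \<pi>' aS by (simp add: permutes_compose permutes_swap_id)
  have "orbit ?\<rho> x \<in> cyc (insert x S) ?\<rho>" by (auto simp: cyc_def)
  then have "card (cyc (insert x S) ?\<rho>) = Suc (card (cyc S \<pi> - {orbit \<pi> a}))"
    unfolding jo(2)[symmetric] using finite_cyc(1)[OF \<rho> fin] by (rule card.remove[rotated])
  also have "\<dots> = card (cyc S \<pi>)"
    using aS finite_cyc(1)[OF \<pi>] by (intro card_Suc_Diff1) (auto simp: cyc_def)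
  finally show ?thesis using False by simp
qed

text \<open>Each permutation of \<open>insert x S\<close> is uniquely a transposition of x and a
  after a permutation fixing x. In a product of two of them, the second transposition is moved left
  across \<sigma>, which replaces b by \<sigma>(b) and so only permutes the summation index. The
  factors u and v record a = x and b = x, where a new cycle appears.\<close>

lemma rooted_recursion:
  fixes S :: "'a set"
  assumes S: "finite S" "x \<notin> S" and M: "M \<ge> card S"
  shows "(\<Sum>\<sigma> | \<sigma> permutes insert x S. \<Sum>\<rho> | \<rho> permutes insert x S. map_weight (insert x S) \<sigma> \<rho> *
     rooted_weight pvar (insert x S) x k (\<sigma> \<circ> \<rho>)) = vir M k (ZZ S)"
proof -
  let ?S = "insert x S" and ?P = "{\<pi>. \<pi> permutes S}"
  let ?R = "rooted_weight pvar ?S x k"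
  have "(\<Sum>\<sigma> | \<sigma> permutes ?S. \<Sum>\<rho> | \<rho> permutes ?S. map_weight ?S \<sigma> \<rho> * ?R (\<sigma> \<circ> \<rho>)) =
     (\<Sum>a\<in>?S. \<Sum>\<sigma>\<in>?P. \<Sum>b\<in>?S. \<Sum>\<rho>\<in>?P. map_weight ?S (transpose x a \<circ> \<sigma>) (transpose x b \<circ> \<rho>) *
        ?R (transpose x a \<circ> \<sigma> \<circ> (transpose x b \<circ> \<rho>)))"
    unfolding sum_over_permutations_insert[OF S] ..
  also have "\<dots> = (\<Sum>a\<in>?S. \<Sum>\<sigma>\<in>?P. \<Sum>b\<in>?S. \<Sum>\<rho>\<in>?P. map_weight S \<sigma> \<rho> * ((if a = x then Var GU else 1) * (if b = x then Var GV else 1) *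
        ?R (transpose x a \<circ> (transpose x (\<sigma> b) \<circ> (\<sigma> \<circ> \<rho>)))))"
  proof (intro sum.cong refl)
    fix a \<sigma> b \<rho> assume *: "a \<in> ?S" "\<sigma> \<in> ?P" "b \<in> ?S" "\<rho> \<in> ?P"
    have "map_weight ?S (transpose x a \<circ> \<sigma>) (transpose x b \<circ> \<rho>) = map_weight S \<sigma> \<rho> * ((if a = x then Var GU else 1) * (if b = x then Var GV else 1))"
      using * S by (simp add: map_weight_def card_cyc_transpose power_add)
    moreover have "transpose x a \<circ> \<sigma> \<circ> (transpose x b \<circ> \<rho>) = transpose x a \<circ> (transpose x (\<sigma> b) \<circ> (\<sigma> \<circ> \<rho>))"
    proof -
      have "bij \<sigma>" "\<sigma> x = x" using * S by (auto simp: permutes_bij permutes_not_in)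
      then have inj: "\<sigma> w = \<sigma> w' \<longleftrightarrow> w = w'" for w w' by (auto dest: bij_is_inj simp: inj_eq)
      have "\<sigma> (transpose x b w) = transpose x (\<sigma> b) (\<sigma> w)" for w
        using inj[of w x] inj[of w b] \<open>\<sigma> x = x\<close> by (auto simp: transpose_def)
      then have "\<sigma> \<circ> transpose x b = transpose x (\<sigma> b) \<circ> \<sigma>"
        by (simp add: fun_eq_iff)
      then show ?thesis by (simp add: comp_assoc) (simp add: comp_assoc[symmetric])
    qed
    ultimately show "map_weight ?S (transpose x a \<circ> \<sigma>) (transpose x b \<circ> \<rho>) * ?R (transpose x a \<circ> \<sigma> \<circ> (transpose x b \<circ> \<rho>)) =
      map_weight S \<sigma> \<rho> * ((if a = x then Var GU else 1) * (if b = x then Var GV else 1) * ?R (transpose x a \<circ> (transpose x (\<sigma> b) \<circ> (\<sigma> \<circ> \<rho>))))"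
      by (simp only: mult.assoc)
  qed
  also have "\<dots> = (\<Sum>\<sigma>\<in>?P. \<Sum>\<rho>\<in>?P. map_weight S \<sigma> \<rho> * (\<Sum>b\<in>?S. \<Sum>a\<in>?S. (if a = x then Var GU else 1) * (if b = x then Var GV else 1) *
        ?R (transpose x a \<circ> (transpose x (\<sigma> b) \<circ> (\<sigma> \<circ> \<rho>)))))"
  proof -
    have "(\<Sum>a\<in>?S. \<Sum>\<sigma>\<in>?P. \<Sum>b\<in>?S. \<Sum>\<rho>\<in>?P. f a \<sigma> b \<rho>) = (\<Sum>\<sigma>\<in>?P. \<Sum>\<rho>\<in>?P. \<Sum>b\<in>?S. \<Sum>a\<in>?S. f a \<sigma> b \<rho>)"
      for f :: "'a \<Rightarrow> ('a \<Rightarrow> 'a) \<Rightarrow> 'a \<Rightarrow> ('a \<Rightarrow> 'a) \<Rightarrow> (gen, rat) mpoly"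
    proof (subst sum.swap, intro sum.cong refl)
      fix \<sigma>
      have "(\<Sum>a\<in>?S. \<Sum>b\<in>?S. \<Sum>\<rho>\<in>?P. f a \<sigma> b \<rho>) = (\<Sum>b\<in>?S. \<Sum>a\<in>?S. \<Sum>\<rho>\<in>?P. f a \<sigma> b \<rho>)" by (rule sum.swap)
      also have "\<dots> = (\<Sum>b\<in>?S. \<Sum>\<rho>\<in>?P. \<Sum>a\<in>?S. f a \<sigma> b \<rho>)" by (intro sum.cong refl sum.swap)
      also have "\<dots> = (\<Sum>\<rho>\<in>?P. \<Sum>b\<in>?S. \<Sum>a\<in>?S. f a \<sigma> b \<rho>)" by (rule sum.swap)
      finally show "(\<Sum>a\<in>?S. \<Sum>b\<in>?S. \<Sum>\<rho>\<in>?P. f a \<sigma> b \<rho>) = \<dots>" .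
    qed
    then show ?thesis by (simp only: sum_distrib_left)
  qed
  also have "\<dots> = (\<Sum>\<sigma>\<in>?P. \<Sum>\<rho>\<in>?P. map_weight S \<sigma> \<rho> * vir M k (\<Prod>C\<in>cyc S (\<sigma> \<circ> \<rho>). pvar (card C)))"
  proof (intro sum.cong refl arg_cong2[of _ _ _ _ "(*)"])
    fix \<sigma> \<rho> assume *: "\<sigma> \<in> ?P" "\<rho> \<in> ?P"
    then have \<pi>: "\<sigma> \<circ> \<rho> permutes S" by (simp add: permutes_compose)
    have \<sigma>: "\<sigma> permutes ?S" using * by (auto intro: permutes_subset)
    have \<sigma>x: "\<sigma> b = x \<longleftrightarrow> b = x" for b
      using * S by (metis mem_Collect_eq permutes_def)
    have "(\<Sum>b\<in>?S. \<Sum>a\<in>?S. (if a = x then Var GU else 1) * (if b = x then Var GV else 1) * ?R (transpose x a \<circ> (transpose x (\<sigma> b) \<circ> (\<sigma> \<circ> \<rho>)))) =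
       (\<Sum>b\<in>?S. (if \<sigma> b = x then Var GV else 1) * (\<Sum>a\<in>?S. (if a = x then Var GU else 1) * ?R (transpose x a \<circ> (transpose x (\<sigma> b) \<circ> (\<sigma> \<circ> \<rho>)))))"
      by (simp add: \<sigma>x sum_distrib_left mult_ac)
    also have "\<dots> = (\<Sum>b\<in>?S. (if b = x then Var GV else 1) * (\<Sum>a\<in>?S. (if a = x then Var GU else 1) * ?R (transpose x a \<circ> (transpose x b \<circ> (\<sigma> \<circ> \<rho>)))))"
      by (rule sum.permute[OF \<sigma>, symmetric, unfolded comp_def])
    also have "\<dots> = vir M k (\<Prod>C\<in>cyc S (\<sigma> \<circ> \<rho>). pvar (card C))"
    proof (rule trans[OF sum_double_transpositions[OF \<pi> S] vir_prod[symmetric]])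
      show "card C \<le> M" if "C \<in> cyc S (\<sigma> \<circ> \<rho>)" for C
        using card_mono[OF S(1) cyc_subset[OF \<pi> S(1) that]] M by simp
    qed (use finite_cyc(1)[OF \<pi> S(1)] cyc_nonempty[OF \<pi> S(1)] in auto)
    finally show "(\<Sum>b\<in>?S. \<Sum>a\<in>?S. (if a = x then Var GU else 1) * (if b = x then Var GV else 1) * ?R (transpose x a \<circ> (transpose x (\<sigma> b) \<circ> (\<sigma> \<circ> \<rho>)))) = \<dots>" .
  qed
  also have "\<dots> = vir M k (ZZ S)"
  proof -
    have add: "vir M k (f + g) = vir M k f + vir M k g" for f g
      by (simp add: vir_def alg.add distrib_left sum.distrib)
    have zero: "vir M k 0 = 0" by (simp add: vir_def)
    have sum: "vir M k (\<Sum>i\<in>I. f i) = (\<Sum>i\<in>I. vir M k (f i))" for I :: "('a \<Rightarrow> 'a) set" and f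
      by (induction I rule: infinite_finite_induct) (simp_all add: add zero)
    have "alg i (map_weight S \<sigma> \<rho>) = 0" for i \<sigma> \<rho>
    proof -
      have "alg i (Var GU ^ n) = 0" "alg i (Var GV ^ n) = 0" for n
        by (induction n) (simp_all add: alg.mult al_Var)
      then show ?thesis by (simp add: map_weight_def alg.mult)
    qed
    then have "vir M k (map_weight S \<sigma> \<rho> * f) = map_weight S \<sigma> \<rho> * vir M k f" for \<sigma> \<rho> f
      by (simp add: vir_def alg.mult distrib_left sum_distrib_left mult_ac)
    then show ?thesis by (simp add: ZZ_def sum)
  qed
  finally show ?thesis .
qed

lemma conj_orbit:
  assumes \<pi>: "\<pi> permutes S" "finite S"
  shows "orbit (transpose x y \<circ> \<pi> \<circ> transpose x y) (transpose x y z) = transpose x y ` orbit \<pi> z"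
  by (rule orbit_inverse[symmetric, OF self_in_orbit[OF \<pi>]]) simp

lemma conj_cyc:
  assumes \<pi>: "\<pi> permutes S" "finite S" and xy: "x \<in> S" "y \<in> S"
  shows "cyc S (transpose x y \<circ> \<pi> \<circ> transpose x y) = (`) (transpose x y) ` cyc S \<pi>"
proof -
  have "transpose x y ` S = S" by (rule permutes_image[OF permutes_swap_id[OF xy]])
  then have "cyc S (transpose x y \<circ> \<pi> \<circ> transpose x y) = orbit (transpose x y \<circ> \<pi> \<circ> transpose x y) ` (transpose x y ` S)"
    unfolding cyc_def by (simp only:)
  then have "cyc S (transpose x y \<circ> \<pi> \<circ> transpose x y) = (\<lambda>z. orbit (transpose x y \<circ> \<pi> \<circ> transpose x y) (transpose x y z)) ` S"
    unfolding image_image .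
  then show ?thesis unfolding conj_orbit[OF \<pi>] cyc_def by (simp add: image_image)
qed

lemma inj_image_transpose: "inj ((`) (transpose x y))"
  by (rule injI) (simp add: inj_image_eq_iff[OF inj_transpose])

lemma card_conj_cyc:
  assumes "\<pi> permutes S" "finite S" "x \<in> S" "y \<in> S"
  shows "card (cyc S (transpose x y \<circ> \<pi> \<circ> transpose x y)) = card (cyc S \<pi>)"
proof -
  have "card ((`) (transpose x y) ` cyc S \<pi>) = card (cyc S \<pi>)"
    by (rule card_image) (rule inj_on_subset[OF inj_image_transpose subset_UNIV])
  then show ?thesis by (simp only: conj_cyc[OF assms])
qed

lemma card_image_transpose: "card (transpose x y ` A) = card A"
  by (rule card_image) (rule inj_on_subset[OF inj_transpose subset_UNIV])

lemma rooted_weight_conj: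
  assumes \<pi>: "\<pi> permutes S" "finite S" and xy: "x \<in> S" "y \<in> S"
  shows "rooted_weight q S x k (transpose x y \<circ> \<pi> \<circ> transpose x y) = rooted_weight q S y k \<pi>"
proof -
  have o: "orbit (transpose x y \<circ> \<pi> \<circ> transpose x y) x = transpose x y ` orbit \<pi> y"
    using conj_orbit[OF \<pi>, of x y y] by simp
  have "cyc S (transpose x y \<circ> \<pi> \<circ> transpose x y) - {transpose x y ` orbit \<pi> y} = (`) (transpose x y) ` (cyc S \<pi> - {orbit \<pi> y})"
    unfolding conj_cyc[OF \<pi> xy] by (simp add: image_set_diff[OF inj_image_transpose])
  then have "(\<Prod>C\<in>cyc S (transpose x y \<circ> \<pi> \<circ> transpose x y) - {transpose x y ` orbit \<pi> y}. q (card C)) =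
      (\<Prod>C\<in>cyc S \<pi> - {orbit \<pi> y}. q (card C))"
    by (simp add: prod.reindex[OF inj_on_subset[OF inj_image_transpose]] card_image_transpose)
  then show ?thesis
    unfolding rooted_weight_def o by (simp only: card_image_transpose)
qed

lemma sum_conj:
  assumes "finite S" "x \<in> S" "y \<in> S"
  shows "(\<Sum>\<sigma> | \<sigma> permutes S. f \<sigma>) = (\<Sum>\<sigma> | \<sigma> permutes S. f (transpose x y \<circ> \<sigma> \<circ> transpose x y))"
proof -
  have perm: "transpose x y \<circ> \<sigma> \<circ> transpose x y permutes S" if "\<sigma> permutes S" for \<sigma>
    using permutes_compose[OF permutes_compose[OF permutes_swap_id[OF assms(2,3)] that] permutes_swap_id[OF assms(2,3)]]
    by (simp only: comp_assoc)
  have inv: "transpose x y \<circ> (transpose x y \<circ> \<sigma> \<circ> transpose x y) \<circ> transpose x y = \<sigma>" for \<sigma> :: "'a \<Rightarrow> 'a"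
    by (simp add: fun_eq_iff)
  show ?thesis
    by (rule sum.reindex_bij_witness[of _ "\<lambda>\<sigma>. transpose x y \<circ> \<sigma> \<circ> transpose x y" "\<lambda>\<sigma>. transpose x y \<circ> \<sigma> \<circ> transpose x y"])
       (simp_all only: inv mem_Collect_eq perm)
qed

text \<open>Conjugating \<sigma> and \<rho> by the transposition of x and y preserves the weights
  and moves the root.\<close>

lemma rooted_symmetric:
  assumes S: "finite S" "x \<in> S" "y \<in> S"
  shows "(\<Sum>\<sigma> | \<sigma> permutes S. \<Sum>\<rho> | \<rho> permutes S. map_weight S \<sigma> \<rho> * rooted_weight q S x k (\<sigma> \<circ> \<rho>)) =
    (\<Sum>\<sigma> | \<sigma> permutes S. \<Sum>\<rho> | \<rho> permutes S. map_weight S \<sigma> \<rho> * rooted_weight q S y k (\<sigma> \<circ> \<rho>))"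
proof -
  let ?c = "\<lambda>\<sigma>. transpose x y \<circ> \<sigma> \<circ> transpose x y"
  have "(\<Sum>\<sigma> | \<sigma> permutes S. \<Sum>\<rho> | \<rho> permutes S. map_weight S \<sigma> \<rho> * rooted_weight q S x k (\<sigma> \<circ> \<rho>)) =
    (\<Sum>\<sigma> | \<sigma> permutes S. \<Sum>\<rho> | \<rho> permutes S. map_weight S (?c \<sigma>) (?c \<rho>) * rooted_weight q S x k (?c \<sigma> \<circ> ?c \<rho>))"
    by (subst sum_conj[OF S], subst sum_conj[OF S]) (rule refl)
  also have "\<dots> = (\<Sum>\<sigma> | \<sigma> permutes S. \<Sum>\<rho> | \<rho> permutes S. map_weight S \<sigma> \<rho> * rooted_weight q S y k (\<sigma> \<circ> \<rho>))"
  proof (intro sum.cong refl)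
    fix \<sigma> \<rho> assume "\<sigma> \<in> {\<sigma>. \<sigma> permutes S}" "\<rho> \<in> {\<rho>. \<rho> permutes S}"
    then have p: "\<sigma> permutes S" "\<rho> permutes S" "\<sigma> \<circ> \<rho> permutes S" by (simp_all add: permutes_compose)
    have "?c \<sigma> \<circ> ?c \<rho> = ?c (\<sigma> \<circ> \<rho>)" by (simp add: fun_eq_iff)
    then show "map_weight S (?c \<sigma>) (?c \<rho>) * rooted_weight q S x k (?c \<sigma> \<circ> ?c \<rho>) = map_weight S \<sigma> \<rho> * rooted_weight q S y k (\<sigma> \<circ> \<rho>)"
      using rooted_weight_conj[OF p(3) S, of q k] card_conj_cyc[OF p(1) S] card_conj_cyc[OF p(2) S]
      by (simp only: map_weight_def)
  qed
  finally show ?thesis .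
qed

lemma alg_map_weight [simp]: "alg i (map_weight S \<sigma> \<rho>) = 0"
proof -
  have "alg i (Var GU ^ n) = 0" "alg i (Var GV ^ n) = 0" for n
    by (induction n) (simp_all add: alg.mult al_Var)
  then show ?thesis by (simp add: map_weight_def alg.mult)
qed

lemma alg_cyc_prod:
  assumes \<pi>: "\<pi> permutes S" "finite S"
  shows "alg (k + 1) (\<Prod>C\<in>cyc S \<pi>. pvar (card C)) = (\<Sum>x\<in>S. rooted_weight pvar S x k \<pi>)"
  using sum_over_cyc[OF \<pi>, of "cyc S \<pi>" "\<lambda>C. if card C = k + 1 then \<Prod>C\<in>cyc S \<pi> - {C}. pvar (card C) else 0", unfolded Union_cyc[OF \<pi>]]
  by (simp add: alg_prod[OF finite_cyc(1)[OF \<pi>]] rooted_weight_def)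

text \<open>The derivative marks a point on a face of degree k + 1. By symmetry each of the |S| + 1
  points contributes as much as x, for which the rooted edge can be deleted.\<close>

theorem alg_ZZ:
  assumes S: "finite S" "x \<notin> S" and M: "M \<ge> card S"
  shows "alg (k + 1) (ZZ (insert x S)) = of_nat (card S + 1) * vir M k (ZZ S)"
proof -
  let ?S = "insert x S"
  have fin: "finite ?S" using S by simp
  have "alg (k + 1) (ZZ ?S) = (\<Sum>\<sigma> | \<sigma> permutes ?S. \<Sum>\<rho> | \<rho> permutes ?S. \<Sum>y\<in>?S. map_weight ?S \<sigma> \<rho> * rooted_weight pvar ?S y k (\<sigma> \<circ> \<rho>))"
    unfolding ZZ_def alg.sum alg.mult alg_map_weight mult_zero_left add_0_left
  proof (intro sum.cong refl)
    fix \<sigma> \<rho> assume "\<sigma> \<in> {\<sigma>. \<sigma> permutes ?S}" "\<rho> \<in> {\<rho>. \<rho> permutes ?S}"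
    then have "\<sigma> \<circ> \<rho> permutes ?S" by (simp add: permutes_compose)
    then show "map_weight ?S \<sigma> \<rho> * alg (k + 1) (\<Prod>C\<in>cyc ?S (\<sigma> \<circ> \<rho>). pvar (card C)) =
       (\<Sum>y\<in>?S. map_weight ?S \<sigma> \<rho> * rooted_weight pvar ?S y k (\<sigma> \<circ> \<rho>))"
      unfolding sum_distrib_left[symmetric] using alg_cyc_prod[OF _ fin] by metis
  qed
  also have "\<dots> = (\<Sum>\<sigma> | \<sigma> permutes ?S. \<Sum>y\<in>?S. \<Sum>\<rho> | \<rho> permutes ?S. map_weight ?S \<sigma> \<rho> * rooted_weight pvar ?S y k (\<sigma> \<circ> \<rho>))"
    by (intro sum.cong refl sum.swap)
  also have "\<dots> = (\<Sum>y\<in>?S. \<Sum>\<sigma> | \<sigma> permutes ?S. \<Sum>\<rho> | \<rho> permutes ?S. map_weight ?S \<sigma> \<rho> * rooted_weight pvar ?S y k (\<sigma> \<circ> \<rho>))"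
    by (rule sum.swap)
  also have "\<dots> = (\<Sum>y\<in>?S. vir M k (ZZ S))"
  proof (rule sum.cong)
    fix y assume "y \<in> ?S"
    from rooted_symmetric[OF fin this insertI1, of pvar k] rooted_recursion[OF S M]
    show "(\<Sum>\<sigma> | \<sigma> permutes ?S. \<Sum>\<rho> | \<rho> permutes ?S. map_weight ?S \<sigma> \<rho> * rooted_weight pvar ?S y k (\<sigma> \<circ> \<rho>)) = vir M k (ZZ S)"
      by (simp only:)
  qed simp
  also have "\<dots> = of_nat (card S + 1) * vir M k (ZZ S)"
    using S by simp
  finally show ?thesis .
qed

lemma euler_ZZ:
  assumes S: "finite S" and M: "M \<ge> card S"
  shows "(\<Sum>i=1..M. pvar i * alg i (ZZ S)) = of_nat (card S) * ZZ S"
proof -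
  have *: "(\<Sum>i=1..M. pvar i * alg i (\<Prod>C\<in>cyc S \<pi>. pvar (card C))) = of_nat (card S) * (\<Prod>C\<in>cyc S \<pi>. pvar (card C))"
    if \<pi>: "\<pi> permutes S" for \<pi>
  proof -
    note fin = finite_cyc(1)[OF \<pi> S]
    have "(\<Sum>i=1..M. pvar i * alg i (\<Prod>C\<in>cyc S \<pi>. pvar (card C))) =
       (\<Sum>C\<in>cyc S \<pi>. \<Sum>i=1..M. pvar i * (of_nat (card C) * (if card C = i then \<Prod>C\<in>cyc S \<pi> - {C}. pvar (card C) else 0)))"
      unfolding alg_prod[OF fin] sum_distrib_left by (rule sum.swap)
    also have "\<dots> = (\<Sum>C\<in>cyc S \<pi>. of_nat (card C) * (\<Prod>C\<in>cyc S \<pi>. pvar (card C)))"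
    proof (rule sum.cong)
      fix X assume X: "X \<in> cyc S \<pi>"
      have cX: "card X \<in> {1..M}"
        using cyc_nonempty[OF \<pi> S X] card_mono[OF S cyc_subset[OF \<pi> S X]] M by simp
      have "(\<Sum>i=1..M. pvar i * (of_nat (card X) * (if card X = i then \<Prod>C\<in>cyc S \<pi> - {X}. pvar (card C) else 0))) =
        (\<Sum>i=1..M. if card X = i then of_nat (card X) * (pvar (card X) * (\<Prod>C\<in>cyc S \<pi> - {X}. pvar (card C))) else 0)"
        by (intro sum.cong) auto
      also have "\<dots> = of_nat (card X) * (pvar (card X) * (\<Prod>C\<in>cyc S \<pi> - {X}. pvar (card C)))"
        using cX by simp
      also have "pvar (card X) * (\<Prod>C\<in>cyc S \<pi> - {X}. pvar (card C)) = (\<Prod>C\<in>cyc S \<pi>. pvar (card C))"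
        using fin X by (rule prod.remove[symmetric])
      finally show "(\<Sum>i=1..M. pvar i * (of_nat (card X) * (if card X = i then \<Prod>C\<in>cyc S \<pi> - {X}. pvar (card C) else 0))) =
        of_nat (card X) * (\<Prod>C\<in>cyc S \<pi>. pvar (card C))" .
    qed simp
    also have "\<dots> = of_nat (card S) * (\<Prod>C\<in>cyc S \<pi>. pvar (card C))"
      using sum_over_cyc[OF \<pi> S, of "cyc S \<pi>" "\<lambda>_. \<Prod>C\<in>cyc S \<pi>. pvar (card C)", unfolded Union_cyc[OF \<pi> S]] by simp
    finally show ?thesis .
  qed
  have "(\<Sum>i=1..M. pvar i * alg i (ZZ S)) = (\<Sum>i=1..M. \<Sum>\<sigma> | \<sigma> permutes S. \<Sum>\<rho> | \<rho> permutes S.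
     map_weight S \<sigma> \<rho> * (pvar i * alg i (\<Prod>C\<in>cyc S (\<sigma> \<circ> \<rho>). pvar (card C))))"
    by (simp add: ZZ_def alg.sum alg.mult sum_distrib_left mult_ac)
  also have "\<dots> = (\<Sum>\<sigma> | \<sigma> permutes S. \<Sum>i=1..M. \<Sum>\<rho> | \<rho> permutes S. map_weight S \<sigma> \<rho> * (pvar i * alg i (\<Prod>C\<in>cyc S (\<sigma> \<circ> \<rho>). pvar (card C))))"
    by (rule sum.swap)
  also have "\<dots> = (\<Sum>\<sigma> | \<sigma> permutes S. \<Sum>\<rho> | \<rho> permutes S. \<Sum>i=1..M. map_weight S \<sigma> \<rho> * (pvar i * alg i (\<Prod>C\<in>cyc S (\<sigma> \<circ> \<rho>). pvar (card C))))"
    by (intro sum.cong refl sum.swap)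
  also have "\<dots> = (\<Sum>\<sigma> | \<sigma> permutes S. \<Sum>\<rho> | \<rho> permutes S. map_weight S \<sigma> \<rho> * (of_nat (card S) * (\<Prod>C\<in>cyc S (\<sigma> \<circ> \<rho>). pvar (card C))))"
    unfolding sum_distrib_left[symmetric] by (intro sum.cong refl arg_cong2[of _ _ _ _ "(*)"] *) (simp add: permutes_compose)
  finally show ?thesis by (simp add: ZZ_def sum_distrib_left mult_ac)
qed

lemma sum_card_cyc:
  assumes "\<pi> permutes S" "finite S"
  shows "(\<Sum>C\<in>cyc S \<pi>. card C) = card S"
proof -
  have "(\<Sum>C\<in>cyc S \<pi>. of_nat (card C) * (1::int)) = (\<Sum>a\<in>S. 1)"
    using sum_over_cyc[OF assms, of "cyc S \<pi>" "\<lambda>_. 1::int", unfolded Union_cyc[OF assms]] by simp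
  then show ?thesis by (simp flip: of_nat_sum)
qed

lemma bounded_weight_prod:
  assumes "\<And>x. x \<in> A \<Longrightarrow> g x \<in> bounded_weight w (int (c x))"
  shows "(\<Prod>x\<in>A. g x) \<in> bounded_weight w (int (\<Sum>x\<in>A. c x))"
  using assms
  by (induction A rule: infinite_finite_induct) (auto simp: bounded_weight_mult bounded_weight_Const[of 0 1, simplified])

lemma ZZ_weight:
  assumes "finite S"
  shows "ZZ S \<in> bounded_weight gen_weight (int (card S))"
  unfolding ZZ_def
proof (intro bounded_weight_sum)
  fix \<sigma> \<rho> assume "\<sigma> \<in> {\<sigma>. \<sigma> permutes S}" "\<rho> \<in> {\<rho>. \<rho> permutes S}"
  then have \<pi>: "\<sigma> \<circ> \<rho> permutes S" by (simp add: permutes_compose)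
  have "(\<Prod>C\<in>cyc S (\<sigma> \<circ> \<rho>). pvar (card C)) \<in> bounded_weight gen_weight (int (\<Sum>C\<in>cyc S (\<sigma> \<circ> \<rho>). card C))"
    by (intro bounded_weight_prod bounded_weight_Var) (simp add: gen_weight_def)
  moreover have "Var GU ^ n \<in> bounded_weight gen_weight 0" "Var GV ^ n \<in> bounded_weight gen_weight 0" for n
    using bounded_weight_prod[of "{..<n}" "\<lambda>_. Var GU" gen_weight "\<lambda>_. 0"] bounded_weight_prod[of "{..<n}" "\<lambda>_. Var GV" gen_weight "\<lambda>_. 0"]
    by (simp_all add: bounded_weight_Var gen_weight_def)
  ultimately have "map_weight S \<sigma> \<rho> * (\<Prod>C\<in>cyc S (\<sigma> \<circ> \<rho>). pvar (card C)) \<in> bounded_weight gen_weight (0 + 0 + int (card S))"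
    unfolding map_weight_def sum_card_cyc[OF \<pi> assms] by (intro bounded_weight_mult) blast+
  then show "map_weight S \<sigma> \<rho> * (\<Prod>C\<in>cyc S (\<sigma> \<circ> \<rho>). pvar (card C)) \<in> bounded_weight gen_weight (int (card S))" by simp
qed

subsection \<open>The series \<open>\<tau>\<close>\<close>

lemma finite_partitions: "finite (partitions n)"
proof (rule finite_subset)
  show "partitions n \<subseteq> mset ` {xs. set xs \<subseteq> {..n} \<and> length xs \<le> n}"
  proof
    fix lam assume lam: "lam \<in> partitions n"
    obtain xs where xs: "mset xs = lam" using ex_mset by blast
    have "size lam \<le> n" using lam sum_mset_ge_size[of lam] by (auto simp: partitions_def)
    moreover have "x \<le> n" if "x \<in># lam" for x
    proof -
      obtain A where "lam = add_mset x A" using multi_member_split[OF \<open>x \<in># lam\<close>] by blast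
      then show ?thesis using lam by (auto simp: partitions_def)
    qed
    ultimately show "lam \<in> mset ` {xs. set xs \<subseteq> {..n} \<and> length xs \<le> n}"
      using xs by (intro image_eqI[of _ _ xs]) auto
  qed
qed (intro finite_imageI finite_lists_length_le, simp)

lemma cycle_type_partition:
  assumes "\<pi> permutes {1..n}"
  shows "cycle_type n \<pi> \<in> partitions n"
proof -
  note fin = finite_cyc(1)[OF assms finite_atLeastAtMost]
  have "sum_mset (cycle_type n \<pi>) = (\<Sum>C\<in>cyc {1..n} \<pi>. card C)"
    by (simp add: cycle_type_def cycles_cyc sum_unfold_sum_mset)
  also have "\<dots> = n" using sum_card_cyc[OF assms] by simp
  moreover have "0 \<notin># cycle_type n \<pi>"
  proof
    assume "0 \<in># cycle_type n \<pi>"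
    then obtain C where "C \<in> cyc {1..n} \<pi>" "card C = 0"
      using fin by (auto simp: cycle_type_def cycles_cyc)
    then show False using cyc_nonempty[OF assms finite_atLeastAtMost, of C] by simp
  qed
  ultimately show ?thesis by (simp add: partitions_def)
qed

lemma card_cycles_le: "\<pi> permutes {1..n} \<Longrightarrow> card (cycles n \<pi>) \<le> n"
  unfolding cycles_def using card_image_le[of "{1..n}" "orbit \<pi>"] by simp

text \<open>Pairs of permutations are grouped by their two numbers of cycles and by the cycle type
  of the product; the ranges in the definition of \<open>tau\<close> contain all values.\<close>

lemma tau_nth: "fps_nth tau n = Const (1 / fact n) * ZZ {1..n}"
proof -
  let ?P = "{\<pi>. \<pi> permutes {1..n}}"
  let ?key = "\<lambda>(\<sigma>, \<rho>). ((card (cycles n \<sigma>), card (cycles n \<rho>)), cycle_type n (\<sigma> \<circ> \<rho>))"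
  let ?f = "\<lambda>((V, W), lam). Var GU ^ V * Var GV ^ W * (\<Prod>i\<in>#lam. pvar i)"
  let ?T = "({..n} \<times> {..n}) \<times> partitions n"
  have "(\<Sum>V\<le>n. \<Sum>W\<le>n. \<Sum>lam\<in>partitions n. of_nat (num_maps V W lam n) * Var GU ^ V * Var GV ^ W * (\<Prod>i\<in>#lam. pvar i)) =
     (\<Sum>t\<in>?T. \<Sum>x\<in>{x \<in> ?P \<times> ?P. ?key x = t}. ?f (?key x))"
  proof -
    have "of_nat (num_maps V W lam n) * Var GU ^ V * Var GV ^ W * (\<Prod>i\<in>#lam. pvar i) =
       (\<Sum>x\<in>{x \<in> ?P \<times> ?P. ?key x = ((V, W), lam)}. ?f (?key x))" for V W lam
    proof -
      have "num_maps V W lam n = card {x \<in> ?P \<times> ?P. ?key x = ((V, W), lam)}"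
        unfolding num_maps_def by (rule arg_cong[of _ _ card]) auto
      moreover have "(\<Sum>x\<in>{x \<in> ?P \<times> ?P. ?key x = ((V, W), lam)}. ?f (?key x)) =
         (\<Sum>x\<in>{x \<in> ?P \<times> ?P. ?key x = ((V, W), lam)}. ?f ((V, W), lam))"
        by (rule sum.cong) auto
      ultimately show ?thesis by (simp add: mult.assoc)
    qed
    then show ?thesis
      by (simp only: sum.cartesian_product')
  qed
  also have "\<dots> = (\<Sum>x\<in>?P \<times> ?P. ?f (?key x))"
  proof (rule sum.group)
    show "finite (?P \<times> ?P)" by (simp add: finite_permutations)
    show "finite ?T" by (simp add: finite_partitions)
    show "?key ` (?P \<times> ?P) \<subseteq> ?T"
      using cycle_type_partition by (auto simp: card_cycles_le permutes_compose)
  qed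
  also have "\<dots> = (\<Sum>(\<sigma>, \<rho>)\<in>?P \<times> ?P. map_weight {1..n} \<sigma> \<rho> * (\<Prod>C\<in>cyc {1..n} (\<sigma> \<circ> \<rho>). pvar (card C)))"
    by (intro sum.cong refl) (auto simp: map_weight_def cycle_type_def cycles_cyc prod_unfold_prod_mset image_mset.compositionality comp_def)
  also have "\<dots> = ZZ {1..n}"
    by (simp add: ZZ_def sum.cartesian_product)
  finally show ?thesis by (simp add: tau_def)
qed

lemma alg_Const_mult: "alg i (Const c * f) = Const c * alg i f"
  by (simp add: alg.mult)

lemma vir_Const_mult: "vir M k (Const c * f) = Const c * vir M k f"
  unfolding vir_def alg_Const_mult by (simp add: sum_distrib_left distrib_left mult_ac)

lemma alg_weight: "f \<in> bounded_weight gen_weight n \<Longrightarrow> alg i f \<in> bounded_weight gen_weight (n - int i)"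
  unfolding alg_def using bounded_weight_pdiff[of f gen_weight n "GP i"]
  by (intro bounded_weight_of_nat) (simp add: gen_weight_def)

lemma alg_eq_0: "f \<in> bounded_weight gen_weight n \<Longrightarrow> n < int i \<Longrightarrow> alg i f = 0"
  using alg_weight[of f n i] bounded_weight_neg[of "n - int i" gen_weight] by auto

lemma alg_0 [simp]: "alg 0 f = 0"
  by (simp add: alg_def)

text \<open>The operators L_k, multiplied by p_(k+1), sum to the evolution operator. Pairs (i, j)
  with i + j > M may be included on the right, as they lower the weight below 0.\<close>

lemma vir_map_op:
  assumes x: "x \<in> bounded_weight gen_weight (int n)" and M: "M \<ge> n"
  shows "(\<Sum>i=1..Suc M. pvar i * vir M (i - 1) x) = map_op alg pvar (Var GU) (Var GV) M x"
proof -
  have sh: "(\<Sum>a=1..M. g a) = (\<Sum>k<M. g (Suc k))" for g :: "nat \<Rightarrow> (gen, rat) mpoly"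
    using sum.atLeast1_atMost_eq[of g M] by simp
  have z1: "alg i x = 0" if "i > M" for i
    using that M by (intro alg_eq_0[OF x]) simp
  have z2: "alg i (alg j x) = 0" if "i + j > M" for i j
    using that M by (intro alg_eq_0[OF alg_weight[OF x]]) simp
  have "(\<Sum>i=1..Suc M. pvar i * vir M (i - 1) x) = (\<Sum>k<Suc M. pvar (Suc k) * vir M k x)"
    using sum.atLeast1_atMost_eq[of "\<lambda>i. pvar i * vir M (i - 1) x" "Suc M"] by simp
  also have "\<dots> = (\<Sum>k<Suc M. \<Sum>b=1..M. pvar (Suc k) * (pvar b * alg (Suc k + b - 1) x))
     + (\<Sum>k<Suc M. (Var GU + Var GV) * (pvar (Suc k) * alg k x))
     + (\<Sum>k<Suc M. \<Sum>i\<in>{1..<k}. pvar (Suc k) * alg i (alg (k - i) x))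
     + (\<Sum>k<Suc M. if k = 0 then Var GU * Var GV * (pvar 1 * x) else 0)"
    unfolding sum.distrib[symmetric]
  proof (rule sum.cong)
    fix k
    show "pvar (Suc k) * vir M k x = (\<Sum>b=1..M. pvar (Suc k) * (pvar b * alg (Suc k + b - 1) x))
      + (Var GU + Var GV) * (pvar (Suc k) * alg k x) + (\<Sum>i\<in>{1..<k}. pvar (Suc k) * alg i (alg (k - i) x))
      + (if k = 0 then Var GU * Var GV * (pvar 1 * x) else 0)"
      by (simp add: vir_def distrib_left sum_distrib_left mult_ac add.commute[of k])
  qed simp
  also have "(\<Sum>k<Suc M. \<Sum>b=1..M. pvar (Suc k) * (pvar b * alg (Suc k + b - 1) x)) =
      (\<Sum>a=1..M. \<Sum>b=1..M. pvar a * (pvar b * alg (a + b - 1) x))"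
    by (simp only: sh[of "\<lambda>a. \<Sum>b=1..M. pvar a * (pvar b * alg (a + b - 1) x)"] sum.lessThan_Suc)
       (simp add: z1)
  also have "(\<Sum>k<Suc M. (Var GU + Var GV) * (pvar (Suc k) * alg k x)) = (\<Sum>j=1..M. (Var GU + Var GV) * (pvar (j + 1) * alg j x))"
    by (simp only: sh[of "\<lambda>j. (Var GU + Var GV) * (pvar (j + 1) * alg j x)"] sum.lessThan_Suc_shift) simp
  also have "(\<Sum>k<Suc M. \<Sum>i\<in>{1..<k}. pvar (Suc k) * alg i (alg (k - i) x)) =
      (\<Sum>i=1..M. \<Sum>j=1..M. pvar (i + j + 1) * alg i (alg j x))"
  proof -
    have "(\<Sum>(k, i)\<in>(SIGMA k:{..<Suc M}. {1..<k}). pvar (Suc k) * alg i (alg (k - i) x)) =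
      (\<Sum>(i, j)\<in>{1..M} \<times> {1..M}. pvar (i + j + 1) * alg i (alg j x))"
    proof (rule sum_reindex_support[of _ _ _ "\<lambda>(k, i). (i, k - i)" "\<lambda>(i, j). (i + j, i)"], goal_cases)
      case (4 y)
      obtain i j where y: "y = (i, j)" by (cases y)
      then have "i + j \<le> M" using 4(2) z2[of i j] by (cases "i + j \<le> M") auto
      then show ?case using 4(1) y by auto
    qed auto
    moreover have "(\<Sum>k<Suc M. \<Sum>i\<in>{1..<k}. pvar (Suc k) * alg i (alg (k - i) x)) =
      (\<Sum>(k, i)\<in>(SIGMA k:{..<Suc M}. {1..<k}). pvar (Suc k) * alg i (alg (k - i) x))"
      by (rule sum.Sigma) simp_all
    moreover have "(\<Sum>i=1..M. \<Sum>j=1..M. pvar (i + j + 1) * alg i (alg j x)) =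
      (\<Sum>(i, j)\<in>{1..M} \<times> {1..M}. pvar (i + j + 1) * alg i (alg j x))"
      by (rule sum.cartesian_product)
    ultimately show ?thesis by (simp only:)
  qed
  also have "(\<Sum>k<Suc M. if k = 0 then Var GU * Var GV * (pvar 1 * x) else 0) = Var GU * Var GV * (pvar 1 * x)"
    by (simp add: sum.lessThan_Suc_shift)
  finally show ?thesis by (simp only: map_op_def)
qed

text \<open>The n + 1 choices of the root turn 1/(n+1)! into 1/n!.\<close>

lemma tau_vir:
  assumes "M \<ge> n"
  shows "alg (k + 1) (fps_nth tau (Suc n)) = vir M k (fps_nth tau n)"
proof -
  have "alg (k + 1) (ZZ {1..Suc n}) = of_nat (Suc n) * vir M k (ZZ {1..n})"
    using alg_ZZ[of "{1..n}" "Suc n" M k] assms by (simp add: atLeastAtMostSuc_conv)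
  then have "alg (k + 1) (fps_nth tau (Suc n)) = Const (1 / fact (Suc n)) * of_nat (Suc n) * vir M k (ZZ {1..n})"
    by (simp only: tau_nth alg_Const_mult mult.assoc)
  also have "Const (1 / fact (Suc n)) * of_nat (Suc n) = (Const (1 / fact n) :: (gen, rat) mpoly)"
    by (simp add: Const_mult[symmetric] flip: Const_of_nat del: of_nat_Suc)
  finally show ?thesis by (simp only: tau_nth vir_Const_mult)
qed

lemma tau_euler:
  assumes "M \<ge> n"
  shows "(\<Sum>i=1..M. pvar i * alg i (fps_nth tau n)) = of_nat n * fps_nth tau n"
proof -
  have "(\<Sum>i=1..M. pvar i * alg i (fps_nth tau n)) = Const (1 / fact n) * (\<Sum>i=1..M. pvar i * alg i (ZZ {1..n}))"
    unfolding tau_nth alg_Const_mult by (simp add: sum_distrib_left mult_ac)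
  also have "(\<Sum>i=1..M. pvar i * alg i (ZZ {1..n})) = of_nat n * ZZ {1..n}"
    using euler_ZZ[of "{1..n}" M] assms by simp
  finally show ?thesis by (simp add: tau_nth mult_ac)
qed

lemma tau_0: "fps_nth tau 0 = 1"
  by (simp add: tau_nth ZZ_def map_weight_def cyc_def)

text \<open>The evolution equation is Euler's relation for the coefficient of t^(n+1), with every i
  d/dp_i expressed by the coefficient of t^n through \<open>tau_vir\<close>.\<close>

interpretation tau: map_series "fps_nth tau"
proof
  show "fps_nth tau 0 = 1" by (rule tau_0)
  show w: "fps_nth tau n \<in> bounded_weight gen_weight (int n)" for n
    using bounded_weight_cmult[OF ZZ_weight[of "{1..n}"]] by (simp add: tau_nth)
  show "of_nat (Suc n) * fps_nth tau (Suc n) = map_op alg (\<lambda>i. Var (GP i)) (Var GU) (Var GV) M (fps_nth tau n)"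
    if M: "M \<ge> n" for n M
  proof -
    have "of_nat (Suc n) * fps_nth tau (Suc n) = (\<Sum>i=1..Suc M. pvar i * alg i (fps_nth tau (Suc n)))"
      using M by (intro tau_euler[symmetric]) simp
    also have "\<dots> = (\<Sum>i=1..Suc M. pvar i * vir M (i - 1) (fps_nth tau n))"
    proof (rule sum.cong)
      fix i assume "i \<in> {1..Suc M}"
      then show "pvar i * alg i (fps_nth tau (Suc n)) = pvar i * vir M (i - 1) (fps_nth tau n)"
        using tau_vir[OF M, of "i - 1"] by simp
    qed simp
    finally show ?thesis by (simp only: vir_map_op[OF w M])
  qed
qed

lemma tauS_tau: "tau.tauS = tau"
  by (rule fps_ext) (simp add: tau.tauS_def)

subsection \<open>Equations for the logarithm\<close>

text \<open>With a fixed cut \<open>M\<close> the equations for \<open>tau\<close> hold up to a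
  finite order in t only. Division by a series with constant term 1 respects this.\<close>

lemma fps_unit_cancel:
  fixes f g :: "'a::comm_ring_1 fps"
  assumes f: "fps_nth f 0 = 1" and "\<And>i. i \<le> N \<Longrightarrow> fps_nth (f * g) i = 0"
  shows "i \<le> N \<Longrightarrow> fps_nth g i = 0"
proof (induction i rule: less_induct)
  case (less i)
  have "fps_nth (f * g) i = (\<Sum>j=0..i. fps_nth f j * fps_nth g (i - j))"
    by (simp add: fps_mult_nth)
  also have "\<dots> = fps_nth f 0 * fps_nth g i + (\<Sum>j\<in>{0..i} - {0}. fps_nth f j * fps_nth g (i - j))"
    by (subst sum.remove[of _ 0]) simp_all
  also have "(\<Sum>j\<in>{0..i} - {0}. fps_nth f j * fps_nth g (i - j)) = 0"
    using less by (intro sum.neutral) auto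
  finally show ?case using assms(2)[OF less.prems] f by simp
qed

lemma derivation_power_mult:
  assumes "ring_derivation \<delta>"
  shows "(\<delta> ^^ l) (x * y) = (\<Sum>r\<le>l. of_nat (l choose r) * (\<delta> ^^ r) x * (\<delta> ^^ (l - r)) y)"
proof (induction l)
  case (Suc l)
  interpret \<delta>: ring_derivation \<delta> by fact
  let ?t = "\<lambda>r. (\<delta> ^^ r) x * (\<delta> ^^ (Suc l - r)) y"
  have "(\<delta> ^^ Suc l) (x * y) = (\<Sum>r\<le>l. of_nat (l choose r) * ?t (Suc r)) + (\<Sum>r\<le>l. of_nat (l choose r) * ?t r)"
    by (simp add: Suc \<delta>.sum \<delta>.mult mult.assoc distrib_left sum.distrib Suc_diff_le)
  also have "(\<Sum>r\<le>l. of_nat (l choose r) * ?t r) = (\<Sum>r\<le>Suc l. of_nat (l choose r) * ?t r)"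
    by (simp add: binomial_eq_0)
  also have "\<dots> = ?t 0 + (\<Sum>r\<le>l. of_nat (l choose Suc r) * ?t (Suc r))"
    by (simp only: sum.atMost_Suc_shift) simp
  also have "(\<Sum>r\<le>l. of_nat (l choose r) * ?t (Suc r)) + (?t 0 + (\<Sum>r\<le>l. of_nat (l choose Suc r) * ?t (Suc r))) =
      ?t 0 + (\<Sum>r\<le>l. of_nat (Suc l choose Suc r) * ?t (Suc r))"
    by (simp add: sum.distrib distrib_right)
  also have "\<dots> = (\<Sum>r\<le>Suc l. of_nat (Suc l choose r) * ?t r)"
    by (simp only: sum.atMost_Suc_shift) simp
  finally show ?case by (simp only: mult.assoc)
qed simp

text \<open>The Leibniz sum stops after two terms. For d/dp_1 and p = p_1 the second one is the
  origin of F_(k+1,1^(l-1)) in the definition of G.\<close>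

lemma derivation_power_mult_linear:
  assumes "ring_derivation \<delta>" "\<delta> (\<delta> p) = 0"
  shows "(\<delta> ^^ l) (p * y) = p * (\<delta> ^^ l) y + of_nat l * (\<delta> p * (\<delta> ^^ (l - 1)) y)"
proof (induction l)
  case (Suc l)
  interpret \<delta>: ring_derivation \<delta> by fact
  show ?case using Suc by (cases l) (simp_all add: \<delta>.add \<delta>.mult assms(2) algebra_simps)
qed simp

lemma (in ring_derivation) ring_power_sum: "(\<delta> ^^ l) (\<Sum>i\<in>I. f i) = (\<Sum>i\<in>I. (\<delta> ^^ l) (f i))"
  by (induction l) (simp_all add: sum)

lemma (in ring_derivation) ring_power_add: "(\<delta> ^^ l) (x + y) = (\<delta> ^^ l) x + (\<delta> ^^ l) y"
  by (induction l) (simp_all add: add)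

lemma (in ring_derivation) ring_power_of_nat: "(\<delta> ^^ l) (of_nat c * x) = of_nat c * (\<delta> ^^ l) x"
  by (induction l) simp_all

lemma (in ring_derivation) ring_power_cmult: "\<delta> c = 0 \<Longrightarrow> (\<delta> ^^ l) (c * x) = c * (\<delta> ^^ l) x"
  by (induction l) (simp_all add: mult)

lemma (in ring_derivation) ring_power_const: "\<delta> c = 0 \<Longrightarrow> (\<delta> ^^ l) c = (if l = 0 then c else 0)"
proof (induction l)
  case (Suc l)
  then show ?case by (cases l) simp_all
qed simp

abbreviation pder :: "nat \<Rightarrow> (gen, rat) mpoly fps \<Rightarrow> (gen, rat) mpoly fps" where
  "pder i \<equiv> fps_cw (pdiff (GP i))"

abbreviation cst :: "(gen, rat) mpoly \<Rightarrow> (gen, rat) mpoly fps" where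
  "cst \<equiv> fps_const"

interpretation pder: ring_derivation "pder i" for i
  by (rule tau.ring_derivation_pd)

abbreviation FT :: "nat multiset \<Rightarrow> (gen, rat) mpoly fps" where
  "FT \<equiv> tau.FS"

lemma pder_cst: "pder i (cst c) = cst (pdiff (GP i) c)"
  by (rule fps_ext) simp

lemma pder_power_FT: "(pder 1 ^^ l) (FT mu) = FT (mu + replicate_mset l 1)"
  by (induction l) (simp_all only: funpow.simps comp_apply id_apply tau.pd_FS replicate_mset_0 add_0_right replicate_mset_Suc union_mset_add_mset_right)

lemma pder_power_FT_single: "(pder 1 ^^ l) (FT {#m#}) = FT (hook m l)"
  by (simp only: pder_power_FT) (simp add: hook_def)

lemma fps_cw_alg: "fps_cw (alg i) x = of_nat i * pder i x"
  by (rule fps_ext) (simp add: alg_def fps_of_nat[symmetric])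

text \<open>The l-th derivative in p_1 of tau^(-1) L_k tau, written in F: second derivatives of
  \<open>tau\<close> give F_(i,j) + F_i F_j.\<close>

definition vir_log :: "nat \<Rightarrow> nat \<Rightarrow> nat \<Rightarrow> (gen, rat) mpoly fps" where
  "vir_log M k l = (\<Sum>i=1..M. cst (pvar i) * (of_nat (i + k) * FT (hook (i + k) l)))
     + of_nat (l * (k + 1)) * FT (hook (k + 1) (l - 1)) + cst (Var GU + Var GV) * (of_nat k * FT (hook k l))
     + (\<Sum>i\<in>{1..<k}. of_nat (i * (k - i)) * (FT ({#i, k - i#} + replicate_mset l 1)
         + (\<Sum>r\<le>l. of_nat (l choose r) * FT (hook i r) * FT (hook (k - i) (l - r)))))
     + (if k = 0 \<and> l = 0 then cst (Var GU * Var GV) else 0)"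

lemma fps_cw_vir: "fps_cw (vir M k) tau = tau * vir_log M k 0"
proof -
  have 1: "fps_cw (alg i) tau = tau * (of_nat i * FT {#i#})" for i
    using tau.pd_tauS[of i] by (simp add: fps_cw_alg tauS_tau mult_ac)
  have 2: "fps_cw (alg i) (fps_cw (alg j) tau) = tau * (of_nat (i * j) * (FT {#i, j#} + FT {#i#} * FT {#j#}))" for i j
  proof -
    have "fps_cw (alg i) (fps_cw (alg j) tau) = of_nat i * (of_nat j * (pder i tau * FT {#j#} + tau * pder i (FT {#j#})))"
      unfolding 1 by (simp add: fps_cw_alg pder.mult algebra_simps)
    then show ?thesis
      using tau.pd_tauS[of i] by (simp add: tauS_tau tau.pd_FS algebra_simps)
  qed
  have "fps_cw (vir M k) tau = (\<Sum>i=1..M. cst (pvar i) * fps_cw (alg (i + k)) tau) + cst (Var GU + Var GV) * fps_cw (alg k) tau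
     + (\<Sum>i\<in>{1..<k}. fps_cw (alg i) (fps_cw (alg (k - i)) tau)) + (if k = 0 then cst (Var GU * Var GV) else 0) * tau"
    by (rule fps_ext) (simp add: vir_def fps_sum_nth)
  then show ?thesis
    unfolding 2 unfolding 1 vir_log_def hook_def by (simp add: distrib_left sum_distrib_left mult_ac del: fps_const_add of_nat_add)
qed

lemma FT_nth_0: "fps_nth (FT mu) 0 = 0"
proof (induction mu)
  case (add x mu)
  then show ?case by (simp flip: tau.pd_FS)
qed (simp add: tau.FS_def log_series_def)

text \<open>\<open>tau\<close> times the difference of the two sides is the constraint for
  \<open>tau\<close>, known through order n + 1 when \<open>M\<close> \<ge> n.\<close>

lemma virasoro_log_0:
  assumes "M \<ge> n"
  shows "fps_nth (of_nat (k + 1) * FT {#k + 1#}) (Suc n) = fps_nth (vir_log M k 0) n"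
proof -
  let ?g = "of_nat (k + 1) * FT {#k + 1#} - fps_X * vir_log M k 0"
  have "tau * ?g = fps_cw (alg (k + 1)) tau - fps_X * fps_cw (vir M k) tau"
    using tau.pd_tauS[of "k + 1"] unfolding fps_cw_vir by (simp add: fps_cw_alg tauS_tau right_diff_distrib mult_ac)
  moreover have "fps_nth (fps_cw (alg (k + 1)) tau - fps_X * fps_cw (vir M k) tau) i = 0" if "i \<le> Suc n" for i
  proof (cases i)
    case (Suc j)
    then show ?thesis using tau_vir[of j M k] that assms by simp
  qed (simp add: tau_0)
  ultimately have "fps_nth (tau * ?g) i = 0" if "i \<le> Suc n" for i
    using that by (simp only:)
  from fps_unit_cancel[OF tau_0 this order_refl] have "fps_nth ?g (Suc n) = 0" .
  then show ?thesis by simp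
qed

lemma fps_cw_power_nth: "fps_nth ((fps_cw f ^^ l) x) n = (f ^^ l) (fps_nth x n)" for f :: "'a \<Rightarrow> 'a"
  by (induction l) simp_all

text \<open>Differentiation l times in p_1; \<open>M\<close> \<ge> 1 makes p_1 occur in the cut sum,
  so the extra Leibniz term is really there.\<close>

lemma virasoro_log:
  assumes "M \<ge> n" "M \<ge> 1"
  shows "fps_nth (of_nat (k + 1) * FT (hook (k + 1) l)) (Suc n) = fps_nth (vir_log M k l) n"
proof -
  have z: "pder 1 (cst (Var GU + Var GV)) = 0" "pder 1 (cst (Var GU * Var GV)) = 0"
    by (simp_all only: pder_cst pdiff_add pdiff_mult pdiff_Var) simp_all
  have h0: "hook m 0 + replicate_mset l 1 = hook m l" for m l
    by (simp add: hook_def)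
  have h: "(pder 1 ^^ l) (FT (hook m 0)) = FT (hook m l)" for m l
    by (simp only: hook_def replicate_mset_0 pder_power_FT) simp
  have p: "(pder 1 ^^ l) (cst (pvar i) * (of_nat (i + k) * FT (hook (i + k) 0))) =
     cst (pvar i) * (of_nat (i + k) * FT (hook (i + k) l)) + (if i = 1 then of_nat (l * (k + 1)) * FT (hook (k + 1) (l - 1)) else 0)" for i
  proof -
    have q: "pder 1 (cst (pvar i)) = (if i = 1 then 1 else 0)" by (simp add: pder_cst pdiff_Var)
    have "pder 1 (pder 1 (cst (pvar i))) = 0" unfolding q by simp
    from derivation_power_mult_linear[OF tau.ring_derivation_pd this, of l "of_nat (i + k) * FT (hook (i + k) 0)"]
    have "(pder 1 ^^ l) (cst (pvar i) * (of_nat (i + k) * FT (hook (i + k) 0))) = cst (pvar i) * (of_nat (i + k) * FT (hook (i + k) l))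
      + of_nat l * ((if i = 1 then 1 else 0) * (of_nat (i + k) * FT (hook (i + k) (l - 1))))"
      by (simp only: q pder.ring_power_of_nat h)
    then show ?thesis by (simp only:) (simp add: algebra_simps)
  qed
  have "(pder 1 ^^ l) (vir_log M k 0) = vir_log M k l"
    using assms(2) h0
    unfolding vir_log_def pder.ring_power_add pder.ring_power_sum p pder.ring_power_of_nat pder.ring_power_cmult[OF z(1)]
    by (simp add: sum.distrib pder_power_FT h derivation_power_mult[OF tau.ring_derivation_pd] pder.ring_power_const[OF z(2)]
        pder.ring_power_const[OF pder.zero] del: One_nat_def)
  moreover have "(pder 1 ^^ l) (of_nat (k + 1) * FT {#k + 1#}) = of_nat (k + 1) * FT (hook (k + 1) l)"
    by (simp only: pder.ring_power_of_nat pder_power_FT_single)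
  moreover have "fps_nth ((pder 1 ^^ l) (of_nat (k + 1) * FT {#k + 1#})) (Suc n) = fps_nth ((pder 1 ^^ l) (vir_log M k 0)) n"
    unfolding fps_cw_power_nth virasoro_log_0[OF assms(1)] ..
  ultimately show ?thesis by simp
qed

text \<open>The operator t d/dt - sum of p_i i d/dp_i is a derivation that annihilates
  \<open>tau\<close> up to the cut, and its action on the coefficient of t^n depends on n.\<close>

lemma euler_log:
  assumes "n \<le> M"
  shows "of_nat n * fps_nth (FT {#}) n = (\<Sum>i=1..M. pvar i * (of_nat i * fps_nth (FT {#i#}) n))"
proof -
  define \<delta> where "\<delta> n f = of_nat n * f - (\<Sum>i=1..M. pvar i * alg i f)" for n f
  define D where "D g = fps_X * fps_deriv g - (\<Sum>i=1..M. cst (pvar i) * fps_cw (alg i) g)" for g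
  have nth: "fps_nth (D g) n = \<delta> n (fps_nth g n)" for g n
    by (cases n) (simp_all add: D_def \<delta>_def fps_sum_nth)
  have "ring_derivation D"
  proof
    show "D (x + y) = D x + D y" for x y
      by (rule fps_ext) (simp add: nth \<delta>_def alg.add algebra_simps sum.distrib)
    show "D (x * y) = D x * y + x * D y" for x y
    proof -
      have m: "fps_cw (alg i) (x * y) = fps_cw (alg i) x * y + x * fps_cw (alg i) y" for i
        by (simp add: fps_cw_alg pder.mult algebra_simps)
      show ?thesis unfolding D_def m fps_deriv_mult
        by (simp add: algebra_simps sum.distrib sum_distrib_left sum_distrib_right)
    qed
  qed
  then have "tau * D (log_series tau) = D tau"
  proof (rule log_series_derivation[where \<delta> = \<delta>, OF tau_0 _ nth])
    show "\<delta> n (x + y) = \<delta> n x + \<delta> n y" for n x y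
      by (simp add: \<delta>_def alg.add algebra_simps sum.distrib)
    show "\<delta> n (Const c * x) = Const c * \<delta> n x" for n c x
      unfolding \<delta>_def alg_Const_mult by (simp add: algebra_simps sum_distrib_left)
  qed
  moreover have "fps_nth (D tau) i = 0" if "i \<le> M" for i
    using tau_euler[OF that] by (simp add: nth \<delta>_def)
  ultimately have "fps_nth (D (log_series tau)) n = 0"
    using fps_unit_cancel[OF tau_0, of M "D (log_series tau)" n] assms by simp
  then show ?thesis
    unfolding nth \<delta>_def by (simp add: tau.FS_def tauS_tau alg_def)
qed

lemma euler_log_deriv:
  assumes "n \<le> M" "1 \<le> k" "k \<le> M"
  shows "of_nat n * fps_nth (FT {#k#}) n = of_nat k * fps_nth (FT {#k#}) n
     + (\<Sum>i=1..M. pvar i * (of_nat i * fps_nth (FT {#i, k#}) n))"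
proof -
  have nth: "pdiff (GP k) (fps_nth (FT mu) n) = fps_nth (FT (add_mset k mu)) n" for mu
    using arg_cong[OF tau.pd_FS[of k mu], of "\<lambda>f. fps_nth f n"] by simp
  have "of_nat n * fps_nth (FT {#k#}) n = pdiff (GP k) (of_nat n * fps_nth (FT {#}) n)"
    by (simp add: nth)
  also have "\<dots> = (\<Sum>i=1..M. (if k = i then of_nat k * fps_nth (FT {#k#}) n else 0) + pvar i * (of_nat i * fps_nth (FT {#i, k#}) n))"
    unfolding euler_log[OF assms(1)] pdiff.sum
    by (intro sum.cong refl) (simp add: pdiff_mult pdiff_Var nth add_mset_commute)
  finally show ?thesis using assms by (simp add: sum.distrib)
qed

text \<open>The constraint k = 0 and Euler's relation combine to F_1 = t^2 dF/dt + u v t. A further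
  derivative removes u v t, which is why another index j must be present.\<close>

lemma FT_add_1:
  "FT (add_mset 1 (add_mset j mu)) = fps_X ^ 2 * fps_deriv (FT (add_mset j mu))"
proof (induction mu arbitrary: j)
  case empty
  have "fps_nth (FT {#1#}) (Suc n) = of_nat n * fps_nth (FT {#}) n + (if n = 0 then Var GU * Var GV else 0)" for n
    using virasoro_log[of n "Suc n" 0 0] euler_log[of n "Suc n"]
    by (simp add: vir_log_def hook_def fps_sum_nth fps_of_nat[symmetric])
  then have *: "FT {#1#} = fps_X ^ 2 * fps_deriv (FT {#}) + fps_X * cst (Var GU * Var GV)"
  proof -
    have "fps_nth (FT {#1#}) n = fps_nth (fps_X ^ 2 * fps_deriv (FT {#}) + fps_X * cst (Var GU * Var GV)) n" for n
    proof (cases n)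
      case (Suc m)
      show ?thesis
        unfolding Suc \<open>\<And>n. fps_nth (FT {#1#}) (Suc n) = _ n\<close>
        by (cases m) (simp_all add: fps_X_power_mult_nth)
    qed (simp add: FT_nth_0)
    then show ?thesis by (rule fps_ext)
  qed
  have "FT {#1, j#} = pder j (FT {#1#})"
    by (simp only: tau.pd_FS add_mset_commute)
  also have "\<dots> = fps_X ^ 2 * fps_deriv (pder j (FT {#}))"
    unfolding * by (rule fps_ext) (simp add: fps_X_power_mult_nth fps_X_mult_nth pdiff_mult pdiff_Var pdiff.diff)
  finally show ?case by (simp add: tau.pd_FS)
next
  case (add x mu)
  have "FT (add_mset 1 (add_mset j (add_mset x mu))) = pder j (FT (add_mset 1 (add_mset x mu)))"
    by (simp only: tau.pd_FS add_mset_commute)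
  also have "\<dots> = fps_X ^ 2 * fps_deriv (pder j (FT (add_mset x mu)))"
    unfolding add by (rule fps_ext) (simp add: fps_X_power_mult_nth pdiff_mult pdiff.diff)
  finally show ?case by (simp only: tau.pd_FS)
qed

subsection \<open>The projection and the operator \<open>T\<close>\<close>

lemma hom_eval_mpoly:
  assumes "coeff_hom \<psi>" "coeff_hom \<phi>"
  shows "\<psi> (eval_mpoly \<phi> f P) = eval_mpoly (\<lambda>c. \<psi> (\<phi> c)) (\<lambda>x. \<psi> (f x)) P"
proof -
  interpret A: coeff_hom \<phi> by fact
  interpret B: coeff_hom "\<lambda>c. \<psi> (\<phi> c)" by (rule coeff_hom_comp) fact+
  show ?thesis
    by (rule coeff_hom_unique[OF coeff_hom_comp[OF assms(1) A.coeff_hom_eval] B.coeff_hom_eval]) simp_all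
qed

lemma Var_neq_0 [simp]: "Var x \<noteq> (0 :: ('x, rat) mpoly)"
proof
  assume "Var x = (0 :: ('x, rat) mpoly)"
  then have "vars (Var x :: ('x, rat) mpoly) = vars (0 :: ('x, rat) mpoly)" by simp
  then show False by simp
qed

lemma Const_eq_0_iff [simp]: "(Const c :: ('b, 'a::comm_ring_1) mpoly) = 0 \<longleftrightarrow> c = 0"
proof
  assume "Const c = (0 :: ('b, 'a) mpoly)"
  then have "Poly_Mapping.lookup (Const c :: ('b, 'a) mpoly) 0 = 0" by simp
  then show "c = 0" by (simp add: Const_def)
qed simp

lemma to_fract_of_nat: "to_fract (of_nat n) = of_nat n"
  by (induction n) simp_all

lemma of_nat_coeff_eq_0 [simp]: "of_nat n = (0 :: coeff) \<longleftrightarrow> n = 0"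
proof -
  have "of_nat n = to_fract (Const (of_nat n :: rat))" by (simp only: Const_of_nat to_fract_of_nat)
  then show ?thesis unfolding \<open>of_nat n = to_fract _\<close> by (simp del: Const_of_nat)
qed

lemma p_coeff_neq_0 [simp]: "p_coeff i \<noteq> 0"
  by (simp add: p_coeff_def)

definition Pi_coeff :: "nat \<Rightarrow> (gen, rat) mpoly \<Rightarrow> coeff" where
  "Pi_coeff d f = to_fract (proj d f)"

interpretation Pi_coeff: coeff_hom "Pi_coeff d" for d
proof -
  have "coeff_hom to_fract" by unfold_locales simp_all
  then show "coeff_hom (Pi_coeff d)"
    unfolding Pi_coeff_def proj_def by (rule coeff_hom_comp) (rule Const.coeff_hom_eval)
qed

lemma Pi_coeff_simps [simp]:
  "Pi_coeff d (Const c) = to_fract (Const c)"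
  "Pi_coeff d (Var GU) = u_coeff" "Pi_coeff d (Var GV) = v_coeff"
  "Pi_coeff d (Var (GP i)) = (if i > d then 0 else p_coeff i)"
  by (simp_all add: Pi_coeff_def proj_def u_coeff_def v_coeff_def p_coeff_def)

interpretation Pi_fps: coeff_hom "fps_cw (Pi_coeff d)" for d
  by (rule coeff_hom_fps_cw) (rule Pi_coeff.coeff_hom_axioms)

text \<open>Laurent series, because t^(-1) occurs in the definition of G.\<close>

definition Pi_fls :: "nat \<Rightarrow> (gen, rat) mpoly fps \<Rightarrow> coeff fls" where
  "Pi_fls d x = fps_to_fls (fps_cw (Pi_coeff d) x)"

interpretation Pi_fls: coeff_hom "Pi_fls d" for d
  unfolding Pi_fls_def
  by (rule coeff_hom_comp[OF _ Pi_fps.coeff_hom_axioms]) (unfold_locales, simp_all add: fls_times_fps_to_fls)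

lemma Pi_fps_cst: "fps_cw (Pi_coeff d) (cst c) = fps_const (Pi_coeff d c)"
  by (rule fps_ext) simp

lemma Pi_fls_cst [simp]: "Pi_fls d (cst c) = fls_const (Pi_coeff d c)"
  by (simp only: Pi_fls_def Pi_fps_cst fps_const_to_fls)

abbreviation FP :: "nat \<Rightarrow> nat multiset \<Rightarrow> coeff fls" where
  "FP d mu \<equiv> Pi_fls d (FT mu)"

lemma Fpi_FP: "fps_to_fls (Fpi d k) = FP d {#k#}"
proof -
  have "Fpi d k = fps_cw (Pi_coeff d) (FT {#k#})"
    by (rule fps_ext) (simp add: Fpi_def Pi_coeff_def tau.FS_def tauS_tau)
  then show ?thesis by (simp only: Pi_fls_def)
qed

lemma FP_hook_Suc:
  "FP d (hook m (Suc l)) = fls_X ^ 2 * fls_deriv (FP d (hook m l))"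
proof -
  have D: "fps_cw (Pi_coeff d) (fps_deriv x) = fps_deriv (fps_cw (Pi_coeff d) x)" for x
    by (rule fps_ext) (simp add: Pi_coeff.hom_mult Pi_coeff.hom_of_nat Pi_coeff.hom_add)
  have X: "fps_cw (Pi_coeff d) fps_X = fps_X"
    by (rule fps_ext) (simp add: fps_X_def)
  have "FT (hook m (Suc l)) = fps_X ^ 2 * fps_deriv (FT (hook m l))"
    using FT_add_1[of m "replicate_mset l 1"] by (simp add: hook_def add_mset_commute)
  then show ?thesis
    by (simp only: Pi_fls_def Pi_fps.hom_mult Pi_fps.hom_power D X fls_times_fps_to_fls fps_to_fls_power fls_deriv_fps_to_fls fps_X_to_fls)
qed

interpretation T: coeff_hom "T_op X" for X
  unfolding T_op_def by (rule coeff_hom.coeff_hom_eval[OF coeff_hom_id])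

lemma T_Const [simp]: "T_op X (Const c) = c"
  unfolding T_op_def by (rule coeff_hom.eval_Const[OF coeff_hom_id])

lemma T_coeff_adm [simp]: "T_op X (coeff_adm c) = fls_const c"
  by (simp add: coeff_adm_def)

lemma T_hook: "1 \<le> m \<Longrightarrow> T_op X (Var (hook m l)) = ((\<lambda>f. fls_X ^ 2 * fls_deriv f) ^^ l) (fps_to_fls (X m))"
  unfolding T_op_def coeff_hom.eval_Var[OF coeff_hom_id] by simp

lemma T_Fpi_hook:
  assumes "1 \<le> m"
  shows "T_op (Fpi d) (Var (hook m l)) = FP d (hook m l)"
proof -
  have "((\<lambda>f. fls_X ^ 2 * fls_deriv f) ^^ l) (FP d {#m#}) = FP d (hook m l)"
  proof (induction l)
    case (Suc l)
    then show ?case by (simp only: funpow.simps comp_apply FP_hook_Suc)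
  qed (simp add: hook_def)
  then show ?thesis by (simp only: T_hook[OF assms] Fpi_FP)
qed

interpretation rat_adm: coeff_hom rat_adm
  by unfold_locales
     (simp_all add: rat_adm_def coeff_adm_def Const_add Const_mult fls_plus_const[symmetric] fls_const_mult_const[symmetric] del: fls_plus_const fls_const_mult_const)

text \<open>Going through admissible expressions and going through the series F are two evaluations
  of \<open>P\<close>; they agree on constants and, by assumption, on the variables of
  \<open>P\<close>.\<close>

lemma T_eval_rat_adm:
  assumes "\<And>mu. mu \<in> vars P \<Longrightarrow> T_op (Fpi d) (h mu) = FP d mu"
  shows "T_op (Fpi d) (eval_mpoly rat_adm h P) = Pi_fls d (tau.ev P)"
proof -
  interpret TR: coeff_hom "\<lambda>q. T_op X (rat_adm q)" for X
    by (rule coeff_hom_comp[OF T.coeff_hom_axioms rat_adm.coeff_hom_axioms])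
  have "T_op (Fpi d) (eval_mpoly rat_adm h P) = eval_mpoly (\<lambda>q. T_op (Fpi d) (rat_adm q)) (\<lambda>mu. T_op (Fpi d) (h mu)) P"
    by (rule hom_eval_mpoly[OF T.coeff_hom_axioms rat_adm.coeff_hom_axioms])
  also have "\<dots> = eval_mpoly (\<lambda>q. T_op (Fpi d) (rat_adm q)) (FP d) P"
    using assms by (rule TR.eval_cong)
  also have "(\<lambda>q. T_op (Fpi d) (rat_adm q)) = (\<lambda>q. Pi_fls d (tau.ratc q))"
    by (simp add: fun_eq_iff rat_adm_def)
  also have "eval_mpoly (\<lambda>q. Pi_fls d (tau.ratc q)) (FP d) P = Pi_fls d (tau.ev P)"
    by (rule hom_eval_mpoly[OF Pi_fls.coeff_hom_axioms tau.coeff_hom_ratc, symmetric])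
  finally show ?thesis .
qed

lemma fls_X_inv_X: "fls_X_inv * fls_X = (1 :: coeff fls)"
  by (simp flip: fls_inverse_X)

text \<open>At each order some large cut is valid, and the projection reduces it to d. The
  constraint becomes an identity of whole series, which can be multiplied by t^(-1).\<close>

lemma virasoro_FP:
  assumes "d \<ge> 1"
  shows "fls_X_inv * (of_nat (k + 1) * FP d (hook (k + 1) l)) =
    (\<Sum>i=1..d. fls_const (p_coeff i) * (of_nat (i + k) * FP d (hook (i + k) l)))
     + of_nat (l * (k + 1)) * FP d (hook (k + 1) (l - 1)) + fls_const (u_coeff + v_coeff) * (of_nat k * FP d (hook k l))
     + (\<Sum>i\<in>{1..<k}. of_nat (i * (k - i)) * (FP d ({#i, k - i#} + replicate_mset l 1)
         + (\<Sum>r\<le>l. of_nat (l choose r) * FP d (hook i r) * FP d (hook (k - i) (l - r)))))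
     + (if k = 0 \<and> l = 0 then fls_const (u_coeff * v_coeff) else 0)" (is "_ = ?rhs")
proof -
  let ?P = "fps_cw (Pi_coeff d)"
  have trunc: "?P (vir_log M k l) = ?P (vir_log d k l)" if "M \<ge> d" for M
  proof -
    have "?P (\<Sum>i=1..M. cst (pvar i) * (of_nat (i + k) * FT (hook (i + k) l))) =
       ?P (\<Sum>i=1..d. cst (pvar i) * (of_nat (i + k) * FT (hook (i + k) l)))"
      unfolding Pi_fps.hom_sum Pi_fps.hom_mult Pi_fps_cst using that
      by (intro sum.mono_neutral_right) auto
    then show ?thesis by (simp only: vir_log_def Pi_fps.hom_add)
  qed
  have "?P (of_nat (k + 1) * FT (hook (k + 1) l)) = fps_X * ?P (vir_log d k l)"
  proof (rule fps_ext)
    fix n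
    show "fps_nth (?P (of_nat (k + 1) * FT (hook (k + 1) l))) n = fps_nth (fps_X * ?P (vir_log d k l)) n"
    proof (cases n)
      case 0
      then show ?thesis by (simp add: FT_nth_0)
    next
      case (Suc n')
      have "fps_nth (?P (of_nat (k + 1) * FT (hook (k + 1) l))) n = fps_nth (?P (vir_log (max d n') k l)) n'"
      proof -
        have "n' \<le> max d n'" "1 \<le> max d n'" using assms by auto
        from virasoro_log[OF this, of k l] show ?thesis by (simp only: Suc fps_cw_nth)
      qed
      also have "?P (vir_log (max d n') k l) = ?P (vir_log d k l)"
        by (rule trunc) simp
      finally show ?thesis unfolding Suc by simp
    qed
  qed
  then have "Pi_fls d (of_nat (k + 1) * FT (hook (k + 1) l)) = fls_X * Pi_fls d (vir_log d k l)"
    by (simp only: Pi_fls_def fls_times_fps_to_fls fps_X_to_fls)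
  then have "fls_X_inv * Pi_fls d (of_nat (k + 1) * FT (hook (k + 1) l)) = Pi_fls d (vir_log d k l)"
    by (simp only: mult.assoc[symmetric] fls_X_inv_X mult_1)
  also have "Pi_fls d (vir_log d k l) = ?rhs"
  proof -
    have "(\<Sum>i=1..d. fls_const (Pi_coeff d (pvar i)) * (of_nat (i + k) * FP d (hook (i + k) l))) =
      (\<Sum>i=1..d. fls_const (p_coeff i) * (of_nat (i + k) * FP d (hook (i + k) l)))"
      by (intro sum.cong) auto
    then show ?thesis
      unfolding vir_log_def Pi_fls.hom_add Pi_fls.hom_sum Pi_fls.hom_mult Pi_fls.hom_of_nat Pi_fls_cst
      by (simp only:) (simp add: Pi_coeff.hom_add Pi_coeff.hom_mult)
  qed
  finally show ?thesis by (simp only: Pi_fls.hom_mult Pi_fls.hom_of_nat)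
qed

lemma euler_FP:
  assumes "1 \<le> k" "k \<le> d"
  shows "fls_X * fls_deriv (FP d {#k#}) = of_nat k * FP d {#k#}
     + (\<Sum>i=1..d. fls_const (p_coeff i) * (of_nat i * FP d {#i, k#}))"
proof -
  let ?P = "fps_cw (Pi_coeff d)"
  have "fps_X * fps_deriv (?P (FT {#k#})) = of_nat k * ?P (FT {#k#}) + (\<Sum>i=1..d. fps_const (p_coeff i) * (of_nat i * ?P (FT {#i, k#})))"
  proof (rule fps_ext)
    fix n
    let ?M = "max d n"
    have "fps_nth (fps_X * fps_deriv (?P (FT {#k#}))) n = Pi_coeff d (of_nat n * fps_nth (FT {#k#}) n)"
      by (cases n) (simp_all add: Pi_coeff.hom_mult Pi_coeff.hom_of_nat Pi_coeff.hom_add)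
    also have "\<dots> = of_nat k * Pi_coeff d (fps_nth (FT {#k#}) n) +
        (\<Sum>i=1..?M. Pi_coeff d (pvar i) * (of_nat i * Pi_coeff d (fps_nth (FT {#i, k#}) n)))"
      using assms by (subst euler_log_deriv[of n ?M k])
        (simp_all add: Pi_coeff.hom_add Pi_coeff.hom_mult Pi_coeff.hom_sum Pi_coeff.hom_of_nat)
    also have "(\<Sum>i=1..?M. Pi_coeff d (pvar i) * (of_nat i * Pi_coeff d (fps_nth (FT {#i, k#}) n))) =
       (\<Sum>i=1..d. p_coeff i * (of_nat i * Pi_coeff d (fps_nth (FT {#i, k#}) n)))"
      by (intro sum.mono_neutral_cong_right) auto
    finally show "fps_nth (fps_X * fps_deriv (?P (FT {#k#}))) n =
      fps_nth (of_nat k * ?P (FT {#k#}) + (\<Sum>i=1..d. fps_const (p_coeff i) * (of_nat i * ?P (FT {#i, k#})))) n"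
      by (simp add: fps_sum_nth fps_of_nat[symmetric])
  qed
  then have "fps_to_fls (fps_X * fps_deriv (?P (FT {#k#}))) =
    fps_to_fls (of_nat k * ?P (FT {#k#}) + (\<Sum>i=1..d. fps_const (p_coeff i) * (of_nat i * ?P (FT {#i, k#}))))"
    by (rule arg_cong)
  moreover have "fps_to_fls (\<Sum>i\<in>I. f i) = (\<Sum>i\<in>I. fps_to_fls (f i))" for f :: "nat \<Rightarrow> coeff fps" and I
    by (induction I rule: infinite_finite_induct) simp_all
  ultimately show ?thesis
    unfolding Pi_fls_def by (simp add: fls_times_fps_to_fls fls_deriv_fps_to_fls)
qed

text \<open>Indices i < d - k lead to F_(i+k,1^l) with i + k < d, the next ones to earlier G, and i
  = d to the derivative that is solved for.\<close>

lemma sum_split_at: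
  assumes "k < (d::nat)" "d \<ge> 1"
  shows "(\<Sum>i=1..d. f i) = (\<Sum>i\<in>{1..<d - k}. f i) + (\<Sum>j<k. f (d + j - k)) + (f d :: 'a::comm_ring_1)"
proof -
  have "(\<Sum>i=1..d. f i) = (\<Sum>i\<in>{1..<d}. f i) + f d"
    using assms by (simp add: sum.last_plus add.commute)
  also have "(\<Sum>i\<in>{1..<d}. f i) = (\<Sum>i\<in>{1..<d - k}. f i) + (\<Sum>i\<in>{d - k..<d}. f i)"
    using assms by (intro sum.atLeastLessThan_concat[symmetric]) auto
  also have "(\<Sum>i\<in>{d - k..<d}. f i) = (\<Sum>j<k. f (d + j - k))"
    by (rule sum.reindex_bij_witness[of _ "\<lambda>j. d + j - k" "\<lambda>i. i + k - d"]) (use assms in auto)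
  finally show ?thesis .
qed

lemma FP_KP:
  assumes "0 \<notin># lam" "lam \<noteq> {#}"
  shows "Pi_fls d (tau.ev (KP lam)) = FP d lam"
  by (simp only: tau.ev_KP[OF assms])

text \<open>\<open>G_adm\<close> solves the constraint of index k = m - d for F of (m,1^l); the
  bound m \<le> 2 d - 1 keeps k < d. The induction is on m, and k + 1 < d + k since d \<ge>
  2.\<close>

theorem T_G_adm:
  assumes d: "d \<ge> 2" and m: "1 \<le> m" "m \<le> 2 * d - 1"
  shows "T_op (Fpi d) (G_adm d m l) = FP d (hook m l)"
  using m
proof (induction m arbitrary: l rule: less_induct)
  case (less m)
  show ?case
  proof (cases "m < d")
    case True
    then show ?thesis using less.prems by (simp add: G_adm.simps[of d m l] T_Fpi_hook)
  next
    case False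
    define k where "k = m - d"
    have k: "m = d + k" "k < d" using False less.prems d by (auto simp: k_def)
    let ?T = "T_op (Fpi d)"
    have T1: "?T (G_adm d (k + 1) l') = FP d (hook (k + 1) l')" for l'
      using less.IH[of "k + 1"] k d by auto
    have T2: "?T (G_adm d (d + j) l) = FP d (hook (d + j) l)" if "j < k" for j
      using less.IH[of "d + j"] that k d by auto
    have T3: "of_nat k * ?T (Var (hook k l)) = of_nat k * FP d (hook k l)"
      by (cases "k = 0") (simp_all add: T_Fpi_hook)
    have KP: "?T (eval_mpoly rat_adm Var (KP ({#i, k - i#} + replicate_mset l 1))) = FP d ({#i, k - i#} + replicate_mset l 1)"
      if "i \<in> {1..<k}" for i
    proof -
      have lam: "0 \<notin># {#i, k - i#} + replicate_mset l 1" "{#i, k - i#} + replicate_mset l 1 \<noteq> {#}"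
        using that by (auto simp: count_eq_zero_iff)
      have "?T (Var mu) = FP d mu" if "mu \<in> vars (KP ({#i, k - i#} + replicate_mset l 1))" for mu
      proof -
        have "mu \<in> hooks (sum_mset ({#i, k - i#} + replicate_mset l 1) - size ({#i, k - i#} + replicate_mset l 1))
            (min 1 (size ({#i, k - i#} + replicate_mset l 1) - 1))"
          using vars_KP[OF lam] that by (rule subsetD)
        then obtain m l' where "mu = hook m l'" "1 \<le> m" by (auto simp: hooks_def)
        then show ?thesis by (simp only: T_Fpi_hook)
      qed
      from T_eval_rat_adm[of "KP ({#i, k - i#} + replicate_mset l 1)" d Var, OF this] show ?thesis
        by (simp only: FP_KP[OF lam])
    qed
    have KPsum: "(\<Sum>i\<in>{1..<k}. of_nat (i * (k - i)) * ((\<Sum>r\<le>l. of_nat (l choose r) * ?T (Var (hook i r)) * ?T (Var (hook (k - i) (l - r))))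
              + ?T (eval_mpoly rat_adm Var (KP ({#i, k - i#} + replicate_mset l 1))))) =
       (\<Sum>i\<in>{1..<k}. of_nat (i * (k - i)) * ((\<Sum>r\<le>l. of_nat (l choose r) * FP d (hook i r) * FP d (hook (k - i) (l - r)))
              + FP d ({#i, k - i#} + replicate_mset l 1)))" (is "?S1 = ?S1'")
      by (intro sum.cong refl arg_cong2[of _ _ _ _ "(*)"] arg_cong2[of _ _ _ _ "(+)"] KP) (auto intro!: T_Fpi_hook)
    have Vsum: "(\<Sum>i\<in>{1..<d - k}. of_nat (i + k) * fls_const (p_coeff i) * ?T (Var (hook (i + k) l))) =
       (\<Sum>i\<in>{1..<d - k}. of_nat (i + k) * fls_const (p_coeff i) * FP d (hook (i + k) l))" (is "?S2 = ?S2'")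
      by (intro sum.cong refl) (simp add: T_Fpi_hook)
    have Gsum: "(\<Sum>j<k. of_nat (d + j) * fls_const (p_coeff (d + j - k)) * ?T (G_adm d (d + j) l)) =
       (\<Sum>j<k. of_nat (d + j) * fls_const (p_coeff (d + j - k)) * FP d (hook (d + j) l))" (is "?S3 = ?S3'")
      by (intro sum.cong refl) (simp add: T2)
    let ?Z = "- ?S1' + of_nat (k + 1) * fls_X_inv * FP d (hook (k + 1) l) - fls_const (u_coeff + v_coeff) * (of_nat k * FP d (hook k l))
        - of_nat (l * (k + 1)) * FP d (hook (k + 1) (l - 1)) - (if k = 0 \<and> l = 0 then fls_const (u_coeff * v_coeff) else 0) - ?S2' - ?S3'"
    have "?T (G_adm d m l) = fls_const (1 / (of_nat (d + k) * p_coeff d)) *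
       (- ?S1 + of_nat (k + 1) * fls_X_inv * ?T (G_adm d (k + 1) l) - fls_const (u_coeff + v_coeff) * (of_nat k * ?T (Var (hook k l)))
        - of_nat (l * (k + 1)) * ?T (G_adm d (k + 1) (l - 1)) - (if k = 0 \<and> l = 0 then fls_const (u_coeff * v_coeff) else 0) - ?S2 - ?S3)"
    proof -
      have "?T (if k = 0 \<and> l = 0 then coeff_adm (u_coeff * v_coeff) else 0) = (if k = 0 \<and> l = 0 then fls_const (u_coeff * v_coeff) else 0)"
        by simp
      moreover have "\<not> (m < d \<or> d < 2)" using False d by simp
      ultimately show ?thesis
        by (subst G_adm.simps)
           (simp only: if_False Let_def k_def[symmetric] T.hom_mult T.hom_add T.hom_diff T.hom_uminus T.hom_sum T.hom_of_nat T_Const T_coeff_adm mult.assoc)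
    qed
    also have "\<dots> = fls_const (1 / (of_nat (d + k) * p_coeff d)) * ?Z"
      by (simp only: T1 T3 KPsum Vsum Gsum)
    also have "?Z = fls_const (p_coeff d) * (of_nat (d + k) * FP d (hook (d + k) l))"
    proof -
      have arith: "A = B + L + U + Q + C \<Longrightarrow> B = S2 + S3 + R \<Longrightarrow> - Q + A - U - L - C - S2 - S3 = R"
        for A B C L U Q R S2 S3 :: "coeff fls" by simp
      have B: "(\<Sum>i=1..d. fls_const (p_coeff i) * (of_nat (i + k) * FP d (hook (i + k) l))) = ?S2' + ?S3' + fls_const (p_coeff d) * (of_nat (d + k) * FP d (hook (d + k) l))"
      proof -
        have "(\<Sum>j<k. fls_const (p_coeff (d + j - k)) * (of_nat (d + j - k + k) * FP d (hook (d + j - k + k) l))) = ?S3'"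
          using k by (intro sum.cong refl) (simp add: mult_ac)
        moreover have "(\<Sum>i\<in>{1..<d - k}. fls_const (p_coeff i) * (of_nat (i + k) * FP d (hook (i + k) l))) = ?S2'"
          by (intro sum.cong refl) (simp add: mult_ac)
        moreover have "d \<ge> 1" using d by simp
        ultimately show ?thesis by (simp only: sum_split_at[OF k(2)])
      qed
      have A: "of_nat (k + 1) * fls_X_inv * FP d (hook (k + 1) l) = fls_X_inv * (of_nat (k + 1) * FP d (hook (k + 1) l))"
        by (simp only: mult_ac)
      have Q: "(\<Sum>i\<in>{1..<k}. of_nat (i * (k - i)) * (FP d ({#i, k - i#} + replicate_mset l 1)
         + (\<Sum>r\<le>l. of_nat (l choose r) * FP d (hook i r) * FP d (hook (k - i) (l - r))))) = ?S1'"
        by (intro sum.cong refl) (simp only: add.commute)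
      have "d \<ge> 1" using d by simp
      then show ?thesis
        by (rule arith[OF trans[OF A virasoro_FP[of d k l, unfolded Q]] B])
    qed
    also have "fls_const (1 / (of_nat (d + k) * p_coeff d)) * (fls_const (p_coeff d) * (of_nat (d + k) * FP d (hook (d + k) l))) = FP d (hook m l)"
    proof -
      have "of_nat (d + k) \<noteq> (0::coeff)" using d by (simp del: of_nat_add)
      then have "1 / (of_nat (d + k) * p_coeff d) * (p_coeff d * of_nat (d + k)) = 1"
        by (simp del: of_nat_add)
      then have "fls_const (1 / (of_nat (d + k) * p_coeff d)) * (fls_const (p_coeff d) * fls_const (of_nat (d + k))) = 1"
        by (simp only: fls_const_mult_const fls_const_1)
      then have "fls_const (1 / (of_nat (d + k) * p_coeff d)) * (fls_const (p_coeff d) * of_nat (d + k)) = 1"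
        by (simp only: fls_of_nat)
      then show ?thesis by (simp only: mult.assoc[symmetric] k(1)) simp
    qed
    finally show ?thesis .
  qed
qed

text \<open>Hooks in the polynomial of (i,k) have largest part at most i + k - 1 \<le> 2 d - 1, the
  range where G is correct.\<close>

theorem T_KP_G:
  assumes d: "d \<ge> 2" and ik: "i \<in> {1..d}" "k \<in> {1..d}"
  shows "T_op (Fpi d) (KP_G d i k) = FP d {#i, k#}"
proof -
  have lam: "0 \<notin># {#i, k#}" "{#i, k#} \<noteq> {#}" using ik by auto
  have "T_op (Fpi d) (G_adm d (Max_mset mu) (size mu - 1)) = FP d mu" if "mu \<in> vars (KP {#i, k#})" for mu
  proof -
    have "mu \<in> hooks (sum_mset {#i, k#} - size {#i, k#}) (min 1 (size {#i, k#} - 1))"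
      using vars_KP[OF lam] that by (rule subsetD)
    then obtain m l where ml: "mu = hook m l" "1 \<le> m" "m \<le> i + k - 1" using ik by (auto simp: hooks_def)
    have "T_op (Fpi d) (G_adm d m l) = FP d (hook m l)"
      by (rule T_G_adm[OF d ml(2)]) (use ml ik d in auto)
    then show ?thesis using ml by simp
  qed
  from T_eval_rat_adm[OF this] show ?thesis
    by (simp only: KP_G_def FP_KP[OF lam])
qed

text \<open>For k \<ge> 2 this is Euler's relation for F_k. The equation E_1 is Euler's relation for
  F_d multiplied by d p_d; as F_d is not an unknown, d p_d F_d is eliminated by the constraint k =
  0.\<close>

theorem E_eq_Fpi:
  assumes d: "d \<ge> 2" and k: "k \<in> {1..d - 1}"
  shows "E_eq d (Fpi d) k = 0"
proof (cases "k = 1")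
  case False
  have "(\<Sum>i=1..d. of_nat i * fls_const (p_coeff i) * T_op (Fpi d) (KP_G d i k)) = (\<Sum>i=1..d. fls_const (p_coeff i) * (of_nat i * FP d {#i, k#}))"
    using k by (intro sum.cong refl) (subst T_KP_G[OF d], auto simp: mult_ac)
  moreover have "fls_X * fls_deriv (FP d {#k#}) = of_nat k * FP d {#k#} + (\<Sum>i=1..d. fls_const (p_coeff i) * (of_nat i * FP d {#i, k#}))"
    using k by (intro euler_FP) auto
  ultimately show ?thesis using False by (simp add: E_eq_def Let_def Fpi_FP)
next
  case True
  define y where "y i = FP d {#i#}" for i
  define c where "c = of_nat d * fls_const (p_coeff d)"
  define S where "S = (\<Sum>i=1..d-1. of_nat i * fls_const (p_coeff i) * y i)"
  have 1: "(\<Sum>i=1..d. of_nat i * fls_const (p_coeff i) * T_op (Fpi d) (KP_G d i d)) = fls_X * fls_deriv (y d) - of_nat d * y d"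
  proof -
    have "(\<Sum>i=1..d. of_nat i * fls_const (p_coeff i) * T_op (Fpi d) (KP_G d i d)) = (\<Sum>i=1..d. fls_const (p_coeff i) * (of_nat i * FP d {#i, d#}))"
      using d by (intro sum.cong refl) (subst T_KP_G[OF d], auto simp: mult_ac)
    then show ?thesis using euler_FP[of d d] d by (simp add: y_def)
  qed
  have 2: "c * y d = fls_X_inv * y 1 - fls_const (u_coeff * v_coeff) - S"
  proof -
    have "(\<Sum>i=1..d. fls_const (p_coeff i) * (of_nat i * y i)) = S + c * y d"
    proof -
      have "{1..d} = insert d {1..d-1}" using d by auto
      then show ?thesis using d by (simp add: S_def c_def mult_ac)
    qed
    then show ?thesis using virasoro_FP[of d 0 0] d by (simp add: hook_def y_def)
  qed
  have dS: "fls_deriv (\<Sum>i\<in>I. f i) = (\<Sum>i\<in>I. fls_deriv (f i))" for f :: "nat \<Rightarrow> coeff fls" and I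
    by (induction I rule: infinite_finite_induct) simp_all
  have dc: "fls_deriv c = 0" "fls_deriv (of_nat i * fls_const (p_coeff i)) = 0" for i
    by (simp_all add: c_def)
  \<comment> \<open>\<open>c\<close> does not depend on t, so the eliminated form can be
    differentiated directly.\<close>
  have 3: "c * fls_deriv (y d) = - (fls_X_inv ^ 2 * y 1) + fls_X_inv * fls_deriv (y 1) - (\<Sum>i=1..d-1. of_nat i * fls_const (p_coeff i) * fls_deriv (y i))"
  proof -
    have "fls_deriv (c * y d) = c * fls_deriv (y d)" by (simp add: dc)
    moreover have "fls_deriv (fls_X_inv * y 1 - fls_const (u_coeff * v_coeff) - S) =
       - (fls_X_inv ^ 2 * y 1) + fls_X_inv * fls_deriv (y 1) - (\<Sum>i=1..d-1. of_nat i * fls_const (p_coeff i) * fls_deriv (y i))"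
      by (simp add: S_def dS dc del: fls_const_mult_const)
    ultimately show ?thesis using 2 by simp
  qed
  have XX: "fls_X * (fls_X_inv * z) = z" "fls_X_inv * (fls_X * z) = z" "fls_X_inv ^ 2 * (fls_X * z) = fls_X_inv * z" for z :: "coeff fls"
  proof -
    show X: "fls_X * (fls_X_inv * z) = z" for z :: "coeff fls"
      unfolding mult.assoc[symmetric] mult.commute[of fls_X] fls_X_inv_X by simp
    show Y: "fls_X_inv * (fls_X * z) = z" for z :: "coeff fls"
      unfolding mult.left_commute[of fls_X_inv] by (rule X)
    show "fls_X_inv ^ 2 * (fls_X * z) = fls_X_inv * z"
      unfolding power2_eq_square mult.assoc Y ..
  qed
  have "c * (fls_X * fls_deriv (y d) - of_nat d * y d) = fls_X * (c * fls_deriv (y d)) - of_nat d * (c * y d)"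
    by (simp add: algebra_simps)
  also have "\<dots> = - (fls_X_inv * y 1) + fls_deriv (y 1) - (\<Sum>i=1..d-1. of_nat i * fls_const (p_coeff i) * (fls_X * fls_deriv (y i)))
      - of_nat d * (fls_X_inv * y 1) + of_nat d * fls_const (u_coeff * v_coeff) + (\<Sum>i=1..d-1. of_nat i * fls_const (p_coeff i) * (of_nat d * y i))"
    unfolding 2 3 S_def by (simp add: right_diff_distrib distrib_left XX sum_distrib_left mult.left_commute[of fls_X] mult.left_commute[of "of_nat d"])
  finally have 4: "c * (fls_X * fls_deriv (y d) - of_nat d * y d) = \<dots>" .
  have "E_eq d (Fpi d) k = - (c * (fls_X * fls_deriv (y d) - of_nat d * y d)) + fls_deriv (y 1) - of_nat (d + 1) * fls_X_inv * y 1
       + (\<Sum>i=1..d-1. of_nat i * fls_const (p_coeff i) * (of_nat d * y i - fls_X * fls_deriv (y i))) + of_nat d * fls_const (u_coeff * v_coeff)"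
    unfolding True E_eq_def Let_def Fpi_FP y_def[symmetric] c_def[symmetric] 1 by (simp only: if_True simp_thms)
  also have "\<dots> = 0"
  proof -
    have "(\<Sum>i=1..d-1. of_nat i * fls_const (p_coeff i) * (of_nat d * y i - fls_X * fls_deriv (y i))) =
      (\<Sum>i=1..d-1. of_nat i * fls_const (p_coeff i) * (of_nat d * y i)) - (\<Sum>i=1..d-1. of_nat i * fls_const (p_coeff i) * (fls_X * fls_deriv (y i)))"
      unfolding right_diff_distrib sum_subtractf ..
    moreover have "of_nat (d + 1) * fls_X_inv * y 1 = of_nat d * (fls_X_inv * y 1) + fls_X_inv * y 1"
      by (simp add: algebra_simps)
    ultimately show ?thesis unfolding 4 by simp
  qed
  finally show ?thesis .
qed

lemma Fpi_nth_0: "fps_nth (Fpi d k) 0 = 0"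
  using FT_nth_0[of "{#k#}"] by (simp add: Fpi_def tau.FS_def tauS_tau proj_def)

subsection \<open>Shape of the KP polynomials\<close>

lemmas idc_eval_add = coeff_hom.eval_add[OF coeff_hom_id]
lemmas idc_eval_mult = coeff_hom.eval_mult[OF coeff_hom_id]
lemmas idc_eval_sum = coeff_hom.eval_sum[OF coeff_hom_id]
lemmas idc_eval_prod = coeff_hom.eval_prod[OF coeff_hom_id]
lemmas idc_eval_mpoly_alt = coeff_hom.eval_mpoly_alt[OF coeff_hom_id]
lemmas idc_eval_simps [simp] = coeff_hom.eval_Var[OF coeff_hom_id] coeff_hom.eval_Const[OF coeff_hom_id] coeff_hom.eval_0[OF coeff_hom_id]

lemma monom_eval_zero: "monom_eval (\<lambda>_. 0) m = (if m = 0 then 1 else 0)"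
proof (cases "m = 0")
  case False
  then obtain x where "x \<in> Poly_Mapping.keys m" using keys_eq_empty by blast
  then show ?thesis using False unfolding monom_eval_def
    by (auto intro!: prod_zero bexI[of _ x] simp: in_keys_iff zero_power card_gt_0_iff keys_eq_empty)
qed simp

lemma eval_zero: "eval_mpoly (\<lambda>c. c) (\<lambda>_. 0) P = Poly_Mapping.lookup P 0"
proof -
  have "eval_mpoly (\<lambda>c. c) (\<lambda>_. 0) P = (\<Sum>m\<in>Poly_Mapping.keys P. if m = 0 then Poly_Mapping.lookup P 0 else 0)"
    unfolding idc_eval_mpoly_alt monom_eval_zero by (intro sum.cong) auto
  then show ?thesis by (simp add: in_keys_iff)
qed

abbreviation const_term :: "('x, rat) mpoly \<Rightarrow> rat" where
  "const_term \<equiv> eval_mpoly (\<lambda>c. c) (\<lambda>_. 0)"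

lemma const_term_d_p1: "const_term (d_p1 P) = 0"
  by (simp add: d_p1_def derivation_def idc_eval_sum idc_eval_mult)

lemma const_term_hirota_gen:
  assumes "length is > 0" "\<And>P B. P \<in> even_partitions (length is) \<Longrightarrow> B \<in> P \<Longrightarrow> const_term (g (block is B)) = 0"
  shows "const_term (hirota_gen g is) = 0"
  unfolding hirota_gen_def idc_eval_sum idc_eval_prod idc_eval_mult
proof (intro sum.neutral ballI)
  fix P assume P: "P \<in> even_partitions (length is)"
  then have po: "partition_on {..<length is} P" by (simp add: even_partitions_def)
  have "P \<noteq> {}"
  proof
    assume "P = {}"
    then have "{..<length is} = {}" using po by (simp add: partition_on_def)
    then show False using assms(1) by auto
  qed
  then obtain B where B: "B \<in> P" by blast
  have "finite P" using finite_elements[OF _ po] by simp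
  moreover have "\<exists>B\<in>P. const_term 2 * const_term (g (block is B)) = 0"
  proof (rule bexI[OF _ B])
    show "const_term 2 * const_term (g (block is B)) = 0"
      unfolding assms(2)[OF P B] by (rule mult_zero_right)
  qed
  ultimately show "(\<Prod>B\<in>P. const_term 2 * const_term (g (block is B))) = 0"
    by (rule prod_zero)
qed

text \<open>Every even partition of a nonempty index set has a block, whose factor has no constant
  term by induction. For longer partitions each variable of the smaller polynomial is a hook with a
  part 1, so at least one \<open>d_p1\<close> is applied, and that leaves no constant.\<close>

lemma const_term_KP:
  assumes "0 \<notin># lam" "lam \<noteq> {#}"
  shows "const_term (KP lam) = 0"
  using assms
proof (induction lam rule: wf_induct_rule[OF wf_KP_order])
  case (1 lam)
  show ?case
  proof (cases "is_hook lam")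
    case True
    then obtain m l where ml: "lam = hook m l" "1 \<le> m" by (auto simp: is_hook_def)
    then show ?thesis by (simp add: KP_hook)
  next
    case False
    then show ?thesis
    proof (cases rule: non_hook_cases[OF False 1(2,3)])
      case (1 k l)
      have lam: "lam = {#k, l#}" by fact
      have "const_term (hirota_gen (KP_prev lam) (monom_list m)) = 0" if m: "m \<in> Poly_Mapping.keys (hirota_op k l)" for m
      proof (rule const_term_hirota_gen)
        have op: "op_mset k l (mset (monom_list m))" using keys_hirota_op[OF m] 1 by (simp add: mono_list)
        then show "length (monom_list m) > 0" unfolding op_mset_def size_mset by linarith
        fix P B assume P: "P \<in> even_partitions (length (monom_list m))" "B \<in> P"
        note bd = block_bound[OF op P]
        show "const_term (KP_prev lam (block (monom_list m) B)) = 0"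
        proof (cases "(block (monom_list m) B, lam) \<in> KP_order")
          case True
          from "1.IH"[OF this bd(1,2)] True show ?thesis by (simp add: KP_prev_def)
        qed (simp add: KP_prev_def)
      qed
      then show ?thesis
        unfolding lam KP_pair[OF 1(2,3)] hirota_poly_def hirota_hirota_gen idc_eval_mult idc_eval_sum
        by (simp add: lam)
    next
      case 2
      define q where "q = Min_mset lam"
      define mu where "mu = lam - {#q#}"
      note K = KP_more[OF False "1.prems"(1) 2, folded q_def, folded mu_def]
      have "const_term ((d_p1 ^^ (size nu - 1)) (KP_prev lam {#Max_mset nu, q#})) = 0" if nu: "nu \<in> vars (KP mu)" for nu
      proof -
        have "nu \<in> hooks (sum_mset mu - size mu) (min 1 (size mu - 1))"
          using vars_KP[OF K(8,9)] nu by (rule subsetD)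
        moreover have "min 1 (size mu - 1) = 1" using 2 K(2) by (simp add: mu_def size_Diff_singleton)
        ultimately obtain m l where "nu = hook m l" "1 \<le> l" by (auto simp: hooks_def)
        then have "size nu - 1 = Suc (l - 1)" by simp
        then show ?thesis by (simp only: funpow.simps comp_apply const_term_d_p1)
      qed
      then show ?thesis
        unfolding K(1) derivation_def idc_eval_sum idc_eval_mult by simp
    qed
  qed
qed

text \<open>Modulo smaller hooks, each known derivative of two indices with sum k + l equals H of
  the hook (k+l-1,1), by induction on l. The coefficients of the leading monomials sum to 0, so
  solving for F_(k,l) gives the same hook with coefficient 1.\<close>

lemma KP_top_aux:
  assumes "1 \<le> l" "l \<le> k"
  shows "vars (KP {#k, l#} - Var (hook (k + l - 1) 1)) \<subseteq> hooks (k + l - 3) 1"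
  using assms
proof (induction l arbitrary: k rule: less_induct)
  case (less l)
  show ?case
  proof (cases "l = 1")
    case True
    have "{#k, l#} = hook k 1" using True by (simp add: hook_def)
    then show ?thesis using less.prems True by (simp add: KP_hook)
  next
    case False
    then have kl: "k \<ge> l" "l \<ge> 2" using less.prems by auto
    define s where "s i = Poly_Mapping.single i (1::nat)" for i :: nat
    have ms: "mono_mset (s a + s b) = {#a, b#}" for a b
      by (simp add: s_def mono_mset_add)
    \<comment> \<open>For l = 2 the second and the third monomial coincide. Summing over the set
      \<open>S\<close> treats this case together with the general one.\<close>
    define S where "S = {s l + s k, s (k + 1) + s (l - 1), s 1 + s (k + l - 1)}"
    define m0 where "m0 = s l + s k"
    let ?lam = "{#k, l#}" and ?op = "hirota_op k l" and ?V = "Var (hook (k + l - 1) 1) :: (nat multiset, rat) mpoly" and ?W = "hooks (k + l - 3) 1"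
    define c where "c m = Poly_Mapping.lookup ?op m" for m
    define g where "g = KP_prev ?lam"
    have finS: "finite S" "m0 \<in> S" by (simp_all add: S_def m0_def)
    have gm0: "g (mono_mset m0) = 0"
    proof -
      have "mono_mset m0 = ?lam" by (simp add: m0_def ms add_mset_commute)
      then show ?thesis by (simp add: g_def KP_prev_def KP_order_def)
    qed
    have D: "vars (g (mono_mset m) - ?V) \<subseteq> ?W" if "m \<in> S - {m0}" for m
    proof -
      have "m = s (k + 1) + s (l - 1) \<or> m = s 1 + s (k + l - 1)" using that by (auto simp: S_def m0_def)
      then have "mono_mset m = {#k + 1, l - 1#} \<or> mono_mset m = {#k + l - 1, 1#}"
        by (auto simp: ms add_mset_commute)
      then show ?thesis
      proof
        assume m: "mono_mset m = {#k + 1, l - 1#}"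
        have "({#k + 1, l - 1#}, ?lam) \<in> KP_order" using kl by (auto simp: KP_order_def min_def)
        then have g: "g (mono_mset m) = KP {#k + 1, l - 1#}" by (simp only: m g_def KP_prev_def if_True)
        have kl': "k + 1 + (l - 1) = k + l" using kl by simp
        have "l - 1 < l" "1 \<le> l - 1" "l - 1 \<le> k + 1" using kl by auto
        from less.IH[OF this] show ?thesis unfolding g kl' .
      next
        assume m: "mono_mset m = {#k + l - 1, 1#}"
        have "({#k + l - 1, 1#}, ?lam) \<in> KP_order" using kl by (auto simp: KP_order_def min_def)
        then have g: "g (mono_mset m) = KP {#k + l - 1, 1#}" by (simp only: m g_def KP_prev_def if_True)
        have "{#k + l - 1, 1#} = hook (k + l - 1) 1" by (simp add: hook_def)
        then have "g (mono_mset m) = ?V" using kl KP_hook[of "k + l - 1" 1] unfolding g by simp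
        then show ?thesis by simp
      qed
    qed
    \<comment> \<open>k + (l - 1) - (k + l - 1) = 0, and the part belonging to \<open>m0\<close> is
      k.\<close>
    have sum_c: "(\<Sum>m\<in>S - {m0}. c m) = - of_nat k"
    proof -
      have one: "(\<Sum>m\<in>S. Poly_Mapping.lookup (hvar n * Var j) m) = 1" if nj: "s n + s j \<in> S" "n \<ge> 1" "j \<ge> 1" for n j
      proof -
        have "Poly_Mapping.lookup (hvar n * Var j) m = (if m = s n + s j then 1 else 0)" if "m \<in> S" for m
        proof (cases "m = s n + s j")
          case True
          have "Poly_Mapping.lookup (hvar n * Var j) (s n + s j) = 1"
            unfolding s_def lookup_mult_Var using nj by (intro lookup_hvar_single) simp
          then show ?thesis using True by simp
        next
          case False
          have "m \<notin> Poly_Mapping.keys (hvar n * Var j)"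
          proof
            assume "m \<in> Poly_Mapping.keys (hvar n * Var j)"
            moreover have "size (mono_mset m) = 2" using that by (auto simp: S_def ms)
            ultimately have "mono_mset m = mono_mset (s n + s j)" using op_mset_hvar(4)[of m n j] nj by (simp add: ms)
            then show False using False by (simp add: mono_mset_inject)
          qed
          then show ?thesis using False by (simp add: in_keys_iff)
        qed
        then have "(\<Sum>m\<in>S. Poly_Mapping.lookup (hvar n * Var j) m) = (\<Sum>m\<in>S. if m = s n + s j then 1 else 0)"
          by (intro sum.cong refl)
        then show ?thesis using finS nj by simp
      qed
      have "hvar 1 = Var 1" using complete_h_rec[of 1 "\<lambda>i. of_nat i * Var i :: (nat, rat) mpoly"] by simp
      then have op: "?op = of_nat k * (hvar l * Var k) + of_nat (l - 1) * (hvar (k + 1) * Var (l - 1))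
         - of_nat (k + l - 1) * (hvar 1 * Var (k + l - 1))"
        by (simp only: hirota_op_alt)
      have lookup_of_nat: "Poly_Mapping.lookup (of_nat c * P) m = of_nat c * Poly_Mapping.lookup P m" for c m and P :: "(nat, rat) mpoly"
        using lookup_Const_mult[of "of_nat c" P m] by simp
      have a: "(\<Sum>m\<in>S. Poly_Mapping.lookup (hvar l * Var k) m) = 1" using kl by (intro one) (auto simp: S_def)
      have b: "(\<Sum>m\<in>S. Poly_Mapping.lookup (hvar (k + 1) * Var (l - 1)) m) = 1" using kl by (intro one) (auto simp: S_def)
      have e: "(\<Sum>m\<in>S. Poly_Mapping.lookup (hvar 1 * Var (k + l - 1)) m) = 1" using kl by (intro one) (auto simp: S_def)
      have "(\<Sum>m\<in>S. c m) = of_nat k * 1 + of_nat (l - 1) * 1 - of_nat (k + l - 1) * 1"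
        unfolding c_def op lookup_minus lookup_add lookup_of_nat sum_subtractf sum.distrib sum_distrib_left[symmetric] a b e ..
      also have "\<dots> = 0" using kl by (simp add: of_nat_diff)
      finally have "(\<Sum>m\<in>S. c m) = 0" .
      moreover have "c m0 = of_nat k"
        unfolding c_def using lookup_hirota_op[OF kl, of m0] by (simp add: m0_def ms add_mset_commute)
      ultimately show ?thesis using finS by (simp add: sum.remove[of S m0] add_eq_0_iff)
    qed
    \<comment> \<open>Monomials with three or more factors: their blocks satisfy the bound k + l -
      3, one below the top.\<close>
    define R where "R = (\<Sum>m\<in>Poly_Mapping.keys ?op - S. Const (c m) * hirota_gen g (monom_list m))"
    have vR: "vars R \<subseteq> ?W"
      unfolding R_def
    proof (intro vars_sum_le vars_mult_le vars_hirota_gen)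
      fix m P B assume m: "m \<in> Poly_Mapping.keys ?op - S" and P: "P \<in> even_partitions (length (monom_list m))" "B \<in> P"
      have op: "op_mset k l (mset (monom_list m))" using keys_hirota_op[of m k l] m kl by (simp add: mono_list)
      have ne: "size (mset (monom_list m)) \<noteq> 2"
      proof
        assume "size (mset (monom_list m)) = 2"
        then have "mono_mset m \<in> {{#k, l#}, {#k + 1, l - 1#}, {#k + l - 1, 1#}}"
          using op by (simp add: op_mset_def mono_list)
        moreover have "{#k, l#} = mono_mset (s l + s k)" "{#k + 1, l - 1#} = mono_mset (s (k + 1) + s (l - 1))"
          "{#k + l - 1, 1#} = mono_mset (s 1 + s (k + l - 1))" by (simp_all add: ms add_mset_commute)
        ultimately have "m \<in> S" by (simp add: mono_mset_inject S_def)
        then show False using m by simp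
      qed
      let ?mu = "block (monom_list m) B"
      have "sum_mset ?mu - size ?mu \<le> sum_mset (mset (monom_list m)) - size (mset (monom_list m))"
        using op by (intro sum_minus_size_mono block_subset[OF P]) (simp add: op_mset_def)
      also have "\<dots> \<le> k + l - 3"
      proof -
        have "sum_mset (mset (monom_list m)) = k + l" "size (mset (monom_list m)) \<ge> 2" using op by (simp_all only: op_mset_def)
        then show ?thesis using ne by linarith
      qed
      finally have bd: "sum_mset ?mu - size ?mu \<le> k + l - 3" .
      have mn: "min 1 (size ?mu - 1) = 1" using size_block_ge_2[OF P, of "monom_list m"] by simp
      show "vars (g ?mu) \<subseteq> ?W"
      proof (cases "(?mu, ?lam) \<in> KP_order")
        case True
        have "vars (KP ?mu) \<subseteq> hooks (sum_mset ?mu - size ?mu) (min 1 (size ?mu - 1))"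
          by (rule vars_KP[OF block_bound(1,2)[OF op P]])
        also have "\<dots> \<subseteq> ?W" unfolding mn by (rule hooks_mono[OF bd])
        finally show ?thesis using True by (simp add: g_def KP_prev_def)
      qed (simp add: g_def KP_prev_def)
    qed simp
    have len: "length (monom_list m) = 2" if "m \<in> S" for m
    proof -
      have "size (mono_mset m) = 2" using that by (auto simp: S_def ms)
      then show ?thesis by (simp flip: mono_list)
    qed
    have hp: "hirota_poly g ?op = R + (\<Sum>m\<in>S - {m0}. Const (c m) * (2 * g (mono_mset m)))"
    proof -
      let ?f = "\<lambda>m. Const (c m) * hirota_gen g (monom_list m)"
      have "hirota_poly g ?op = (\<Sum>m\<in>(Poly_Mapping.keys ?op - S) \<union> S. ?f m)"
        unfolding hirota_poly_def hirota_hirota_gen c_def[symmetric]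
        using finS by (intro sum.mono_neutral_left) (auto simp: in_keys_iff c_def)
      also have "\<dots> = R + (\<Sum>m\<in>S. ?f m)"
        unfolding R_def using finS by (intro sum.union_disjoint) auto
      also have "(\<Sum>m\<in>S. ?f m) = ?f m0 + (\<Sum>m\<in>S - {m0}. ?f m)"
        by (rule sum.remove[OF finS])
      also have "?f m0 = 0" using hirota_gen_2[OF len[OF finS(2)], of g] gm0 by (simp add: mono_list)
      also have "(\<Sum>m\<in>S - {m0}. ?f m) = (\<Sum>m\<in>S - {m0}. Const (c m) * (2 * g (mono_mset m)))"
      proof (intro sum.cong refl)
        fix m assume "m \<in> S - {m0}"
        then have "length (monom_list m) = 2" using len by simp
        from hirota_gen_2[OF this, of g] show "?f m = Const (c m) * (2 * g (mono_mset m))" by (simp only: mono_list)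
      qed
      finally show ?thesis by simp
    qed
    have "KP ?lam - ?V = Const (- 1 / (2 * of_nat k)) * (R + (\<Sum>m\<in>S - {m0}. Const (c m) * (2 * (g (mono_mset m) - ?V))))"
    proof -
      have "(\<Sum>m\<in>S - {m0}. Const (c m) * (2 * g (mono_mset m))) =
        (\<Sum>m\<in>S - {m0}. Const (c m) * (2 * (g (mono_mset m) - ?V))) + (\<Sum>m\<in>S - {m0}. Const (c m) * (2 * ?V))"
        unfolding sum.distrib[symmetric] by (intro sum.cong refl) (simp add: algebra_simps)
      also have "(\<Sum>m\<in>S - {m0}. Const (c m) * (2 * ?V)) = Const (\<Sum>m\<in>S - {m0}. c m) * (2 * ?V)"
        by (simp only: sum_distrib_right Const.hom_sum)
      finally have "KP ?lam = Const (- 1 / (2 * of_nat k)) * (R + (\<Sum>m\<in>S - {m0}. Const (c m) * (2 * (g (mono_mset m) - ?V))))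
         + Const (- 1 / (2 * of_nat k)) * (Const (- of_nat k) * (2 * ?V))"
        unfolding KP_pair[OF kl] g_def[symmetric] hp sum_c by (simp only: distrib_left add.assoc)
      also have "Const (- 1 / (2 * of_nat k)) * (Const (- of_nat k) * (2 * ?V)) = ?V"
      proof -
        have "(2 :: (nat multiset, rat) mpoly) = Const 2" by (metis Const_of_nat of_nat_numeral)
        then have "Const (- 1 / (2 * of_nat k)) * (Const (- of_nat k) * (2 * ?V)) = Const (- 1 / (2 * of_nat k) * (- of_nat k * 2)) * ?V"
          by (simp only: Const_mult mult.assoc)
        also have "- 1 / (2 * of_nat k) * (- of_nat k * 2) = (1 :: rat)" using kl by simp
        finally show ?thesis by simp
      qed
      finally show ?thesis by simp
    qed
    moreover have "vars (R + (\<Sum>m\<in>S - {m0}. Const (c m) * (2 * (g (mono_mset m) - ?V)))) \<subseteq> ?W"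
      using vR D by (intro order_trans[OF vars_add] Un_least vars_sum_le vars_mult_le order_trans[OF vars_numeral_mult]) simp_all
    ultimately show ?thesis by (simp only:) (intro vars_mult_le, simp_all)
  qed
qed

lemma KP_top:
  assumes "1 \<le> k" "1 \<le> l"
  shows "vars (KP {#k, l#} - Var (hook (k + l - 1) 1)) \<subseteq> hooks (k + l - 3) 1"
proof (cases "l \<le> k")
  case True
  then show ?thesis using assms by (intro KP_top_aux)
next
  case False
  then have "vars (KP {#l, k#} - Var (hook (l + k - 1) 1)) \<subseteq> hooks (l + k - 3) 1" using assms by (intro KP_top_aux) auto
  then show ?thesis by (simp only: add_mset_commute add.commute[of k])
qed

abbreviation fls_coeff :: "'a::zero fls \<Rightarrow> int \<Rightarrow> 'a" (infixl "$$" 75) where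
  "f $$ n \<equiv> fls_nth f n"

subsection \<open>Dependence of coefficients on the unknowns\<close>

lemma fls_times_nth_bounds:
  fixes f g :: "'a::comm_ring_1 fls"
  assumes "\<And>i. i < a \<Longrightarrow> f $$ i = 0" "\<And>i. i < b \<Longrightarrow> g $$ i = 0"
  shows "(f * g) $$ n = (\<Sum>i=a..n - b. f $$ i * g $$ (n - i))"
  unfolding fls_times_nth(2)
proof (rule sum_reindex_support[of _ _ _ "\<lambda>i. i" "\<lambda>i. i"], goal_cases)
  case (3 x)
  then have nz: "f $$ x \<noteq> 0" "g $$ (n - x) \<noteq> 0" by auto
  have "\<not> x < a" using nz(1) assms(1) by blast
  moreover have "\<not> n - x < b" using nz(2) assms(2) by blast
  ultimately show ?case by auto
next
  case (4 x)
  then have "f $$ x \<noteq> 0" "g $$ (n - x) \<noteq> 0" by auto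
  then have "fls_subdegree f \<le> x" "fls_subdegree g \<le> n - x" by (auto intro!: fls_subdegree_leI)
  then show ?case by auto
qed simp_all

type_synonym unknowns = "nat \<Rightarrow> coeff fps"

text \<open>\<open>X\<close> is indexed by all natural numbers, but the unknown series are those
  with index 1 to d - 1.\<close>

definition vanishing :: "nat \<Rightarrow> unknowns \<Rightarrow> bool" where
  "vanishing d X \<longleftrightarrow> (\<forall>j\<in>{1..d-1}. fps_nth (X j) 0 = 0)"

lemma vanishingD: "vanishing d X \<Longrightarrow> 1 \<le> m \<Longrightarrow> m < d \<Longrightarrow> fps_nth (X m) 0 = 0"
  unfolding vanishing_def by auto

abbreviation eval_unknowns :: "unknowns \<Rightarrow> (nat \<times> nat, coeff) mpoly \<Rightarrow> coeff" where
  "eval_unknowns X \<equiv> eval_mpoly (\<lambda>a. a) (\<lambda>(m, j). fps_nth (X j) m)"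

text \<open>A polynomial witness is required because the recursion is to consist of polynomial
  formulas. The formula has to hold for families with zero constant terms, for which products have
  sums of known finite range.\<close>

definition depends :: "nat \<Rightarrow> (nat \<times> nat) set \<Rightarrow> (unknowns \<Rightarrow> coeff) \<Rightarrow> bool" where
  "depends d V \<phi> \<longleftrightarrow> (\<exists>P. vars P \<subseteq> V \<and> (\<forall>X. vanishing d X \<longrightarrow> \<phi> X = eval_unknowns X P))"

lemma depends_const: "depends d V (\<lambda>_. c)"
  unfolding depends_def by (intro exI[of _ "Const c"]) simp

lemma depends_var: "(m, j) \<in> V \<Longrightarrow> depends d V (\<lambda>X. fps_nth (X j) m)"
  unfolding depends_def by (intro exI[of _ "Var (m, j)"]) simp

lemma depends_cong: "depends d V \<psi> \<Longrightarrow> (\<And>X. vanishing d X \<Longrightarrow> \<phi> X = \<psi> X) \<Longrightarrow> depends d V \<phi>"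
  unfolding depends_def by auto

lemma depends_mono: "depends d V \<phi> \<Longrightarrow> V \<subseteq> V' \<Longrightarrow> depends d V' \<phi>"
  unfolding depends_def by blast

lemma depends_add: 
  assumes "depends d V \<phi>" "depends d V \<psi>"
  shows "depends d V (\<lambda>X. \<phi> X + \<psi> X)"
proof -
  from assms obtain P Q where P: "vars P \<subseteq> V" "\<And>X. vanishing d X \<Longrightarrow> \<phi> X = eval_unknowns X P"
    and Q: "vars Q \<subseteq> V" "\<And>X. vanishing d X \<Longrightarrow> \<psi> X = eval_unknowns X Q"
    unfolding depends_def by blast
  have "vars (P + Q) \<subseteq> V" using vars_add[of P Q] P(1) Q(1) by (intro order_trans[OF vars_add] Un_least)
  then show ?thesis unfolding depends_def using P(2) Q(2) by (intro exI[of _ "P + Q"]) (simp add: idc_eval_add)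
qed

lemma depends_mult: 
  assumes "depends d V \<phi>" "depends d V \<psi>"
  shows "depends d V (\<lambda>X. \<phi> X * \<psi> X)"
proof -
  from assms obtain P Q where P: "vars P \<subseteq> V" "\<And>X. vanishing d X \<Longrightarrow> \<phi> X = eval_unknowns X P"
    and Q: "vars Q \<subseteq> V" "\<And>X. vanishing d X \<Longrightarrow> \<psi> X = eval_unknowns X Q"
    unfolding depends_def by blast
  have "vars (P * Q) \<subseteq> V" using P(1) Q(1) by (rule vars_mult_le)
  then show ?thesis unfolding depends_def using P(2) Q(2) by (intro exI[of _ "P * Q"]) (simp add: idc_eval_mult)
qed

lemma depends_cmult: "depends d V \<phi> \<Longrightarrow> depends d V (\<lambda>X. c * \<phi> X)"
  by (rule depends_mult[OF depends_const])

lemma depends_uminus: "depends d V \<phi> \<Longrightarrow> depends d V (\<lambda>X. - \<phi> X)"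
  using depends_cmult[of d V \<phi> "- 1"] by simp

lemma depends_sum: "(\<And>i. i \<in> I \<Longrightarrow> depends d V (\<lambda>X. \<phi> i X)) \<Longrightarrow> depends d V (\<lambda>X. \<Sum>i\<in>I. \<phi> i X)"
  by (induction I rule: infinite_finite_induct) (auto intro: depends_add depends_const)

text \<open>What precedes the pair (\<open>N\<close>, \<open>\<kappa>\<close>) when computing first
  by n and then by k. For \<open>\<kappa>\<close> = d these are all m \<le> N, for
  \<open>\<kappa>\<close> = 1 all m < N.\<close>

definition prev :: "nat \<Rightarrow> int \<Rightarrow> nat \<Rightarrow> (nat \<times> nat) set" where
  "prev d N \<kappa> = {(m, j). 1 \<le> m \<and> j \<in> {1..d-1} \<and> (int m < N \<or> int m = N \<and> j < \<kappa>)}"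

lemma prev_mono: "N < N' \<or> N = N' \<and> \<kappa> \<le> \<kappa>' \<Longrightarrow> prev d N \<kappa> \<subseteq> prev d N' \<kappa>'"
  unfolding prev_def by auto

text \<open>The coefficient of \<open>t\<^sup>e\<close> only involves the unknown coefficients \<open>f\<^sup>(\<^sup>j\<^sup>)\<^sub>m\<close> with \<open>m < e - s\<close>,
  or with \<open>m = e - s\<close> and \<open>j < \<kappa>\<close>.\<close>

definition lagged :: "nat \<Rightarrow> int \<Rightarrow> nat \<Rightarrow> (unknowns \<Rightarrow> coeff fls) \<Rightarrow> bool" where
  "lagged d s \<kappa> \<Phi> \<longleftrightarrow> (\<forall>e. depends d (prev d (e - s) \<kappa>) (\<lambda>X. \<Phi> X $$ e))"

definition valued :: "nat \<Rightarrow> int \<Rightarrow> (unknowns \<Rightarrow> coeff fls) \<Rightarrow> bool" where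
  "valued d a \<Phi> \<longleftrightarrow> (\<forall>X e. vanishing d X \<longrightarrow> e < a \<longrightarrow> \<Phi> X $$ e = 0)"

lemma lagged_mono:
  assumes "lagged d s \<kappa> \<Phi>" "s' < s \<or> s' = s \<and> \<kappa> \<le> \<kappa>'"
  shows "lagged d s' \<kappa>' \<Phi>"
  unfolding lagged_def
proof
  fix e
  have "prev d (e - s) \<kappa> \<subseteq> prev d (e - s') \<kappa>'" using assms(2) by (intro prev_mono) auto
  then show "depends d (prev d (e - s') \<kappa>') (\<lambda>X. \<Phi> X $$ e)"
    using assms(1) depends_mono unfolding lagged_def by blast
qed

lemma valued_mono: "valued d a \<Phi> \<Longrightarrow> a' \<le> a \<Longrightarrow> valued d a' \<Phi>"
  unfolding valued_def by auto

lemma lagged_const: "lagged d s \<kappa> (\<lambda>_. c)"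
  unfolding lagged_def by (intro allI depends_const)

lemma valued_0: "valued d a (\<lambda>_. 0)"
  unfolding valued_def by simp

lemma lagged_add: "lagged d s \<kappa> \<Phi> \<Longrightarrow> lagged d s \<kappa> \<Psi> \<Longrightarrow> lagged d s \<kappa> (\<lambda>X. \<Phi> X + \<Psi> X)"
  unfolding lagged_def fls_plus_nth using depends_add by blast

lemma valued_add: "valued d a \<Phi> \<Longrightarrow> valued d a \<Psi> \<Longrightarrow> valued d a (\<lambda>X. \<Phi> X + \<Psi> X)"
  unfolding valued_def by simp

lemma lagged_uminus: "lagged d s \<kappa> \<Phi> \<Longrightarrow> lagged d s \<kappa> (\<lambda>X. - \<Phi> X)"
  unfolding lagged_def fls_uminus_nth using depends_uminus by blast

lemma valued_uminus: "valued d a \<Phi> \<Longrightarrow> valued d a (\<lambda>X. - \<Phi> X)"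
  unfolding valued_def by simp

lemma lagged_diff: "lagged d s \<kappa> \<Phi> \<Longrightarrow> lagged d s \<kappa> \<Psi> \<Longrightarrow> lagged d s \<kappa> (\<lambda>X. \<Phi> X - \<Psi> X)"
  using lagged_add[OF _ lagged_uminus, of d s \<kappa> \<Phi> \<Psi>] by simp

lemma valued_diff: "valued d a \<Phi> \<Longrightarrow> valued d a \<Psi> \<Longrightarrow> valued d a (\<lambda>X. \<Phi> X - \<Psi> X)"
  unfolding valued_def by simp

lemma lagged_sum: "(\<And>i. i \<in> I \<Longrightarrow> lagged d s \<kappa> (\<Phi> i)) \<Longrightarrow> lagged d s \<kappa> (\<lambda>X. \<Sum>i\<in>I. \<Phi> i X)"
  by (induction I rule: infinite_finite_induct) (auto intro: lagged_add lagged_const)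

lemma valued_sum: "(\<And>i. i \<in> I \<Longrightarrow> valued d a (\<Phi> i)) \<Longrightarrow> valued d a (\<lambda>X. \<Sum>i\<in>I. \<Phi> i X)"
  by (induction I rule: infinite_finite_induct) (auto intro: valued_add valued_0)

lemma lagged_cmult: "lagged d s \<kappa> \<Phi> \<Longrightarrow> lagged d s \<kappa> (\<lambda>X. fls_const c * \<Phi> X)"
  unfolding lagged_def fls_mult_const_nth using depends_cmult by blast

lemma valued_cmult: "valued d a \<Phi> \<Longrightarrow> valued d a (\<lambda>X. fls_const c * \<Phi> X)"
  unfolding valued_def by simp

lemma lagged_of_nat: "lagged d s \<kappa> \<Phi> \<Longrightarrow> lagged d s \<kappa> (\<lambda>X. of_nat c * \<Phi> X)"
  unfolding fls_of_nat by (rule lagged_cmult)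

lemma valued_of_nat: "valued d a \<Phi> \<Longrightarrow> valued d a (\<lambda>X. of_nat c * \<Phi> X)"
  unfolding fls_of_nat by (rule valued_cmult)

lemma fls_X_inv_mult_nth: "(fls_X_inv * f) $$ e = f $$ (e + 1)" for f :: "coeff fls"
  by (simp add: fls_X_inv_times_conv_shift)

lemma lagged_X_inv:
  assumes "lagged d s \<kappa> \<Phi>"
  shows "lagged d (s - 1) \<kappa> (\<lambda>X. fls_X_inv * \<Phi> X)"
  unfolding lagged_def fls_X_inv_mult_nth
proof
  fix e
  have "e + 1 - s = e - (s - 1)" by simp
  then show "depends d (prev d (e - (s - 1)) \<kappa>) (\<lambda>X. \<Phi> X $$ (e + 1))"
    using assms unfolding lagged_def by metis
qed

lemma valued_X_inv: "valued d a \<Phi> \<Longrightarrow> valued d (a - 1) (\<lambda>X. fls_X_inv * \<Phi> X)"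
  unfolding valued_def fls_X_inv_mult_nth by simp

text \<open>In the coefficient of t^e the first factor is read at exponents up to e - a' only, so
  its lag grows by the order a' of the other factor; likewise for the second.\<close>

lemma lagged_mult:
  assumes "lagged d s d \<Phi>" "valued d a \<Phi>" "lagged d s' d \<Psi>" "valued d a' \<Psi>" "r \<le> s + a'" "r \<le> s' + a"
  shows "lagged d r d (\<lambda>X. \<Phi> X * \<Psi> X)"
  unfolding lagged_def
proof
  fix e
  have "depends d (prev d (e - r) d) (\<lambda>X. \<Sum>i=a..e - a'. \<Phi> X $$ i * \<Psi> X $$ (e - i))"
  proof (intro depends_sum depends_mult)
    fix i assume i: "i \<in> {a..e - a'}"
    have "prev d (i - s) d \<subseteq> prev d (e - r) d" using i assms(5) by (intro prev_mono) auto
    then show "depends d (prev d (e - r) d) (\<lambda>X. \<Phi> X $$ i)"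
      using assms(1) depends_mono unfolding lagged_def by blast
    have "prev d (e - i - s') d \<subseteq> prev d (e - r) d" using i assms(6) by (intro prev_mono) auto
    then show "depends d (prev d (e - r) d) (\<lambda>X. \<Psi> X $$ (e - i))"
      using assms(3) depends_mono unfolding lagged_def by blast
  qed
  then show "depends d (prev d (e - r) d) (\<lambda>X. (\<Phi> X * \<Psi> X) $$ e)"
  proof (rule depends_cong)
    fix X assume X: "vanishing d X"
    show "(\<Phi> X * \<Psi> X) $$ e = (\<Sum>i=a..e - a'. \<Phi> X $$ i * \<Psi> X $$ (e - i))"
      using assms(2,4) X by (intro fls_times_nth_bounds) (simp_all add: valued_def)
  qed
qed

lemma valued_mult:
  assumes "valued d a \<Phi>" "valued d a' \<Psi>"
  shows "valued d (a + a') (\<lambda>X. \<Phi> X * \<Psi> X)"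
  unfolding valued_def
proof (intro allI impI)
  fix X e assume X: "vanishing d X" "e < a + a'"
  have "(\<Phi> X * \<Psi> X) $$ e = (\<Sum>i=a..e - a'. \<Phi> X $$ i * \<Psi> X $$ (e - i))"
    using assms X(1) by (intro fls_times_nth_bounds) (simp_all add: valued_def)
  then show "(\<Phi> X * \<Psi> X) $$ e = 0" using X(2) by simp
qed

lemma T_hook_Suc: "1 \<le> m \<Longrightarrow> T_op X (Var (hook m (Suc l))) $$ e = of_int (e - 1) * T_op X (Var (hook m l)) $$ (e - 1)"
proof -
  assume m: "1 \<le> m"
  have "T_op X (Var (hook m (Suc l))) = fls_X ^ 2 * fls_deriv (T_op X (Var (hook m l)))"
    by (simp only: T_hook[OF m] funpow.simps comp_apply)
  then show ?thesis by (simp add: fls_X_power_times_conv_shift)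
qed

lemma T_hook_0: "1 \<le> m \<Longrightarrow> T_op X (Var (hook m 0)) = fps_to_fls (X m)"
  by (simp add: T_hook)

text \<open>Each application of t^2 d/dt delays the coefficients by one power of t.\<close>

lemma lagged_T_hook:
  assumes "1 \<le> m" "m < d"
  shows "lagged d (int l) d (\<lambda>X. T_op X (Var (hook m l)))"
proof (induction l)
  case 0
  show ?case unfolding lagged_def T_hook_0[OF assms(1)]
  proof
    fix e
    show "depends d (prev d (e - int 0) d) (\<lambda>X. fps_to_fls (X m) $$ e)"
    proof (cases "e > 0")
      case True
      then have "depends d (prev d (e - int 0) d) (\<lambda>X. fps_nth (X m) (nat e))"
        using assms by (intro depends_var) (auto simp: prev_def)
      then show ?thesis by (rule depends_cong) (use True in simp)
    next
      case False
      show ?thesis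
        by (rule depends_cong[OF depends_const[of d _ 0]]) (use False assms in \<open>auto simp: vanishingD not_less le_less\<close>)
    qed
  qed
next
  case (Suc l)
  show ?case unfolding lagged_def T_hook_Suc[OF assms(1)]
  proof
    fix e
    have "e - 1 - int l = e - int (Suc l)" by simp
    then have "depends d (prev d (e - int (Suc l)) d) (\<lambda>X. T_op X (Var (hook m l)) $$ (e - 1))"
      using Suc unfolding lagged_def by metis
    then show "depends d (prev d (e - int (Suc l)) d) (\<lambda>X. of_int (e - 1) * T_op X (Var (hook m l)) $$ (e - 1))"
      by (rule depends_cmult)
  qed
qed

lemma valued_T_hook:
  assumes "1 \<le> m" "m < d"
  shows "valued d (int l + 1) (\<lambda>X. T_op X (Var (hook m l)))"
proof (induction l)
  case 0
  show ?case unfolding valued_def T_hook_0[OF assms(1)]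
    using assms by (auto simp: vanishingD not_less le_less)
next
  case (Suc l)
  then show ?case unfolding valued_def T_hook_Suc[OF assms(1)] by simp
qed

text \<open>\<open>N\<close> will express a positive order in t, which nonzero constants violate. A
  monomial is therefore built up from a single variable, and the constant term of \<open>P\<close>
  has to be 0.\<close>

lemma T_eval_closed:
  fixes N :: "(unknowns \<Rightarrow> coeff fls) \<Rightarrow> bool"
  assumes N: "N (\<lambda>_. 0)" "\<And>\<Phi> \<Psi>. N \<Phi> \<Longrightarrow> N \<Psi> \<Longrightarrow> N (\<lambda>X. \<Phi> X + \<Psi> X)" "\<And>\<Phi> \<Psi>. N \<Phi> \<Longrightarrow> N \<Psi> \<Longrightarrow> N (\<lambda>X. \<Phi> X * \<Psi> X)"
      "\<And>c \<Phi>. N \<Phi> \<Longrightarrow> N (\<lambda>X. fls_const c * \<Phi> X)"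
    and h: "\<And>x. x \<in> vars P \<Longrightarrow> N (\<lambda>X. T_op X (h x))" and P: "Poly_Mapping.lookup P 0 = 0"
  shows "N (\<lambda>X. T_op X (eval_mpoly rat_adm h P))"
proof -
  have mon: "Poly_Mapping.keys m \<subseteq> vars P \<longrightarrow> m = 0 \<or> N (\<lambda>X. T_op X (monom_eval h m))" for m
  proof (induction m rule: monom_induct)
    case (add m x)
    show ?case
    proof
      assume k: "Poly_Mapping.keys (m + Poly_Mapping.single x 1) \<subseteq> vars P"
      have "x \<in> Poly_Mapping.keys (m + Poly_Mapping.single x 1)" by (simp add: in_keys_iff lookup_add)
      then have x: "N (\<lambda>X. T_op X (h x))" using k by (intro h) blast
      have "Poly_Mapping.keys m \<subseteq> vars P" using k by (auto simp: in_keys_iff lookup_add)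
      then have "m = 0 \<or> N (\<lambda>X. T_op X (monom_eval h m))" using add by simp
      then have "N (\<lambda>X. T_op X (monom_eval h (m + Poly_Mapping.single x 1)))"
      proof
        assume "m = 0"
        then show ?thesis using x by (simp add: monom_eval_add)
      next
        assume "N (\<lambda>X. T_op X (monom_eval h m))"
        from N(3)[OF this x] show ?thesis by (simp add: monom_eval_add T.hom_mult)
      qed
      then show "m + Poly_Mapping.single x 1 = 0 \<or> N (\<lambda>X. T_op X (monom_eval h (m + Poly_Mapping.single x 1)))" ..
    qed
  qed simp
  have eq: "(\<lambda>X. T_op X (eval_mpoly rat_adm h P)) =
     (\<lambda>X. \<Sum>m\<in>Poly_Mapping.keys P. fls_const (to_fract (Const (Poly_Mapping.lookup P m))) * T_op X (monom_eval h m))"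
    by (simp add: fun_eq_iff rat_adm.eval_mpoly_alt T.hom_sum T.hom_mult rat_adm_def)
  have "N (\<lambda>X. \<Sum>m\<in>I. fls_const (to_fract (Const (Poly_Mapping.lookup P m))) * T_op X (monom_eval h m))" if "finite I" "I \<subseteq> Poly_Mapping.keys P" for I
    using that
  proof (induction I rule: finite_induct)
    case (insert m I)
    have "m \<noteq> 0" using insert.prems P by (auto simp: in_keys_iff)
    moreover have "Poly_Mapping.keys m \<subseteq> vars P" using insert.prems by (auto simp: vars_def)
    ultimately have "N (\<lambda>X. T_op X (monom_eval h m))" using mon[of m] by blast
    then have "N (\<lambda>X. fls_const (to_fract (Const (Poly_Mapping.lookup P m))) * T_op X (monom_eval h m))" by (rule N(4))
    then show ?case using insert by (simp add: N(2))
  qed (simp add: N(1))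
  from this[OF finite_keys subset_refl] show ?thesis unfolding eq .
qed

subsection \<open>The recursion\<close>

lemma vars_KP_pair:
  assumes "mu \<in> vars (KP ({#i, j#} + replicate_mset l 1))" "1 \<le> i" "1 \<le> j"
  obtains m l' where "mu = hook m l'" "1 \<le> m" "m \<le> i + j - 1" "1 \<le> l'"
proof -
  let ?lam = "{#i, j#} + replicate_mset l 1"
  have lam: "0 \<notin># ?lam" "?lam \<noteq> {#}" using assms(2,3) by (auto simp: count_eq_zero_iff)
  have "mu \<in> hooks (sum_mset ?lam - size ?lam) (min 1 (size ?lam - 1))"
    using vars_KP[OF lam] assms(1) by (rule subsetD)
  moreover have "sum_mset ?lam - size ?lam = i + j - 2" by simp
  moreover have "min 1 (size ?lam - 1) = 1" by simp
  ultimately have "mu \<in> hooks (i + j - 2) 1" by (simp only:)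
  then obtain m l' where "mu = hook m l'" "1 \<le> m" "m \<le> i + j - 2 + 1" "1 \<le> l'" unfolding hooks_def by blast
  then show thesis using assms(2,3) by (intro that[of m l']) auto
qed

lemma const_term_KP_pair:
  assumes "1 \<le> i" "1 \<le> j"
  shows "Poly_Mapping.lookup (KP ({#i, j#} + replicate_mset l 1)) 0 = 0"
  unfolding eval_zero[symmetric] using assms by (intro const_term_KP) (auto simp: count_eq_zero_iff)

lemma valued_const: "b \<le> 0 \<Longrightarrow> valued d b (\<lambda>_. fls_const c)"
  unfolding valued_def by simp

text \<open>All hooks that occur have a further part 1 and thus lag at least 1; products only
  gain.\<close>

lemma lagged_KP_F:
  assumes "i \<in> {1..<k}" "k < d"
  shows "lagged d 1 d (\<lambda>X. T_op X (eval_mpoly rat_adm Var (KP ({#i, k - i#} + replicate_mset l 1)))) \<and>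
     valued d 1 (\<lambda>X. T_op X (eval_mpoly rat_adm Var (KP ({#i, k - i#} + replicate_mset l 1))))"
proof (rule T_eval_closed[where N = "\<lambda>\<Phi>. lagged d 1 d \<Phi> \<and> valued d 1 \<Phi>"])
  show "lagged d 1 d (\<lambda>_. 0) \<and> valued d 1 (\<lambda>_. 0)" by (simp add: lagged_const valued_0)
  show "lagged d 1 d (\<lambda>X. \<Phi> X + \<Psi> X) \<and> valued d 1 (\<lambda>X. \<Phi> X + \<Psi> X)"
    if "lagged d 1 d \<Phi> \<and> valued d 1 \<Phi>" "lagged d 1 d \<Psi> \<and> valued d 1 \<Psi>" for \<Phi> \<Psi>
    using that by (simp add: lagged_add valued_add)
  show "lagged d 1 d (\<lambda>X. \<Phi> X * \<Psi> X) \<and> valued d 1 (\<lambda>X. \<Phi> X * \<Psi> X)"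
    if N: "lagged d 1 d \<Phi> \<and> valued d 1 \<Phi>" "lagged d 1 d \<Psi> \<and> valued d 1 \<Psi>" for \<Phi> \<Psi>
  proof
    show "lagged d 1 d (\<lambda>X. \<Phi> X * \<Psi> X)" by (rule lagged_mult[of d 1 \<Phi> 1 1 \<Psi> 1]) (use N in simp_all)
    have "valued d (1 + 1) (\<lambda>X. \<Phi> X * \<Psi> X)" using N by (intro valued_mult) simp_all
    then show "valued d 1 (\<lambda>X. \<Phi> X * \<Psi> X)" by (rule valued_mono) simp
  qed
  show "lagged d 1 d (\<lambda>X. fls_const c * \<Phi> X) \<and> valued d 1 (\<lambda>X. fls_const c * \<Phi> X)"
    if "lagged d 1 d \<Phi> \<and> valued d 1 \<Phi>" for c \<Phi>
    using that by (simp add: lagged_cmult valued_cmult)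
  show "lagged d 1 d (\<lambda>X. T_op X (Var mu)) \<and> valued d 1 (\<lambda>X. T_op X (Var mu))"
    if "mu \<in> vars (KP ({#i, k - i#} + replicate_mset l 1))" for mu
  proof -
    from that assms obtain m l' where m: "mu = hook m l'" "1 \<le> m" "m \<le> i + (k - i) - 1" "1 \<le> l'"
      by (elim vars_KP_pair) auto
    have md: "m < d" using m(3) assms by auto
    have "lagged d 1 d (\<lambda>X. T_op X (Var mu))"
      unfolding m(1) by (rule lagged_mono[OF lagged_T_hook[OF m(2) md]]) (use m(4) in auto)
    moreover have "valued d 1 (\<lambda>X. T_op X (Var mu))"
      unfolding m(1) by (rule valued_mono[OF valued_T_hook[OF m(2) md]]) simp
    ultimately show ?thesis ..
  qed
  show "Poly_Mapping.lookup (KP ({#i, k - i#} + replicate_mset l 1)) 0 = 0"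
    using assms by (intro const_term_KP_pair) auto
qed

text \<open>(d+k) p_d G_(d+k,1^l) without the two terms in G_(k+1): those, one of them with t^(-1),
  are the terms in which the newest coefficient can appear.\<close>

definition G_tail :: "nat \<Rightarrow> nat \<Rightarrow> nat \<Rightarrow> unknowns \<Rightarrow> coeff fls" where
  "G_tail d k l X =
     - (\<Sum>i\<in>{1..<k}. of_nat (i * (k - i)) *
          ((\<Sum>r\<le>l. of_nat (l choose r) * (T_op X (Var (hook i r)) * T_op X (Var (hook (k - i) (l - r)))))
           + T_op X (eval_mpoly rat_adm Var (KP ({#i, k - i#} + replicate_mset l 1)))))
     - fls_const (u_coeff + v_coeff) * (of_nat k * T_op X (Var (hook k l)))
     - (if k = 0 \<and> l = 0 then fls_const (u_coeff * v_coeff) else 0)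
     - (\<Sum>i\<in>{1..<d - k}. of_nat (i + k) * (fls_const (p_coeff i) * T_op X (Var (hook (i + k) l))))
     - (\<Sum>j<k. of_nat (d + j) * (fls_const (p_coeff (d + j - k)) * T_op X (G_adm d (d + j) l)))"

lemma T_G_rec:
  assumes "d \<ge> 2"
  shows "T_op X (G_adm d (d + k) l) = fls_const (1 / (of_nat (d + k) * p_coeff d)) *
     (G_tail d k l X + of_nat (k + 1) * (fls_X_inv * T_op X (G_adm d (k + 1) l))
       - of_nat (l * (k + 1)) * T_op X (G_adm d (k + 1) (l - 1)))"
proof -
  have 1: "T_op X (if k = 0 \<and> l = 0 then coeff_adm (u_coeff * v_coeff) else 0) = (if k = 0 \<and> l = 0 then fls_const (u_coeff * v_coeff) else 0)"
    by simp
  have 2: "\<not> (d + k < d \<or> d < 2)" "d + k - d = k" using assms by auto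
  have arith: "- a + A - b - B - c - e - f = (- a - b - c - e - f) + A - B" for a A b B c e f :: "coeff fls"
    by simp
  show ?thesis
    by (subst G_adm.simps)
       (simp only: 2 if_False Let_def T.hom_mult T.hom_add T.hom_diff T.hom_uminus T.hom_sum T.hom_of_nat T_Const T_coeff_adm mult.assoc 1 arith G_tail_def)
qed

text \<open>The bounds on s come from the KP terms, of lag 1, and from the F_(m,1^l), of lag
  l.\<close>

lemma lagged_G_tail:
  assumes d: "d \<ge> 2" "k < d" and s1: "s < 1 \<or> s = 1 \<and> \<kappa> = d" and s2: "s < int l \<or> s = int l \<and> \<kappa> = d"
    and G: "\<And>j. j < k \<Longrightarrow> lagged d s \<kappa> (\<lambda>X. T_op X (G_adm d (d + j) l))"
  shows "lagged d s \<kappa> (G_tail d k l)"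
proof -
  have F: "lagged d s \<kappa> (\<lambda>X. T_op X (Var (hook m l)))" if "1 \<le> m" "m < d" for m
    by (rule lagged_mono[OF lagged_T_hook[OF that]]) (use s2 in auto)
  have FF: "lagged d s \<kappa> (\<lambda>X. T_op X (Var (hook i r)) * T_op X (Var (hook (k - i) (l - r))))" if "i \<in> {1..<k}" "r \<le> l" for i r
  proof -
    have i: "1 \<le> i" "i < d" "1 \<le> k - i" "k - i < d" using that d by auto
    have "lagged d (int l + 1) d (\<lambda>X. T_op X (Var (hook i r)) * T_op X (Var (hook (k - i) (l - r))))"
      by (rule lagged_mult[OF lagged_T_hook[OF i(1,2)] valued_T_hook[OF i(1,2)] lagged_T_hook[OF i(3,4)] valued_T_hook[OF i(3,4)]])
         (use that in auto)
    then show ?thesis by (rule lagged_mono) (use s2 in auto)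
  qed
  have K: "lagged d s \<kappa> (\<lambda>X. T_op X (eval_mpoly rat_adm Var (KP ({#i, k - i#} + replicate_mset l 1))))" if "i \<in> {1..<k}" for i
    using lagged_KP_F[OF that d(2), of l] s1 by (auto elim: lagged_mono)
  have U: "lagged d s \<kappa> (\<lambda>X. fls_const (u_coeff + v_coeff) * (of_nat k * T_op X (Var (hook k l))))"
  proof (cases "k = 0")
    case True
    then show ?thesis by (simp add: lagged_const)
  next
    case False
    then show ?thesis using d by (intro lagged_cmult lagged_of_nat F) auto
  qed
  have S1: "lagged d s \<kappa> (\<lambda>X. \<Sum>i\<in>{1..<k}. of_nat (i * (k - i)) *
          ((\<Sum>r\<le>l. of_nat (l choose r) * (T_op X (Var (hook i r)) * T_op X (Var (hook (k - i) (l - r)))))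
           + T_op X (eval_mpoly rat_adm Var (KP ({#i, k - i#} + replicate_mset l 1)))))"
    by (intro lagged_sum lagged_of_nat lagged_add FF K) auto
  have S2: "lagged d s \<kappa> (\<lambda>X. \<Sum>i\<in>{1..<d - k}. of_nat (i + k) * (fls_const (p_coeff i) * T_op X (Var (hook (i + k) l))))"
    by (intro lagged_sum lagged_of_nat lagged_cmult F) auto
  have S3: "lagged d s \<kappa> (\<lambda>X. \<Sum>j<k. of_nat (d + j) * (fls_const (p_coeff (d + j - k)) * T_op X (G_adm d (d + j) l)))"
    by (intro lagged_sum lagged_of_nat lagged_cmult G) auto
  show ?thesis
    unfolding G_tail_def[abs_def] by (intro lagged_diff lagged_uminus S1 U S2 S3 lagged_const)
qed

lemma valued_G_tail:
  assumes d: "d \<ge> 2" "k < d" and b: "b \<le> 1" "b \<le> int l"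
    and G: "\<And>j. j < k \<Longrightarrow> valued d b (\<lambda>X. T_op X (G_adm d (d + j) l))"
  shows "valued d b (G_tail d k l)"
proof -
  have F: "valued d b (\<lambda>X. T_op X (Var (hook m l)))" if "1 \<le> m" "m < d" for m
    by (rule valued_mono[OF valued_T_hook[OF that]]) (use b in auto)
  have FF: "valued d b (\<lambda>X. T_op X (Var (hook i r)) * T_op X (Var (hook (k - i) (l - r))))" if "i \<in> {1..<k}" "r \<le> l" for i r
  proof -
    have i: "1 \<le> i" "i < d" "1 \<le> k - i" "k - i < d" using that d by auto
    show ?thesis
      by (rule valued_mono[OF valued_mult[OF valued_T_hook[OF i(1,2)] valued_T_hook[OF i(3,4)]]]) (use b that in auto)
  qed
  have K: "valued d b (\<lambda>X. T_op X (eval_mpoly rat_adm Var (KP ({#i, k - i#} + replicate_mset l 1))))" if "i \<in> {1..<k}" for i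
    using lagged_KP_F[OF that d(2), of l] b by (auto elim: valued_mono)
  have U: "valued d b (\<lambda>X. fls_const (u_coeff + v_coeff) * (of_nat k * T_op X (Var (hook k l))))"
  proof (cases "k = 0")
    case True
    then show ?thesis by (simp add: valued_0)
  next
    case False
    then show ?thesis using d by (intro valued_cmult valued_of_nat F) auto
  qed
  have C: "valued d b (\<lambda>X. if k = 0 \<and> l = 0 then fls_const (u_coeff * v_coeff) else 0)"
    using b valued_const[of b d] by (cases "k = 0 \<and> l = 0") (auto simp: valued_0)
  have S1: "valued d b (\<lambda>X. \<Sum>i\<in>{1..<k}. of_nat (i * (k - i)) *
          ((\<Sum>r\<le>l. of_nat (l choose r) * (T_op X (Var (hook i r)) * T_op X (Var (hook (k - i) (l - r)))))
           + T_op X (eval_mpoly rat_adm Var (KP ({#i, k - i#} + replicate_mset l 1)))))"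
    by (intro valued_sum valued_of_nat valued_add FF K) auto
  have S2: "valued d b (\<lambda>X. \<Sum>i\<in>{1..<d - k}. of_nat (i + k) * (fls_const (p_coeff i) * T_op X (Var (hook (i + k) l))))"
    by (intro valued_sum valued_of_nat valued_cmult F) auto
  have S3: "valued d b (\<lambda>X. \<Sum>j<k. of_nat (d + j) * (fls_const (p_coeff (d + j - k)) * T_op X (G_adm d (d + j) l)))"
    by (intro valued_sum valued_of_nat valued_cmult G) auto
  show ?thesis
    unfolding G_tail_def[abs_def] by (intro valued_diff valued_uminus S1 U S2 S3 C)
qed

lemma G_adm_small: "m < d \<Longrightarrow> G_adm d m l = Var (hook m l)"
  by (simp add: G_adm.simps[of d m l])

text \<open>The factor t^(-1) costs one unit of lag and of order. Up to m = 2 d - 2 the index k + 1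
  stays below d, so it is met only once along the recursion; G_(2d-1) refers back to G_d and meets
  it twice.\<close>

lemma lagged_G:
  assumes d: "d \<ge> 2" and "1 \<le> m" "m \<le> 2 * d - 2"
  shows "lagged d (min 1 (int l - 1)) d (\<lambda>X. T_op X (G_adm d m l)) \<and> valued d (min 1 (int l)) (\<lambda>X. T_op X (G_adm d m l))"
  using assms(2,3)
proof (induction m rule: less_induct)
  case (less m)
  show ?case
  proof (cases "m < d")
    case True
    have "lagged d (min 1 (int l - 1)) d (\<lambda>X. T_op X (Var (hook m l)))"
      by (rule lagged_mono[OF lagged_T_hook[OF less.prems(1) True]]) auto
    moreover have "valued d (min 1 (int l)) (\<lambda>X. T_op X (Var (hook m l)))"
      by (rule valued_mono[OF valued_T_hook[OF less.prems(1) True]]) auto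
    ultimately show ?thesis by (simp add: G_adm_small[OF True])
  next
    case False
    define k where "k = m - d"
    have k: "m = d + k" "k < d" "1 \<le> k + 1" "k + 1 < d" using False less.prems d by (auto simp: k_def)
    note IH = less.IH[unfolded k(1)]
    have IH': "lagged d (min 1 (int l - 1)) d (\<lambda>X. T_op X (G_adm d (d + j) l)) \<and> valued d (min 1 (int l)) (\<lambda>X. T_op X (G_adm d (d + j) l))" if "j < k" for j
      using that k d less.prems by (intro IH) auto
    have L1: "lagged d (min 1 (int l - 1)) d (G_tail d k l)"
      using d k(2) IH' by (intro lagged_G_tail) auto
    have V1: "valued d (min 1 (int l)) (G_tail d k l)"
      using d k(2) IH' by (intro valued_G_tail) auto
    have L2: "lagged d (min 1 (int l - 1)) d (\<lambda>X. fls_X_inv * T_op X (G_adm d (k + 1) l))"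
      unfolding G_adm_small[OF k(4)] by (rule lagged_mono[OF lagged_X_inv[OF lagged_T_hook[OF k(3,4)]]]) auto
    have V2: "valued d (min 1 (int l)) (\<lambda>X. fls_X_inv * T_op X (G_adm d (k + 1) l))"
      unfolding G_adm_small[OF k(4)] by (rule valued_mono[OF valued_X_inv[OF valued_T_hook[OF k(3,4)]]]) auto
    have L3: "lagged d (min 1 (int l - 1)) d (\<lambda>X. of_nat (l * (k + 1)) * T_op X (G_adm d (k + 1) (l - 1)))"
    proof (cases l)
      case (Suc l')
      show ?thesis unfolding G_adm_small[OF k(4)]
        by (intro lagged_of_nat, rule lagged_mono[OF lagged_T_hook[OF k(3,4)]]) (auto simp: Suc)
    qed (simp add: lagged_const)
    have V3: "valued d (min 1 (int l)) (\<lambda>X. of_nat (l * (k + 1)) * T_op X (G_adm d (k + 1) (l - 1)))"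
    proof (cases l)
      case (Suc l')
      show ?thesis unfolding G_adm_small[OF k(4)]
        by (intro valued_of_nat, rule valued_mono[OF valued_T_hook[OF k(3,4)]]) (auto simp: Suc)
    qed (simp add: valued_0)
    show ?thesis unfolding k(1) T_G_rec[OF d]
      by (intro conjI lagged_cmult lagged_diff lagged_add L1 lagged_of_nat[OF L2] L3
           valued_cmult valued_diff valued_add V1 valued_of_nat[OF V2] V3)
  qed
qed

lemma T_hook_0_nth: "1 \<le> m \<Longrightarrow> T_op X (Var (hook m 0)) $$ e = (if e < 0 then 0 else fps_nth (X m) (nat e))"
  by (simp add: T_hook_0)

lemma T_hook_1_nth: "1 \<le> m \<Longrightarrow> (fls_X_inv * T_op X (Var (hook m 1))) $$ e = of_int e * T_op X (Var (hook m 0)) $$ e"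
  using T_hook_Suc[of m X 0 "e + 1"] by (simp add: fls_X_inv_mult_nth)

lemma lagged_hook_0:
  assumes "1 \<le> m" "m < d"
  shows "lagged d 0 (m + 1) (\<lambda>X. T_op X (Var (hook m 0)))"
  unfolding lagged_def
proof
  fix e
  show "depends d (prev d (e - 0) (m + 1)) (\<lambda>X. T_op X (Var (hook m 0)) $$ e)"
  proof (cases "e > 0")
    case True
    then have "depends d (prev d (e - 0) (m + 1)) (\<lambda>X. fps_nth (X m) (nat e))"
      using assms by (intro depends_var) (auto simp: prev_def)
    then show ?thesis by (rule depends_cong) (use True assms in \<open>simp add: T_hook_0_nth\<close>)
  next
    case False
    show ?thesis
      by (rule depends_cong[OF depends_const[of d _ 0]]) (use False assms in \<open>auto simp: T_hook_0_nth vanishingD not_less le_less\<close>)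
  qed
qed

lemma lagged_hook_1:
  assumes "1 \<le> m" "m < d"
  shows "lagged d 0 (m + 1) (\<lambda>X. fls_X_inv * T_op X (Var (hook m 1)))"
  unfolding lagged_def T_hook_1_nth[OF assms(1)]
proof
  fix e
  have "depends d (prev d (e - 0) (m + 1)) (\<lambda>X. T_op X (Var (hook m 0)) $$ e)"
    using lagged_hook_0[OF assms] unfolding lagged_def by (rule spec)
  then show "depends d (prev d (e - 0) (m + 1)) (\<lambda>X. of_int e * T_op X (Var (hook m 0)) $$ e)"
    by (rule depends_cmult)
qed

text \<open>For l = 1 the lag is exactly used up: t^(-1) F_(k+1,1) and F_(k+1) reach the coefficient
  of order e itself, but only for the series of index k + 1, hence the bound k + 2.\<close>

lemma lagged_G_1:
  assumes d: "d \<ge> 2"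
  shows "k + 1 < d \<Longrightarrow> lagged d 0 (k + 2) (\<lambda>X. T_op X (G_adm d (d + k) 1))"
proof (induction k rule: less_induct)
  case (less k)
  have k: "1 \<le> k + 1" "k + 1 < d" using less.prems by auto
  have T: "lagged d 0 (k + 2) (G_tail d k 1)"
  proof (rule lagged_G_tail)
    fix j assume "j < k"
    then have "lagged d 0 (j + 2) (\<lambda>X. T_op X (G_adm d (d + j) 1))" using less by simp
    then show "lagged d 0 (k + 2) (\<lambda>X. T_op X (G_adm d (d + j) 1))"
      by (rule lagged_mono) (use \<open>j < k\<close> in simp)
  qed (use d k in auto)
  have k2: "k + 1 + 1 = k + 2" "1 - 1 = (0::nat)" by simp_all
  show ?case
    unfolding T_G_rec[OF d] G_adm_small[OF k(2)] k2
    by (intro lagged_cmult lagged_diff lagged_add T lagged_of_nat lagged_hook_1[OF k, unfolded k2] lagged_hook_0[OF k, unfolded k2])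
qed

text \<open>For l \<ge> 2 the lag is 1, so order e is not reached at all. For l = 1 and m = d + j it
  is reached with indices at most j + 1 < \<open>\<kappa>\<close>.\<close>

lemma lagged_G_upto:
  assumes d: "d \<ge> 2" and \<kappa>: "2 \<le> \<kappa>" "\<kappa> \<le> d" and m: "1 \<le> m" "m \<le> d + \<kappa> - 2" and l: "1 \<le> l"
  shows "lagged d 0 \<kappa> (\<lambda>X. T_op X (G_adm d m l)) \<and> lagged d 0 d (\<lambda>X. T_op X (G_adm d m l)) \<and> valued d 1 (\<lambda>X. T_op X (G_adm d m l))"
proof -
  have "m \<le> 2 * d - 2" using m \<kappa> by simp
  note G = lagged_G[OF d m(1) this, of l]
  have v: "valued d 1 (\<lambda>X. T_op X (G_adm d m l))" using G l by simp
  have "lagged d 0 \<kappa> (\<lambda>X. T_op X (G_adm d m l))"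
  proof (cases "l = 1")
    case False
    then have "min 1 (int l - 1) = 1" using l by auto
    then have "lagged d 1 d (\<lambda>X. T_op X (G_adm d m l))" using G by simp
    then show ?thesis by (rule lagged_mono) simp
  next
    case True
    show ?thesis
    proof (cases "m < d")
      case md: True
      show ?thesis unfolding G_adm_small[OF md] True
        by (rule lagged_mono[OF lagged_T_hook[OF m(1) md]]) simp
    next
      case False
      then obtain j where j: "m = d + j" using le_Suc_ex not_less by blast
      have "lagged d 0 (j + 2) (\<lambda>X. T_op X (G_adm d (d + j) 1))" using j m \<kappa> by (intro lagged_G_1[OF d]) auto
      then show ?thesis unfolding True j by (rule lagged_mono) (use j m \<kappa> in auto)
    qed
  qed
  moreover from this have "lagged d 0 d (\<lambda>X. T_op X (G_adm d m l))" by (rule lagged_mono) (use \<kappa> in auto)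
  ultimately show ?thesis using v by simp
qed

abbreviation G_of_hook :: "nat \<Rightarrow> nat multiset \<Rightarrow> adm" where
  "G_of_hook d \<equiv> \<lambda>mu. G_adm d (Max_mset mu) (size mu - 1)"

lemma G_of_hook: "1 \<le> m \<Longrightarrow> G_of_hook d (hook m l) = G_adm d m l"
  by simp

lemma KP_G_top:
  assumes "1 \<le> i" "1 \<le> k"
  shows "T_op X (KP_G d i k) = T_op X (eval_mpoly rat_adm (G_of_hook d) (KP {#i, k#} - Var (hook (i + k - 1) 1)))
     + T_op X (G_adm d (i + k - 1) 1)"
proof -
  have "1 \<le> i + k - 1" using assms by simp
  from G_of_hook[OF this, of d 1] show ?thesis
    unfolding KP_G_def rat_adm.eval_diff T.hom_diff rat_adm.eval_Var by simp
qed

text \<open>By \<open>KP_top\<close> the hooks here have m \<le> i + \<kappa> - 2 \<le> d + \<kappa>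
  - 2. Besides the claim, lag 0 with bound d and order 1 are carried through: they turn a product
  into an expression of lag 1.\<close>

lemma lagged_KP_rest:
  assumes d: "d \<ge> 2" and \<kappa>: "2 \<le> \<kappa>" "\<kappa> \<le> d" and i: "i \<in> {1..d}"
  shows "lagged d 0 \<kappa> (\<lambda>X. T_op X (eval_mpoly rat_adm (G_of_hook d) (KP {#i, \<kappa>#} - Var (hook (i + \<kappa> - 1) 1))))"
proof -
  let ?Q = "KP {#i, \<kappa>#} - Var (hook (i + \<kappa> - 1) 1)"
  let ?N = "\<lambda>\<Phi>. lagged d 0 \<kappa> \<Phi> \<and> lagged d 0 d \<Phi> \<and> valued d 1 \<Phi>"
  have "?N (\<lambda>X. T_op X (eval_mpoly rat_adm (G_of_hook d) ?Q))"
  proof (rule T_eval_closed[where N = ?N])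
    show "?N (\<lambda>_. 0)" by (simp add: lagged_const valued_0)
    show "?N (\<lambda>X. \<Phi> X + \<Psi> X)" if "?N \<Phi>" "?N \<Psi>" for \<Phi> \<Psi>
      using that by (simp add: lagged_add valued_add)
    show "?N (\<lambda>X. \<Phi> X * \<Psi> X)" if N: "?N \<Phi>" "?N \<Psi>" for \<Phi> \<Psi>
    proof -
      have L: "lagged d 1 d (\<lambda>X. \<Phi> X * \<Psi> X)" by (rule lagged_mult[of d 0 \<Phi> 1 0 \<Psi> 1]) (use N in simp_all)
      have "valued d (1 + 1) (\<lambda>X. \<Phi> X * \<Psi> X)" using N by (intro valued_mult) simp_all
      then have "valued d 1 (\<lambda>X. \<Phi> X * \<Psi> X)" by (rule valued_mono) simp
      moreover have "lagged d 0 \<kappa> (\<lambda>X. \<Phi> X * \<Psi> X)" by (rule lagged_mono[OF L]) simp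
      moreover have "lagged d 0 d (\<lambda>X. \<Phi> X * \<Psi> X)" by (rule lagged_mono[OF L]) simp
      ultimately show ?thesis by simp
    qed
    show "?N (\<lambda>X. fls_const c * \<Phi> X)" if "?N \<Phi>" for c \<Phi>
      using that by (simp add: lagged_cmult valued_cmult)
    show "?N (\<lambda>X. T_op X (G_of_hook d mu))" if mu: "mu \<in> vars ?Q" for mu
    proof -
      have "1 \<le> i" "1 \<le> \<kappa>" using i \<kappa> by auto
      then have "mu \<in> hooks (i + \<kappa> - 3) 1" using KP_top mu by blast
      then obtain m l where m: "mu = hook m l" "1 \<le> m" "m \<le> i + \<kappa> - 3 + 1" "1 \<le> l" unfolding hooks_def by blast
      have "m \<le> d + \<kappa> - 2" using m(3) i \<kappa> by auto
      from lagged_G_upto[OF d \<kappa> m(2) this m(4)] show ?thesis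
        unfolding m(1) G_of_hook[OF m(2)] .
    qed
    show "Poly_Mapping.lookup ?Q 0 = 0"
    proof -
      have "Poly_Mapping.lookup (KP {#i, \<kappa>#}) 0 = 0" using const_term_KP_pair[of i \<kappa> 0] i \<kappa> by simp
      moreover have "Poly_Mapping.lookup (Var (hook (i + \<kappa> - 1) 1) :: (nat multiset, rat) mpoly) 0 = 0"
        unfolding eval_zero[symmetric] by simp
      ultimately show ?thesis by (simp only: lookup_minus diff_self)
    qed
  qed
  then show ?thesis by simp
qed

text \<open>For i < d even the top hook (i+\<kappa>-1,1) lies in the range of
  \<open>lagged_G_upto\<close>; only i = d leaves a term outside.\<close>

lemma lagged_KP_sum:
  assumes d: "d \<ge> 2" and \<kappa>: "2 \<le> \<kappa>" "\<kappa> \<le> d"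
  shows "\<exists>\<Psi>. lagged d 0 \<kappa> \<Psi> \<and> (\<forall>X. (\<Sum>i=1..d. of_nat i * fls_const (p_coeff i) * T_op X (KP_G d i \<kappa>)) =
     \<Psi> X + of_nat d * fls_const (p_coeff d) * T_op X (G_adm d (d + (\<kappa> - 1)) 1))"
proof -
  let ?Q = "\<lambda>i X. T_op X (eval_mpoly rat_adm (G_of_hook d) (KP {#i, \<kappa>#} - Var (hook (i + \<kappa> - 1) 1)))"
  define \<Psi> where "\<Psi> X = (\<Sum>i=1..d-1. of_nat i * (fls_const (p_coeff i) * (?Q i X + T_op X (G_adm d (i + \<kappa> - 1) 1))))
     + of_nat d * (fls_const (p_coeff d) * ?Q d X)" for X
  have "lagged d 0 \<kappa> \<Psi>"
    unfolding \<Psi>_def[abs_def]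
  proof (intro lagged_add lagged_sum lagged_of_nat lagged_cmult lagged_KP_rest[OF d \<kappa>])
    fix i assume "i \<in> {1..d - 1}"
    then show "i \<in> {1..d}" by auto
    have "1 \<le> i + \<kappa> - 1" "i + \<kappa> - 1 \<le> d + \<kappa> - 2" using \<open>i \<in> {1..d - 1}\<close> \<kappa> by auto
    from lagged_G_upto[OF d \<kappa> this, of 1] show "lagged d 0 \<kappa> (\<lambda>X. T_op X (G_adm d (i + \<kappa> - 1) 1))" by simp
  qed (use d in auto)
  moreover have "(\<Sum>i=1..d. of_nat i * fls_const (p_coeff i) * T_op X (KP_G d i \<kappa>)) =
     \<Psi> X + of_nat d * fls_const (p_coeff d) * T_op X (G_adm d (d + (\<kappa> - 1)) 1)" for X
  proof -
    have "{1..d} = insert d {1..d-1}" using d by auto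
    then have "(\<Sum>i=1..d. of_nat i * fls_const (p_coeff i) * T_op X (KP_G d i \<kappa>)) =
      of_nat d * fls_const (p_coeff d) * T_op X (KP_G d d \<kappa>) + (\<Sum>i=1..d-1. of_nat i * fls_const (p_coeff i) * T_op X (KP_G d i \<kappa>))"
      using d by simp
    also have "(\<Sum>i=1..d-1. of_nat i * fls_const (p_coeff i) * T_op X (KP_G d i \<kappa>)) =
       (\<Sum>i=1..d-1. of_nat i * (fls_const (p_coeff i) * (?Q i X + T_op X (G_adm d (i + \<kappa> - 1) 1))))"
    proof (intro sum.cong refl)
      fix i assume "i \<in> {1..d-1}"
      then have "1 \<le> i" "1 \<le> \<kappa>" using \<kappa> by auto
      from KP_G_top[OF this, of X d] show "of_nat i * fls_const (p_coeff i) * T_op X (KP_G d i \<kappa>) =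
         of_nat i * (fls_const (p_coeff i) * (?Q i X + T_op X (G_adm d (i + \<kappa> - 1) 1)))" by (simp only: mult.assoc)
    qed
    also have "T_op X (KP_G d d \<kappa>) = ?Q d X + T_op X (G_adm d (d + (\<kappa> - 1)) 1)"
    proof -
      have top: "d + (\<kappa> - 1) = d + \<kappa> - 1" using \<kappa> by simp
      have "T_op X (KP_G d d \<kappa>) = ?Q d X + T_op X (G_adm d (d + \<kappa> - 1) 1)"
        using d \<kappa> by (intro KP_G_top) auto
      then show ?thesis by (simp only: top)
    qed
    finally have "(\<Sum>i=1..d. of_nat i * fls_const (p_coeff i) * T_op X (KP_G d i \<kappa>)) =
      of_nat d * fls_const (p_coeff d) * (?Q d X + T_op X (G_adm d (d + (\<kappa> - 1)) 1))
       + (\<Sum>i=1..d-1. of_nat i * (fls_const (p_coeff i) * (?Q i X + T_op X (G_adm d (i + \<kappa> - 1) 1))))" .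
    moreover have "a * b * (q + g) + R = (R + a * (b * q)) + a * b * g" for a b q g R :: "coeff fls"
      by (simp add: algebra_simps)
    ultimately show ?thesis unfolding \<Psi>_def by (simp only:)
  qed
  ultimately show ?thesis by blast
qed

lemma lagged_nth: "lagged d 0 \<kappa> \<Phi> \<Longrightarrow> depends d (prev d e \<kappa>) (\<lambda>X. \<Phi> X $$ e)"
  unfolding lagged_def by (metis diff_zero)

lemma of_int_coeff_eq_0 [simp]: "of_int z = (0 :: coeff) \<longleftrightarrow> z = 0"
  by (cases z rule: int_cases2) (simp_all del: of_nat_Suc)

lemma G_coeff_cancel:
  assumes "d \<ge> 1"
  shows "of_nat d * fls_const (p_coeff d) * (fls_const (1 / (of_nat m * p_coeff d)) * f) = fls_const (of_nat d / of_nat m) * (f :: coeff fls)"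
proof -
  have "of_nat d * p_coeff d * (1 / (of_nat m * p_coeff d)) = of_nat d / of_nat m" by simp
  then show ?thesis
    unfolding fls_of_nat by (simp only: mult.assoc[symmetric] fls_const_mult_const)
qed

text \<open>The new coefficient enters through t^(-1) F_(k,1) and F_k inside G_(d+k-1,1) and through
  the linear terms t dF_k/dt - k F_k. The resulting factor would be 0 for k = 1, which is why E_1
  starts from F_d instead.\<close>

lemma E_eq_step:
  assumes d: "d \<ge> 2" and k: "2 \<le> k" "k < d" and n: "n \<ge> 1"
  shows "\<exists>c \<rho>. c \<noteq> 0 \<and> depends d (prev d (int n) k) \<rho> \<and> (\<forall>X. E_eq d X k $$ int n = c * fps_nth (X k) n + \<rho> X)"
proof -
  define k' where "k' = k - 1"
  have k': "k' + 1 = k" "k' < d" "k = k' + 1" using k by (auto simp: k'_def)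
  have "k \<le> d" using k by simp
  from lagged_KP_sum[OF d k(1) this] obtain \<Psi> where \<Psi>: "lagged d 0 k \<Psi>"
    "\<And>X. (\<Sum>i=1..d. of_nat i * fls_const (p_coeff i) * T_op X (KP_G d i k)) =
     \<Psi> X + of_nat d * fls_const (p_coeff d) * T_op X (G_adm d (d + k') 1)"
    unfolding k'_def by blast
  have tail: "lagged d 0 k (G_tail d k' 1)"
  proof (rule lagged_G_tail[OF d k'(2)])
    fix j assume "j < k'"
    then have "lagged d 0 (j + 2) (\<lambda>X. T_op X (G_adm d (d + j) 1))" using k k' by (intro lagged_G_1[OF d]) auto
    then show "lagged d 0 k (\<lambda>X. T_op X (G_adm d (d + j) 1))"
      by (rule lagged_mono) (use \<open>j < k'\<close> k' in simp)
  qed simp_all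
  define a :: coeff where "a = of_nat d / of_nat (d + k')"
  \<comment> \<open>The bracket n - 1 joins n f_n from t^(-1) F_(k,1) and -f_n from F_k, both with
    the factor k' + 1 = k of the recursion for G; n - k comes from the linear terms.\<close>
  define c where "c = - (a * (of_nat k * (of_int (int n) - 1))) + of_nat n - of_nat k"
  define \<rho> where "\<rho> X = - (\<Psi> X $$ int n + a * G_tail d k' 1 X $$ int n)" for X
  have "depends d (prev d (int n) k) \<rho>"
    unfolding \<rho>_def[abs_def]
    by (intro depends_uminus depends_add depends_cmult lagged_nth \<Psi>(1) tail)
  moreover have "E_eq d X k $$ int n = c * fps_nth (X k) n + \<rho> X" for X
  proof -
    have "k \<noteq> 1" "1 \<le> k" using k by auto
    have x: "fps_to_fls (X k) $$ int n = fps_nth (X k) n" by simp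
    have F0: "T_op X (Var (hook k 0)) $$ int n = fps_nth (X k) n"
      using T_hook_0_nth[OF \<open>1 \<le> k\<close>, of X "int n"] by simp
    have F1: "(fls_X_inv * T_op X (Var (hook k 1))) $$ int n = of_nat n * fps_nth (X k) n"
      unfolding T_hook_1_nth[OF \<open>1 \<le> k\<close>] F0 by simp
    have der: "(fls_X * fls_deriv (fps_to_fls (X k))) $$ int n = of_nat n * fps_nth (X k) n"
      using n by (simp add: fls_X_times_conv_shift)
    have "of_nat d * fls_const (p_coeff d) * T_op X (G_adm d (d + k') 1) =
        fls_const a * (G_tail d k' 1 X + of_nat k * (fls_X_inv * T_op X (Var (hook k 1))) - of_nat k * T_op X (Var (hook k 0)))"
    proof -
      have "G_adm d k 1 = Var (hook k 1)" "G_adm d k 0 = Var (hook k 0)" using k by (simp_all add: G_adm_small)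
      moreover have "d \<ge> 1" using d by simp
      ultimately show ?thesis
        unfolding T_G_rec[OF d] k'(1) a_def G_coeff_cancel[OF \<open>d \<ge> 1\<close>] mult_1 diff_self_eq_0 by (simp only:)
    qed
    then have G: "(of_nat d * fls_const (p_coeff d) * T_op X (G_adm d (d + k') 1)) $$ int n =
        a * (G_tail d k' 1 X $$ int n + of_nat k * (of_nat n * fps_nth (X k) n) - of_nat k * fps_nth (X k) n)"
      by (simp only: fls_mult_const_nth fls_plus_nth fls_minus_nth fls_mult_of_nat_nth F0 F1)
    have "E_eq d X k = - (\<Psi> X + of_nat d * fls_const (p_coeff d) * T_op X (G_adm d (d + k') 1))
       + fls_X * fls_deriv (fps_to_fls (X k)) - of_nat k * fps_to_fls (X k)"
      unfolding E_eq_def Let_def \<Psi>(2) using \<open>k \<noteq> 1\<close> by (simp only: if_False)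
    then have "E_eq d X k $$ int n = - (\<Psi> X $$ int n + a * (G_tail d k' 1 X $$ int n + of_nat k * (of_nat n * fps_nth (X k) n) - of_nat k * fps_nth (X k) n))
       + of_nat n * fps_nth (X k) n - of_nat k * fps_nth (X k) n"
      by (simp only: fls_plus_nth fls_minus_nth fls_uminus_nth G der fls_mult_of_nat_nth x)
    then show ?thesis by (simp add: c_def \<rho>_def algebra_simps)
  qed
  moreover have "c \<noteq> 0"
  proof -
    \<comment> \<open>Minus the numerator of \<open>c\<close>; regrouped, it is a nonnegative term
      plus k (k - 1) > 0.\<close>
    define z where "z = int d * (int k * (int n - 1)) - (int n - int k) * (int d + int k')"
    have nz: "of_nat (d + k') \<noteq> (0::coeff)" using d by (simp del: of_nat_add)
    have "c * of_nat (d + k') = - (of_nat d * (of_nat k * (of_int (int n) - 1))) + (of_nat n - of_nat k) * of_nat (d + k')"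
      unfolding c_def a_def using nz by (simp add: field_simps del: of_nat_add)
    also have "\<dots> = - of_int z" by (simp add: z_def)
    finally have cz: "c * of_nat (d + k') = - of_int z" .
    have "z = int n * (int d - 1) * (int k - 1) + int k * (int k - 1)"
      unfolding z_def k'(3) by (simp add: algebra_simps)
    also have "\<dots> > 0"
      using d k by (intro add_nonneg_pos mult_nonneg_nonneg mult_pos_pos) auto
    finally have "z \<noteq> 0" by simp
    then show ?thesis using cz nz by auto
  qed
  ultimately show ?thesis by blast
qed

lemma lagged_x: "1 \<le> i \<Longrightarrow> i < d \<Longrightarrow> lagged d 0 d (\<lambda>X. fps_to_fls (X i))"
  using lagged_T_hook[of i d 0] by (simp add: T_hook_0)

lemma lagged_X_deriv:
  assumes "lagged d 0 d \<Phi>"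
  shows "lagged d 0 d (\<lambda>X. fls_X * fls_deriv (\<Phi> X))"
proof -
  have nth: "(fls_X * fls_deriv f) $$ e = of_int e * f $$ e" for f :: "coeff fls" and e
    by (simp add: fls_X_times_conv_shift)
  show ?thesis using assms unfolding lagged_def nth by (auto intro: depends_cmult)
qed

text \<open>G_(2d-1,1) contains t^(-1) G_(d,1) and G_(d,0), and each of these contains t^(-1) times
  the hook of first part 1. Thus t^(-2) F_(1,1) and t^(-1) F_1 arise, and f_n of F_1 appears already
  at t^(n-1).\<close>

lemma E_eq_step_1:
  assumes d: "d \<ge> 2" and n: "n \<ge> 1"
  shows "\<exists>c \<rho>. c \<noteq> 0 \<and> depends d (prev d (int n) 1) \<rho> \<and> (\<forall>X. E_eq d X 1 $$ (int n - 1) = c * fps_nth (X 1) n + \<rho> X)"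
proof -
  define k' where "k' = d - 1"
  have k': "k' + 1 = d" "k' < d" "d = k' + 1" using d by (auto simp: k'_def)
  have d1: "d \<ge> 1" "1 < d" using d by auto
  from lagged_KP_sum[OF d d order_refl] obtain \<Psi> where \<Psi>: "lagged d 0 d \<Psi>"
    "\<And>X. (\<Sum>i=1..d. of_nat i * fls_const (p_coeff i) * T_op X (KP_G d i d)) =
     \<Psi> X + of_nat d * fls_const (p_coeff d) * T_op X (G_adm d (d + k') 1)"
    unfolding k'_def by blast
  have tail: "lagged d 0 d (G_tail d k' 1)"
  proof (rule lagged_G_tail[OF d k'(2)])
    fix j assume "j < k'"
    then have "lagged d 0 (j + 2) (\<lambda>X. T_op X (G_adm d (d + j) 1))" using k' by (intro lagged_G_1[OF d]) auto
    then show "lagged d 0 d (\<lambda>X. T_op X (G_adm d (d + j) 1))"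
      by (rule lagged_mono) (use \<open>j < k'\<close> k' in simp)
  qed simp_all
  have tail1: "lagged d 1 d (G_tail d 0 1)" by (rule lagged_G_tail[OF d]) (use d in auto)
  have tail0: "lagged d 0 d (G_tail d 0 0)" by (rule lagged_G_tail[OF d]) (use d in auto)
  define a :: coeff where "a = of_nat d / of_nat (d + k')"
  define \<Theta> where "\<Theta> X = - (of_nat d * fls_const (p_coeff d) * \<Psi> X) - fls_const (of_nat d * p_coeff d * a) * G_tail d k' 1 X
      - fls_const (of_nat d * a) * (fls_X_inv * G_tail d 0 1 X - G_tail d 0 0 X)
      + (\<Sum>i=1..d-1. of_nat i * fls_const (p_coeff i) * (of_nat d * fps_to_fls (X i) - fls_X * fls_deriv (fps_to_fls (X i))))
      + of_nat d * fls_const (u_coeff * v_coeff)" for X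
  have "lagged d 0 d \<Theta>"
  proof -
    have "lagged d (1 - 1) d (\<lambda>X. fls_X_inv * G_tail d 0 1 X)" by (rule lagged_X_inv[OF tail1])
    then have t1: "lagged d 0 d (\<lambda>X. fls_X_inv * G_tail d 0 1 X)" by simp
    have x: "lagged d 0 d (\<lambda>X. fps_to_fls (X i))" if "i \<in> {1..d-1}" for i
      using that by (intro lagged_x) auto
    have S: "lagged d 0 d (\<lambda>X. \<Sum>i=1..d-1. of_nat i * (fls_const (p_coeff i) * (of_nat d * fps_to_fls (X i) - fls_X * fls_deriv (fps_to_fls (X i)))))"
      by (intro lagged_sum lagged_of_nat lagged_cmult lagged_diff lagged_X_deriv x)
    show ?thesis unfolding \<Theta>_def[abs_def] mult.assoc[of "of_nat _"]
      by (intro lagged_add[OF lagged_add[OF lagged_diff[OF lagged_diff]]] S lagged_const lagged_uminus lagged_of_nat lagged_cmult \<Psi>(1) tail lagged_diff t1 tail0)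
  qed
  then have "depends d (prev d (int n - 1) d) (\<lambda>X. \<Theta> X $$ (int n - 1))" by (rule lagged_nth)
  \<comment> \<open>At exponent n - 1 lag 0 leaves orders at most n - 1, so nothing else of order n
    interferes.\<close>
  then have \<rho>: "depends d (prev d (int n) 1) (\<lambda>X. \<Theta> X $$ (int n - 1))"
    by (rule depends_mono) (rule prev_mono, simp)
  \<comment> \<open>The 2 counts t^(-1) F_1 twice, once from G_(d,1) and once from G_(d,0); n - (d +
    1) comes from dF_1/dt - (d+1) t^(-1) F_1.\<close>
  define c where "c = - (of_nat d * a * (of_int (int n) - 2)) + of_nat n - of_nat (d + 1)"
  have "E_eq d X 1 $$ (int n - 1) = c * fps_nth (X 1) n + \<Theta> X $$ (int n - 1)" for X
  proof -
    define x1 where "x1 = fps_to_fls (X 1)"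
    define F1 where "F1 = T_op X (Var (hook 1 1))"
    have F0: "T_op X (Var (hook 1 0)) = x1" by (simp add: T_hook_0 x1_def)
    have Gd1: "T_op X (G_adm d d 1) = fls_const (1 / (of_nat d * p_coeff d)) * (G_tail d 0 1 X + fls_X_inv * F1 - x1)"
      using T_G_rec[OF d, of X 0 1] G_adm_small[OF d1(2)] by (simp add: F0 F1_def del: One_nat_def)
    have Gd0: "T_op X (G_adm d d 0) = fls_const (1 / (of_nat d * p_coeff d)) * (G_tail d 0 0 X + fls_X_inv * x1)"
      using T_G_rec[OF d, of X 0 0] G_adm_small[OF d1(2)] by (simp add: F0 del: One_nat_def)
    have canc: "of_nat d * fls_const (p_coeff d) * (fls_const (1 / (of_nat d * p_coeff d)) * f) = f" for f :: "coeff fls"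
      using d unfolding G_coeff_cancel[OF d1(1)] by simp
    have "of_nat d * fls_const (p_coeff d) * T_op X (G_adm d (d + k') 1) =
      fls_const a * (G_tail d k' 1 X + of_nat d * (fls_X_inv * T_op X (G_adm d d 1)) - of_nat d * T_op X (G_adm d d 0))"
      unfolding T_G_rec[OF d] k'(1) a_def G_coeff_cancel[OF d1(1)] mult_1 diff_self_eq_0 by (simp only:)
    then have "of_nat d * fls_const (p_coeff d) * (of_nat d * fls_const (p_coeff d) * T_op X (G_adm d (d + k') 1)) =
      fls_const a * (of_nat d * fls_const (p_coeff d) * G_tail d k' 1 X
        + of_nat d * (fls_X_inv * (of_nat d * fls_const (p_coeff d) * T_op X (G_adm d d 1)))
        - of_nat d * (of_nat d * fls_const (p_coeff d) * T_op X (G_adm d d 0)))"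
      by (simp only:) (simp only: algebra_simps)
    also have "\<dots> = fls_const a * (of_nat d * fls_const (p_coeff d) * G_tail d k' 1 X
        + of_nat d * (fls_X_inv * (G_tail d 0 1 X + fls_X_inv * F1 - x1)) - of_nat d * (G_tail d 0 0 X + fls_X_inv * x1))"
      unfolding Gd1 Gd0 canc ..
    finally have GG: "of_nat d * fls_const (p_coeff d) * (of_nat d * fls_const (p_coeff d) * T_op X (G_adm d (d + k') 1)) = \<dots>" .
    define S where "S = (\<Sum>i=1..d-1. of_nat i * fls_const (p_coeff i) * (of_nat d * fps_to_fls (X i) - fls_X * fls_deriv (fps_to_fls (X i))))"
    have fc: "fls_const (of_nat d * p_coeff d * a) = of_nat d * fls_const (p_coeff d) * fls_const a" "fls_const (of_nat d * a) = of_nat d * fls_const a"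
      unfolding fls_of_nat by (simp_all only: fls_const_mult_const)
    have "E_eq d X 1 = - (of_nat d * fls_const (p_coeff d) * (\<Psi> X + of_nat d * fls_const (p_coeff d) * T_op X (G_adm d (d + k') 1)))
       + fls_deriv x1 - of_nat (d + 1) * fls_X_inv * x1 + S + of_nat d * fls_const (u_coeff * v_coeff)"
      unfolding E_eq_def Let_def \<Psi>(2) S_def x1_def by (simp only: if_True simp_thms)
    also have "\<dots> = \<Theta> X - of_nat d * (fls_const a * (fls_X_inv * (fls_X_inv * F1) - 2 * (fls_X_inv * x1)))
       + fls_deriv x1 - of_nat (d + 1) * (fls_X_inv * x1)"
      unfolding distrib_left[of "of_nat d * fls_const (p_coeff d)"] GG \<Theta>_def S_def[symmetric] fc by (simp add: algebra_simps)
    finally have E: "E_eq d X 1 = \<dots>" .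
    have x: "x1 $$ int n = fps_nth (X 1) n" by (simp add: x1_def)
    have F1n: "(fls_X_inv * F1) $$ int n = of_nat n * fps_nth (X 1) n"
      unfolding F1_def T_hook_1_nth[OF order_refl] F0 x by simp
    have nn: "int n - 1 + 1 = int n" by simp
    have two: "(2 * f) $$ e = 2 * f $$ e" for f :: "coeff fls" and e
      using fls_mult_of_nat_nth(1)[of 2 f e] by simp
    have "E_eq d X 1 $$ (int n - 1) = \<Theta> X $$ (int n - 1) - of_nat d * (a * (of_nat n * fps_nth (X 1) n - 2 * fps_nth (X 1) n))
       + of_nat n * fps_nth (X 1) n - of_nat (d + 1) * fps_nth (X 1) n"
      unfolding E by (simp only: fls_plus_nth fls_minus_nth fls_mult_const_nth fls_mult_of_nat_nth two
          fls_X_inv_mult_nth[of "fls_X_inv * F1"] fls_X_inv_mult_nth[of x1] fls_deriv_nth nn F1n x of_int_of_nat_eq)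
    then show ?thesis by (simp add: c_def algebra_simps)
  qed
  moreover have "c \<noteq> 0"
  proof -
    define z where "z = int d * int d * (int n - 2) - (int n - (int d + 1)) * (int d + int k')"
    have nz: "of_nat (d + k') \<noteq> (0::coeff)" using d by (simp del: of_nat_add)
    have "c * of_nat (d + k') = - (of_nat d * of_nat d * (of_int (int n) - 2)) + (of_nat n - of_nat (d + 1)) * of_nat (d + k')"
      unfolding c_def a_def using nz by (simp add: field_simps del: of_nat_add)
    also have "\<dots> = - of_int z" by (simp add: z_def)
    finally have cz: "c * of_nat (d + k') = - of_int z" .
    have "z = int n * (int d - 1) * (int d - 1) + (int d - 1)"
      unfolding z_def k'(3) by (simp add: algebra_simps)
    also have "\<dots> > 0"
      using d by (intro add_nonneg_pos mult_nonneg_nonneg) auto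
    finally have "z \<noteq> 0" by simp
    then show ?thesis using cz nz by auto
  qed
  ultimately show ?thesis using \<rho> by blast
qed

text \<open>Division by the nonzero factor c of the new coefficient turns the remainder into the
  recurrence polynomial, with c itself put in front.\<close>

lemma recursion_step:
  assumes d: "d \<ge> 2" and n: "n \<ge> 1" and k: "k \<in> {1..d-1}"
  shows "\<exists>P e c. vars P \<subseteq> {(m, j). 1 \<le> m \<and> j \<in> {1..d-1} \<and> (m < n \<or> m = n \<and> j < k)} \<and> c \<noteq> 0 \<and>
    (\<forall>X. vanishing d X \<longrightarrow> E_eq d X k $$ e = c * (fps_nth (X k) n - eval_unknowns X P))"
proof -
  have "\<exists>e c \<rho>. c \<noteq> 0 \<and> depends d (prev d (int n) k) \<rho> \<and> (\<forall>X. E_eq d X k $$ e = c * fps_nth (X k) n + \<rho> X)"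
  proof (cases "k = 1")
    case True
    then show ?thesis using E_eq_step_1[OF d n] by blast
  next
    case False
    then have "2 \<le> k" "k < d" using k by auto
    then show ?thesis using E_eq_step[OF d _ _ n] by blast
  qed
  then obtain e c \<rho> where c: "c \<noteq> 0" "depends d (prev d (int n) k) \<rho>" "\<And>X. E_eq d X k $$ e = c * fps_nth (X k) n + \<rho> X"
    by blast
  from depends_cmult[OF c(2), of "- (1 / c)"] obtain P where P: "vars P \<subseteq> prev d (int n) k"
    "\<And>X. vanishing d X \<Longrightarrow> - (1 / c) * \<rho> X = eval_unknowns X P"
    unfolding depends_def by blast
  have "E_eq d X k $$ e = c * (fps_nth (X k) n - eval_unknowns X P)" if "vanishing d X" for X
    unfolding P(2)[OF that, symmetric] c(3) using c(1) by (simp add: field_simps)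
  moreover have "vars P \<subseteq> {(m, j). 1 \<le> m \<and> j \<in> {1..d-1} \<and> (m < n \<or> m = n \<and> j < k)}"
    using P(1) by (auto simp: prev_def)
  ultimately show ?thesis using c(1) by blast
qed

theorem theorem5p1:
  fixes d :: nat
  assumes "d \<ge> 2"
  shows "(\<forall>k\<in>{1..d-1}. fps_nth (Fpi d k) 0 = 0) \<and>
    (\<forall>k\<in>{1..d-1}. E_eq d (Fpi d) k = 0) \<and>
    (\<exists>R :: nat \<Rightarrow> nat \<Rightarrow> (nat \<times> nat, coeff) mpoly.
      \<forall>n\<ge>1. \<forall>k\<in>{1..d-1}.
        vars (R n k) \<subseteq> {(m, j). 1 \<le> m \<and> j \<in> {1..d-1} \<and> (m < n \<or> m = n \<and> j < k)} \<and>
        (\<exists>(e::int) (c::coeff). c \<noteq> 0 \<and>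
          (\<forall>X :: nat \<Rightarrow> coeff fps. (\<forall>j\<in>{1..d-1}. fps_nth (X j) 0 = 0) \<longrightarrow>
            fls_nth (E_eq d X k) e =
              c * (fps_nth (X k) n - eval_mpoly (\<lambda>a. a) (\<lambda>(m, j). fps_nth (X j) m) (R n k)))) \<and>
        fps_nth (Fpi d k) n = eval_mpoly (\<lambda>a. a) (\<lambda>(m, j). fps_nth (Fpi d j) m) (R n k))"
proof -
  let ?rec = "\<lambda>n k P. vars P \<subseteq> {(m, j). 1 \<le> m \<and> j \<in> {1..d-1} \<and> (m < n \<or> m = n \<and> j < k)} \<and>
    (\<exists>e c. c \<noteq> 0 \<and> (\<forall>X. vanishing d X \<longrightarrow> E_eq d X k $$ e = c * (fps_nth (X k) n - eval_unknowns X P)))"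
  \<comment> \<open>The polynomials are fixed by the equations for arbitrary \<open>X\<close>. The
    map series enter only afterwards, as a family with zero constant terms for which all E_k
    vanish.\<close>
  define R where "R n k = (SOME P. ?rec n k P)" for n k
  have R: "?rec n k (R n k)" if "n \<ge> 1" "k \<in> {1..d-1}" for n k
  proof -
    have "\<exists>P. ?rec n k P" using recursion_step[OF assms that] by blast
    then show ?thesis unfolding R_def by (rule someI_ex)
  qed
  have "fps_nth (Fpi d k) n = eval_unknowns (Fpi d) (R n k)" if "n \<ge> 1" "k \<in> {1..d-1}" for n k
  proof -
    have van: "vanishing d (Fpi d)" by (simp add: vanishing_def Fpi_nth_0)
    from R[OF that] obtain e c where c: "c \<noteq> 0"
      "\<And>X. vanishing d X \<Longrightarrow> E_eq d X k $$ e = c * (fps_nth (X k) n - eval_unknowns X (R n k))" by blast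
    have "E_eq d (Fpi d) k $$ e = 0" by (simp only: E_eq_Fpi[OF assms that(2)] fls_zero_nth)
    then show ?thesis using c(1) c(2)[OF van] by simp
  qed
  with R show ?thesis
    unfolding vanishing_def by (intro conjI ballI exI[of _ R] allI impI) (simp_all add: Fpi_nth_0 E_eq_Fpi[OF assms])
qed

end
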